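(* Fix an integer $d\geq 1$. Let $(N_n)_{n\geq 1}$ be a sequence of positive integers with $N_n\to\infty$ and, for each $n\geq 1$, let $\{a_n(i_1,\ldots,i_d)\}_{1\leq i_1,\ldots,i_d\leq N_n}$ be real numbers that are symmetric in the indices and vanish on diagonals (that is, $a_n(i_1,\ldots,i_d)=0$ whenever $i_j=i_k$ for some $j\neq k$). Let $Q_n:\mathbb{R}^{N_n}\to\mathbb{R}$ be the homogeneous polynomial $$Q_n(x_1,\ldots,x_{N_n})=\sum_{i_1,\ldots,i_d=1}^{N_n} a_n(i_1,\ldots,i_d)\,x_{i_1}\cdots x_{i_d}.$$ Assume that $$d!\sum_{i_1,\ldots,i_d=1}^{N_n} a_n(i_1,\ldots,i_d)^2=1\quad\text{for all } n\geq 1,$$ and that $$\lim_{n\to\infty}\ \max_{1\leq i_1\leq N_n}\ \sum_{i_2,\ldots,i_d=1}^{N_n} a_n(i_1,\ldots,i_d)^2=0.$$ Let $\mathbf{X}=(X_1,X_2,\ldots)$ and $\mathbf{Y}=(Y_1,Y_2,\ldots)$ both belong to $\mathcal{D}(\alpha,p,2+\epsilon)$ for some $\epsilon>0$, $\alpha>0$ and $p\in(0,1]$. Then $$\lim_{n\to\infty} d_{TV}\big(Q_n(\mathbf{X}),Q_n(\mathbf{Y})\big)=0,$$ where $Q_n(\mathbf{X})=Q_n(X_1,\ldots,X_{N_n})$ and $Q_n(\mathbf{Y})=Q_n(Y_1,\ldots,Y_{N_n})$.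
   Context: Total variation distance: for real random variables $U,V$, $d_{TV}(U,V)=\sup_{A\in\mathcal{B}(\mathbb{R})}|P(U\in A)-P(V\in A)|$, where $\mathcal{B}(\mathbb{R})$ is the Borel $\sigma$-field. Class $\mathcal{C}(p,\alpha)$: for $p\in(0,1]$ and $\alpha>0$, $\mathcal{C}(p,\alpha)$ is the set of real random variables $X$ that have the same law as $\varepsilon(\alpha U+x_0)+(1-\varepsilon)V$, where $x_0\in\mathbb{R}$ is some real number and $U,\varepsilon,V$ are three independent random variables such that $U$ is uniformly distributed on $[-1,1]$, $\varepsilon$ is Bernoulli with $P(\varepsilon=1)=p=1-P(\varepsilon=0)$, and $V$ is a real random variable with arbitrary distribution. Class $\mathcal{D}(\alpha,p,2+\epsilon)$: for $\alpha>0$, $p\in(0,1]$, $\epsilon>0$, a sequence $\mathbf{X}=(X_1,X_2,\ldots)$ of real random variables belongs to $\mathcal{D}(\alpha,p,2+\epsilon)$ if the $X_i$ are independent, $\sup_i E|X_i|^{2+\epsilon}<\infty$, and, for each $i$, $E[X_i]=0$, $E[X_i^2]=1$ and $X_i\in\mathcal{C}(p,\alpha)$ (same $p$ and $\alpha$ for all $i$; $x_0$ and the law of $V$ may depend on $i$). *)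

theory Defs
  imports "HOL-Probability.Probability" "HOL-Combinatorics.Permutations"
begin

text \<open>The two random variables may live on different probability spaces; only their laws matter.\<close>

definition dTV :: "'a measure \<Rightarrow> ('a \<Rightarrow> real) \<Rightarrow> 'b measure \<Rightarrow> ('b \<Rightarrow> real) \<Rightarrow> real" where
  "dTV M U M' V = (SUP A\<in>sets borel.
     \<bar>measure M (U -` A \<inter> space M) - measure M' (V -` A \<inter> space M')\<bar>)"

text \<open>
  Membership of \<open>X\<close> in $\mathcal{C}(p,\alpha)$. The auxiliary variables \<open>U\<close>, \<open>E\<close>, \<open>V\<close> live on some
  probability space of their own. HOL cannot quantify over its type, so the type is fixed to
  \<open>real \<times> real \<times> real\<close>. This loses no generality: the joint law of any three real random variables
  is a probability measure on that type, and the projections realise it.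
\<close>

definition class_C :: "real \<Rightarrow> real \<Rightarrow> 'a measure \<Rightarrow> ('a \<Rightarrow> real) \<Rightarrow> bool" where
  "class_C p \<alpha> M X \<longleftrightarrow>
     0 < p \<and> p \<le> 1 \<and> 0 < \<alpha> \<and> X \<in> borel_measurable M \<and>
     (\<exists>(W :: (real \<times> real \<times> real) measure) U E V x0.
        prob_space W \<and>
        prob_space.indep_vars W (\<lambda>_. borel) (nth [U, E, V]) {..<3} \<and>
        distr W borel U = uniform_measure lborel {-1..1} \<and>
        measure W {w \<in> space W. E w = 1} = p \<and>
        measure W {w \<in> space W. E w = 0} = 1 - p \<and>
        distr M borel X = distr W borel (\<lambda>w. E w * (\<alpha> * U w + x0) + (1 - E w) * V w))"

text \<open>
  Membership of $(X_1, X_2, \ldots)$ in $\mathcal{D}(\alpha,p,2+e)$; the value \<open>X 0\<close> is never used.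
  The moments are taken in \<open>ennreal\<close>, so finiteness of the supremum entails integrability of
  \<open>X i\<close> and \<open>(X i)\<^sup>2\<close>, and the Bochner integrals below are genuine expectations.
\<close>

definition class_D :: "real \<Rightarrow> real \<Rightarrow> real \<Rightarrow> 'a measure \<Rightarrow> (nat \<Rightarrow> 'a \<Rightarrow> real) \<Rightarrow> bool" where
  "class_D \<alpha> p e M X \<longleftrightarrow>
     0 < \<alpha> \<and> 0 < p \<and> p \<le> 1 \<and> 0 < e \<and>
     prob_space.indep_vars M (\<lambda>_. borel) X {1..} \<and>
     (SUP i\<in>{1..}. \<integral>\<^sup>+ \<omega>. ennreal (\<bar>X i \<omega>\<bar> powr (2 + e)) \<partial>M) < \<infinity> \<and>
     (\<forall>i\<ge>1. (\<integral>\<omega>. X i \<omega> \<partial>M) = 0 \<and> (\<integral>\<omega>. (X i \<omega>)\<^sup>2 \<partial>M) = 1 \<and> class_C p \<alpha> M (X i))"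

text \<open>A multi-index $(i_1,\ldots,i_d)$ with $1 \le i_j \le N$ is a list of length \<open>d\<close>.\<close>

definition multi_indices :: "nat \<Rightarrow> nat \<Rightarrow> nat list set" where
  "multi_indices d N = {is. length is = d \<and> set is \<subseteq> {1..N}}"

definition symmetric_coeffs :: "nat \<Rightarrow> nat \<Rightarrow> (nat list \<Rightarrow> real) \<Rightarrow> bool" where
  "symmetric_coeffs d N c \<longleftrightarrow>
     (\<forall>is\<in>multi_indices d N. \<forall>\<sigma>. \<sigma> permutes {..<d} \<longrightarrow> c (permute_list \<sigma> is) = c is)"

definition vanishes_on_diagonals :: "nat \<Rightarrow> nat \<Rightarrow> (nat list \<Rightarrow> real) \<Rightarrow> bool" where
  "vanishes_on_diagonals d N c \<longleftrightarrow>
     (\<forall>is\<in>multi_indices d N. (\<exists>j<d. \<exists>k<d. j \<noteq> k \<and> is ! j = is ! k) \<longrightarrow> c is = 0)"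

definition Q_form :: "nat \<Rightarrow> nat \<Rightarrow> (nat list \<Rightarrow> real) \<Rightarrow> (nat \<Rightarrow> real) \<Rightarrow> real" where
  "Q_form d N c x = (\<Sum>is\<in>multi_indices d N. c is * (\<Prod>j<d. x (is ! j)))"

end

theory Submission
  imports Defs "HOL-Computational_Algebra.Polynomial"
begin

text \<open>
  The coefficients are indexed by the subsets of size \<open>d\<close>, since \<open>a\<^sub>n\<close> vanishes on diagonals. Uniform noise is
  traded for rotational symmetry: if \<open>(u, w)\<close> is uniform on \<open>[-1, 1]\<^sup>2\<close>, its law is invariant under rotating
  the points of the unit disc, so each \<open>X\<^sub>i\<close> has the law of \<open>r + \<alpha> u\<close> for a block \<open>(r, u, w)\<close> whose law is invariant
  under rotations of \<open>(u, w)\<close>, with \<open>w\<close> not identically zero. Rotating all the blocks simultaneously moves \<open>Q\<^sub>n\<close>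
  with speed \<open>\<alpha> D\<close>, where \<open>D\<close> is the derivative of \<open>Q\<^sub>n\<close> in the direction \<open>(w\<^sub>i)\<close>, and integrating by parts along
  this flow bounds the error made by replacing a test function \<open>h\<close> with a moving average of itself, for every
  continuous \<open>h\<close> with values in \<open>[0, 1]\<close>. The bound is effective as long as \<open>D\<close> is rarely small. By Lindeberg
  replacement, \<open>D\<close> behaves like its Gaussian analogue, whose small-ball probabilities are controlled uniformly:
  along the Gaussian rotation of two independent copies the form is a polynomial of degree \<open>d\<close> in the angle
  parameter, so it is small at more than \<open>d\<close> of \<open>m\<close> prescribed angles only if both copies are small, whence
  \<open>p(\<delta>) \<le> d / m + p(A)\<^sup>2\<close>, and this recursion starts at the Paley-Zygmund bound. Lindeberg replacement
  for the smoothed test function then compares both \<open>Q\<^sub>n(X)\<close> and \<open>Q\<^sub>n(Y)\<close> with the same Gaussian form, and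
  inner regularity passes from continuous test functions to Borel sets.
\<close>

subsection \<open>Forms and their moments\<close>

text \<open>Replacing variables block by block needs three derivatives of the test function, which
  the indicator of a Borel set does not have. The smoothing scale must therefore be fixed before the
  influences tend to 0, at a cost uniform in \<open>h\<close> and in n; the bound along the flow
  provides this because it sees \<open>h\<close> only through a primitive of size at most t. A
  rotation is used instead of a shift of \<open>u\<close>: a shift meets the ends of [-1, 1] and
  produces boundary terms, whereas a rotation of the disc has no boundary to cross, and the rest of
  the square stays fixed, so that \<open>u\<close> keeps its uniform law. The division by the speed
  that integration by parts asks for is regularised, since the speed may vanish. The auxiliary
  \<open>w\<close> is centred and uncorrelated with the variable that it moves, so value and
  \<open>w\<close> have covariance diag(1, s) and can be compared with independent Gaussians. Here s
  depends on p alone, which is why X and Y meet in one Gaussian form. Only moments of order 2 +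
  \<epsilon> are given, while replacement needs fourth moments; a truncation at a level R, chosen
  before the influence threshold, bridges the gap.\<close>

text \<open>
  \<open>mon b x y S\<close> is \<open>b\<close> times the monomial \<open>x\<^sub>S\<close> plus its derivative in the direction \<open>y\<close>. Treating both at once,
  the forms \<open>(1, 0)\<close> (value) and \<open>(0, y)\<close> (directional derivative) share every moment bound. The coefficients
  \<open>link i c\<close> are those of the partial derivative with respect to \<open>x\<^sub>i\<close>.
\<close>

definition mon :: "real \<Rightarrow> (nat \<Rightarrow> real) \<Rightarrow> (nat \<Rightarrow> real) \<Rightarrow> nat set \<Rightarrow> real" where
  "mon b x y S = b * (\<Prod>i\<in>S. x i) + (\<Sum>k\<in>S. y k * (\<Prod>i\<in>S - {k}. x i))"

definition form :: "real \<Rightarrow> nat set \<Rightarrow> (nat set \<Rightarrow> real) \<Rightarrow> (nat \<Rightarrow> real) \<Rightarrow> (nat \<Rightarrow> real) \<Rightarrow> real" where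
  "form b I c x y = (\<Sum>S\<in>Pow I. c S * mon b x y S)"

definition link :: "nat \<Rightarrow> (nat set \<Rightarrow> real) \<Rightarrow> nat set \<Rightarrow> real" where
  "link i c S = c (insert i S)"

lemma mon_empty [simp]: "mon b x y {} = b"
  by (simp add: mon_def)

lemma mon_one_zero: "mon 1 x (\<lambda>_. 0) S = (\<Prod>i\<in>S. x i)"
  by (simp add: mon_def)

lemma mon_insert:
  assumes "finite S" "i \<notin> S"
  shows "mon b x y (insert i S) = x i * mon b x y S + y i * mon 1 x (\<lambda>_. 0) S"
proof -
  have *: "insert i S - {k} = insert i (S - {k})" if "k \<in> S" for k
    using that assms by auto
  have "(\<Sum>k\<in>S. y k * (\<Prod>j\<in>insert i S - {k}. x j)) = (\<Sum>k\<in>S. x i * (y k * (\<Prod>j\<in>S - {k}. x j)))"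
    using assms by (intro sum.cong) (auto simp: * algebra_simps)
  then show ?thesis
    using assms by (simp add: mon_def algebra_simps sum_distrib_left)
qed

lemma sum_Pow_insert:
  fixes f :: "nat set \<Rightarrow> real"
  assumes "finite I" "i \<notin> I"
  shows "(\<Sum>S\<in>Pow (insert i I). f S) = (\<Sum>S\<in>Pow I. f S) + (\<Sum>S\<in>Pow I. f (insert i S))"
proof -
  have "(\<Sum>S\<in>insert i ` Pow I. f S) = (\<Sum>S\<in>Pow I. f (insert i S))"
    using assms by (intro sum.reindex_cong[of "insert i"]) (auto simp: inj_on_def)
  moreover have "(\<Sum>S\<in>Pow (insert i I). f S) = (\<Sum>S\<in>Pow I. f S) + (\<Sum>S\<in>insert i ` Pow I. f S)"
    unfolding Pow_insert using assms by (intro sum.union_disjoint) auto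
  ultimately show ?thesis by simp
qed

text \<open>A form is affine in the pair \<open>(x i, y i)\<close>, with coefficients that do not
  involve coordinate i. The moment bounds below are inductions over the variables through this
  splitting: the coefficients are functions of the other blocks, hence independent of block
  i.\<close>

lemma form_insert:
  assumes "finite I" "i \<notin> I"
  shows "form b (insert i I) c x y =
    form b I c x y + x i * form b I (link i c) x y + y i * form 1 I (link i c) x (\<lambda>_. 0)"
proof -
  have "(\<Sum>S\<in>Pow I. c (insert i S) * mon b x y (insert i S)) =
      (\<Sum>S\<in>Pow I. x i * (c (insert i S) * mon b x y S) + y i * (c (insert i S) * mon 1 x (\<lambda>_. 0) S))"
    using assms by (intro sum.cong refl) (subst mon_insert, auto intro: finite_subset simp: algebra_simps)
  then show ?thesis
    using sum_Pow_insert[OF assms, of "\<lambda>S. c S * mon b x y S"]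
    by (simp add: form_def link_def sum.distrib sum_distrib_left)
qed

lemma form_empty [simp]: "form b {} c x y = c {} * b"
  by (simp add: form_def)

lemma form_cong:
  assumes "\<And>S. S \<subseteq> I \<Longrightarrow> c S = c' S" "\<And>i. i \<in> I \<Longrightarrow> x i = x' i" "\<And>i. i \<in> I \<Longrightarrow> y i = y' i"
  shows "form b I c x y = form b I c' x' y'"
  unfolding form_def mon_def
  by (intro sum.cong refl arg_cong2[where f="(*)"] arg_cong2[where f="(+)"] prod.cong)
     (use assms in \<open>auto simp: subset_iff\<close>)

lemma borel_measurable_mon:
  assumes "\<And>i. i \<in> S \<Longrightarrow> X i \<in> borel_measurable M" "\<And>i. i \<in> S \<Longrightarrow> Y i \<in> borel_measurable M"
  shows "(\<lambda>\<omega>. mon b (\<lambda>i. X i \<omega>) (\<lambda>i. Y i \<omega>) S) \<in> borel_measurable M"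
  unfolding mon_def using assms
  by (intro borel_measurable_add borel_measurable_times borel_measurable_const
      borel_measurable_prod borel_measurable_sum) auto

lemma borel_measurable_form:
  assumes "\<And>i. i \<in> I \<Longrightarrow> X i \<in> borel_measurable M" "\<And>i. i \<in> I \<Longrightarrow> Y i \<in> borel_measurable M"
  shows "(\<lambda>\<omega>. form b I c (\<lambda>i. X i \<omega>) (\<lambda>i. Y i \<omega>)) \<in> borel_measurable M"
  unfolding form_def using assms
  by (intro borel_measurable_sum borel_measurable_times borel_measurable_const borel_measurable_mon) auto

definition coef_norm :: "nat set \<Rightarrow> (nat set \<Rightarrow> real) \<Rightarrow> real" where
  "coef_norm I c = (\<Sum>S\<in>Pow I. (c S)\<^sup>2)"

lemma coef_norm_nonneg [simp]: "0 \<le> coef_norm I c"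
  by (simp add: coef_norm_def sum_nonneg)

lemma coef_norm_insert:
  "finite I \<Longrightarrow> i \<notin> I \<Longrightarrow> coef_norm (insert i I) c = coef_norm I c + coef_norm I (link i c)"
  by (simp add: coef_norm_def sum_Pow_insert link_def)

definition deg_le :: "nat \<Rightarrow> nat set \<Rightarrow> (nat set \<Rightarrow> real) \<Rightarrow> bool" where
  "deg_le d I c \<longleftrightarrow> (\<forall>S\<subseteq>I. d < card S \<longrightarrow> c S = 0)"

lemma deg_le_subset: "deg_le d I c \<Longrightarrow> J \<subseteq> I \<Longrightarrow> deg_le d J c"
  by (auto simp: deg_le_def)

text \<open>Each coordinate that is split off with a factor uses up one degree. An induction over
  arbitrarily many variables therefore produces constants that depend on d only.\<close>

lemma deg_le_link:
  assumes "finite I" "i \<notin> I" "deg_le (Suc d) (insert i I) c"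
  shows "deg_le d I (link i c)"
  unfolding deg_le_def link_def
proof safe
  fix S assume S: "S \<subseteq> I" "d < card S"
  then have "card (insert i S) = Suc (card S)"
    using assms by (subst card_insert_disjoint) (auto intro: finite_subset)
  then show "c (insert i S) = 0"
    using assms(3) S Set.insert_mono[OF S(1), of i] unfolding deg_le_def by simp
qed

lemma link_zero:
  assumes "finite I" "i \<notin> I" "deg_le 0 (insert i I) c" "S \<subseteq> I"
  shows "link i c S = 0"
proof -
  have "card (insert i S) > 0"
    using assms by (auto simp: card_gt_0_iff intro: finite_subset)
  then show ?thesis
    using assms(3) Set.insert_mono[OF assms(4), of i] unfolding deg_le_def link_def by simp
qed

text \<open>Independence is formulated for \<sigma>-algebras rather than for random variables,
  because one block carries several mutually dependent variables: value, velocity, acceleration and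
  the truncated or Gaussian replacements.\<close>

locale indep_blocks = prob_space M for M :: "'a measure" +
  fixes F :: "nat \<Rightarrow> 'a set set" and I :: "nat set"
  assumes finite_I: "finite I"
    and indep_F: "indep_sets F I"
    and sigma_F: "\<And>i. i \<in> I \<Longrightarrow> sigma_algebra (space M) (F i)"
begin

definition sub :: "nat set \<Rightarrow> 'a measure" where
  "sub J = sigma (space M) (\<Union>i\<in>J. F i)"

lemma F_events: "i \<in> I \<Longrightarrow> F i \<subseteq> events"
  using indep_F by (auto simp: indep_sets_def)

lemma F_Pow: "i \<in> I \<Longrightarrow> F i \<subseteq> Pow (space M)"
  using F_events sets.sets_into_space by blast

lemma space_sub [simp]: "space (sub J) = space M"
  by (simp add: sub_def space_measure_of_conv)

lemma sets_sub: "J \<subseteq> I \<Longrightarrow> sets (sub J) = sigma_sets (space M) (\<Union>i\<in>J. F i)"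
  using F_Pow by (auto simp: sub_def intro!: sets_measure_of)

lemma sets_sub_mono: "J \<subseteq> K \<Longrightarrow> K \<subseteq> I \<Longrightarrow> sets (sub J) \<subseteq> sets (sub K)"
  by (subst (1 2) sets_sub) (auto intro!: sigma_sets_mono')

lemma sets_sub_M: "J \<subseteq> I \<Longrightarrow> sets (sub J) \<subseteq> sets M"
  by (subst sets_sub) (use F_events in \<open>auto intro!: sets.sigma_sets_subset\<close>)

lemma sub_mono:
  assumes "J \<subseteq> K" "K \<subseteq> I" "f \<in> borel_measurable (sub J)"
  shows "f \<in> borel_measurable (sub K)"
  using assms sets_sub_mono[OF assms(1,2)] by (auto simp: measurable_def)

lemma sub_M: "J \<subseteq> I \<Longrightarrow> f \<in> borel_measurable (sub J) \<Longrightarrow> f \<in> borel_measurable M"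
  using sets_sub_M[of J] by (auto simp: measurable_def)

text \<open>Grouping preserves independence because the generators \<open>F i\<close> are closed
  under intersection.\<close>

lemma indep_sub:
  fixes f g :: "'a \<Rightarrow> real"
  assumes A: "A \<subseteq> I" and B: "B \<subseteq> I" and AB: "A \<inter> B = {}"
    and f: "f \<in> borel_measurable (sub A)" and g: "g \<in> borel_measurable (sub B)"
  shows "indep_var borel f borel g"
  unfolding indep_var_eq
proof (intro conjI)
  show fM: "f \<in> borel_measurable M" and gM: "g \<in> borel_measurable M"
    using sub_M A B f g by auto
  have "indep_sets (\<lambda>j. sigma_sets (space M) (\<Union>i\<in>case_bool A B j. F i)) UNIV"
  proof (rule indep_sets_collect_sigma)
    show "indep_sets F (\<Union>j. case_bool A B j)"
      using indep_F A B by (auto intro!: indep_sets_mono_index[of _ I] split: bool.splits)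
    show "Int_stable (F i)" if "i \<in> case_bool A B j" for i j
    proof -
      have "i \<in> I" using that A B by (auto split: bool.splits)
      then interpret sigma_algebra "space M" "F i" by (rule sigma_F)
      show ?thesis by (auto simp: Int_stable_def)
    qed
    show "disjoint_family_on (case_bool A B) UNIV"
      using AB by (auto simp: disjoint_family_on_def split: bool.splits)
  qed
  then have *: "indep_sets (case_bool (sets (sub A)) (sets (sub B))) UNIV"
    using A B by (subst indep_sets_cong[OF refl, of _ _ "\<lambda>j. sigma_sets (space M) (\<Union>i\<in>case_bool A B j. F i)"])
      (auto simp: sets_sub split: bool.splits)
  have sf: "sigma_sets (space M) {f -` S \<inter> space M |S. S \<in> sets borel} \<subseteq> sets (sub A)"
    using sets.sigma_sets_subset[of "{f -` S \<inter> space M |S. S \<in> sets borel}" "sub A"] measurable_sets[OF f]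
    unfolding space_sub by blast
  have sg: "sigma_sets (space M) {g -` S \<inter> space M |S. S \<in> sets borel} \<subseteq> sets (sub B)"
    using sets.sigma_sets_subset[of "{g -` S \<inter> space M |S. S \<in> sets borel}" "sub B"] measurable_sets[OF g]
    unfolding space_sub by blast
  show "indep_set (sigma_sets (space M) {f -` S \<inter> space M |S. S \<in> sets borel})
     (sigma_sets (space M) {g -` S \<inter> space M |S. S \<in> sets borel})"
    unfolding indep_set_def
    by (rule indep_sets_mono_sets[OF *]) (use sf sg in \<open>auto split: bool.splits\<close>)
qed

lemma
  fixes f g :: "'a \<Rightarrow> real"
  assumes "J \<subseteq> I" "i \<in> I" "i \<notin> J"
    and "f \<in> borel_measurable (sub J)" "g \<in> borel_measurable (sub {i})"
    and "integrable M f" "integrable M g"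
  shows integrable_block_mult: "integrable M (\<lambda>\<omega>. f \<omega> * g \<omega>)"
    and expectation_block_mult: "expectation (\<lambda>\<omega>. f \<omega> * g \<omega>) = expectation f * expectation g"
proof -
  have *: "indep_var borel f borel g"
    using assms by (intro indep_sub[of J "{i}"]) auto
  show "integrable M (\<lambda>\<omega>. f \<omega> * g \<omega>)" "expectation (\<lambda>\<omega>. f \<omega> * g \<omega>) = expectation f * expectation g"
    using indep_var_integrable[OF *] indep_var_lebesgue_integral[OF *] assms by auto
qed

lemma form_sub:
  assumes "J \<subseteq> I" "\<And>i. i \<in> J \<Longrightarrow> X i \<in> borel_measurable (sub {i})"
    "\<And>i. i \<in> J \<Longrightarrow> Y i \<in> borel_measurable (sub {i})"
  shows "(\<lambda>\<omega>. form b J c (\<lambda>i. X i \<omega>) (\<lambda>i. Y i \<omega>)) \<in> borel_measurable (sub J)"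
proof (rule borel_measurable_form)
  fix i assume "i \<in> J"
  then show "X i \<in> borel_measurable (sub J)" "Y i \<in> borel_measurable (sub J)"
    using assms by (auto intro: sub_mono[of "{i}"])
qed

end

section \<open>Second and fourth moments of real random variables\<close>

lemma (in prob_space) integrable_sq_mult:
  fixes f g :: "'a \<Rightarrow> real"
  assumes "f \<in> borel_measurable M" "g \<in> borel_measurable M"
    "integrable M (\<lambda>\<omega>. (f \<omega>)\<^sup>2)" "integrable M (\<lambda>\<omega>. (g \<omega>)\<^sup>2)"
  shows "integrable M (\<lambda>\<omega>. f \<omega> * g \<omega>)"
proof (rule Bochner_Integration.integrable_bound)
  show "integrable M (\<lambda>\<omega>. (f \<omega>)\<^sup>2 + (g \<omega>)\<^sup>2)" using assms by auto
  have "\<bar>a * b\<bar> \<le> a\<^sup>2 + b\<^sup>2" for a b :: real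
  proof -
    have "2 * \<bar>a * b\<bar> \<le> a\<^sup>2 + b\<^sup>2"
      using sum_squares_bound[of "\<bar>a\<bar>" "\<bar>b\<bar>"] by (simp add: abs_mult)
    then show ?thesis by linarith
  qed
  then show "AE \<omega> in M. norm (f \<omega> * g \<omega>) \<le> norm ((f \<omega>)\<^sup>2 + (g \<omega>)\<^sup>2)" by simp
qed (use assms in auto)

lemma (in prob_space) integrable_sq_self:
  fixes f :: "'a \<Rightarrow> real"
  assumes "f \<in> borel_measurable M" "integrable M (\<lambda>\<omega>. (f \<omega>)\<^sup>2)"
  shows "integrable M f"
  using integrable_sq_mult[of f "\<lambda>_. 1"] assms by simp

text \<open>The second moment of s f + t g is a nonnegative quadratic form in (s, t). If g has
  positive second moment, evaluate it at (c, -b); otherwise it is affine in t for s = 1, and a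
  nonzero slope would allow the value -1.\<close>

lemma (in prob_space) Cauchy_Schwarz_expectation:
  fixes f g :: "'a \<Rightarrow> real"
  assumes m: "f \<in> borel_measurable M" "g \<in> borel_measurable M"
    and i: "integrable M (\<lambda>\<omega>. (f \<omega>)\<^sup>2)" "integrable M (\<lambda>\<omega>. (g \<omega>)\<^sup>2)"
  shows "(expectation (\<lambda>\<omega>. f \<omega> * g \<omega>))\<^sup>2 \<le> expectation (\<lambda>\<omega>. (f \<omega>)\<^sup>2) * expectation (\<lambda>\<omega>. (g \<omega>)\<^sup>2)"
proof -
  let ?a = "expectation (\<lambda>\<omega>. (f \<omega>)\<^sup>2)" and ?b = "expectation (\<lambda>\<omega>. f \<omega> * g \<omega>)" and ?c = "expectation (\<lambda>\<omega>. (g \<omega>)\<^sup>2)"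
  note fg = integrable_sq_mult[OF m i]
  have q: "0 \<le> s\<^sup>2 * ?a + 2 * s * t * ?b + t\<^sup>2 * ?c" for s t
  proof -
    have "0 \<le> expectation (\<lambda>\<omega>. (s * f \<omega> + t * g \<omega>)\<^sup>2)" by (rule Bochner_Integration.integral_nonneg) simp
    also have "(\<lambda>\<omega>. (s * f \<omega> + t * g \<omega>)\<^sup>2) = (\<lambda>\<omega>. s\<^sup>2 * (f \<omega>)\<^sup>2 + 2 * s * t * (f \<omega> * g \<omega>) + t\<^sup>2 * (g \<omega>)\<^sup>2)"
      by (simp add: power2_sum power_mult_distrib algebra_simps)
    also have "expectation \<dots> = s\<^sup>2 * ?a + 2 * s * t * ?b + t\<^sup>2 * ?c"
      using i fg by simp
    finally show ?thesis .
  qed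
  have a: "0 \<le> ?a" and c: "0 \<le> ?c" by simp_all
  show ?thesis
  proof (cases "?c = 0")
    case True
    have "?b = 0"
    proof (rule ccontr)
      assume b: "?b \<noteq> 0"
      have "0 \<le> ?a + 2 * (-(?a + 1) / (2 * ?b)) * ?b"
        using q[of 1 "-(?a + 1) / (2 * ?b)"] True by simp
      also have "\<dots> = -1" using b by (simp add: field_simps)
      finally show False by simp
    qed
    then show ?thesis using True by simp
  next
    case False
    then have c': "?c > 0" using c by linarith
    have "0 \<le> ?c * (?a * ?c - ?b\<^sup>2)"
      using q[of ?c "-?b"] by (simp add: power2_eq_square algebra_simps)
    then show ?thesis using c' by (simp add: zero_le_mult_iff)
  qed
qed

lemma (in prob_space) square_expectation_le:
  fixes f :: "'a \<Rightarrow> real"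
  assumes "f \<in> borel_measurable M" "integrable M (\<lambda>\<omega>. (f \<omega>)\<^sup>2)"
  shows "(expectation f)\<^sup>2 \<le> expectation (\<lambda>\<omega>. (f \<omega>)\<^sup>2)"
  using Cauchy_Schwarz_expectation[of f "\<lambda>_. 1"] assms by (simp add: prob_space)

definition (in prob_space) L2 :: "('a \<Rightarrow> real) \<Rightarrow> bool" where
  "L2 f \<longleftrightarrow> f \<in> borel_measurable M \<and> integrable M (\<lambda>\<omega>. (f \<omega>)\<^sup>2)"

definition (in prob_space) L4 :: "('a \<Rightarrow> real) \<Rightarrow> bool" where
  "L4 f \<longleftrightarrow> f \<in> borel_measurable M \<and> integrable M (\<lambda>\<omega>. (f \<omega>) ^ 4)"

context prob_space
begin

lemma L2_const [simp]: "L2 (\<lambda>_. k)"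
  by (simp add: L2_def)

lemma L2_cmult: "L2 f \<Longrightarrow> L2 (\<lambda>\<omega>. k * f \<omega>)"
  by (auto simp: L2_def power_mult_distrib)

lemma L2_integrable_mult: "L2 f \<Longrightarrow> L2 g \<Longrightarrow> integrable M (\<lambda>\<omega>. f \<omega> * g \<omega>)"
  unfolding L2_def by (rule integrable_sq_mult) auto

lemma L2_integrable: "L2 f \<Longrightarrow> integrable M f"
  unfolding L2_def by (rule integrable_sq_self) auto

lemma L2_add:
  assumes "L2 f" "L2 g"
  shows "L2 (\<lambda>\<omega>. f \<omega> + g \<omega>)"
proof -
  have "integrable M (\<lambda>\<omega>. (f \<omega>)\<^sup>2 + (g \<omega>)\<^sup>2 + 2 * (f \<omega> * g \<omega>))"
    using assms L2_integrable_mult[OF assms] by (auto simp: L2_def)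
  then show ?thesis
    using assms by (auto simp: L2_def power2_sum mult.assoc)
qed

lemma L2_diff: "L2 f \<Longrightarrow> L2 g \<Longrightarrow> L2 (\<lambda>\<omega>. f \<omega> - g \<omega>)"
  using L2_add[of f "\<lambda>\<omega>. (-1) * g \<omega>"] L2_cmult[of g "-1"] by simp

lemma L4_L2:
  assumes "L4 f"
  shows "L2 f"
  unfolding L2_def
proof
  show "f \<in> borel_measurable M" using assms by (simp add: L4_def)
  show "integrable M (\<lambda>\<omega>. (f \<omega>)\<^sup>2)"
  proof (rule Bochner_Integration.integrable_bound)
    show "integrable M (\<lambda>\<omega>. 1 + (f \<omega>) ^ 4)" using assms by (auto simp: L4_def)
    have "a\<^sup>2 \<le> 1 + a ^ 4" for a :: real
    proof -
      have "2 * a\<^sup>2 \<le> 1 + (a\<^sup>2)\<^sup>2" using sum_squares_bound[of 1 "a\<^sup>2"] by simp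
      moreover have "(a\<^sup>2)\<^sup>2 = a ^ 4" by simp
      moreover have "0 \<le> a\<^sup>2" by simp
      ultimately show ?thesis by linarith
    qed
    then show "AE \<omega> in M. norm ((f \<omega>)\<^sup>2) \<le> norm (1 + (f \<omega>) ^ 4)" by simp
  qed (use assms in \<open>auto simp: L4_def\<close>)
qed

lemma L4_square: "L4 f \<longleftrightarrow> f \<in> borel_measurable M \<and> L2 (\<lambda>\<omega>. (f \<omega>)\<^sup>2)"
  by (auto simp: L4_def L2_def)

lemma add_pow4_le: "(a + b) ^ 4 \<le> 8 * (a ^ 4 + b ^ 4)" for a b :: real
proof -
  have *: "(x + y)\<^sup>2 \<le> 2 * (x\<^sup>2 + y\<^sup>2)" for x y :: real
    using sum_squares_bound[of x y] by (simp add: power2_sum)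
  have "(a + b) ^ 4 = ((a + b)\<^sup>2)\<^sup>2" by simp
  also have "\<dots> \<le> (2 * (a\<^sup>2 + b\<^sup>2))\<^sup>2" using *[of a b] by (intro power_mono) auto
  also have "\<dots> = 4 * (a\<^sup>2 + b\<^sup>2)\<^sup>2" by algebra
  also have "\<dots> \<le> 4 * (2 * ((a\<^sup>2)\<^sup>2 + (b\<^sup>2)\<^sup>2))" using *[of "a\<^sup>2" "b\<^sup>2"] by simp
  finally show ?thesis by simp
qed

lemma L4_add:
  assumes "L4 f" "L4 g"
  shows "L4 (\<lambda>\<omega>. f \<omega> + g \<omega>)"
  unfolding L4_def
proof
  show "integrable M (\<lambda>\<omega>. (f \<omega> + g \<omega>) ^ 4)"
  proof (rule Bochner_Integration.integrable_bound)
    show "integrable M (\<lambda>\<omega>. 8 * ((f \<omega>) ^ 4 + (g \<omega>) ^ 4))" using assms by (auto simp: L4_def)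
  qed (use assms add_pow4_le in \<open>auto simp: L4_def\<close>)
qed (use assms in \<open>auto simp: L4_def\<close>)

lemma L4_const [simp]: "L4 (\<lambda>_. k)"
  by (simp add: L4_def)

lemma cube_mult_le: "\<bar>a ^ 3 * b\<bar> \<le> a ^ 4 + b ^ 4" for a b :: real
proof -
  define m where "m = max \<bar>a\<bar> \<bar>b\<bar>"
  have "\<bar>a ^ 3 * b\<bar> = \<bar>a\<bar> ^ 3 * \<bar>b\<bar>" by (simp add: abs_mult power_abs)
  also have "\<dots> \<le> m ^ 3 * m" unfolding m_def by (intro mult_mono power_mono) auto
  also have "\<dots> = m ^ 4" by (simp add: power_numeral_reduce)
  also have "\<dots> \<le> a ^ 4 + b ^ 4" unfolding m_def by (auto simp: max_def power_abs)
  finally show ?thesis .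
qed

lemma L4_integrable_cube_mult:
  assumes "L4 f" "L4 g"
  shows "integrable M (\<lambda>\<omega>. (f \<omega>) ^ 3 * g \<omega>)"
proof (rule Bochner_Integration.integrable_bound)
  show "integrable M (\<lambda>\<omega>. (f \<omega>) ^ 4 + (g \<omega>) ^ 4)" using assms by (auto simp: L4_def)
  show "AE \<omega> in M. norm ((f \<omega>) ^ 3 * g \<omega>) \<le> norm ((f \<omega>) ^ 4 + (g \<omega>) ^ 4)"
    using cube_mult_le by (auto intro: order_trans)
qed (use assms in \<open>auto simp: L4_def\<close>)

text \<open>The term 4 f^3 g vanishes in expectation by assumption, but 4 f g^3 need not. It is
  absorbed by 4 a b^3 \<le> 2 a^2 b^2 + 2 b^4, which explains the coefficients 8 and 3 in place of 6
  and 1.\<close>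

lemma expectation_add_pow4_le:
  assumes f: "L4 f" and g: "L4 g" and "expectation (\<lambda>\<omega>. (f \<omega>) ^ 3 * g \<omega>) = 0"
  shows "expectation (\<lambda>\<omega>. (f \<omega> + g \<omega>) ^ 4) \<le> expectation (\<lambda>\<omega>. (f \<omega>) ^ 4) +
    8 * sqrt (expectation (\<lambda>\<omega>. (f \<omega>) ^ 4) * expectation (\<lambda>\<omega>. (g \<omega>) ^ 4)) + 3 * expectation (\<lambda>\<omega>. (g \<omega>) ^ 4)"
proof -
  have i: "integrable M (\<lambda>\<omega>. (f \<omega>)\<^sup>2 * (g \<omega>)\<^sup>2)" "integrable M (\<lambda>\<omega>. (f \<omega>) ^ 3 * g \<omega>)"
    "integrable M (\<lambda>\<omega>. (f \<omega>) ^ 4)" "integrable M (\<lambda>\<omega>. (g \<omega>) ^ 4)"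
    using L4_square[of f] L4_square[of g] f g
    by (auto intro!: L2_integrable_mult L4_integrable_cube_mult simp: L4_def)
  have "(a + b) ^ 4 \<le> a ^ 4 + 4 * (a ^ 3 * b) + 8 * (a\<^sup>2 * b\<^sup>2) + 3 * b ^ 4" for a b :: real
  proof -
    have "0 \<le> 2 * (b * (a - b))\<^sup>2" by simp
    also have "\<dots> = a ^ 4 + 4 * (a ^ 3 * b) + 8 * (a\<^sup>2 * b\<^sup>2) + 3 * b ^ 4 - (a + b) ^ 4"
      by algebra
    finally show ?thesis by simp
  qed
  then have "expectation (\<lambda>\<omega>. (f \<omega> + g \<omega>) ^ 4) \<le> expectation (\<lambda>\<omega>. (f \<omega>) ^ 4 + 4 * ((f \<omega>) ^ 3 * g \<omega>) +
      8 * ((f \<omega>)\<^sup>2 * (g \<omega>)\<^sup>2) + 3 * (g \<omega>) ^ 4)"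
    using L4_add[OF f g] i by (intro integral_mono) (auto simp: L4_def)
  also have "\<dots> = expectation (\<lambda>\<omega>. (f \<omega>) ^ 4) + 8 * expectation (\<lambda>\<omega>. (f \<omega>)\<^sup>2 * (g \<omega>)\<^sup>2) +
      3 * expectation (\<lambda>\<omega>. (g \<omega>) ^ 4)"
    using i assms(3) by simp
  also have "expectation (\<lambda>\<omega>. (f \<omega>)\<^sup>2 * (g \<omega>)\<^sup>2) \<le>
      sqrt (expectation (\<lambda>\<omega>. (f \<omega>) ^ 4) * expectation (\<lambda>\<omega>. (g \<omega>) ^ 4))"
    using Cauchy_Schwarz_expectation[of "\<lambda>\<omega>. (f \<omega>)\<^sup>2" "\<lambda>\<omega>. (g \<omega>)\<^sup>2"] f g
    by (intro real_le_rsqrt) (auto simp: L4_def)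
  finally show ?thesis by simp
qed

end

section \<open>Moments of forms by induction over the blocks\<close>

context indep_blocks
begin

lemma L2_block_mult:
  assumes "J \<subseteq> I" "i \<in> I" "i \<notin> J" "B \<in> borel_measurable (sub J)" "U \<in> borel_measurable (sub {i})" "L2 B" "L2 U"
  shows "L2 (\<lambda>\<omega>. U \<omega> * B \<omega>)"
    and "expectation (\<lambda>\<omega>. (U \<omega> * B \<omega>)\<^sup>2) = expectation (\<lambda>\<omega>. (U \<omega>)\<^sup>2) * expectation (\<lambda>\<omega>. (B \<omega>)\<^sup>2)"
proof -
  have "(\<lambda>\<omega>. (U \<omega> * B \<omega>)\<^sup>2) = (\<lambda>\<omega>. (B \<omega>)\<^sup>2 * (U \<omega>)\<^sup>2)"
    by (auto simp: power_mult_distrib)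
  moreover have "(\<lambda>\<omega>. (B \<omega>)\<^sup>2) \<in> borel_measurable (sub J)" "(\<lambda>\<omega>. (U \<omega>)\<^sup>2) \<in> borel_measurable (sub {i})"
    using assms(4,5) by auto
  moreover have "integrable M (\<lambda>\<omega>. (B \<omega>)\<^sup>2)" "integrable M (\<lambda>\<omega>. (U \<omega>)\<^sup>2)"
    "B \<in> borel_measurable M" "U \<in> borel_measurable M"
    using assms(6,7) by (auto simp: L2_def)
  ultimately show "L2 (\<lambda>\<omega>. U \<omega> * B \<omega>)"
    and "expectation (\<lambda>\<omega>. (U \<omega> * B \<omega>)\<^sup>2) = expectation (\<lambda>\<omega>. (U \<omega>)\<^sup>2) * expectation (\<lambda>\<omega>. (B \<omega>)\<^sup>2)"
    using integrable_block_mult[OF assms(1-3)] expectation_block_mult[OF assms(1-3)]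
    by (simp_all add: L2_def)
qed

lemma L4_block_mult:
  assumes "J \<subseteq> I" "i \<in> I" "i \<notin> J" "B \<in> borel_measurable (sub J)" "U \<in> borel_measurable (sub {i})" "L4 B" "L4 U"
  shows "L4 (\<lambda>\<omega>. U \<omega> * B \<omega>)"
    and "expectation (\<lambda>\<omega>. (U \<omega> * B \<omega>) ^ 4) = expectation (\<lambda>\<omega>. (U \<omega>) ^ 4) * expectation (\<lambda>\<omega>. (B \<omega>) ^ 4)"
proof -
  have "(\<lambda>\<omega>. (U \<omega> * B \<omega>) ^ 4) = (\<lambda>\<omega>. (B \<omega>) ^ 4 * (U \<omega>) ^ 4)"
    by (auto simp: power_mult_distrib)
  moreover have "(\<lambda>\<omega>. (B \<omega>) ^ 4) \<in> borel_measurable (sub J)" "(\<lambda>\<omega>. (U \<omega>) ^ 4) \<in> borel_measurable (sub {i})"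
    using assms(4,5) by auto
  moreover have "integrable M (\<lambda>\<omega>. (B \<omega>) ^ 4)" "integrable M (\<lambda>\<omega>. (U \<omega>) ^ 4)"
    "B \<in> borel_measurable M" "U \<in> borel_measurable M"
    using assms(6,7) by (auto simp: L4_def)
  ultimately show "L4 (\<lambda>\<omega>. U \<omega> * B \<omega>)"
    and "expectation (\<lambda>\<omega>. (U \<omega> * B \<omega>) ^ 4) = expectation (\<lambda>\<omega>. (U \<omega>) ^ 4) * expectation (\<lambda>\<omega>. (B \<omega>) ^ 4)"
    using integrable_block_mult[OF assms(1-3)] expectation_block_mult[OF assms(1-3)]
    by (simp_all add: L4_def)
qed

lemma expectation_centered_mult:
  assumes "J \<subseteq> I" "i \<in> I" "i \<notin> J" "A \<in> borel_measurable (sub J)" "B \<in> borel_measurable (sub J)"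
    "U \<in> borel_measurable (sub {i})" "integrable M (\<lambda>\<omega>. A \<omega> * B \<omega>)" "L2 U" "expectation U = 0"
  shows "integrable M (\<lambda>\<omega>. A \<omega> * (U \<omega> * B \<omega>))" "expectation (\<lambda>\<omega>. A \<omega> * (U \<omega> * B \<omega>)) = 0"
proof -
  have *: "(\<lambda>\<omega>. A \<omega> * (U \<omega> * B \<omega>)) = (\<lambda>\<omega>. (A \<omega> * B \<omega>) * U \<omega>)" by (auto simp: algebra_simps)
  show "integrable M (\<lambda>\<omega>. A \<omega> * (U \<omega> * B \<omega>))" "expectation (\<lambda>\<omega>. A \<omega> * (U \<omega> * B \<omega>)) = 0"
    using integrable_block_mult[of J i "\<lambda>\<omega>. A \<omega> * B \<omega>" U] expectation_block_mult[of J i "\<lambda>\<omega>. A \<omega> * B \<omega>" U] assms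
    unfolding * by (auto simp: L2_integrable)
qed

text \<open>The three summands are orthogonal: \<open>U\<close> and \<open>V\<close> are centred and
  independent of \<open>A\<close>, \<open>B\<close>, \<open>C\<close>, and the last cross term
  factors into E(B C) E(U V) with E(U V) = 0.\<close>

lemma second_moment_step:
  assumes J: "J \<subseteq> I" "i \<in> I" "i \<notin> J"
    and A: "A \<in> borel_measurable (sub J)" "L2 A" and B: "B \<in> borel_measurable (sub J)" "L2 B"
    and C: "C \<in> borel_measurable (sub J)" "L2 C"
    and U: "U \<in> borel_measurable (sub {i})" "L2 U" "expectation U = 0"
    and V: "V \<in> borel_measurable (sub {i})" "L2 V" "expectation V = 0"
    and UV: "expectation (\<lambda>\<omega>. U \<omega> * V \<omega>) = 0"
  shows "expectation (\<lambda>\<omega>. (A \<omega> + U \<omega> * B \<omega> + V \<omega> * C \<omega>)\<^sup>2) = expectation (\<lambda>\<omega>. (A \<omega>)\<^sup>2) +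
    expectation (\<lambda>\<omega>. (U \<omega>)\<^sup>2) * expectation (\<lambda>\<omega>. (B \<omega>)\<^sup>2) + expectation (\<lambda>\<omega>. (V \<omega>)\<^sup>2) * expectation (\<lambda>\<omega>. (C \<omega>)\<^sup>2)"
proof -
  note AUB = expectation_centered_mult[OF J A(1) B(1) U(1) L2_integrable_mult[OF A(2) B(2)] U(2,3)]
  note AVC = expectation_centered_mult[OF J A(1) C(1) V(1) L2_integrable_mult[OF A(2) C(2)] V(2,3)]
  note UB = L2_block_mult[OF J B(1) U(1) B(2) U(2)]
  note VC = L2_block_mult[OF J C(1) V(1) C(2) V(2)]
  have eq: "(\<lambda>\<omega>. (U \<omega> * B \<omega>) * (V \<omega> * C \<omega>)) = (\<lambda>\<omega>. (B \<omega> * C \<omega>) * (U \<omega> * V \<omega>))" by auto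
  have UBVC: "expectation (\<lambda>\<omega>. (U \<omega> * B \<omega>) * (V \<omega> * C \<omega>)) = 0"
    unfolding eq using UV J A B C U V
    by (subst expectation_block_mult[of J i]) (auto intro: L2_integrable_mult)
  have "expectation (\<lambda>\<omega>. (A \<omega> + U \<omega> * B \<omega> + V \<omega> * C \<omega>)\<^sup>2) = expectation (\<lambda>\<omega>. (A \<omega>)\<^sup>2 + (U \<omega> * B \<omega>)\<^sup>2 + (V \<omega> * C \<omega>)\<^sup>2
      + 2 * (A \<omega> * (U \<omega> * B \<omega>)) + 2 * (A \<omega> * (V \<omega> * C \<omega>)) + 2 * ((U \<omega> * B \<omega>) * (V \<omega> * C \<omega>)))"
    by (intro Bochner_Integration.integral_cong refl) (simp add: power2_eq_square algebra_simps)
  also have "\<dots> = expectation (\<lambda>\<omega>. (A \<omega>)\<^sup>2) + expectation (\<lambda>\<omega>. (U \<omega> * B \<omega>)\<^sup>2) + expectation (\<lambda>\<omega>. (V \<omega> * C \<omega>)\<^sup>2)"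
    using AUB AVC UBVC A UB(1) VC(1) L2_integrable_mult[OF UB(1) VC(1)] by (simp add: L2_def)
  finally show ?thesis using UB(2) VC(2) by simp
qed

text \<open>Here the \<open>U k\<close> may be correlated among themselves, so only orthogonality to
  \<open>A\<close> is exact; the sum of three products is estimated with the factor 3. Keeping the
  coefficient 1 in front of \<open>A\<close> is essential, since a factor there would be compounded
  once per variable.\<close>

lemma second_moment_step3_le:
  assumes J: "J \<subseteq> I" "i \<in> I" "i \<notin> J"
    and A: "A \<in> borel_measurable (sub J)" "L2 A"
    and B: "\<And>k::nat. k < 3 \<Longrightarrow> B k \<in> borel_measurable (sub J)" "\<And>k. k < 3 \<Longrightarrow> L2 (B k)"
    and U: "\<And>k. k < 3 \<Longrightarrow> U k \<in> borel_measurable (sub {i})" "\<And>k. k < 3 \<Longrightarrow> L2 (U k)"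
      "\<And>k. k < 3 \<Longrightarrow> expectation (U k) = 0"
  shows "L2 (\<lambda>\<omega>. A \<omega> + (\<Sum>k<3. U k \<omega> * B k \<omega>))"
    and "expectation (\<lambda>\<omega>. (A \<omega> + (\<Sum>k<3. U k \<omega> * B k \<omega>))\<^sup>2) \<le> expectation (\<lambda>\<omega>. (A \<omega>)\<^sup>2) +
      3 * (\<Sum>k<3. expectation (\<lambda>\<omega>. (U k \<omega>)\<^sup>2) * expectation (\<lambda>\<omega>. (B k \<omega>)\<^sup>2))"
proof -
  define L where "L = (\<lambda>\<omega>. \<Sum>k<3. U k \<omega> * B k \<omega>)"
  have UB: "L2 (\<lambda>\<omega>. U k \<omega> * B k \<omega>)"
     "expectation (\<lambda>\<omega>. (U k \<omega> * B k \<omega>)\<^sup>2) = expectation (\<lambda>\<omega>. (U k \<omega>)\<^sup>2) * expectation (\<lambda>\<omega>. (B k \<omega>)\<^sup>2)" if "k < 3" for k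
    using L2_block_mult[OF J B(1) U(1) B(2) U(2)] that by auto
  have L2L: "L2 L"
    unfolding L_def using UB(1) by (auto simp: numeral_eq_Suc intro!: L2_add)
  show "L2 (\<lambda>\<omega>. A \<omega> + (\<Sum>k<3. U k \<omega> * B k \<omega>))"
    using L2_add[OF A(2) L2L] unfolding L_def .
  have ac: "expectation (\<lambda>\<omega>. A \<omega> * (U k \<omega> * B k \<omega>)) = 0" "integrable M (\<lambda>\<omega>. A \<omega> * (U k \<omega> * B k \<omega>))" if "k < 3" for k
    using expectation_centered_mult[OF J A(1) B(1) U(1) L2_integrable_mult[OF A(2) B(2)] U(2,3)] that by auto
  have AL: "expectation (\<lambda>\<omega>. A \<omega> * L \<omega>) = 0"
    unfolding L_def sum_distrib_left using ac by (subst Bochner_Integration.integral_sum) auto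
  have "(L \<omega>)\<^sup>2 \<le> 3 * (\<Sum>k<3. (U k \<omega> * B k \<omega>)\<^sup>2)" for \<omega>
    using sum_squared_le_sum_of_squares[of "\<lambda>k. U k \<omega> * B k \<omega>" "{..<3}"] by (simp add: L_def mult.commute)
  then have "expectation (\<lambda>\<omega>. (L \<omega>)\<^sup>2) \<le> expectation (\<lambda>\<omega>. 3 * (\<Sum>k<3. (U k \<omega> * B k \<omega>)\<^sup>2))"
    using L2L UB(1) by (intro integral_mono) (auto simp: L2_def intro!: Bochner_Integration.integrable_sum)
  also have "\<dots> = 3 * (\<Sum>k<3. expectation (\<lambda>\<omega>. (U k \<omega>)\<^sup>2) * expectation (\<lambda>\<omega>. (B k \<omega>)\<^sup>2))"
    using UB by (simp add: L2_def Bochner_Integration.integral_sum)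
  finally have EL: "expectation (\<lambda>\<omega>. (L \<omega>)\<^sup>2) \<le> 3 * (\<Sum>k<3. expectation (\<lambda>\<omega>. (U k \<omega>)\<^sup>2) * expectation (\<lambda>\<omega>. (B k \<omega>)\<^sup>2))" .
  have "expectation (\<lambda>\<omega>. (A \<omega> + L \<omega>)\<^sup>2) = expectation (\<lambda>\<omega>. (A \<omega>)\<^sup>2 + (L \<omega>)\<^sup>2 + 2 * (A \<omega> * L \<omega>))"
    by (intro Bochner_Integration.integral_cong refl) (simp add: power2_eq_square algebra_simps)
  also have "\<dots> = expectation (\<lambda>\<omega>. (A \<omega>)\<^sup>2) + expectation (\<lambda>\<omega>. (L \<omega>)\<^sup>2)"
    using A L2L AL L2_integrable_mult[OF A(2) L2L] by (simp add: L2_def)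
  finally show "expectation (\<lambda>\<omega>. (A \<omega> + (\<Sum>k<3. U k \<omega> * B k \<omega>))\<^sup>2) \<le> expectation (\<lambda>\<omega>. (A \<omega>)\<^sup>2) +
      3 * (\<Sum>k<3. expectation (\<lambda>\<omega>. (U k \<omega>)\<^sup>2) * expectation (\<lambda>\<omega>. (B k \<omega>)\<^sup>2))"
    using EL by (simp add: L_def)
qed

end

text \<open>The second derivative of the monomial along a curve with velocity \<open>y\<close> and acceleration \<open>z\<close>.\<close>

definition mon2 :: "(nat \<Rightarrow> real) \<Rightarrow> (nat \<Rightarrow> real) \<Rightarrow> (nat \<Rightarrow> real) \<Rightarrow> nat set \<Rightarrow> real" where
  "mon2 x y z S = mon 0 x z S + (\<Sum>k\<in>S. y k * mon 0 x y (S - {k}))"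

definition form2 :: "nat set \<Rightarrow> (nat set \<Rightarrow> real) \<Rightarrow> (nat \<Rightarrow> real) \<Rightarrow> (nat \<Rightarrow> real) \<Rightarrow> (nat \<Rightarrow> real) \<Rightarrow> real" where
  "form2 I c x y z = (\<Sum>S\<in>Pow I. c S * mon2 x y z S)"

lemma mon2_insert:
  assumes "finite S" "i \<notin> S"
  shows "mon2 x y z (insert i S) = x i * mon2 x y z S + 2 * y i * mon 0 x y S + z i * mon 1 x (\<lambda>_. 0) S"
proof -
  have "(\<Sum>k\<in>S. y k * mon 0 x y (insert i S - {k})) =
      (\<Sum>k\<in>S. x i * (y k * mon 0 x y (S - {k})) + y i * (y k * (\<Prod>i\<in>S - {k}. x i)))"
  proof (intro sum.cong refl)
    fix k assume k: "k \<in> S"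
    then have "insert i S - {k} = insert i (S - {k})" using assms by auto
    then show "y k * mon 0 x y (insert i S - {k}) = x i * (y k * mon 0 x y (S - {k})) + y i * (y k * (\<Prod>i\<in>S - {k}. x i))"
      using assms by (simp add: mon_insert mon_one_zero algebra_simps)
  qed
  also have "\<dots> = x i * (\<Sum>k\<in>S. y k * mon 0 x y (S - {k})) + y i * mon 0 x y S"
    by (simp add: sum.distrib sum_distrib_left mon_def)
  finally show ?thesis
    using assms by (simp add: mon2_def mon_insert mon_one_zero algebra_simps)
qed

lemma mon2_empty [simp]: "mon2 x y z {} = 0"
  by (simp add: mon2_def)

lemma form2_empty [simp]: "form2 {} c x y z = 0"
  by (simp add: form2_def)

lemma form2_insert:
  assumes "finite I" "i \<notin> I"
  shows "form2 (insert i I) c x y z = form2 I c x y z + x i * form2 I (link i c) x y z +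
    2 * y i * form 0 I (link i c) x y + z i * form 1 I (link i c) x (\<lambda>_. 0)"
proof -
  have "(\<Sum>S\<in>Pow I. c (insert i S) * mon2 x y z (insert i S)) =
      (\<Sum>S\<in>Pow I. x i * (c (insert i S) * mon2 x y z S) + 2 * y i * (c (insert i S) * mon 0 x y S) +
        z i * (c (insert i S) * mon 1 x (\<lambda>_. 0) S))"
    using assms by (intro sum.cong refl) (subst mon2_insert, auto intro: finite_subset simp: algebra_simps)
  then show ?thesis
    using sum_Pow_insert[OF assms, of "\<lambda>S. c S * mon2 x y z S"]
    by (simp add: form_def form2_def link_def sum.distrib sum_distrib_left)
qed

lemma borel_measurable_form2:
  assumes "\<And>i. i \<in> I \<Longrightarrow> X i \<in> borel_measurable M" "\<And>i. i \<in> I \<Longrightarrow> Y i \<in> borel_measurable M" "\<And>i. i \<in> I \<Longrightarrow> Z i \<in> borel_measurable M"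
  shows "(\<lambda>\<omega>. form2 I c (\<lambda>i. X i \<omega>) (\<lambda>i. Y i \<omega>) (\<lambda>i. Z i \<omega>)) \<in> borel_measurable M"
  unfolding form2_def mon2_def using assms
  by (intro borel_measurable_sum borel_measurable_times borel_measurable_const borel_measurable_add borel_measurable_mon) auto

context indep_blocks
begin

definition block_rv :: "nat \<Rightarrow> ('a \<Rightarrow> real) \<Rightarrow> bool" where
  "block_rv i U \<longleftrightarrow> U \<in> borel_measurable (sub {i}) \<and> L2 U \<and> expectation U = 0"

lemma block_rv_zero [simp]: "block_rv i (\<lambda>_. 0)"
  by (simp add: block_rv_def)

lemma form2_sub:
  assumes "J \<subseteq> I" "\<And>i. i \<in> J \<Longrightarrow> X i \<in> borel_measurable (sub {i})"
    "\<And>i. i \<in> J \<Longrightarrow> Y i \<in> borel_measurable (sub {i})" "\<And>i. i \<in> J \<Longrightarrow> Z i \<in> borel_measurable (sub {i})"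
  shows "(\<lambda>\<omega>. form2 J c (\<lambda>i. X i \<omega>) (\<lambda>i. Y i \<omega>) (\<lambda>i. Z i \<omega>)) \<in> borel_measurable (sub J)"
proof (rule borel_measurable_form2)
  fix i assume "i \<in> J"
  then show "X i \<in> borel_measurable (sub J)" "Y i \<in> borel_measurable (sub J)" "Z i \<in> borel_measurable (sub J)"
    using assms by (auto intro: sub_mono[of "{i}"])
qed

text \<open>Distinct products of block variables are orthogonal. A set S contributes b^2 through its
  monomial and s through each of its \<open>card S\<close> derivatives in the direction Y.\<close>

lemma form_second_moment:
  assumes "J \<subseteq> I" "\<And>i. i \<in> J \<Longrightarrow> block_rv i (X i)" "\<And>i. i \<in> J \<Longrightarrow> block_rv i (Y i)"
    and "\<And>i. i \<in> J \<Longrightarrow> expectation (\<lambda>\<omega>. (X i \<omega>)\<^sup>2) = 1"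
    and "\<And>i. i \<in> J \<Longrightarrow> expectation (\<lambda>\<omega>. (Y i \<omega>)\<^sup>2) = s"
    and "\<And>i. i \<in> J \<Longrightarrow> expectation (\<lambda>\<omega>. X i \<omega> * Y i \<omega>) = 0"
  shows "L2 (\<lambda>\<omega>. form b J c (\<lambda>i. X i \<omega>) (\<lambda>i. Y i \<omega>)) \<and>
    expectation (\<lambda>\<omega>. (form b J c (\<lambda>i. X i \<omega>) (\<lambda>i. Y i \<omega>))\<^sup>2) = (\<Sum>S\<in>Pow J. (c S)\<^sup>2 * (b\<^sup>2 + s * card S))"
  using finite_subset[OF assms(1) finite_I] assms
proof (induction J arbitrary: b c Y s rule: finite_induct)
  case empty
  then show ?case by (simp add: power_mult_distrib prob_space)
next
  case (insert i J)
  let ?A = "\<lambda>\<omega>. form b J c (\<lambda>i. X i \<omega>) (\<lambda>i. Y i \<omega>)"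
  let ?B = "\<lambda>\<omega>. form b J (link i c) (\<lambda>i. X i \<omega>) (\<lambda>i. Y i \<omega>)"
  let ?C = "\<lambda>\<omega>. form 1 J (link i c) (\<lambda>i. X i \<omega>) (\<lambda>i. 0)"
  have J: "J \<subseteq> I" "i \<in> I" "i \<notin> J" using insert by auto
  have A: "?A \<in> borel_measurable (sub J)" and B: "?B \<in> borel_measurable (sub J)"
    and C: "?C \<in> borel_measurable (sub J)"
    using insert.prems J by (auto intro!: form_sub simp: block_rv_def)
  have A2: "L2 ?A" "expectation (\<lambda>\<omega>. (?A \<omega>)\<^sup>2) = (\<Sum>S\<in>Pow J. (c S)\<^sup>2 * (b\<^sup>2 + s * card S))"
    and B2: "L2 ?B" "expectation (\<lambda>\<omega>. (?B \<omega>)\<^sup>2) = (\<Sum>S\<in>Pow J. (link i c S)\<^sup>2 * (b\<^sup>2 + s * card S))"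
    using insert.IH[OF J(1), of Y s] insert.prems by auto
  have C2: "L2 ?C" "expectation (\<lambda>\<omega>. (?C \<omega>)\<^sup>2) = (\<Sum>S\<in>Pow J. (link i c S)\<^sup>2)"
    using insert.IH[OF J(1), of "\<lambda>_ _. 0" 0 1 "link i c"] insert.prems by auto
  have U: "X i \<in> borel_measurable (sub {i})" "L2 (X i)" "expectation (X i) = 0"
    and V: "Y i \<in> borel_measurable (sub {i})" "L2 (Y i)" "expectation (Y i) = 0"
    using insert.prems by (auto simp: block_rv_def)
  have f: "form b (insert i J) c (\<lambda>i. X i \<omega>) (\<lambda>i. Y i \<omega>) = ?A \<omega> + X i \<omega> * ?B \<omega> + Y i \<omega> * ?C \<omega>" for \<omega>
    using insert by (simp add: form_insert)
  have "expectation (\<lambda>\<omega>. (?A \<omega> + X i \<omega> * ?B \<omega> + Y i \<omega> * ?C \<omega>)\<^sup>2) =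
     expectation (\<lambda>\<omega>. (?A \<omega>)\<^sup>2) + expectation (\<lambda>\<omega>. (?B \<omega>)\<^sup>2) + s * expectation (\<lambda>\<omega>. (?C \<omega>)\<^sup>2)"
    using second_moment_step[OF J A A2(1) B B2(1) C C2(1) U V] insert.prems by simp
  also have "\<dots> = (\<Sum>S\<in>Pow J. (c S)\<^sup>2 * (b\<^sup>2 + s * card S)) + (\<Sum>S\<in>Pow J. (link i c S)\<^sup>2 * (b\<^sup>2 + s * (1 + card S)))"
    unfolding A2 B2 C2 by (simp add: sum.distrib[symmetric] sum_distrib_left algebra_simps)
  also have "(\<Sum>S\<in>Pow J. (link i c S)\<^sup>2 * (b\<^sup>2 + s * (1 + card S))) =
     (\<Sum>S\<in>Pow J. (c (insert i S))\<^sup>2 * (b\<^sup>2 + s * card (insert i S)))"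
  proof (intro sum.cong refl)
    fix S assume "S \<in> Pow J"
    then have "card (insert i S) = Suc (card S)"
      using insert by (subst card_insert_disjoint) (auto intro: finite_subset)
    then show "(link i c S)\<^sup>2 * (b\<^sup>2 + s * (1 + card S)) = (c (insert i S))\<^sup>2 * (b\<^sup>2 + s * card (insert i S))"
      by (simp add: link_def)
  qed
  finally show ?case
    unfolding f using L2_add[OF L2_add[OF A2(1) L2_block_mult(1)[OF J B U(1) B2(1) U(2)]] L2_block_mult(1)[OF J C V(1) C2(1) V(2)]]
      sum_Pow_insert[of J i "\<lambda>S. (c S)\<^sup>2 * (b\<^sup>2 + s * card S)"] insert.hyps by simp
qed

lemma form_second_moment_le:
  assumes "J \<subseteq> I" "\<And>i. i \<in> J \<Longrightarrow> block_rv i (X i)" "\<And>i. i \<in> J \<Longrightarrow> block_rv i (Y i)"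
    and "\<And>i. i \<in> J \<Longrightarrow> expectation (\<lambda>\<omega>. (X i \<omega>)\<^sup>2) = 1"
    and "\<And>i. i \<in> J \<Longrightarrow> expectation (\<lambda>\<omega>. (Y i \<omega>)\<^sup>2) = s"
    and "\<And>i. i \<in> J \<Longrightarrow> expectation (\<lambda>\<omega>. X i \<omega> * Y i \<omega>) = 0"
    and "0 \<le> s" "s \<le> 1" "b\<^sup>2 \<le> 1" "deg_le d J c"
  shows "expectation (\<lambda>\<omega>. (form b J c (\<lambda>i. X i \<omega>) (\<lambda>i. Y i \<omega>))\<^sup>2) \<le> (1 + real d) * coef_norm J c"
proof -
  have "(\<Sum>S\<in>Pow J. (c S)\<^sup>2 * (b\<^sup>2 + s * card S)) \<le> (\<Sum>S\<in>Pow J. (c S)\<^sup>2 * (1 + real d))"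
  proof (intro sum_mono)
    fix S assume "S \<in> Pow J"
    show "(c S)\<^sup>2 * (b\<^sup>2 + s * card S) \<le> (c S)\<^sup>2 * (1 + real d)"
    proof (cases "d < card S")
      case True
      then show ?thesis using assms(10) \<open>S \<in> Pow J\<close> by (auto simp: deg_le_def)
    next
      case False
      have "s * card S \<le> 1 * real d" using False assms by (intro mult_mono) auto
      then show ?thesis using assms by (intro mult_left_mono) auto
    qed
  qed
  then show ?thesis
    using form_second_moment[OF assms(1-6), of b c] by (simp add: coef_norm_def sum_distrib_left mult.commute)
qed

end

text \<open>The recursion is dictated by \<open>form_diff_second_moment\<close>: a factor 3 for
  three products, 1 + d for the second moment of the form multiplied by \<open>X i - X' i\<close>,
  and twice the constant of lower degree for the two differences of linked forms.\<close>

fun diff_const :: "nat \<Rightarrow> real" where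
  "diff_const 0 = 0"
| "diff_const (Suc d) = 3 * (1 + real d + 2 * diff_const d)"

lemma diff_const_nonneg [simp]: "0 \<le> diff_const d"
  by (induction d) auto

lemma sum_lessThan_3: "(\<Sum>k<3. f k) = f 0 + f 1 + f (2::nat)" for f :: "nat \<Rightarrow> real"
  by (simp add: numeral_eq_Suc)

context indep_blocks
begin

text \<open>Replacing X by a nearby X' in all variables costs \<epsilon> times the coefficient norm,
  whatever the number of variables, because the contributions of different coefficients add up
  orthogonally instead of accumulating by the triangle inequality.\<close>

lemma form_diff_second_moment:
  assumes "J \<subseteq> I" "\<And>i. i \<in> J \<Longrightarrow> block_rv i (X i)" "\<And>i. i \<in> J \<Longrightarrow> block_rv i (Y i)"
    and "\<And>i. i \<in> J \<Longrightarrow> block_rv i (X' i)"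
    and "\<And>i. i \<in> J \<Longrightarrow> expectation (\<lambda>\<omega>. (X i \<omega>)\<^sup>2) = 1"
    and "\<And>i. i \<in> J \<Longrightarrow> expectation (\<lambda>\<omega>. (Y i \<omega>)\<^sup>2) = s"
    and "\<And>i. i \<in> J \<Longrightarrow> expectation (\<lambda>\<omega>. X i \<omega> * Y i \<omega>) = 0"
    and "0 \<le> s" "s \<le> 1" "b\<^sup>2 \<le> 1" "deg_le d J c"
    and "\<And>i. i \<in> J \<Longrightarrow> expectation (\<lambda>\<omega>. (X' i \<omega>)\<^sup>2) \<le> 1"
    and "\<And>i. i \<in> J \<Longrightarrow> expectation (\<lambda>\<omega>. (X i \<omega> - X' i \<omega>)\<^sup>2) \<le> \<epsilon>" "0 \<le> \<epsilon>"
  shows "L2 (\<lambda>\<omega>. form b J c (\<lambda>i. X i \<omega>) (\<lambda>i. Y i \<omega>) - form b J c (\<lambda>i. X' i \<omega>) (\<lambda>i. Y i \<omega>)) \<and>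
    expectation (\<lambda>\<omega>. (form b J c (\<lambda>i. X i \<omega>) (\<lambda>i. Y i \<omega>) - form b J c (\<lambda>i. X' i \<omega>) (\<lambda>i. Y i \<omega>))\<^sup>2)
      \<le> \<epsilon> * diff_const d * coef_norm J c"
  using finite_subset[OF assms(1) finite_I] assms
proof (induction J arbitrary: b c Y s d rule: finite_induct)
  case empty
  then show ?case by simp
next
  case (insert i J)
  have J: "J \<subseteq> I" "i \<in> I" "i \<notin> J" using insert by auto
  define A where "A = (\<lambda>\<omega>. form b J c (\<lambda>i. X i \<omega>) (\<lambda>i. Y i \<omega>) - form b J c (\<lambda>i. X' i \<omega>) (\<lambda>i. Y i \<omega>))"
  define B where "B = (\<lambda>\<omega>. form b J (link i c) (\<lambda>i. X i \<omega>) (\<lambda>i. Y i \<omega>))"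
  define B' where "B' = (\<lambda>\<omega>. form b J (link i c) (\<lambda>i. X i \<omega>) (\<lambda>i. Y i \<omega>) - form b J (link i c) (\<lambda>i. X' i \<omega>) (\<lambda>i. Y i \<omega>))"
  define C' where "C' = (\<lambda>\<omega>. form 1 J (link i c) (\<lambda>i. X i \<omega>) (\<lambda>i. 0) - form 1 J (link i c) (\<lambda>i. X' i \<omega>) (\<lambda>i. 0))"
  \<comment> \<open>The telescoping x B - x' B' = (x - x') B + x' (B - B'), in which only the first
    product needs the closeness of x and x' directly.\<close>
  have f: "form b (insert i J) c (\<lambda>i. X i \<omega>) (\<lambda>i. Y i \<omega>) - form b (insert i J) c (\<lambda>i. X' i \<omega>) (\<lambda>i. Y i \<omega>) =
      A \<omega> + (\<Sum>k<(3::nat). (if k = 0 then \<lambda>\<omega>. X i \<omega> - X' i \<omega> else if k = 1 then X' i else Y i) \<omega> *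
         (if k = 0 then B else if k = 1 then B' else C') \<omega>)" for \<omega>
    unfolding A_def B_def B'_def C'_def sum_lessThan_3
    using insert.hyps by (simp add: form_insert algebra_simps)
  let ?U = "\<lambda>k::nat. if k = 0 then \<lambda>\<omega>. X i \<omega> - X' i \<omega> else if k = 1 then X' i else Y i"
  let ?B = "\<lambda>k::nat. if k = 0 then B else if k = 1 then B' else C'"
  have m: "A \<in> borel_measurable (sub J)" "B \<in> borel_measurable (sub J)" "B' \<in> borel_measurable (sub J)" "C' \<in> borel_measurable (sub J)"
    unfolding A_def B_def B'_def C'_def
    using insert.prems J by (auto intro!: form_sub borel_measurable_diff simp: block_rv_def)
  have IHA: "L2 A \<and> expectation (\<lambda>\<omega>. (A \<omega>)\<^sup>2) \<le> \<epsilon> * diff_const d * coef_norm J c"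
    unfolding A_def using insert.IH[OF J(1), of Y s b d c] insert.prems by (auto intro: deg_le_subset)
  have rvs: "block_rv i (X i)" "block_rv i (X' i)" "block_rv i (Y i)" using insert.prems by auto
  have U: "?U k \<in> borel_measurable (sub {i})" "L2 (?U k)" "expectation (?U k) = 0" for k
    using rvs by (auto simp: block_rv_def L2_integrable intro: L2_diff)
  have L2B: "L2 B" unfolding B_def using form_second_moment[of J X Y s b "link i c"] insert.prems J by auto
  show ?case
  proof (cases d)
    case 0
    have z: "link i c S = 0" if "S \<subseteq> J" for S
      using link_zero[OF insert.hyps] insert.prems that 0 by auto
    have "form b' J (link i c) x y = 0" for b' x y
      unfolding form_def using z by (intro sum.neutral) auto
    then have "B = (\<lambda>_. 0)" "B' = (\<lambda>_. 0)" "C' = (\<lambda>_. 0)"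
      by (auto simp: B_def B'_def C'_def)
    moreover have "coef_norm J (link i c) = 0"
      unfolding coef_norm_def using z by (intro sum.neutral) auto
    ultimately show ?thesis
      unfolding f using IHA insert.hyps by (simp add: sum_lessThan_3 coef_norm_insert)
  next
    case (Suc d')
    have deg: "deg_le d' J (link i c)"
      using deg_le_link[OF insert.hyps] insert.prems Suc by auto
    let ?n = "coef_norm J (link i c)"
    have B2: "expectation (\<lambda>\<omega>. (B \<omega>)\<^sup>2) \<le> (1 + real d') * ?n"
      unfolding B_def using insert.prems deg J by (intro form_second_moment_le[where s=s]) auto
    have B'2: "L2 B' \<and> expectation (\<lambda>\<omega>. (B' \<omega>)\<^sup>2) \<le> \<epsilon> * diff_const d' * ?n"
      unfolding B'_def using insert.IH[OF J(1), of Y s b d' "link i c"] insert.prems deg by auto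
    have C'2: "L2 C' \<and> expectation (\<lambda>\<omega>. (C' \<omega>)\<^sup>2) \<le> \<epsilon> * diff_const d' * ?n"
      unfolding C'_def using insert.IH[OF J(1), of "\<lambda>_ _. 0" 0 1 d' "link i c"] insert.prems deg by auto
    have Bk: "?B k \<in> borel_measurable (sub J)" "L2 (?B k)" for k
      using m L2B B'2 C'2 by auto
    have "3 * (\<Sum>k<3. expectation (\<lambda>\<omega>. (?U k \<omega>)\<^sup>2) * expectation (\<lambda>\<omega>. (?B k \<omega>)\<^sup>2)) \<le>
       3 * (\<epsilon> * ((1 + real d') * ?n) + 1 * (\<epsilon> * diff_const d' * ?n) + 1 * (\<epsilon> * diff_const d' * ?n))"
    proof -
      have "expectation (\<lambda>\<omega>. (X i \<omega> - X' i \<omega>)\<^sup>2) * expectation (\<lambda>\<omega>. (B \<omega>)\<^sup>2) \<le> \<epsilon> * ((1 + real d') * ?n)"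
        using insert.prems(13)[of i] insert.prems(14) B2 by (intro mult_mono) auto
      moreover have "expectation (\<lambda>\<omega>. (X' i \<omega>)\<^sup>2) * expectation (\<lambda>\<omega>. (B' \<omega>)\<^sup>2) \<le> 1 * (\<epsilon> * diff_const d' * ?n)"
        using insert.prems(12)[of i] B'2 by (intro mult_mono) auto
      moreover have "expectation (\<lambda>\<omega>. (Y i \<omega>)\<^sup>2) * expectation (\<lambda>\<omega>. (C' \<omega>)\<^sup>2) \<le> 1 * (\<epsilon> * diff_const d' * ?n)"
        using insert.prems(6)[of i] insert.prems(9) C'2 by (intro mult_mono) auto
      ultimately show ?thesis unfolding sum_lessThan_3 by simp
    qed
    also have "\<dots> = \<epsilon> * diff_const d * ?n"
      by (simp add: Suc algebra_simps)
    finally have "expectation (\<lambda>\<omega>. (A \<omega> + (\<Sum>k<3. ?U k \<omega> * ?B k \<omega>))\<^sup>2) \<le> \<epsilon> * diff_const d * (coef_norm J c + ?n)"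
      using second_moment_step3_le(2)[where B = ?B and U = ?U, OF J m(1) IHA[THEN conjunct1] Bk U] IHA
      unfolding distrib_left by linarith
    then show ?thesis
      unfolding f using second_moment_step3_le(1)[where B = ?B and U = ?U, OF J m(1) IHA[THEN conjunct1] Bk U] insert.hyps
      by (simp add: coef_norm_insert)
  qed
qed

end

text \<open>The three products in the expansion of \<open>form2\<close> at a coordinate give the
  summands: \<open>form2\<close> of lower degree, twice a directional derivative (hence 4 after
  squaring), and the value of a linked form.\<close>

fun second_const :: "nat \<Rightarrow> real" where
  "second_const 0 = 0"
| "second_const (Suc d) = 3 * (second_const d + 4 * (1 + real d) + 1 + real d)"

lemma second_const_nonneg [simp]: "0 \<le> second_const d"
  by (induction d) auto

context indep_blocks
begin

text \<open>No condition ties Z to X or Y: in the rotation flow the acceleration is a multiple of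
  \<open>u\<close> and is correlated with the value \<open>r + \<alpha> u\<close>. For this reason
  only the inequality \<open>second_moment_step3_le\<close> is available.\<close>

lemma form2_second_moment:
  assumes "J \<subseteq> I" "\<And>i. i \<in> J \<Longrightarrow> block_rv i (X i)" "\<And>i. i \<in> J \<Longrightarrow> block_rv i (Y i)"
    and "\<And>i. i \<in> J \<Longrightarrow> block_rv i (Z i)"
    and "\<And>i. i \<in> J \<Longrightarrow> expectation (\<lambda>\<omega>. (X i \<omega>)\<^sup>2) = 1"
    and "\<And>i. i \<in> J \<Longrightarrow> expectation (\<lambda>\<omega>. (Y i \<omega>)\<^sup>2) = s"
    and "\<And>i. i \<in> J \<Longrightarrow> expectation (\<lambda>\<omega>. X i \<omega> * Y i \<omega>) = 0"
    and "0 \<le> s" "s \<le> 1" "deg_le d J c"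
    and "\<And>i. i \<in> J \<Longrightarrow> expectation (\<lambda>\<omega>. (Z i \<omega>)\<^sup>2) \<le> 1"
  shows "L2 (\<lambda>\<omega>. form2 J c (\<lambda>i. X i \<omega>) (\<lambda>i. Y i \<omega>) (\<lambda>i. Z i \<omega>)) \<and>
    expectation (\<lambda>\<omega>. (form2 J c (\<lambda>i. X i \<omega>) (\<lambda>i. Y i \<omega>) (\<lambda>i. Z i \<omega>))\<^sup>2) \<le> second_const d * coef_norm J c"
  using finite_subset[OF assms(1) finite_I] assms
proof (induction J arbitrary: c d rule: finite_induct)
  case empty
  then show ?case by simp
next
  case (insert i J)
  have J: "J \<subseteq> I" "i \<in> I" "i \<notin> J" using insert by auto
  define A where "A = (\<lambda>\<omega>. form2 J c (\<lambda>i. X i \<omega>) (\<lambda>i. Y i \<omega>) (\<lambda>i. Z i \<omega>))"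
  define B where "B = (\<lambda>\<omega>. form2 J (link i c) (\<lambda>i. X i \<omega>) (\<lambda>i. Y i \<omega>) (\<lambda>i. Z i \<omega>))"
  define B' where "B' = (\<lambda>\<omega>. 2 * form 0 J (link i c) (\<lambda>i. X i \<omega>) (\<lambda>i. Y i \<omega>))"
  define C' where "C' = (\<lambda>\<omega>. form 1 J (link i c) (\<lambda>i. X i \<omega>) (\<lambda>i. 0))"
  let ?U = "\<lambda>k::nat. if k = 0 then X i else if k = 1 then Y i else Z i"
  let ?B = "\<lambda>k::nat. if k = 0 then B else if k = 1 then B' else C'"
  have f: "form2 (insert i J) c (\<lambda>i. X i \<omega>) (\<lambda>i. Y i \<omega>) (\<lambda>i. Z i \<omega>) =
      A \<omega> + (\<Sum>k<3. ?U k \<omega> * ?B k \<omega>)" for \<omega>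
    unfolding A_def B_def B'_def C'_def sum_lessThan_3
    using insert.hyps by (simp add: form2_insert algebra_simps)
  have m: "A \<in> borel_measurable (sub J)" "B \<in> borel_measurable (sub J)" "B' \<in> borel_measurable (sub J)" "C' \<in> borel_measurable (sub J)"
    unfolding A_def B_def B'_def C'_def
    using insert.prems J by (auto intro!: form_sub form2_sub borel_measurable_times simp: block_rv_def)
  have IHA: "L2 A \<and> expectation (\<lambda>\<omega>. (A \<omega>)\<^sup>2) \<le> second_const d * coef_norm J c"
    unfolding A_def using insert.prems by (intro insert.IH) (auto intro: deg_le_subset)
  have rvs: "block_rv i (X i)" "block_rv i (Y i)" "block_rv i (Z i)" using insert.prems by auto
  have U: "?U k \<in> borel_measurable (sub {i})" "L2 (?U k)" "expectation (?U k) = 0" for k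
    using rvs by (auto simp: block_rv_def)
  show ?case
  proof (cases d)
    case 0
    have z: "link i c S = 0" if "S \<subseteq> J" for S
      using link_zero[OF insert.hyps] insert.prems that 0 by auto
    have "form b' J (link i c) x y = 0" "form2 J (link i c) x y z' = 0" for b' x y z'
      unfolding form_def form2_def using z by (auto intro!: sum.neutral)
    then have "B = (\<lambda>_. 0)" "B' = (\<lambda>_. 0)" "C' = (\<lambda>_. 0)"
      by (auto simp: B_def B'_def C'_def)
    moreover have "coef_norm J (link i c) = 0"
      unfolding coef_norm_def using z by (intro sum.neutral) auto
    ultimately show ?thesis
      unfolding f using IHA insert.hyps by (simp add: sum_lessThan_3 coef_norm_insert)
  next
    case (Suc d')
    have deg: "deg_le d' J (link i c)"
      using deg_le_link[OF insert.hyps] insert.prems Suc by auto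
    let ?n = "coef_norm J (link i c)"
    have B2: "L2 B \<and> expectation (\<lambda>\<omega>. (B \<omega>)\<^sup>2) \<le> second_const d' * ?n"
      unfolding B_def using insert.prems deg by (intro insert.IH) auto
    have "expectation (\<lambda>\<omega>. (form 0 J (link i c) (\<lambda>i. X i \<omega>) (\<lambda>i. Y i \<omega>))\<^sup>2) \<le> (1 + real d') * ?n"
      using insert.prems deg J by (intro form_second_moment_le[where s=s]) auto
    then have B'2: "expectation (\<lambda>\<omega>. (B' \<omega>)\<^sup>2) \<le> 4 * (1 + real d') * ?n"
      unfolding B'_def power_mult_distrib by (simp add: mult.assoc del: distrib_right_numeral distrib_left_numeral)
    have C'2: "expectation (\<lambda>\<omega>. (C' \<omega>)\<^sup>2) \<le> (1 + real d') * ?n"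
      unfolding C'_def using insert.prems deg J by (intro form_second_moment_le[where s=0]) auto
    have "L2 B'" unfolding B'_def using form_second_moment[of J X Y s 0 "link i c"] insert.prems J
      by (intro L2_cmult) auto
    moreover have "L2 C'" unfolding C'_def using form_second_moment[of J X "\<lambda>_ _. 0" 0 1 "link i c"] insert.prems J by auto
    ultimately have Bk: "?B k \<in> borel_measurable (sub J)" "L2 (?B k)" for k
      using m B2 by auto
    have mult_le: "a * b \<le> b'" if "a \<le> 1" "b \<le> b'" "0 \<le> b" for a b b' :: real
    proof -
      have "a * b \<le> 1 * b'" using that by (intro mult_mono) auto
      then show ?thesis by simp
    qed
    have "3 * (\<Sum>k<3. expectation (\<lambda>\<omega>. (?U k \<omega>)\<^sup>2) * expectation (\<lambda>\<omega>. (?B k \<omega>)\<^sup>2)) \<le>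
       3 * (second_const d' * ?n + 4 * (1 + real d') * ?n + (1 + real d') * ?n)"
      unfolding sum_lessThan_3
      using insert.prems(5)[of i] insert.prems(6)[of i] insert.prems(9) insert.prems(11)[of i] B2 B'2 C'2
      by (intro mult_left_mono add_mono) (auto intro!: mult_le)
    also have "\<dots> = second_const d * ?n"
      by (simp add: Suc algebra_simps)
    finally have "expectation (\<lambda>\<omega>. (A \<omega> + (\<Sum>k<3. ?U k \<omega> * ?B k \<omega>))\<^sup>2) \<le> second_const d * (coef_norm J c + ?n)"
      using second_moment_step3_le(2)[where B = ?B and U = ?U, OF J m(1) IHA[THEN conjunct1] Bk U] IHA
      unfolding distrib_left by linarith
    then show ?thesis
      unfolding f using second_moment_step3_le(1)[where B = ?B and U = ?U, OF J m(1) IHA[THEN conjunct1] Bk U] insert.hyps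
      by (simp add: coef_norm_insert)
  qed
qed

text \<open>A hypercontractive estimate: the fourth moment is bounded by the square of the quantity
  that controls the second moment. The increment contributed by block i is centred given the others,
  which removes the cubic cross term and lets the induction close with a constant exponential in
  d.\<close>

lemma form_fourth_moment:
  assumes "J \<subseteq> I" "\<And>i. i \<in> J \<Longrightarrow> block_rv i (X i)" "\<And>i. i \<in> J \<Longrightarrow> block_rv i (Y i)"
    and "\<And>i. i \<in> J \<Longrightarrow> L4 (X i)" "\<And>i. i \<in> J \<Longrightarrow> L4 (Y i)"
    and "\<And>i. i \<in> J \<Longrightarrow> expectation (\<lambda>\<omega>. (X i \<omega>) ^ 4) \<le> K"
    and "\<And>i. i \<in> J \<Longrightarrow> expectation (\<lambda>\<omega>. (Y i \<omega>) ^ 4) \<le> K"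
    and "1 \<le> K" "b\<^sup>2 \<le> 1" "deg_le d J c"
  shows "L4 (\<lambda>\<omega>. form b J c (\<lambda>i. X i \<omega>) (\<lambda>i. Y i \<omega>)) \<and>
    expectation (\<lambda>\<omega>. (form b J c (\<lambda>i. X i \<omega>) (\<lambda>i. Y i \<omega>)) ^ 4) \<le> (256 * K) ^ d * (coef_norm J c)\<^sup>2"
  using finite_subset[OF assms(1) finite_I] assms
proof (induction J arbitrary: b c Y d rule: finite_induct)
  case empty
  have "b ^ 4 \<le> 1" using empty.prems(9) power_mono[of "b\<^sup>2" 1 2] by simp
  then have b: "c' ^ 4 * b ^ 4 \<le> c' ^ 4" for c' by (intro mult_left_le) auto
  have "(c {} * b) ^ 4 \<le> (256 * K) ^ d * (coef_norm {} c)\<^sup>2"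
  proof -
    have "1 * c {} ^ 4 \<le> (256 * K) ^ d * c {} ^ 4"
      using empty.prems(8) by (intro mult_right_mono one_le_power) auto
    then show ?thesis using b[of "c {}"] by (simp add: coef_norm_def power_mult_distrib)
  qed
  then show ?case by (simp add: prob_space)
next
  case (insert i J)
  have J: "J \<subseteq> I" "i \<in> I" "i \<notin> J" using insert by auto
  define A where "A = (\<lambda>\<omega>. form b J c (\<lambda>i. X i \<omega>) (\<lambda>i. Y i \<omega>))"
  define B where "B = (\<lambda>\<omega>. form b J (link i c) (\<lambda>i. X i \<omega>) (\<lambda>i. Y i \<omega>))"
  define C where "C = (\<lambda>\<omega>. form 1 J (link i c) (\<lambda>i. X i \<omega>) (\<lambda>i. 0))"
  have f: "form b (insert i J) c (\<lambda>i. X i \<omega>) (\<lambda>i. Y i \<omega>) = A \<omega> + (X i \<omega> * B \<omega> + Y i \<omega> * C \<omega>)" for \<omega>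
    using insert by (simp add: form_insert A_def B_def C_def)
  have m: "A \<in> borel_measurable (sub J)" "B \<in> borel_measurable (sub J)" "C \<in> borel_measurable (sub J)"
    unfolding A_def B_def C_def
    using insert.prems J by (auto intro!: form_sub simp: block_rv_def)
  have A4: "L4 A \<and> expectation (\<lambda>\<omega>. (A \<omega>) ^ 4) \<le> (256 * K) ^ d * (coef_norm J c)\<^sup>2"
    unfolding A_def using insert.prems by (intro insert.IH) (auto intro: deg_le_subset)
  show ?case
  proof (cases d)
    case 0
    have z: "link i c S = 0" if "S \<subseteq> J" for S
      using link_zero[OF insert.hyps(1,2)] insert.prems that 0 by auto
    have "form b' J (link i c) x y = 0" for b' x y
      unfolding form_def using z by (auto intro!: sum.neutral)
    then have "B = (\<lambda>_. 0)" "C = (\<lambda>_. 0)"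
      by (auto simp: B_def C_def)
    moreover have "coef_norm J (link i c) = 0"
      unfolding coef_norm_def using z by (intro sum.neutral) auto
    ultimately show ?thesis
      unfolding f using A4 insert.hyps by (simp add: coef_norm_insert)
  next
    case (Suc d')
    have deg: "deg_le d' J (link i c)"
      using deg_le_link[OF insert.hyps(1,2)] insert.prems Suc by auto
    define a where "a = coef_norm J c"
    define s where "s = coef_norm J (link i c)"
    define k where "k = (256 * K) ^ d'"
    have nonneg: "0 \<le> a" "0 \<le> s" "0 \<le> k" using insert.prems(8) by (auto simp: a_def s_def k_def)
    have B4: "L4 B \<and> expectation (\<lambda>\<omega>. (B \<omega>) ^ 4) \<le> k * s\<^sup>2"
      unfolding B_def k_def s_def using insert.prems deg by (intro insert.IH) auto
    have C4: "L4 C \<and> expectation (\<lambda>\<omega>. (C \<omega>) ^ 4) \<le> k * s\<^sup>2"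
      unfolding C_def k_def s_def using insert.prems deg by (intro insert.IH) auto
    have rv: "X i \<in> borel_measurable (sub {i})" "Y i \<in> borel_measurable (sub {i})" "L4 (X i)" "L4 (Y i)"
      "L2 (X i)" "L2 (Y i)" "expectation (X i) = 0" "expectation (Y i) = 0"
      using insert.prems(2-5) by (auto simp: block_rv_def)
    note XB = L4_block_mult[OF J m(2) rv(1) _ rv(3)]
    note YC = L4_block_mult[OF J m(3) rv(2) _ rv(4)]
    define L where "L = (\<lambda>\<omega>. X i \<omega> * B \<omega> + Y i \<omega> * C \<omega>)"
    have L4L: "L4 L" unfolding L_def using XB(1) YC(1) B4 C4 by (intro L4_add) auto
    have EX4: "expectation (\<lambda>\<omega>. (X i \<omega>) ^ 4) \<le> K" "expectation (\<lambda>\<omega>. (Y i \<omega>) ^ 4) \<le> K"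
      using insert.prems by auto
    have "expectation (\<lambda>\<omega>. (L \<omega>) ^ 4) \<le> expectation (\<lambda>\<omega>. 8 * ((X i \<omega> * B \<omega>) ^ 4 + (Y i \<omega> * C \<omega>) ^ 4))"
      using L4L XB(1) YC(1) B4 C4 by (intro integral_mono) (auto simp: L4_def L_def add_pow4_le simp del: distrib_left_numeral)
    also have "\<dots> = 8 * (expectation (\<lambda>\<omega>. (X i \<omega>) ^ 4) * expectation (\<lambda>\<omega>. (B \<omega>) ^ 4) +
        expectation (\<lambda>\<omega>. (Y i \<omega>) ^ 4) * expectation (\<lambda>\<omega>. (C \<omega>) ^ 4))"
      using XB YC B4 C4 by (simp add: L4_def)
    also have "\<dots> \<le> 8 * (K * (k * s\<^sup>2) + K * (k * s\<^sup>2))"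
      using EX4 B4 C4 insert.prems(8) by (intro mult_left_mono add_mono mult_mono) auto
    finally have EL: "expectation (\<lambda>\<omega>. (L \<omega>) ^ 4) \<le> (16 * K * k) * s\<^sup>2" by (simp add: algebra_simps)
    have AAA: "expectation (\<lambda>\<omega>. (A \<omega>) ^ 3 * (X i \<omega> * B \<omega>)) = 0" "expectation (\<lambda>\<omega>. (A \<omega>) ^ 3 * (Y i \<omega> * C \<omega>)) = 0"
      "integrable M (\<lambda>\<omega>. (A \<omega>) ^ 3 * (X i \<omega> * B \<omega>))" "integrable M (\<lambda>\<omega>. (A \<omega>) ^ 3 * (Y i \<omega> * C \<omega>))"
      using expectation_centered_mult[OF J borel_measurable_power[OF m(1)] m(2) rv(1) _ rv(5,7), of 3]
        expectation_centered_mult[OF J borel_measurable_power[OF m(1)] m(3) rv(2) _ rv(6,8), of 3]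
        L4_integrable_cube_mult[of A B] L4_integrable_cube_mult[of A C] A4 B4 C4 by auto
    have AL: "expectation (\<lambda>\<omega>. (A \<omega>) ^ 3 * L \<omega>) = 0"
      unfolding L_def distrib_left using AAA by simp
    have dd: "(256 * K) ^ d = 256 * K * k" by (simp add: Suc k_def)
    \<comment> \<open>The choice of 256 makes the cross term match exactly: 8 * 64 = 2 * 256 is the
      coefficient of a s in 256 (a + s)^2, while the fourth moment of \<open>L\<close> needs only 3
      * 16 = 48 of the 256 available.\<close>
    have "sqrt (expectation (\<lambda>\<omega>. (A \<omega>) ^ 4) * expectation (\<lambda>\<omega>. (L \<omega>) ^ 4)) \<le> sqrt ((256 * K * k * a\<^sup>2) * (16 * K * k * s\<^sup>2))"
      using A4 EL nonneg insert.prems(8) unfolding dd a_def[symmetric]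
      by (intro real_sqrt_le_mono mult_mono) auto
    also have "(256 * K * k * a\<^sup>2) * (16 * K * k * s\<^sup>2) = (64 * K * k * a * s)\<^sup>2" by algebra
    finally have sq: "sqrt (expectation (\<lambda>\<omega>. (A \<omega>) ^ 4) * expectation (\<lambda>\<omega>. (L \<omega>) ^ 4)) \<le> 64 * K * k * a * s"
      using nonneg insert.prems(8) by simp
    have "expectation (\<lambda>\<omega>. (A \<omega> + L \<omega>) ^ 4) \<le> 256 * K * k * a\<^sup>2 + 8 * (64 * K * k * a * s) + 3 * (16 * K * k * s\<^sup>2)"
      using expectation_add_pow4_le[OF _ L4L AL] A4 sq EL unfolding dd a_def[symmetric] by linarith
    also have "\<dots> \<le> 256 * K * k * (a + s)\<^sup>2"
    proof -
      have "0 \<le> 208 * K * k * s\<^sup>2" using nonneg insert.prems(8) by simp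
      then show ?thesis by (simp add: power2_sum algebra_simps)
    qed
    finally show ?thesis
      unfolding f dd using A4 L4_add[of A L] L4L insert.hyps
      by (simp add: coef_norm_insert L_def a_def s_def)
  qed
qed

end

subsection \<open>Lindeberg replacement\<close>

text \<open>A Lipschitz bound on the second derivative is all that the cubic Taylor remainder
  requires. The bound 1 on the function itself keeps every expectation finite.\<close>

definition smooth3 :: "real \<Rightarrow> real \<Rightarrow> real \<Rightarrow> (real \<Rightarrow> real) \<Rightarrow> bool" where
  "smooth3 m1 m2 m3 \<psi> \<longleftrightarrow> (\<exists>\<psi>1 \<psi>2.
     (\<forall>x. (\<psi> has_real_derivative \<psi>1 x) (at x)) \<and> (\<forall>x. (\<psi>1 has_real_derivative \<psi>2 x) (at x)) \<and>
     (\<forall>x. \<bar>\<psi> x\<bar> \<le> 1) \<and> (\<forall>x. \<bar>\<psi>1 x\<bar> \<le> m1) \<and> (\<forall>x. \<bar>\<psi>2 x\<bar> \<le> m2) \<and> (\<forall>x y. \<bar>\<psi>2 x - \<psi>2 y\<bar> \<le> m3 * \<bar>x - y\<bar>))"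

lemma taylor2_bound:
  fixes \<psi> :: "real \<Rightarrow> real"
  assumes d1: "\<And>x. (\<psi> has_real_derivative \<psi>1 x) (at x)" and d2: "\<And>x. (\<psi>1 has_real_derivative \<psi>2 x) (at x)"
    and lip: "\<And>x y. \<bar>\<psi>2 x - \<psi>2 y\<bar> \<le> m * \<bar>x - y\<bar>"
  shows "\<bar>\<psi> (a + h) - (\<psi> a + \<psi>1 a * h + \<psi>2 a * h\<^sup>2 / 2)\<bar> \<le> m * \<bar>h\<bar> ^ 3"
proof (cases "h = 0")
  case False
  define D where "D = (\<lambda>n::nat. if n = 0 then \<psi> else if n = 1 then \<psi>1 else \<psi>2)"
  have "\<exists>t. (if a + h < a then a + h < t \<and> t < a else a < t \<and> t < a + h) \<and>
      \<psi> (a + h) = (\<Sum>m<2. D m a / fact m * (a + h - a) ^ m) + D 2 t / fact 2 * (a + h - a) ^ 2"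
    using False d1 d2
    by (intro Taylor[where a = "min a (a + h)" and b = "max a (a + h)"]) (auto simp: D_def less_2_cases_iff)
  then obtain t where t0: "if a + h < a then a + h < t \<and> t < a else a < t \<and> t < a + h"
    "\<psi> (a + h) = (\<Sum>m<2. D m a / fact m * (a + h - a) ^ m) + D 2 t / fact 2 * (a + h - a) ^ 2" by blast
  have t: "\<bar>t - a\<bar> \<le> \<bar>h\<bar>" "\<psi> (a + h) = \<psi> a + \<psi>1 a * h + \<psi>2 t / 2 * h\<^sup>2"
    using t0 by (auto simp: D_def numeral_2_eq_2 split: if_splits)
  have "\<bar>\<psi> (a + h) - (\<psi> a + \<psi>1 a * h + \<psi>2 a * h\<^sup>2 / 2)\<bar> = \<bar>\<psi>2 t - \<psi>2 a\<bar> * h\<^sup>2 / 2"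
    unfolding t(2) by (simp add: abs_mult flip: left_diff_distrib diff_divide_distrib)
  also have "\<dots> \<le> \<bar>\<psi>2 t - \<psi>2 a\<bar> * h\<^sup>2" by simp
  also have "\<dots> \<le> (m * \<bar>h\<bar>) * h\<^sup>2"
  proof (intro mult_right_mono)
    have "0 \<le> m" using order_trans[OF abs_ge_zero lip[of 1 0]] by simp
    then show "\<bar>\<psi>2 t - \<psi>2 a\<bar> \<le> m * \<bar>h\<bar>" using lip[of t a] t(1) mult_left_mono[of "\<bar>t - a\<bar>" "\<bar>h\<bar>" m] by linarith
  qed simp
  also have "\<dots> = m * \<bar>h\<bar> ^ 3" by (simp add: power_numeral_reduce flip: power2_abs)
  finally show ?thesis .
qed simp

text \<open>Interpolation of the third moment between the second and the fourth. The free parameter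
  t is later \<open>sqrt \<tau>\<close>, where \<tau> bounds the influences; this is what makes the
  replacement error small compared with the influence.\<close>

lemma abs_cube_le:
  assumes "0 < t" shows "\<bar>l\<bar> ^ 3 \<le> (t * l\<^sup>2 + l ^ 4 / t) / (2::real)"
proof -
  have "0 \<le> l\<^sup>2 * (t - \<bar>l\<bar>)\<^sup>2 / t" using assms by simp
  also have "\<dots> = t * l\<^sup>2 + l ^ 4 / t - 2 * \<bar>l\<bar> ^ 3"
    using assms by (cases "0 \<le> l") (auto simp: field_simps power2_eq_square power3_eq_cube power4_eq_xxxx)
  finally show ?thesis by simp
qed

context indep_blocks
begin

lemma abs_expectation_bounded_mult:
  fixes f g :: "'a \<Rightarrow> real"
  assumes "g \<in> borel_measurable M" "\<And>x. \<bar>g x\<bar> \<le> m" "integrable M f"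
  shows "integrable M (\<lambda>\<omega>. g \<omega> * f \<omega>)" "\<bar>expectation (\<lambda>\<omega>. g \<omega> * f \<omega>)\<bar> \<le> m * expectation (\<lambda>\<omega>. \<bar>f \<omega>\<bar>)"
proof -
  have m: "0 \<le> m" using order_trans[OF abs_ge_zero assms(2)] .
  have le: "\<bar>g \<omega> * f \<omega>\<bar> \<le> m * \<bar>f \<omega>\<bar>" for \<omega>
    unfolding abs_mult using assms(2) m by (intro mult_mono) auto
  show i: "integrable M (\<lambda>\<omega>. g \<omega> * f \<omega>)"
    by (rule Bochner_Integration.integrable_bound[of _ "\<lambda>\<omega>. m * \<bar>f \<omega>\<bar>"])
      (use assms le m in \<open>auto simp: abs_mult\<close>)
  have "\<bar>expectation (\<lambda>\<omega>. g \<omega> * f \<omega>)\<bar> \<le> expectation (\<lambda>\<omega>. \<bar>g \<omega> * f \<omega>\<bar>)" by (rule integral_abs_bound)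
  also have "\<dots> \<le> expectation (\<lambda>\<omega>. m * \<bar>f \<omega>\<bar>)"
    using i assms(3) le by (intro integral_mono) auto
  finally show "\<bar>expectation (\<lambda>\<omega>. g \<omega> * f \<omega>)\<bar> \<le> m * expectation (\<lambda>\<omega>. \<bar>f \<omega>\<bar>)" by simp
qed

text \<open>Expansion around \<open>A\<close>, which does not involve block i. The linear term
  vanishes because U and V are centred, and the quadratic term factors into covariances of the block
  and expectations over the other blocks. With second moment of order s and fourth moment of order
  s^2, the cubic remainder is of order \<open>sqrt \<tau>\<close> times s; one full factor s is kept
  for the summation over i.\<close>

lemma taylor_block:
  assumes J: "J \<subseteq> I" "i \<in> I" "i \<notin> J"
    and A: "A \<in> borel_measurable (sub J)" and B: "B \<in> borel_measurable (sub J)" "L4 B"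
    and C: "C \<in> borel_measurable (sub J)" "L4 C"
    and U: "block_rv i U" "L4 U" and V: "block_rv i V" "L4 V"
    and \<psi>: "\<And>x. (\<psi> has_real_derivative \<psi>1 x) (at x)" "\<And>x. (\<psi>1 has_real_derivative \<psi>2 x) (at x)"
      "\<And>x. \<bar>\<psi> x\<bar> \<le> 1" "\<And>x. \<bar>\<psi>1 x\<bar> \<le> m1" "\<And>x. \<bar>\<psi>2 x\<bar> \<le> m2" "\<And>x y. \<bar>\<psi>2 x - \<psi>2 y\<bar> \<le> m3 * \<bar>x - y\<bar>"
    and K: "expectation (\<lambda>\<omega>. (U \<omega>) ^ 4) \<le> K" "expectation (\<lambda>\<omega>. (V \<omega>) ^ 4) \<le> K" "1 \<le> K"
    and k: "expectation (\<lambda>\<omega>. (B \<omega>) ^ 4) \<le> k * s\<^sup>2" "expectation (\<lambda>\<omega>. (C \<omega>) ^ 4) \<le> k * s\<^sup>2" "1 \<le> k"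
    and s: "0 \<le> s" "s \<le> \<tau>" "0 < \<tau>"
  shows "\<bar>expectation (\<lambda>\<omega>. \<psi> (A \<omega> + (U \<omega> * B \<omega> + V \<omega> * C \<omega>))) - (expectation (\<lambda>\<omega>. \<psi> (A \<omega>)) +
     (expectation (\<lambda>\<omega>. \<psi>2 (A \<omega>) * (B \<omega>)\<^sup>2) * expectation (\<lambda>\<omega>. (U \<omega>)\<^sup>2) +
     2 * (expectation (\<lambda>\<omega>. \<psi>2 (A \<omega>) * (B \<omega> * C \<omega>)) * expectation (\<lambda>\<omega>. U \<omega> * V \<omega>)) +
     expectation (\<lambda>\<omega>. \<psi>2 (A \<omega>) * (C \<omega>)\<^sup>2) * expectation (\<lambda>\<omega>. (V \<omega>)\<^sup>2)) / 2)\<bar> \<le> m3 * (10 * K * k * sqrt \<tau> * s)"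
proof -
  define L where "L = (\<lambda>\<omega>. U \<omega> * B \<omega> + V \<omega> * C \<omega>)"
  have rv: "U \<in> borel_measurable (sub {i})" "V \<in> borel_measurable (sub {i})" "L2 U" "L2 V" "expectation U = 0" "expectation V = 0"
    using U V by (auto simp: block_rv_def)
  have BC2: "L2 B" "L2 C" using B C by (auto intro: L4_L2)
  note UB = L4_block_mult[OF J B(1) rv(1) B(2) U(2)] and VC = L4_block_mult[OF J C(1) rv(2) C(2) V(2)]
  have L4L: "L4 L" unfolding L_def using UB VC by (intro L4_add) auto
  then have L2L: "L2 L" by (rule L4_L2)
  have cont: "continuous_on UNIV \<psi>" "continuous_on UNIV \<psi>1"
    using DERIV_continuous[OF \<psi>(1)] DERIV_continuous[OF \<psi>(2)] by (auto intro: continuous_at_imp_continuous_on)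
  have m3: "0 \<le> m3" using order_trans[OF abs_ge_zero \<psi>(6)[of 1 0]] by simp
  have cont2: "continuous_on UNIV \<psi>2"
    by (rule lipschitz_on_continuous_on[of m3]) (use \<psi>(6) m3 in \<open>auto simp: lipschitz_on_def dist_real_def\<close>)
  have meas[measurable]: "\<psi> \<in> borel_measurable borel" "\<psi>1 \<in> borel_measurable borel" "\<psi>2 \<in> borel_measurable borel"
    using cont cont2 by (auto intro: borel_measurable_continuous_onI)
  have mA: "A \<in> borel_measurable M" using A J sub_M by blast
  have subA: "(\<lambda>\<omega>. \<psi>1 (A \<omega>)) \<in> borel_measurable (sub J)" "(\<lambda>\<omega>. \<psi>2 (A \<omega>)) \<in> borel_measurable (sub J)"
    using measurable_compose[OF A meas(2)] measurable_compose[OF A meas(3)] by auto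
  have mA': "(\<lambda>\<omega>. \<psi> (A \<omega>)) \<in> borel_measurable M" "(\<lambda>\<omega>. \<psi>1 (A \<omega>)) \<in> borel_measurable M" "(\<lambda>\<omega>. \<psi>2 (A \<omega>)) \<in> borel_measurable M"
    "(\<lambda>\<omega>. \<psi> (A \<omega> + L \<omega>)) \<in> borel_measurable M"
    using mA L2L by (auto simp: L2_def)
  have i1: "integrable M (\<lambda>\<omega>. \<psi> (A \<omega>))" "integrable M (\<lambda>\<omega>. \<psi> (A \<omega> + L \<omega>))"
    using mA' \<psi>(3) by (auto intro!: integrable_const_bound[of _ 1])
  have ib: "integrable M (\<lambda>\<omega>. \<psi>1 (A \<omega>) * L \<omega>)" "integrable M (\<lambda>\<omega>. \<psi>2 (A \<omega>) * (L \<omega>)\<^sup>2)"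
    using abs_expectation_bounded_mult(1)[OF mA'(2) \<psi>(4) L2_integrable[OF L2L]]
      abs_expectation_bounded_mult(1)[OF mA'(3) \<psi>(5), of "\<lambda>\<omega>. (L \<omega>)\<^sup>2"] L2L by (auto simp: L2_def)
  have iB: "integrable M (\<lambda>\<omega>. \<psi>1 (A \<omega>) * B \<omega>)" "integrable M (\<lambda>\<omega>. \<psi>1 (A \<omega>) * C \<omega>)"
    "integrable M (\<lambda>\<omega>. \<psi>2 (A \<omega>) * (B \<omega>)\<^sup>2)" "integrable M (\<lambda>\<omega>. \<psi>2 (A \<omega>) * (C \<omega>)\<^sup>2)"
    "integrable M (\<lambda>\<omega>. \<psi>2 (A \<omega>) * (B \<omega> * C \<omega>))"
    using abs_expectation_bounded_mult(1)[OF mA'(2) \<psi>(4)] abs_expectation_bounded_mult(1)[OF mA'(3) \<psi>(5)]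
      L2_integrable[OF BC2(1)] L2_integrable[OF BC2(2)] L2_integrable_mult[OF BC2] BC2 by (auto simp: L2_def)
  have E1: "expectation (\<lambda>\<omega>. \<psi>1 (A \<omega>) * L \<omega>) = 0"
    unfolding L_def distrib_left
    using expectation_centered_mult[OF J subA(1) B(1) rv(1) iB(1) rv(3,5)] expectation_centered_mult[OF J subA(1) C(1) rv(2) iB(2) rv(4,6)]
    by simp
  have sBC: "(\<lambda>\<omega>. \<psi>2 (A \<omega>) * (B \<omega>)\<^sup>2) \<in> borel_measurable (sub J)" "(\<lambda>\<omega>. \<psi>2 (A \<omega>) * (C \<omega>)\<^sup>2) \<in> borel_measurable (sub J)"
    "(\<lambda>\<omega>. \<psi>2 (A \<omega>) * (B \<omega> * C \<omega>)) \<in> borel_measurable (sub J)"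
    "(\<lambda>\<omega>. (U \<omega>)\<^sup>2) \<in> borel_measurable (sub {i})" "(\<lambda>\<omega>. (V \<omega>)\<^sup>2) \<in> borel_measurable (sub {i})" "(\<lambda>\<omega>. U \<omega> * V \<omega>) \<in> borel_measurable (sub {i})"
    using subA B(1) C(1) rv(1,2) by (auto intro: borel_measurable_times borel_measurable_power)
  have iUV: "integrable M (\<lambda>\<omega>. (U \<omega>)\<^sup>2)" "integrable M (\<lambda>\<omega>. (V \<omega>)\<^sup>2)" "integrable M (\<lambda>\<omega>. U \<omega> * V \<omega>)"
    using rv L2_integrable_mult[OF rv(3,4)] by (auto simp: L2_def)
  have "expectation (\<lambda>\<omega>. \<psi>2 (A \<omega>) * (L \<omega>)\<^sup>2) = expectation (\<lambda>\<omega>. (\<psi>2 (A \<omega>) * (B \<omega>)\<^sup>2) * (U \<omega>)\<^sup>2 +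
     2 * ((\<psi>2 (A \<omega>) * (B \<omega> * C \<omega>)) * (U \<omega> * V \<omega>)) + (\<psi>2 (A \<omega>) * (C \<omega>)\<^sup>2) * (V \<omega>)\<^sup>2)"
    unfolding L_def by (intro Bochner_Integration.integral_cong refl) (simp add: power2_eq_square algebra_simps)
  also have "\<dots> = expectation (\<lambda>\<omega>. \<psi>2 (A \<omega>) * (B \<omega>)\<^sup>2) * expectation (\<lambda>\<omega>. (U \<omega>)\<^sup>2) +
     2 * (expectation (\<lambda>\<omega>. \<psi>2 (A \<omega>) * (B \<omega> * C \<omega>)) * expectation (\<lambda>\<omega>. U \<omega> * V \<omega>)) +
     expectation (\<lambda>\<omega>. \<psi>2 (A \<omega>) * (C \<omega>)\<^sup>2) * expectation (\<lambda>\<omega>. (V \<omega>)\<^sup>2)"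
    using integrable_block_mult[OF J sBC(1,4) iB(3) iUV(1)] expectation_block_mult[OF J sBC(1,4) iB(3) iUV(1)]
      integrable_block_mult[OF J sBC(2,5) iB(4) iUV(2)] expectation_block_mult[OF J sBC(2,5) iB(4) iUV(2)]
      integrable_block_mult[OF J sBC(3,6) iB(5) iUV(3)] expectation_block_mult[OF J sBC(3,6) iB(5) iUV(3)]
    by simp
  finally have E2: "expectation (\<lambda>\<omega>. \<psi>2 (A \<omega>) * (L \<omega>)\<^sup>2) = \<dots>" .
  have iL3: "integrable M (\<lambda>\<omega>. \<bar>L \<omega>\<bar> ^ 3)"
    using L4_integrable_cube_mult[OF L4L L4_const[of 1]] by (simp add: integrable_abs_iff power_abs[symmetric])
  have "\<bar>expectation (\<lambda>\<omega>. \<psi> (A \<omega> + L \<omega>) - (\<psi> (A \<omega>) + \<psi>1 (A \<omega>) * L \<omega> + \<psi>2 (A \<omega>) * (L \<omega>)\<^sup>2 / 2))\<bar> \<le>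
     expectation (\<lambda>\<omega>. \<bar>\<psi> (A \<omega> + L \<omega>) - (\<psi> (A \<omega>) + \<psi>1 (A \<omega>) * L \<omega> + \<psi>2 (A \<omega>) * (L \<omega>)\<^sup>2 / 2)\<bar>)"
    by (rule integral_abs_bound)
  also have "\<dots> \<le> expectation (\<lambda>\<omega>. m3 * \<bar>L \<omega>\<bar> ^ 3)"
    using i1 ib iL3 taylor2_bound[OF \<psi>(1,2,6)] by (intro integral_mono) auto
  also have "\<dots> \<le> m3 * (10 * K * k * sqrt \<tau> * s)"
  proof -
    have "expectation (\<lambda>\<omega>. (L \<omega>) ^ 4) \<le> expectation (\<lambda>\<omega>. 8 * ((U \<omega> * B \<omega>) ^ 4 + (V \<omega> * C \<omega>) ^ 4))"
      using L4L UB(1) VC(1) by (intro integral_mono) (auto simp: L4_def L_def add_pow4_le simp del: distrib_left_numeral)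
    also have "\<dots> = 8 * (expectation (\<lambda>\<omega>. (U \<omega>) ^ 4) * expectation (\<lambda>\<omega>. (B \<omega>) ^ 4) +
        expectation (\<lambda>\<omega>. (V \<omega>) ^ 4) * expectation (\<lambda>\<omega>. (C \<omega>) ^ 4))"
      using UB VC by (simp add: L4_def)
    also have "\<dots> \<le> 8 * (K * (k * s\<^sup>2) + K * (k * s\<^sup>2))"
      using K k by (intro mult_left_mono add_mono mult_mono) auto
    finally have EL4: "expectation (\<lambda>\<omega>. (L \<omega>) ^ 4) \<le> (16 * K * k) * s\<^sup>2" by (simp add: algebra_simps)
    \<comment> \<open>Since K k is at least 1, the square root of 16 K k may be replaced by 4 K k,
      which avoids fractional powers of the constants.\<close>
    have Kk: "1 \<le> K * k" using K(3) k(3) mult_mono[of 1 K 1 k] by simp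
    have "(expectation (\<lambda>\<omega>. (L \<omega>)\<^sup>2))\<^sup>2 \<le> expectation (\<lambda>\<omega>. (L \<omega>) ^ 4)"
      using square_expectation_le[of "\<lambda>\<omega>. (L \<omega>)\<^sup>2"] L4L by (auto simp: L4_def)
    also have "\<dots> \<le> (4 * (K * k) * s)\<^sup>2"
    proof -
      have "(K * k) * 1 \<le> (K * k) * (K * k)" using Kk by (intro mult_left_mono) auto
      then have "16 * (K * k) * s\<^sup>2 \<le> 16 * ((K * k) * (K * k)) * s\<^sup>2" by (intro mult_right_mono) auto
      then show ?thesis using EL4 by (simp add: power2_eq_square algebra_simps)
    qed
    finally have EL2: "expectation (\<lambda>\<omega>. (L \<omega>)\<^sup>2) \<le> 4 * (K * k) * s"
      using Kk s by (simp add: power2_le_iff_abs_le)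
    \<comment> \<open>With t = \<open>sqrt \<tau>\<close> and s \<le> \<tau>, both terms of
      \<open>abs_cube_le\<close> become multiples of s \<open>sqrt \<tau>\<close>; the constant 10
      is (4 + 16) / 2.\<close>
    have "expectation (\<lambda>\<omega>. \<bar>L \<omega>\<bar> ^ 3) \<le> expectation (\<lambda>\<omega>. (sqrt \<tau> * (L \<omega>)\<^sup>2 + (L \<omega>) ^ 4 / sqrt \<tau>) / 2)"
      using iL3 L2L L4L abs_cube_le[of "sqrt \<tau>"] s by (intro integral_mono) (auto simp: L2_def L4_def)
    also have "\<dots> = (sqrt \<tau> * expectation (\<lambda>\<omega>. (L \<omega>)\<^sup>2) + expectation (\<lambda>\<omega>. (L \<omega>) ^ 4) / sqrt \<tau>) / 2"
      using L2L L4L by (simp add: L2_def L4_def)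
    also have "\<dots> \<le> (sqrt \<tau> * (4 * (K * k) * s) + ((16 * K * k) * s * \<tau>) / sqrt \<tau>) / 2"
    proof -
      have "(16 * K * k) * s\<^sup>2 \<le> (16 * K * k) * s * \<tau>"
        using Kk s K(3) k(3) by (auto simp: power2_eq_square mult.assoc intro!: mult_left_mono)
      then show ?thesis using EL2 EL4 s by (intro divide_right_mono add_mono mult_left_mono) auto
    qed
    also have "\<dots> = 10 * K * k * sqrt \<tau> * s"
      using s by (simp add: field_simps real_sqrt_mult_self flip: real_sqrt_mult)
    finally show ?thesis using m3 by (simp add: mult_left_mono)
  qed
  finally have "\<bar>expectation (\<lambda>\<omega>. \<psi> (A \<omega> + L \<omega>) - (\<psi> (A \<omega>) + \<psi>1 (A \<omega>) * L \<omega> + \<psi>2 (A \<omega>) * (L \<omega>)\<^sup>2 / 2))\<bar> \<le> m3 * (10 * K * k * sqrt \<tau> * s)" .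
  moreover have "expectation (\<lambda>\<omega>. \<psi> (A \<omega> + L \<omega>) - (\<psi> (A \<omega>) + \<psi>1 (A \<omega>) * L \<omega> + \<psi>2 (A \<omega>) * (L \<omega>)\<^sup>2 / 2)) =
     expectation (\<lambda>\<omega>. \<psi> (A \<omega> + L \<omega>)) - (expectation (\<lambda>\<omega>. \<psi> (A \<omega>)) + expectation (\<lambda>\<omega>. \<psi>2 (A \<omega>) * (L \<omega>)\<^sup>2) / 2)"
    using i1 ib E1 by simp
  ultimately show ?thesis unfolding E2 unfolding L_def by simp
qed

lemma swap_block:
  assumes J: "J \<subseteq> I" "i \<in> I" "i \<notin> J"
    and A: "A \<in> borel_measurable (sub J)" and B: "B \<in> borel_measurable (sub J)" "L4 B"
    and C: "C \<in> borel_measurable (sub J)" "L4 C"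
    and U: "block_rv i U" "L4 U" and V: "block_rv i V" "L4 V"
    and U': "block_rv i U'" "L4 U'" and V': "block_rv i V'" "L4 V'"
    and \<psi>: "smooth3 m1 m2 m3 \<psi>"
    and K: "expectation (\<lambda>\<omega>. (U \<omega>) ^ 4) \<le> K" "expectation (\<lambda>\<omega>. (V \<omega>) ^ 4) \<le> K"
      "expectation (\<lambda>\<omega>. (U' \<omega>) ^ 4) \<le> K" "expectation (\<lambda>\<omega>. (V' \<omega>) ^ 4) \<le> K" "1 \<le> K"
    and k: "expectation (\<lambda>\<omega>. (B \<omega>) ^ 4) \<le> k * s\<^sup>2" "expectation (\<lambda>\<omega>. (C \<omega>) ^ 4) \<le> k * s\<^sup>2" "1 \<le> k"
    and q: "expectation (\<lambda>\<omega>. (B \<omega>)\<^sup>2) \<le> q * s" "expectation (\<lambda>\<omega>. (C \<omega>)\<^sup>2) \<le> q * s" "0 \<le> q"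
    and s: "0 \<le> s" "s \<le> \<tau>" "0 < \<tau>"
    and \<delta>: "\<bar>expectation (\<lambda>\<omega>. (U \<omega>)\<^sup>2) - expectation (\<lambda>\<omega>. (U' \<omega>)\<^sup>2)\<bar> \<le> \<delta>"
      "\<bar>expectation (\<lambda>\<omega>. U \<omega> * V \<omega>) - expectation (\<lambda>\<omega>. U' \<omega> * V' \<omega>)\<bar> \<le> \<delta>"
      "\<bar>expectation (\<lambda>\<omega>. (V \<omega>)\<^sup>2) - expectation (\<lambda>\<omega>. (V' \<omega>)\<^sup>2)\<bar> \<le> \<delta>"
  shows "\<bar>expectation (\<lambda>\<omega>. \<psi> (A \<omega> + (U \<omega> * B \<omega> + V \<omega> * C \<omega>))) - expectation (\<lambda>\<omega>. \<psi> (A \<omega> + (U' \<omega> * B \<omega> + V' \<omega> * C \<omega>)))\<bar>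
     \<le> s * (2 * q * \<delta> * m2 + 20 * K * k * m3 * sqrt \<tau>)"
proof -
  obtain \<psi>1 \<psi>2 where p: "\<And>x. (\<psi> has_real_derivative \<psi>1 x) (at x)" "\<And>x. (\<psi>1 has_real_derivative \<psi>2 x) (at x)"
      "\<And>x. \<bar>\<psi> x\<bar> \<le> 1" "\<And>x. \<bar>\<psi>1 x\<bar> \<le> m1" "\<And>x. \<bar>\<psi>2 x\<bar> \<le> m2" "\<And>x y. \<bar>\<psi>2 x - \<psi>2 y\<bar> \<le> m3 * \<bar>x - y\<bar>"
    using \<psi> unfolding smooth3_def by blast
  have m2: "0 \<le> m2" using p(5)[of 0] by linarith
  have m3: "0 \<le> m3" using order_trans[OF abs_ge_zero p(6)[of 1 0]] by simp
  have d0: "0 \<le> \<delta>" using \<delta>(1) by linarith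
  have cont2: "continuous_on UNIV \<psi>2"
    by (rule lipschitz_on_continuous_on[of m3]) (use p(6) m3 in \<open>auto simp: lipschitz_on_def dist_real_def\<close>)
  have mA: "(\<lambda>\<omega>. \<psi>2 (A \<omega>)) \<in> borel_measurable M"
    using measurable_compose[OF sub_M[OF J(1) A] borel_measurable_continuous_onI[OF cont2]] .
  have BC2: "L2 B" "L2 C" using B C by (auto intro: L4_L2)
  define b where "b = expectation (\<lambda>\<omega>. \<psi>2 (A \<omega>) * (B \<omega>)\<^sup>2)"
  define bc where "bc = expectation (\<lambda>\<omega>. \<psi>2 (A \<omega>) * (B \<omega> * C \<omega>))"
  define c where "c = expectation (\<lambda>\<omega>. \<psi>2 (A \<omega>) * (C \<omega>)\<^sup>2)"
  have "\<bar>b\<bar> \<le> m2 * expectation (\<lambda>\<omega>. \<bar>(B \<omega>)\<^sup>2\<bar>)" unfolding b_def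
    using BC2 by (intro abs_expectation_bounded_mult(2)[OF mA p(5)]) (auto simp: L2_def)
  also have "\<dots> \<le> m2 * (q * s)" using q m2 by (intro mult_left_mono) auto
  finally have b: "\<bar>b\<bar> \<le> m2 * (q * s)" .
  have "\<bar>c\<bar> \<le> m2 * expectation (\<lambda>\<omega>. \<bar>(C \<omega>)\<^sup>2\<bar>)" unfolding c_def
    using BC2 by (intro abs_expectation_bounded_mult(2)[OF mA p(5)]) (auto simp: L2_def)
  also have "\<dots> \<le> m2 * (q * s)" using q m2 by (intro mult_left_mono) auto
  finally have c: "\<bar>c\<bar> \<le> m2 * (q * s)" .
  have "\<bar>bc\<bar> \<le> m2 * expectation (\<lambda>\<omega>. \<bar>B \<omega> * C \<omega>\<bar>)" unfolding bc_def
    using abs_expectation_bounded_mult(2)[OF mA p(5) L2_integrable_mult[OF BC2]] .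
  also have "expectation (\<lambda>\<omega>. \<bar>B \<omega> * C \<omega>\<bar>) \<le> expectation (\<lambda>\<omega>. ((B \<omega>)\<^sup>2 + (C \<omega>)\<^sup>2) / 2)"
  proof (rule integral_mono)
    show "\<bar>B \<omega> * C \<omega>\<bar> \<le> ((B \<omega>)\<^sup>2 + (C \<omega>)\<^sup>2) / 2" for \<omega>
      using sum_squares_bound[of "\<bar>B \<omega>\<bar>" "\<bar>C \<omega>\<bar>"] by (simp add: abs_mult)
  qed (use BC2 L2_integrable_mult[OF BC2] in \<open>auto simp: L2_def\<close>)
  also have "\<dots> \<le> q * s" using BC2 q by (simp add: L2_def)
  finally have bc: "\<bar>bc\<bar> \<le> m2 * (q * s)" using m2 by (simp add: mult_left_mono)
  let ?T = "\<lambda>u uv v. (b * u + 2 * (bc * uv) + c * v) / (2::real)"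
  note t = taylor_block[OF J A B C U V p K(1,2,5) k s, folded b_def bc_def c_def]
  note t' = taylor_block[OF J A B C U' V' p K(3,4,5) k s, folded b_def bc_def c_def]
  have bd: "\<bar>x * y\<bar> \<le> m2 * (q * s) * \<delta>" if "\<bar>x\<bar> \<le> m2 * (q * s)" "\<bar>y\<bar> \<le> \<delta>" for x y
    unfolding abs_mult using that m2 q s by (intro mult_mono) auto
  have "\<bar>?T (expectation (\<lambda>\<omega>. (U \<omega>)\<^sup>2)) (expectation (\<lambda>\<omega>. U \<omega> * V \<omega>)) (expectation (\<lambda>\<omega>. (V \<omega>)\<^sup>2)) -
     ?T (expectation (\<lambda>\<omega>. (U' \<omega>)\<^sup>2)) (expectation (\<lambda>\<omega>. U' \<omega> * V' \<omega>)) (expectation (\<lambda>\<omega>. (V' \<omega>)\<^sup>2))\<bar> \<le> 2 * (m2 * (q * s) * \<delta>)"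
  proof -
    have "\<bar>(x + 2 * y + z) / 2 - (x' + 2 * y' + z') / 2\<bar> \<le> 2 * r"
      if "\<bar>x - x'\<bar> \<le> r" "\<bar>y - y'\<bar> \<le> r" "\<bar>z - z'\<bar> \<le> r" for x y z x' y' z' r :: real
    proof -
      have "x - x' \<le> r" "x' - x \<le> r" "y - y' \<le> r" "y' - y \<le> r" "z - z' \<le> r" "z' - z \<le> r"
        using that unfolding abs_le_iff by simp_all
      then show ?thesis by (intro abs_leI) (simp_all add: field_simps)
    qed
    from this[OF bd[OF b \<delta>(1), unfolded right_diff_distrib] bd[OF bc \<delta>(2), unfolded right_diff_distrib]
      bd[OF c \<delta>(3), unfolded right_diff_distrib]] show ?thesis .
  qed
  note TT = this
  have "\<bar>expectation (\<lambda>\<omega>. \<psi> (A \<omega> + (U \<omega> * B \<omega> + V \<omega> * C \<omega>))) - expectation (\<lambda>\<omega>. \<psi> (A \<omega> + (U' \<omega> * B \<omega> + V' \<omega> * C \<omega>)))\<bar>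
      \<le> 2 * (m2 * (q * s) * \<delta>) + 2 * (m3 * (10 * K * k * sqrt \<tau> * s))"
  proof -
    have "\<bar>p - q\<bar> \<le> v + 2 * r" if "\<bar>T - T'\<bar> \<le> v" "\<bar>p - (e + T)\<bar> \<le> r" "\<bar>q - (e + T')\<bar> \<le> r" for p q e T T' r v :: real
      using that by linarith
    from this[OF TT t t'] show ?thesis .
  qed
  then show ?thesis by (simp add: algebra_simps)
qed

end

definition influence :: "nat set \<Rightarrow> (nat set \<Rightarrow> real) \<Rightarrow> nat \<Rightarrow> real" where
  "influence I c i = (\<Sum>S\<in>{S\<in>Pow I. i \<in> S}. (c S)\<^sup>2)"

lemma coef_norm_link:
  assumes "finite I" "i \<in> I"
  shows "coef_norm (I - {i}) (link i c) = influence I c i"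
proof -
  have "(\<Sum>S\<in>Pow (I - {i}). (c (insert i S))\<^sup>2) = (\<Sum>S\<in>{S\<in>Pow I. i \<in> S}. (c S)\<^sup>2)"
    by (rule sum.reindex_bij_witness[of _ "\<lambda>S. S - {i}" "insert i"]) (use assms in auto)
  then show ?thesis by (simp add: coef_norm_def link_def influence_def)
qed

text \<open>Each set S is counted once for each of its elements, at most d times. The sum of the
  replacement errors is thus bounded independently of the number of variables.\<close>

lemma sum_influence_le:
  assumes "finite I" "deg_le d I c"
  shows "(\<Sum>i\<in>I. influence I c i) \<le> real d * coef_norm I c"
proof -
  have "(\<Sum>i\<in>I. influence I c i) = (\<Sum>i\<in>I. \<Sum>S\<in>Pow I. if i \<in> S then (c S)\<^sup>2 else 0)"
    unfolding influence_def by (intro sum.cong refl sum.inter_filter) (use assms in auto)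
  also have "\<dots> = (\<Sum>S\<in>Pow I. \<Sum>i\<in>I. if i \<in> S then (c S)\<^sup>2 else 0)"
    by (rule sum.swap)
  also have "\<dots> \<le> (\<Sum>S\<in>Pow I. real d * (c S)\<^sup>2)"
  proof (intro sum_mono)
    fix S assume S: "S \<in> Pow I"
    then have "(\<Sum>i\<in>I. if i \<in> S then (c S)\<^sup>2 else 0) = (\<Sum>i\<in>S. (c S)\<^sup>2)"
      using assms by (subst sum.inter_restrict[symmetric]) (auto simp: Int_absorb1)
    also have "\<dots> \<le> real d * (c S)\<^sup>2"
      using assms S by (cases "d < card S") (auto simp: deg_le_def intro: mult_right_mono)
    finally show "(\<Sum>i\<in>I. if i \<in> S then (c S)\<^sup>2 else 0) \<le> real d * (c S)\<^sup>2" .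
  qed
  finally show ?thesis by (simp add: coef_norm_def sum_distrib_left)
qed

lemma deg_le_link_same:
  assumes "finite I" "i \<in> I" "deg_le d I c"
  shows "deg_le d (I - {i}) (link i c)"
  unfolding deg_le_def link_def
proof safe
  fix S assume S: "S \<subseteq> I - {i}" "d < card S"
  then have "card S \<le> card (insert i S)"
    using assms by (intro card_mono) (auto intro: finite_subset)
  moreover have "insert i S \<subseteq> I" using S assms by auto
  ultimately show "c (insert i S) = 0"
    using assms(3) S(2) unfolding deg_le_def by auto
qed

context indep_blocks
begin

text \<open>The hybrids arising during replacement mix truncated and Gaussian variables, whose
  variances are only at most 1 and for which value and direction may be correlated. The exact
  formula is replaced by a recursion with factor 3 * (1 + 1) = 6 per degree.\<close>

lemma form_second_moment_crude:
  assumes "J \<subseteq> I" "\<And>i. i \<in> J \<Longrightarrow> block_rv i (X i)" "\<And>i. i \<in> J \<Longrightarrow> block_rv i (Y i)"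
    and "\<And>i. i \<in> J \<Longrightarrow> expectation (\<lambda>\<omega>. (X i \<omega>)\<^sup>2) \<le> 1"
    and "\<And>i. i \<in> J \<Longrightarrow> expectation (\<lambda>\<omega>. (Y i \<omega>)\<^sup>2) \<le> 1"
    and "b\<^sup>2 \<le> 1" "deg_le d J c"
  shows "L2 (\<lambda>\<omega>. form b J c (\<lambda>i. X i \<omega>) (\<lambda>i. Y i \<omega>)) \<and>
    expectation (\<lambda>\<omega>. (form b J c (\<lambda>i. X i \<omega>) (\<lambda>i. Y i \<omega>))\<^sup>2) \<le> 6 ^ d * coef_norm J c"
  using finite_subset[OF assms(1) finite_I] assms
proof (induction J arbitrary: b c Y d rule: finite_induct)
  case empty
  have "(c {})\<^sup>2 * b\<^sup>2 \<le> 6 ^ d * (c {})\<^sup>2"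
  proof -
    have "b\<^sup>2 \<le> 6 ^ d" using order_trans[OF empty.prems(6) one_le_power[of 6 d]] by simp
    then show ?thesis by (subst mult.commute) (intro mult_right_mono, auto)
  qed
  then show ?case by (simp add: prob_space power_mult_distrib coef_norm_def)
next
  case (insert i J)
  have J: "J \<subseteq> I" "i \<in> I" "i \<notin> J" using insert by auto
  define A where "A = (\<lambda>\<omega>. form b J c (\<lambda>i. X i \<omega>) (\<lambda>i. Y i \<omega>))"
  define B where "B = (\<lambda>\<omega>. form b J (link i c) (\<lambda>i. X i \<omega>) (\<lambda>i. Y i \<omega>))"
  define C where "C = (\<lambda>\<omega>. form 1 J (link i c) (\<lambda>i. X i \<omega>) (\<lambda>i. 0))"
  let ?U = "\<lambda>k::nat. if k = 0 then X i else if k = 1 then Y i else (\<lambda>_. 0)"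
  let ?B = "\<lambda>k::nat. if k = 0 then B else if k = 1 then C else (\<lambda>_. 0)"
  have f: "form b (insert i J) c (\<lambda>i. X i \<omega>) (\<lambda>i. Y i \<omega>) = A \<omega> + (\<Sum>k<3. ?U k \<omega> * ?B k \<omega>)" for \<omega>
    using insert.hyps by (simp add: form_insert A_def B_def C_def sum_lessThan_3)
  have m: "A \<in> borel_measurable (sub J)" "B \<in> borel_measurable (sub J)" "C \<in> borel_measurable (sub J)"
    unfolding A_def B_def C_def using insert.prems J by (auto intro!: form_sub simp: block_rv_def)
  have A2: "L2 A \<and> expectation (\<lambda>\<omega>. (A \<omega>)\<^sup>2) \<le> 6 ^ d * coef_norm J c"
    unfolding A_def using insert.prems by (intro insert.IH) (auto intro: deg_le_subset)
  have rvs: "block_rv i (X i)" "block_rv i (Y i)" using insert.prems by auto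
  have U: "?U k \<in> borel_measurable (sub {i})" "L2 (?U k)" "expectation (?U k) = 0" for k
    using rvs by (auto simp: block_rv_def)
  show ?case
  proof (cases d)
    case 0
    have z: "link i c S = 0" if "S \<subseteq> J" for S
      using link_zero[OF insert.hyps(1,2)] insert.prems that 0 by auto
    have "form b' J (link i c) x y = 0" for b' x y
      unfolding form_def using z by (auto intro!: sum.neutral)
    then have "B = (\<lambda>_. 0)" "C = (\<lambda>_. 0)" by (auto simp: B_def C_def)
    moreover have "coef_norm J (link i c) = 0"
      unfolding coef_norm_def using z by (intro sum.neutral) auto
    ultimately show ?thesis
      unfolding f using A2 insert.hyps by (simp add: sum_lessThan_3 coef_norm_insert)
  next
    case (Suc d')
    have deg: "deg_le d' J (link i c)"
      using deg_le_link[OF insert.hyps(1,2)] insert.prems Suc by auto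
    let ?n = "coef_norm J (link i c)"
    have B2: "L2 B \<and> expectation (\<lambda>\<omega>. (B \<omega>)\<^sup>2) \<le> 6 ^ d' * ?n"
      unfolding B_def using insert.prems deg by (intro insert.IH) auto
    have C2: "L2 C \<and> expectation (\<lambda>\<omega>. (C \<omega>)\<^sup>2) \<le> 6 ^ d' * ?n"
      unfolding C_def using insert.prems deg by (intro insert.IH) auto
    have Bk: "?B k \<in> borel_measurable (sub J)" "L2 (?B k)" for k
      using m B2 C2 by auto
    have "expectation (\<lambda>\<omega>. (X i \<omega>)\<^sup>2) * expectation (\<lambda>\<omega>. (B \<omega>)\<^sup>2) \<le> 1 * (6 ^ d' * ?n)"
      using insert.prems(4)[of i] B2 by (intro mult_mono) auto
    moreover have "expectation (\<lambda>\<omega>. (Y i \<omega>)\<^sup>2) * expectation (\<lambda>\<omega>. (C \<omega>)\<^sup>2) \<le> 1 * (6 ^ d' * ?n)"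
      using insert.prems(5)[of i] C2 by (intro mult_mono) auto
    ultimately have "3 * (\<Sum>k<3. expectation (\<lambda>\<omega>. (?U k \<omega>)\<^sup>2) * expectation (\<lambda>\<omega>. (?B k \<omega>)\<^sup>2)) \<le> 6 ^ d * ?n"
      by (simp add: sum_lessThan_3 Suc)
    then have "expectation (\<lambda>\<omega>. (A \<omega> + (\<Sum>k<3. ?U k \<omega> * ?B k \<omega>))\<^sup>2) \<le> 6 ^ d * (coef_norm J c + ?n)"
      using second_moment_step3_le(2)[where B = ?B and U = ?U, OF J m(1) A2[THEN conjunct1] Bk U] A2
      unfolding distrib_left by linarith
    then show ?thesis
      unfolding f using second_moment_step3_le(1)[where B = ?B and U = ?U, OF J m(1) A2[THEN conjunct1] Bk U] insert.hyps
      by (simp add: coef_norm_insert)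
  qed
qed

text \<open>Every exchange costs its own influence times a common factor, not a fixed amount; this
  makes the sum over all blocks at most d times that factor.\<close>

lemma lindeberg_swap:
  assumes rv: "\<And>i. i \<in> I \<Longrightarrow> block_rv i (X i)" "\<And>i. i \<in> I \<Longrightarrow> block_rv i (Y i)"
      "\<And>i. i \<in> I \<Longrightarrow> block_rv i (X' i)" "\<And>i. i \<in> I \<Longrightarrow> block_rv i (Y' i)"
    and L4: "\<And>i. i \<in> I \<Longrightarrow> L4 (X i)" "\<And>i. i \<in> I \<Longrightarrow> L4 (Y i)"
      "\<And>i. i \<in> I \<Longrightarrow> L4 (X' i)" "\<And>i. i \<in> I \<Longrightarrow> L4 (Y' i)"
    and K: "\<And>i. i \<in> I \<Longrightarrow> expectation (\<lambda>\<omega>. (X i \<omega>) ^ 4) \<le> K"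
      "\<And>i. i \<in> I \<Longrightarrow> expectation (\<lambda>\<omega>. (Y i \<omega>) ^ 4) \<le> K"
      "\<And>i. i \<in> I \<Longrightarrow> expectation (\<lambda>\<omega>. (X' i \<omega>) ^ 4) \<le> K"
      "\<And>i. i \<in> I \<Longrightarrow> expectation (\<lambda>\<omega>. (Y' i \<omega>) ^ 4) \<le> K" "1 \<le> K"
    and \<delta>: "\<And>i. i \<in> I \<Longrightarrow> \<bar>expectation (\<lambda>\<omega>. (X i \<omega>)\<^sup>2) - expectation (\<lambda>\<omega>. (X' i \<omega>)\<^sup>2)\<bar> \<le> \<delta>"
      "\<And>i. i \<in> I \<Longrightarrow> \<bar>expectation (\<lambda>\<omega>. X i \<omega> * Y i \<omega>) - expectation (\<lambda>\<omega>. X' i \<omega> * Y' i \<omega>)\<bar> \<le> \<delta>"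
      "\<And>i. i \<in> I \<Longrightarrow> \<bar>expectation (\<lambda>\<omega>. (Y i \<omega>)\<^sup>2) - expectation (\<lambda>\<omega>. (Y' i \<omega>)\<^sup>2)\<bar> \<le> \<delta>"
    and le1: "\<And>i. i \<in> I \<Longrightarrow> expectation (\<lambda>\<omega>. (X i \<omega>)\<^sup>2) \<le> 1"
      "\<And>i. i \<in> I \<Longrightarrow> expectation (\<lambda>\<omega>. (Y i \<omega>)\<^sup>2) \<le> 1"
      "\<And>i. i \<in> I \<Longrightarrow> expectation (\<lambda>\<omega>. (X' i \<omega>)\<^sup>2) \<le> 1"
      "\<And>i. i \<in> I \<Longrightarrow> expectation (\<lambda>\<omega>. (Y' i \<omega>)\<^sup>2) \<le> 1"
    and \<psi>: "smooth3 m1 m2 m3 \<psi>" and b: "b\<^sup>2 \<le> 1" and deg: "deg_le d I c"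
    and \<tau>: "\<And>i. i \<in> I \<Longrightarrow> influence I c i \<le> \<tau>" "0 < \<tau>"
    and n: "coef_norm I c \<le> 1" and pos: "0 \<le> m2" "0 \<le> m3" "0 \<le> \<delta>"
  shows "\<bar>expectation (\<lambda>\<omega>. \<psi> (form b I c (\<lambda>i. X i \<omega>) (\<lambda>i. Y i \<omega>))) -
      expectation (\<lambda>\<omega>. \<psi> (form b I c (\<lambda>i. X' i \<omega>) (\<lambda>i. Y' i \<omega>)))\<bar>
    \<le> real d * (2 * 6 ^ d * \<delta> * m2 + 20 * K * (256 * K) ^ d * m3 * sqrt \<tau>)"
proof -
  define r where "r = 2 * 6 ^ d * \<delta> * m2 + 20 * K * (256 * K) ^ d * m3 * sqrt \<tau>"
  have r: "0 \<le> r" unfolding r_def using pos K(5) \<tau>(2) by (auto intro!: add_nonneg_nonneg mult_nonneg_nonneg)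
  define H where "H = (\<lambda>J. \<lambda>i. if i \<in> J then X' i else X i)"
  define G where "G = (\<lambda>J. \<lambda>i. if i \<in> J then Y' i else Y i)"
  define E where "E = (\<lambda>J. expectation (\<lambda>\<omega>. \<psi> (form b I c (\<lambda>i. H J i \<omega>) (\<lambda>i. G J i \<omega>))))"
  \<comment> \<open>The hybrids for \<open>J\<close> and \<open>insert i J\<close> agree off block
    i, so they share \<open>A\<close>, \<open>B\<close>, \<open>C\<close> and differ only in the
    pair multiplying \<open>B\<close> and \<open>C\<close>.\<close>
  have step: "\<bar>E (insert i J) - E J\<bar> \<le> influence I c i * r" if i: "i \<in> I" "i \<notin> J" for i J
  proof -
    let ?J = "I - {i}"
    have J: "?J \<subseteq> I" "i \<in> I" "i \<notin> ?J" using i by auto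
    have Ii: "insert i ?J = I" using i by auto
    have HG: "block_rv j (H J j)" "block_rv j (G J j)" "L4 (H J j)" "L4 (G J j)"
      "expectation (\<lambda>\<omega>. (H J j \<omega>) ^ 4) \<le> K" "expectation (\<lambda>\<omega>. (G J j \<omega>) ^ 4) \<le> K" if "j \<in> I" for j
      using that rv L4 K by (auto simp: H_def G_def)
    have HG2: "expectation (\<lambda>\<omega>. (H J j \<omega>)\<^sup>2) \<le> 1" "expectation (\<lambda>\<omega>. (G J j \<omega>)\<^sup>2) \<le> 1" if "j \<in> I" for j
      using that le1 by (auto simp: H_def G_def)
    define A where "A = (\<lambda>\<omega>. form b ?J c (\<lambda>i. H J i \<omega>) (\<lambda>i. G J i \<omega>))"
    define B where "B = (\<lambda>\<omega>. form b ?J (link i c) (\<lambda>i. H J i \<omega>) (\<lambda>i. G J i \<omega>))"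
    define C where "C = (\<lambda>\<omega>. form 1 ?J (link i c) (\<lambda>i. H J i \<omega>) (\<lambda>i. 0))"
    have m: "A \<in> borel_measurable (sub ?J)" "B \<in> borel_measurable (sub ?J)" "C \<in> borel_measurable (sub ?J)"
      unfolding A_def B_def C_def using HG by (auto intro!: form_sub simp: block_rv_def)
    have dl: "deg_le d ?J (link i c)" using deg_le_link_same[OF finite_I i(1) deg] .
    have BC: "L4 B" "L4 C" "expectation (\<lambda>\<omega>. (B \<omega>) ^ 4) \<le> (256 * K) ^ d * (influence I c i)\<^sup>2"
      "expectation (\<lambda>\<omega>. (C \<omega>) ^ 4) \<le> (256 * K) ^ d * (influence I c i)\<^sup>2"
      using form_fourth_moment[OF J(1), of "H J" "G J" K b d "link i c"] HG b K(5) dl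
        form_fourth_moment[OF J(1), of "H J" "\<lambda>_ _. 0" K 1 d "link i c"]
      unfolding B_def C_def coef_norm_link[OF finite_I i(1)] by auto
    have BC2: "expectation (\<lambda>\<omega>. (B \<omega>)\<^sup>2) \<le> 6 ^ d * influence I c i" "expectation (\<lambda>\<omega>. (C \<omega>)\<^sup>2) \<le> 6 ^ d * influence I c i"
      using form_second_moment_crude[OF J(1), of "H J" "G J" b d "link i c"] HG b dl HG2
        form_second_moment_crude[OF J(1), of "H J" "\<lambda>_ _. 0" 1 d "link i c"]
      unfolding B_def C_def coef_norm_link[OF finite_I i(1)] by auto
    have eq: "form b I c (\<lambda>i. H J i \<omega>) (\<lambda>i. G J i \<omega>) = A \<omega> + (X i \<omega> * B \<omega> + Y i \<omega> * C \<omega>)" for \<omega>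
      using form_insert[of ?J i b c "\<lambda>i. H J i \<omega>" "\<lambda>i. G J i \<omega>"] finite_I i
      unfolding Ii by (simp add: A_def B_def C_def H_def G_def)
    have cong: "form b' ?J c' (\<lambda>j. H (insert i J) j \<omega>) (\<lambda>j. G (insert i J) j \<omega>) = form b' ?J c' (\<lambda>j. H J j \<omega>) (\<lambda>j. G J j \<omega>)"
      "form b' ?J c' (\<lambda>j. H (insert i J) j \<omega>) (\<lambda>j. 0) = form b' ?J c' (\<lambda>j. H J j \<omega>) (\<lambda>j. 0)" for b' c' \<omega>
      by (auto intro!: form_cong simp: H_def G_def split: if_splits)
    have eq': "form b I c (\<lambda>j. H (insert i J) j \<omega>) (\<lambda>j. G (insert i J) j \<omega>) = A \<omega> + (X' i \<omega> * B \<omega> + Y' i \<omega> * C \<omega>)" for \<omega>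
      using form_insert[of ?J i b c "\<lambda>j. H (insert i J) j \<omega>" "\<lambda>j. G (insert i J) j \<omega>"] finite_I i
      unfolding Ii cong by (simp add: A_def B_def C_def H_def G_def)
    have k: "1 \<le> (256 * K) ^ d" using K(5) by (intro one_le_power) auto
    have s0: "0 \<le> influence I c i" by (simp add: influence_def sum_nonneg)
    have "\<bar>E J - E (insert i J)\<bar> \<le> influence I c i * r"
      unfolding E_def eq eq' r_def
      using swap_block[OF J m(1) m(2) BC(1) m(3) BC(2) rv(1)[OF i(1)] L4(1)[OF i(1)] rv(2)[OF i(1)] L4(2)[OF i(1)]
         rv(3)[OF i(1)] L4(3)[OF i(1)] rv(4)[OF i(1)] L4(4)[OF i(1)] \<psi> K(1)[OF i(1)] K(2)[OF i(1)] K(3)[OF i(1)] K(4)[OF i(1)] K(5)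
         BC(3,4) k BC2 _ s0 \<tau>(1)[OF i(1)] \<tau>(2) \<delta>(1)[OF i(1)] \<delta>(2)[OF i(1)] \<delta>(3)[OF i(1)]] by simp
    then show ?thesis by linarith
  qed
  have "\<bar>E J - E {}\<bar> \<le> (\<Sum>i\<in>J. influence I c i) * r" if "J \<subseteq> I" for J
    using finite_subset[OF that finite_I] that
  proof (induction J rule: finite_induct)
    case (insert i J)
    then have "\<bar>E (insert i J) - E J\<bar> \<le> influence I c i * r" by (intro step) auto
    then show ?case using insert by (simp add: distrib_right)
  qed simp
  from this[of I] have "\<bar>E {} - E I\<bar> \<le> (\<Sum>i\<in>I. influence I c i) * r" by simp
  also have "\<dots> \<le> (real d * coef_norm I c) * r"
    using r by (intro mult_right_mono sum_influence_le finite_I deg)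
  also have "\<dots> \<le> (real d * 1) * r" using r n by (intro mult_right_mono mult_left_mono) auto
  finally have "\<bar>E {} - E I\<bar> \<le> real d * r" by simp
  moreover have "form b I c (\<lambda>i. H I i \<omega>) (\<lambda>i. G I i \<omega>) = form b I c (\<lambda>i. X' i \<omega>) (\<lambda>i. Y' i \<omega>)" for \<omega>
    by (rule form_cong) (auto simp: H_def G_def)
  ultimately show ?thesis unfolding E_def r_def by (simp add: H_def G_def)
qed

end

section \<open>Truncation and the invariance principle\<close>

context prob_space
begin

text \<open>Cutting off at R creates fourth moments, and recentring restores mean 0. Subtracting a
  mean does not increase a second moment; this yields both the bound 1 for \<open>T\<close> and the
  bound for \<open>X - T\<close>, because \<open>X - T\<close> is the centred tail of X.\<close>

lemma truncation:
  fixes X :: "'a \<Rightarrow> real" and e R \<kappa> :: real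
  assumes X: "L2 X" "expectation X = 0" "expectation (\<lambda>\<omega>. (X \<omega>)\<^sup>2) = 1"
    and e: "0 < e" and R: "0 < R"
    and mom: "integrable M (\<lambda>\<omega>. \<bar>X \<omega>\<bar> powr (2 + e))" "expectation (\<lambda>\<omega>. \<bar>X \<omega>\<bar> powr (2 + e)) \<le> \<kappa>"
  defines "T \<equiv> \<lambda>\<omega>. (if \<bar>X \<omega>\<bar> \<le> R then X \<omega> else 0) - expectation (\<lambda>\<omega>. if \<bar>X \<omega>\<bar> \<le> R then X \<omega> else 0)"
  shows "L4 T" "expectation T = 0" "expectation (\<lambda>\<omega>. (T \<omega>) ^ 4) \<le> 16 * R ^ 4"
    "expectation (\<lambda>\<omega>. (T \<omega>)\<^sup>2) \<le> 1" "expectation (\<lambda>\<omega>. (X \<omega> - T \<omega>)\<^sup>2) \<le> \<kappa> * R powr - e"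
proof -
  define C where "C = (\<lambda>\<omega>. if \<bar>X \<omega>\<bar> \<le> R then X \<omega> else 0)"
  have mX[measurable]: "X \<in> borel_measurable M" using X by (simp add: L2_def)
  have mC[measurable]: "C \<in> borel_measurable M" unfolding C_def by measurable
  have Cle: "\<bar>C \<omega>\<bar> \<le> R" for \<omega> using R by (simp add: C_def)
  have iC: "integrable M C" using Cle by (intro integrable_const_bound[of _ R]) auto
  have EC: "\<bar>expectation C\<bar> \<le> R"
  proof -
    have "\<bar>expectation C\<bar> \<le> expectation (\<lambda>\<omega>. \<bar>C \<omega>\<bar>)" by (rule integral_abs_bound)
    also have "\<dots> \<le> expectation (\<lambda>_. R)" using iC Cle by (intro integral_mono) auto
    finally show ?thesis by (simp add: prob_space)
  qed
  have T: "T = (\<lambda>\<omega>. C \<omega> - expectation C)" by (simp add: T_def C_def)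
  have Tle: "\<bar>T \<omega>\<bar> \<le> 2 * R" for \<omega>
  proof -
    have "\<bar>T \<omega>\<bar> \<le> \<bar>C \<omega>\<bar> + \<bar>expectation C\<bar>" unfolding T by (rule abs_triangle_ineq4)
    then show ?thesis using Cle[of \<omega>] EC by linarith
  qed
  have T4: "(T \<omega>) ^ 4 \<le> 16 * R ^ 4" for \<omega>
    using power_mono[OF Tle[of \<omega>], of 4] by (simp add: power_mult_distrib power_even_abs)
  have mT[measurable]: "T \<in> borel_measurable M" unfolding T by measurable
  show L4T: "L4 T" unfolding L4_def
    using T4 by (auto intro!: integrable_const_bound[of _ "16 * R ^ 4"])
  have "expectation (\<lambda>\<omega>. (T \<omega>) ^ 4) \<le> expectation (\<lambda>\<omega>. 16 * R ^ 4)"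
    using L4T T4 by (intro integral_mono) (auto simp: L4_def)
  then show "expectation (\<lambda>\<omega>. (T \<omega>) ^ 4) \<le> 16 * R ^ 4" by (simp add: prob_space)
  show "expectation T = 0" unfolding T using iC by (simp add: prob_space)
  have var: "expectation (\<lambda>\<omega>. (Z \<omega> - expectation Z)\<^sup>2) \<le> expectation (\<lambda>\<omega>. (Z \<omega>)\<^sup>2)" if "L2 Z" for Z
    using variance_eq[of Z] that L2_integrable[OF that] by (simp add: L2_def)
  have C2le: "(C \<omega>)\<^sup>2 \<le> (X \<omega>)\<^sup>2" for \<omega> by (simp add: C_def)
  have iX2: "integrable M (\<lambda>\<omega>. (X \<omega>)\<^sup>2)" using X by (simp add: L2_def)
  have iC2: "integrable M (\<lambda>\<omega>. (C \<omega>)\<^sup>2)"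
    using iX2 C2le by (rule_tac Bochner_Integration.integrable_bound) (auto intro!: AE_I2)
  have "expectation (\<lambda>\<omega>. (T \<omega>)\<^sup>2) \<le> expectation (\<lambda>\<omega>. (C \<omega>)\<^sup>2)"
    unfolding T by (rule var) (auto simp: L2_def iC2)
  also have "\<dots> \<le> expectation (\<lambda>\<omega>. (X \<omega>)\<^sup>2)"
    using iC2 iX2 C2le by (intro integral_mono) auto
  finally show "expectation (\<lambda>\<omega>. (T \<omega>)\<^sup>2) \<le> 1" using X(3) by simp
  define Z where "Z = (\<lambda>\<omega>. X \<omega> - C \<omega>)"
  have L2Z: "L2 Z" unfolding Z_def using X(1) iC2 by (intro L2_diff) (auto simp: L2_def)
  have "expectation Z = - expectation C"
    unfolding Z_def using L2_integrable[OF X(1)] iC X(2) by simp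
  then have eq: "(\<lambda>\<omega>. X \<omega> - T \<omega>) = (\<lambda>\<omega>. Z \<omega> - expectation Z)" by (auto simp: T Z_def)
  have "expectation (\<lambda>\<omega>. (X \<omega> - T \<omega>)\<^sup>2) \<le> expectation (\<lambda>\<omega>. (Z \<omega>)\<^sup>2)"
    using var[OF L2Z] fun_cong[OF eq] by simp
  also have "\<dots> \<le> expectation (\<lambda>\<omega>. R powr - e * \<bar>X \<omega>\<bar> powr (2 + e))"
  proof (rule integral_mono)
    show "(Z \<omega>)\<^sup>2 \<le> R powr - e * \<bar>X \<omega>\<bar> powr (2 + e)" for \<omega>
    proof (cases "\<bar>X \<omega>\<bar> \<le> R")
      case False
      then have x: "R < \<bar>X \<omega>\<bar>" by simp
      \<comment> \<open>Beyond R the extra e moments are worth at least R^e, so the square is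
        dominated by R^(-e) times the moment of order 2 + e.\<close>
      have "1 \<le> \<bar>X \<omega>\<bar> powr e * R powr - e"
        using x R e powr_mono2[of e R "\<bar>X \<omega>\<bar>"] by (simp add: powr_minus field_simps)
      then have "\<bar>X \<omega>\<bar>\<^sup>2 * 1 \<le> \<bar>X \<omega>\<bar>\<^sup>2 * (\<bar>X \<omega>\<bar> powr e * R powr - e)" by (intro mult_left_mono) auto
      moreover have "\<bar>X \<omega>\<bar> powr (2 + e) = \<bar>X \<omega>\<bar>\<^sup>2 * \<bar>X \<omega>\<bar> powr e"
        using x R by (simp add: powr_add)
      ultimately show ?thesis using False by (simp add: Z_def C_def mult_ac)
    qed (simp add: Z_def C_def)
  qed (use L2Z mom in \<open>auto simp: L2_def\<close>)
  also have "\<dots> = R powr - e * expectation (\<lambda>\<omega>. \<bar>X \<omega>\<bar> powr (2 + e))" by simp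
  also have "\<dots> \<le> R powr - e * \<kappa>" using mom(2) by (intro mult_left_mono) auto
  finally show "expectation (\<lambda>\<omega>. (X \<omega> - T \<omega>)\<^sup>2) \<le> \<kappa> * R powr - e" by (simp add: mult.commute)
qed

lemma abs_expectation_le_sqrt:
  assumes "L2 f" "L2 g" "expectation (\<lambda>\<omega>. (f \<omega>)\<^sup>2) \<le> a" "expectation (\<lambda>\<omega>. (g \<omega>)\<^sup>2) \<le> b\<^sup>2" "0 \<le> b"
  shows "\<bar>expectation (\<lambda>\<omega>. f \<omega> * g \<omega>)\<bar> \<le> b * sqrt a"
proof -
  have f0: "0 \<le> expectation (\<lambda>\<omega>. (f \<omega>)\<^sup>2)" by simp
  have "(expectation (\<lambda>\<omega>. f \<omega> * g \<omega>))\<^sup>2 \<le> expectation (\<lambda>\<omega>. (f \<omega>)\<^sup>2) * expectation (\<lambda>\<omega>. (g \<omega>)\<^sup>2)"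
    using assms by (intro Cauchy_Schwarz_expectation) (auto simp: L2_def)
  also have "\<dots> \<le> a * b\<^sup>2" using assms(3,4) order_trans[OF f0 assms(3)] by (intro mult_mono) auto
  finally have "sqrt ((expectation (\<lambda>\<omega>. f \<omega> * g \<omega>))\<^sup>2) \<le> sqrt (a * b\<^sup>2)" by (rule real_sqrt_le_mono)
  then show ?thesis using assms(5) by (simp add: real_sqrt_mult mult.commute)
qed

end

lemma smooth3_lipschitz:
  assumes "smooth3 m1 m2 m3 \<psi>"
  shows "\<bar>\<psi> x - \<psi> y\<bar> \<le> m1 * \<bar>x - y\<bar>"
proof -
  obtain \<psi>1 where p: "\<And>x. (\<psi> has_real_derivative \<psi>1 x) (at x)" "\<And>x. \<bar>\<psi>1 x\<bar> \<le> m1"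
    using assms unfolding smooth3_def by blast
  have "norm (\<psi> x - \<psi> y) \<le> m1 * norm (x - y)"
    by (rule field_differentiable_bound[of UNIV \<psi> \<psi>1]) (use p in auto)
  then show ?thesis by simp
qed

lemma smooth3_measurable:
  assumes "smooth3 m1 m2 m3 \<psi>" shows "\<psi> \<in> borel_measurable borel"
proof -
  obtain \<psi>1 where "\<And>x. (\<psi> has_real_derivative \<psi>1 x) (at x)"
    using assms unfolding smooth3_def by blast
  then have "continuous_on UNIV \<psi>" by (intro continuous_at_imp_continuous_on) (blast intro: DERIV_isCont)
  then show ?thesis by (rule borel_measurable_continuous_onI)
qed

lemma smooth3_nonneg:
  assumes "smooth3 m1 m2 m3 \<psi>" shows "0 \<le> m1" "0 \<le> m2" "0 \<le> m3"
proof -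
  obtain \<psi>1 \<psi>2 where p: "\<And>x. \<bar>\<psi>1 x\<bar> \<le> m1" "\<And>x. \<bar>\<psi>2 x\<bar> \<le> m2" "\<And>x y. \<bar>\<psi>2 x - \<psi>2 y\<bar> \<le> m3 * \<bar>x - y\<bar>"
    using assms unfolding smooth3_def by blast
  show "0 \<le> m1" "0 \<le> m2" using order_trans[OF abs_ge_zero p(1)] order_trans[OF abs_ge_zero p(2)] by auto
  show "0 \<le> m3" using order_trans[OF abs_ge_zero p(3)[of 1 0]] by simp
qed

context indep_blocks
begin

text \<open>X is first truncated, which costs the Lipschitz constant m1 times an L2 distance, and
  the truncated variables are then exchanged for X'. The direction Y has bounded fourth moments
  already and stays untouched in the first stage. K covers both the truncated fourth moment 16 R^4
  and the Gaussian value 3; R remains free, to be chosen before \<tau>.\<close>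

lemma invariance:
  assumes rv: "\<And>i. i \<in> I \<Longrightarrow> block_rv i (X i)" "\<And>i. i \<in> I \<Longrightarrow> block_rv i (Y i)"
      "\<And>i. i \<in> I \<Longrightarrow> block_rv i (X' i)" "\<And>i. i \<in> I \<Longrightarrow> block_rv i (Y' i)"
    and X: "\<And>i. i \<in> I \<Longrightarrow> expectation (\<lambda>\<omega>. (X i \<omega>)\<^sup>2) = 1"
      "\<And>i. i \<in> I \<Longrightarrow> integrable M (\<lambda>\<omega>. \<bar>X i \<omega>\<bar> powr (2 + e))"
      "\<And>i. i \<in> I \<Longrightarrow> expectation (\<lambda>\<omega>. \<bar>X i \<omega>\<bar> powr (2 + e)) \<le> \<kappa>"
      "0 < e" "0 \<le> \<kappa>" "1 \<le> R"
    and L4: "\<And>i. i \<in> I \<Longrightarrow> L4 (Y i)" "\<And>i. i \<in> I \<Longrightarrow> L4 (X' i)" "\<And>i. i \<in> I \<Longrightarrow> L4 (Y' i)"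
    and K: "\<And>i. i \<in> I \<Longrightarrow> expectation (\<lambda>\<omega>. (Y i \<omega>) ^ 4) \<le> 3"
      "\<And>i. i \<in> I \<Longrightarrow> expectation (\<lambda>\<omega>. (X' i \<omega>) ^ 4) \<le> 3"
      "\<And>i. i \<in> I \<Longrightarrow> expectation (\<lambda>\<omega>. (Y' i \<omega>) ^ 4) \<le> 3"
    and cov: "\<And>i. i \<in> I \<Longrightarrow> expectation (\<lambda>\<omega>. (X' i \<omega>)\<^sup>2) = 1"
      "\<And>i. i \<in> I \<Longrightarrow> expectation (\<lambda>\<omega>. X i \<omega> * Y i \<omega>) = 0"
      "\<And>i. i \<in> I \<Longrightarrow> expectation (\<lambda>\<omega>. X' i \<omega> * Y' i \<omega>) = 0"
      "\<And>i. i \<in> I \<Longrightarrow> expectation (\<lambda>\<omega>. (Y i \<omega>)\<^sup>2) = s"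
      "\<And>i. i \<in> I \<Longrightarrow> expectation (\<lambda>\<omega>. (Y' i \<omega>)\<^sup>2) = s" "0 \<le> s" "s \<le> 1"
    and \<psi>: "smooth3 m1 m2 m3 \<psi>" and b: "b\<^sup>2 \<le> 1" and deg: "deg_le d I c"
    and \<tau>: "\<And>i. i \<in> I \<Longrightarrow> influence I c i \<le> \<tau>" "0 < \<tau>"
    and n: "coef_norm I c \<le> 1"
  defines "\<epsilon> \<equiv> \<kappa> * R powr - e" and "K \<equiv> 16 * R ^ 4 + 3"
  shows "\<bar>expectation (\<lambda>\<omega>. \<psi> (form b I c (\<lambda>i. X i \<omega>) (\<lambda>i. Y i \<omega>))) -
      expectation (\<lambda>\<omega>. \<psi> (form b I c (\<lambda>i. X' i \<omega>) (\<lambda>i. Y' i \<omega>)))\<bar>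
    \<le> m1 * sqrt (\<epsilon> * diff_const d) +
      real d * (2 * 6 ^ d * (2 * sqrt \<epsilon>) * m2 + 20 * K * (256 * K) ^ d * m3 * sqrt \<tau>)"
proof -
  define T where "T = (\<lambda>i \<omega>. (if \<bar>X i \<omega>\<bar> \<le> R then X i \<omega> else 0) - expectation (\<lambda>\<omega>. if \<bar>X i \<omega>\<bar> \<le> R then X i \<omega> else 0))"
  have \<epsilon>0: "0 \<le> \<epsilon>" using X(5) by (simp add: \<epsilon>_def)
  have m: "0 \<le> m1" "0 \<le> m2" "0 \<le> m3" using smooth3_nonneg[OF \<psi>] by auto
  have K1: "1 \<le> K" "3 \<le> K" using X(6) by (auto simp: K_def)
  have Tr: "L4 (T i)" "expectation (T i) = 0" "expectation (\<lambda>\<omega>. (T i \<omega>) ^ 4) \<le> 16 * R ^ 4"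
    "expectation (\<lambda>\<omega>. (T i \<omega>)\<^sup>2) \<le> 1" "expectation (\<lambda>\<omega>. (X i \<omega> - T i \<omega>)\<^sup>2) \<le> \<epsilon>" if "i \<in> I" for i
    using truncation[of "X i" e R \<kappa>] rv(1)[OF that] X that by (auto simp: block_rv_def T_def \<epsilon>_def)
  have Tsub: "T i \<in> borel_measurable (sub {i})" if "i \<in> I" for i
    using rv(1)[OF that] unfolding T_def block_rv_def by (intro borel_measurable_diff) auto
  have Trv: "block_rv i (T i)" if "i \<in> I" for i
    using Tsub[OF that] Tr[OF that] L4_L2 by (auto simp: block_rv_def)
  have L2X: "L2 (X i)" "L2 (Y i)" "L2 (T i)" if "i \<in> I" for i
    using rv that Trv by (auto simp: block_rv_def)
  have Y4: "expectation (\<lambda>\<omega>. (Y i \<omega>) ^ 4) \<le> K" "expectation (\<lambda>\<omega>. (X' i \<omega>) ^ 4) \<le> K" "expectation (\<lambda>\<omega>. (Y' i \<omega>) ^ 4) \<le> K"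
    "expectation (\<lambda>\<omega>. (T i \<omega>) ^ 4) \<le> K" if "i \<in> I" for i
    using order_trans[OF K(1)[OF that] K1(2)] order_trans[OF K(2)[OF that] K1(2)] order_trans[OF K(3)[OF that] K1(2)]
      Tr(3)[OF that] by (simp_all add: K_def)
  \<comment> \<open>Variance lost by truncation: E X^2 - E T^2 = E (X - T)(X + T), where the first
    factor has L2 norm at most \<open>sqrt \<epsilon>\<close> and the second at most 2.\<close>
  have d1: "\<bar>expectation (\<lambda>\<omega>. (T i \<omega>)\<^sup>2) - expectation (\<lambda>\<omega>. (X' i \<omega>)\<^sup>2)\<bar> \<le> 2 * sqrt \<epsilon>" if i: "i \<in> I" for i
  proof -
    note L = L2X[OF i]
    have "expectation (\<lambda>\<omega>. (X i \<omega> + T i \<omega>)\<^sup>2) \<le> expectation (\<lambda>\<omega>. 2 * (X i \<omega>)\<^sup>2 + 2 * (T i \<omega>)\<^sup>2)"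
    proof (rule integral_mono)
      show "(X i \<omega> + T i \<omega>)\<^sup>2 \<le> 2 * (X i \<omega>)\<^sup>2 + 2 * (T i \<omega>)\<^sup>2" for \<omega>
        using sum_squares_bound[of "X i \<omega>" "T i \<omega>"] by (simp add: power2_sum)
    qed (use L L2_add[OF L(1,3)] in \<open>auto simp: L2_def\<close>)
    also have "\<dots> \<le> 2\<^sup>2" using L Tr(4)[OF i] X(1)[OF i] by (simp add: L2_def)
    finally have "\<bar>expectation (\<lambda>\<omega>. (X i \<omega> - T i \<omega>) * (X i \<omega> + T i \<omega>))\<bar> \<le> 2 * sqrt \<epsilon>"
      using Tr(5)[OF i] L by (intro abs_expectation_le_sqrt L2_diff L2_add) auto
    also have "(\<lambda>\<omega>. (X i \<omega> - T i \<omega>) * (X i \<omega> + T i \<omega>)) = (\<lambda>\<omega>. (X i \<omega>)\<^sup>2 - (T i \<omega>)\<^sup>2)"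
      by (auto simp: power2_eq_square algebra_simps)
    also have "expectation \<dots> = 1 - expectation (\<lambda>\<omega>. (T i \<omega>)\<^sup>2)"
      using L X(1)[OF i] by (simp add: L2_def)
    finally show ?thesis using cov(1)[OF i] by linarith
  qed
  have d2: "\<bar>expectation (\<lambda>\<omega>. T i \<omega> * Y i \<omega>) - expectation (\<lambda>\<omega>. X' i \<omega> * Y' i \<omega>)\<bar> \<le> 2 * sqrt \<epsilon>" if i: "i \<in> I" for i
  proof -
    note L = L2X[OF i]
    have "\<bar>expectation (\<lambda>\<omega>. (X i \<omega> - T i \<omega>) * Y i \<omega>)\<bar> \<le> 1 * sqrt \<epsilon>"
      using Tr(5)[OF i] L cov(4)[OF i] cov(7) by (intro abs_expectation_le_sqrt L2_diff) auto
    also have "expectation (\<lambda>\<omega>. (X i \<omega> - T i \<omega>) * Y i \<omega>) = - expectation (\<lambda>\<omega>. T i \<omega> * Y i \<omega>)"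
      using L2_integrable_mult[OF L(1,2)] L2_integrable_mult[OF L(3,2)] cov(2)[OF i] by (simp add: left_diff_distrib)
    finally show ?thesis using cov(3)[OF i] \<epsilon>0 real_sqrt_ge_zero[OF \<epsilon>0] by simp
  qed
  have lind: "\<bar>expectation (\<lambda>\<omega>. \<psi> (form b I c (\<lambda>i. T i \<omega>) (\<lambda>i. Y i \<omega>))) -
      expectation (\<lambda>\<omega>. \<psi> (form b I c (\<lambda>i. X' i \<omega>) (\<lambda>i. Y' i \<omega>)))\<bar>
    \<le> real d * (2 * 6 ^ d * (2 * sqrt \<epsilon>) * m2 + 20 * K * (256 * K) ^ d * m3 * sqrt \<tau>)"
    using Trv rv Tr(1) L4 Y4 K1 d1 d2 cov Tr(4) \<psi> b deg \<tau> n m \<epsilon>0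
    by (intro lindeberg_swap) auto
  let ?F = "\<lambda>\<omega>. form b I c (\<lambda>i. X i \<omega>) (\<lambda>i. Y i \<omega>)" and ?G = "\<lambda>\<omega>. form b I c (\<lambda>i. T i \<omega>) (\<lambda>i. Y i \<omega>)"
  have D: "L2 (\<lambda>\<omega>. ?F \<omega> - ?G \<omega>)" "expectation (\<lambda>\<omega>. (?F \<omega> - ?G \<omega>)\<^sup>2) \<le> \<epsilon> * diff_const d * coef_norm I c"
    using form_diff_second_moment[OF subset_refl rv(1) rv(2) Trv X(1) cov(4,2,6,7) b deg Tr(4,5) \<epsilon>0] by auto
  have "expectation (\<lambda>\<omega>. (?F \<omega> - ?G \<omega>)\<^sup>2) \<le> \<epsilon> * diff_const d"
    using D(2) mult_left_mono[OF n, of "\<epsilon> * diff_const d"] \<epsilon>0 by simp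
  then have D1: "\<bar>expectation (\<lambda>\<omega>. \<bar>?F \<omega> - ?G \<omega>\<bar> * 1)\<bar> \<le> 1 * sqrt (\<epsilon> * diff_const d)"
    using D(1) by (intro abs_expectation_le_sqrt) (auto simp: L2_def prob_space)
  have mF: "?F \<in> borel_measurable M" "?G \<in> borel_measurable M"
    using form_sub[OF subset_refl, of X Y b c] form_sub[OF subset_refl, of T Y b c] rv Trv sub_M[OF subset_refl]
    by (auto simp: block_rv_def)
  have [measurable]: "\<psi> \<in> borel_measurable borel" using smooth3_measurable[OF \<psi>] .
  have \<psi>1: "\<bar>\<psi> x\<bar> \<le> 1" for x using \<psi> by (auto simp: smooth3_def)
  have ints: "integrable M (\<lambda>\<omega>. \<psi> (?F \<omega>))" "integrable M (\<lambda>\<omega>. \<psi> (?G \<omega>))"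
    using mF \<psi>1 by (auto intro!: integrable_const_bound[of _ 1])
  have "\<bar>expectation (\<lambda>\<omega>. \<psi> (?F \<omega>)) - expectation (\<lambda>\<omega>. \<psi> (?G \<omega>))\<bar> = \<bar>expectation (\<lambda>\<omega>. \<psi> (?F \<omega>) - \<psi> (?G \<omega>))\<bar>"
    using ints by simp
  also have "\<dots> \<le> expectation (\<lambda>\<omega>. \<bar>\<psi> (?F \<omega>) - \<psi> (?G \<omega>)\<bar>)" by (rule integral_abs_bound)
  also have "\<dots> \<le> expectation (\<lambda>\<omega>. m1 * \<bar>?F \<omega> - ?G \<omega>\<bar>)"
    using ints L2_integrable[OF D(1)] smooth3_lipschitz[OF \<psi>] by (intro integral_mono) auto
  also have "\<dots> \<le> m1 * sqrt (\<epsilon> * diff_const d)"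
    using D1 m by (auto intro!: mult_left_mono)
  finally show ?thesis using lind by linarith
qed

end

subsection \<open>Independent coordinates of product measures\<close>

lemma indep_vars_PiM_coordinates:
  assumes "\<And>i. i \<in> I \<Longrightarrow> prob_space (S i)"
  shows "prob_space.indep_vars (PiM I S) S (\<lambda>i \<omega>. \<omega> i) I"
proof -
  interpret P: prob_space "PiM I S" using assms by (intro prob_space_PiM) auto
  show ?thesis
  proof (cases "I = {}")
    case True
    then show ?thesis unfolding P.indep_vars_def P.indep_sets_def by auto
  next
    case False
    have "distr (PiM I S) (PiM I S) (\<lambda>x. \<lambda>i\<in>I. x i) = distr (PiM I S) (PiM I S) (\<lambda>x. x)"
      by (intro distr_cong) (auto simp: space_PiM fun_eq_iff PiE_def extensional_def)
    also have "\<dots> = PiM I S" by (rule distr_id)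
    also have "\<dots> = PiM I (\<lambda>i. distr (PiM I S) (S i) (\<lambda>\<omega>. \<omega> i))"
      using assms by (intro PiM_cong) (auto simp: distr_PiM_component)
    finally show ?thesis
      using False by (subst P.indep_vars_iff_distr_eq_PiM') auto
  qed
qed

lemma PiM_coordinate_law:
  fixes f :: "'b \<Rightarrow> real"
  assumes "\<And>i. i \<in> I \<Longrightarrow> prob_space (S i)" "i \<in> I" "f \<in> borel_measurable (S i)"
  shows "integral\<^sup>L (PiM I S) (\<lambda>\<omega>. f (\<omega> i)) = integral\<^sup>L (S i) f"
    "integrable (PiM I S) (\<lambda>\<omega>. f (\<omega> i)) \<longleftrightarrow> integrable (S i) f"
proof -
  have c: "distr (PiM I S) (S i) (\<lambda>\<omega>. \<omega> i) = S i" using assms by (intro distr_PiM_component) auto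
  show "integral\<^sup>L (PiM I S) (\<lambda>\<omega>. f (\<omega> i)) = integral\<^sup>L (S i) f"
    using assms integral_distr[of "\<lambda>\<omega>. \<omega> i" "PiM I S" "S i" f] unfolding c by auto
  show "integrable (PiM I S) (\<lambda>\<omega>. f (\<omega> i)) \<longleftrightarrow> integrable (S i) f"
    using assms integrable_distr_eq[of "\<lambda>\<omega>. \<omega> i" "PiM I S" "S i" f] unfolding c by auto
qed

lemma distr_PiM_map:
  assumes "finite I" "I \<noteq> {}" "\<And>i. i \<in> I \<Longrightarrow> prob_space (S i)" "\<And>i. i \<in> I \<Longrightarrow> f i \<in> measurable (S i) (R i)"
  shows "distr (PiM I S) (PiM I R) (\<lambda>\<omega>. \<lambda>i\<in>I. f i (\<omega> i)) = PiM I (\<lambda>i. distr (S i) (R i) (f i))"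
proof -
  interpret P: prob_space "PiM I S" using assms by (intro prob_space_PiM) auto
  have "P.indep_vars R (\<lambda>i \<omega>. f i (\<omega> i)) I"
    using P.indep_vars_compose2[OF indep_vars_PiM_coordinates] assms by blast
  then have "distr (PiM I S) (PiM I R) (\<lambda>\<omega>. \<lambda>i\<in>I. f i (\<omega> i)) = PiM I (\<lambda>i. distr (PiM I S) (R i) (\<lambda>\<omega>. f i (\<omega> i)))"
    using assms by (subst (asm) P.indep_vars_iff_distr_eq_PiM') auto
  also have "\<dots> = PiM I (\<lambda>i. distr (S i) (R i) (f i))"
  proof (rule PiM_cong)
    fix i assume i: "i \<in> I"
    have "distr (PiM I S) (R i) (\<lambda>\<omega>. f i (\<omega> i)) = distr (distr (PiM I S) (S i) (\<lambda>\<omega>. \<omega> i)) (R i) (f i)"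
      using assms i by (subst distr_distr) (auto simp: comp_def)
    then show "distr (PiM I S) (R i) (\<lambda>\<omega>. f i (\<omega> i)) = distr (S i) (R i) (f i)"
      using assms i by (simp add: distr_PiM_component)
  qed simp
  finally show ?thesis .
qed

definition coord_algebra :: "nat set \<Rightarrow> (nat \<Rightarrow> 'b measure) \<Rightarrow> nat \<Rightarrow> (nat \<Rightarrow> 'b) set set" where
  "coord_algebra I S i = {(\<lambda>\<omega>. \<omega> i) -` A \<inter> space (PiM I S) | A. A \<in> sets (S i)}"

lemma indep_blocks_PiM:
  assumes "finite I" "\<And>i. i \<in> I \<Longrightarrow> prob_space (S i)"
  shows "indep_blocks (PiM I S) (coord_algebra I S) I"
proof -
  interpret P: prob_space "PiM I S" using assms by (intro prob_space_PiM) auto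
  show ?thesis
  proof (intro indep_blocks.intro indep_blocks_axioms.intro)
    show "prob_space (PiM I S)" by (rule P.prob_space_axioms)
    show "P.indep_sets (coord_algebra I S) I"
      using indep_vars_PiM_coordinates[of I S] assms unfolding P.indep_vars_def2 coord_algebra_def by auto
    fix i assume "i \<in> I"
    then have "(\<lambda>\<omega>. \<omega> i) \<in> space (PiM I S) \<rightarrow> space (S i)" by (auto simp: space_PiM)
    then have "coord_algebra I S i = sets (vimage_algebra (space (PiM I S)) (\<lambda>\<omega>. \<omega> i) (S i))"
      by (simp add: sets_vimage_algebra2 coord_algebra_def)
    then show "sigma_algebra (space (PiM I S)) (coord_algebra I S i)"
      using sets.sigma_algebra_axioms[of "vimage_algebra (space (PiM I S)) (\<lambda>\<omega>. \<omega> i) (S i)"] by simp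
  qed (fact assms)
qed

lemma coordinate_sub:
  fixes f :: "'b \<Rightarrow> real" and S :: "nat \<Rightarrow> 'b measure"
  assumes "finite I" "\<And>i. i \<in> I \<Longrightarrow> prob_space (S i)" "i \<in> I" "f \<in> borel_measurable (S i)"
  shows "(\<lambda>\<omega>. f (\<omega> i)) \<in> borel_measurable (indep_blocks.sub (PiM I S) (coord_algebra I S) {i})"
proof -
  interpret B: indep_blocks "PiM I S" "coord_algebra I S" I
    by (rule indep_blocks_PiM) (use assms in auto)
  show ?thesis
  proof (rule measurableI)
    fix A :: "real set" assume A: "A \<in> sets borel"
    have "(\<lambda>\<omega>. f (\<omega> i)) -` A \<inter> space (PiM I S) = (\<lambda>\<omega>. \<omega> i) -` (f -` A \<inter> space (S i)) \<inter> space (PiM I S)"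
      using assms(3) by (auto simp: space_PiM)
    then have "(\<lambda>\<omega>. f (\<omega> i)) -` A \<inter> space (PiM I S) \<in> coord_algebra I S i"
      unfolding coord_algebra_def using measurable_sets[OF assms(4) A] by blast
    then show "(\<lambda>\<omega>. f (\<omega> i)) -` A \<inter> space (B.sub {i}) \<in> sets (B.sub {i})"
      using assms(3) B.sets_sub[of "{i}"] by (auto intro: sigma_sets.Basic)
  qed auto
qed

lemma coordinate_block_rv:
  fixes f :: "'b \<Rightarrow> real" and S :: "nat \<Rightarrow> 'b measure"
  assumes "finite I" "\<And>i. i \<in> I \<Longrightarrow> prob_space (S i)" "i \<in> I" "f \<in> borel_measurable (S i)"
    "integrable (S i) (\<lambda>x. (f x)\<^sup>2)" "integral\<^sup>L (S i) f = 0"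
  shows "indep_blocks.block_rv (PiM I S) (coord_algebra I S) i (\<lambda>\<omega>. f (\<omega> i))"
proof -
  interpret B: indep_blocks "PiM I S" "coord_algebra I S" I
    by (rule indep_blocks_PiM) (use assms in auto)
  have "(\<lambda>\<omega>. f (\<omega> i)) \<in> borel_measurable (PiM I S)" using assms(3,4) by measurable
  then show ?thesis
    unfolding B.block_rv_def B.L2_def
    by (intro conjI coordinate_sub assms(1-4))
      (simp_all only: PiM_coordinate_law(1)[of I S i f, OF assms(2-4)] assms
        PiM_coordinate_law(2)[of I S i "\<lambda>x. (f x)\<^sup>2", OF assms(2,3) borel_measurable_power[OF assms(4)]])
qed

lemma coordinate_L4:
  fixes f :: "'b \<Rightarrow> real" and S :: "nat \<Rightarrow> 'b measure"
  assumes "finite I" "\<And>i. i \<in> I \<Longrightarrow> prob_space (S i)" "i \<in> I" "f \<in> borel_measurable (S i)"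
    "integrable (S i) (\<lambda>x. (f x) ^ 4)"
  shows "prob_space.L4 (PiM I S) (\<lambda>\<omega>. f (\<omega> i))"
proof -
  interpret B: indep_blocks "PiM I S" "coord_algebra I S" I
    by (rule indep_blocks_PiM) (use assms in auto)
  have "(\<lambda>\<omega>. f (\<omega> i)) \<in> borel_measurable (PiM I S)" using assms(3,4) by measurable
  then show ?thesis
    using PiM_coordinate_law(2)[of I S i "\<lambda>x. (f x) ^ 4"] assms
    by (auto simp: B.L4_def)
qed

subsection \<open>Gaussian small-ball probabilities\<close>

text \<open>Divide out the linear factor at one node. The quotient has degree one less and is at
  most 2 \<epsilon> / m at the other nodes, m being their least distance from that node; multiplying
  back by the factor recovers the coefficients.\<close>

lemma interpolation_bound:
  assumes "finite T" "card T = Suc d"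
  shows "\<exists>C>0. \<forall>p::real poly. \<forall>\<epsilon>. degree p \<le> d \<longrightarrow> (\<forall>t\<in>T. \<bar>poly p t\<bar> \<le> \<epsilon>) \<longrightarrow> (\<forall>k. \<bar>coeff p k\<bar> \<le> C * \<epsilon>)"
  using assms
proof (induction d arbitrary: T)
  case 0
  then obtain t where "T = {t}" by (auto simp: card_Suc_eq)
  then show ?case
  proof (intro exI[of _ 1] conjI allI impI)
    fix p :: "real poly" and \<epsilon> :: real and k
    assume "degree p \<le> 0" and p: "\<forall>t\<in>T. \<bar>poly p t\<bar> \<le> \<epsilon>"
    then obtain a where a: "p = [:a:]" using degree_eq_zeroE by blast
    then have "\<bar>a\<bar> \<le> \<epsilon>" using p \<open>T = {t}\<close> by simp
    then show "\<bar>coeff p k\<bar> \<le> 1 * \<epsilon>" using a by (cases k) auto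
  qed simp
next
  case (Suc d)
  then obtain t0 T' where T: "T = insert t0 T'" "t0 \<notin> T'" "card T' = Suc d"
    by (metis card_Suc_eq)
  have fT': "finite T'" using Suc.prems T by auto
  obtain C where C: "C > 0" "\<And>p::real poly. \<And>\<epsilon> k. degree p \<le> d \<Longrightarrow> (\<forall>t\<in>T'. \<bar>poly p t\<bar> \<le> \<epsilon>) \<Longrightarrow> \<bar>coeff p k\<bar> \<le> C * \<epsilon>"
    using Suc.IH[OF fT' T(3)] by blast
  define m where "m = Min ((\<lambda>t. \<bar>t - t0\<bar>) ` T')"
  have ne: "T' \<noteq> {}" using T by auto
  have m: "0 < m" unfolding m_def using fT' ne T by (subst Min_gr_iff) auto
  have m_le: "m \<le> \<bar>t - t0\<bar>" if "t \<in> T'" for t unfolding m_def using fT' that by simp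
  show ?case
  proof (intro exI[of _ "C * (2 / m) * (1 + \<bar>t0\<bar>) + 1"] conjI allI impI)
    show "0 < C * (2 / m) * (1 + \<bar>t0\<bar>) + 1" using C m by (auto intro!: add_nonneg_pos)
    fix p :: "real poly" and \<epsilon> :: real and k
    assume deg: "degree p \<le> Suc d" and p: "\<forall>t\<in>T. \<bar>poly p t\<bar> \<le> \<epsilon>"
    define q where "q = synthetic_div p t0"
    have pq: "p = [:- t0, 1:] * q + [:poly p t0:]"
      using synthetic_div_correct'[of t0 p] by (simp add: q_def)
    have dq: "degree q \<le> d" using deg by (simp add: q_def degree_synthetic_div)
    have p0: "\<bar>poly p t0\<bar> \<le> \<epsilon>" using p T by auto
    have q: "\<bar>poly q t\<bar> \<le> (2 / m) * \<epsilon>" if t: "t \<in> T'" for t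
    proof -
      have "poly p t = (t - t0) * poly q t + poly p t0" by (subst pq) (simp add: algebra_simps)
      then have "\<bar>t - t0\<bar> * \<bar>poly q t\<bar> = \<bar>poly p t - poly p t0\<bar>" by (simp add: abs_mult)
      also have "\<dots> \<le> 2 * \<epsilon>"
      proof -
        have "\<bar>poly p t\<bar> \<le> \<epsilon>" using p T t by auto
        then show ?thesis using p0 by linarith
      qed
      finally have "\<bar>t - t0\<bar> * \<bar>poly q t\<bar> \<le> 2 * \<epsilon>" .
      moreover have "m * \<bar>poly q t\<bar> \<le> \<bar>t - t0\<bar> * \<bar>poly q t\<bar>" using m_le[OF t] by (intro mult_right_mono) auto
      ultimately show ?thesis using m by (simp add: field_simps)
    qed
    have cq: "\<bar>coeff q k\<bar> \<le> C * ((2 / m) * \<epsilon>)" for k using C(2)[OF dq] q by blast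
    have "coeff p k = (case k of 0 \<Rightarrow> 0 | Suc j \<Rightarrow> coeff q j) - t0 * coeff q k + (if k = 0 then poly p t0 else 0)"
      by (subst pq) (simp add: coeff_pCons split: nat.splits)
    also have "\<bar>\<dots>\<bar> \<le> C * ((2 / m) * \<epsilon>) + \<bar>t0\<bar> * (C * ((2 / m) * \<epsilon>)) + \<epsilon>"
    proof -
      have e0: "0 \<le> \<epsilon>" using p0 by linarith
      have 1: "\<bar>case k of 0 \<Rightarrow> 0 | Suc j \<Rightarrow> coeff q j\<bar> \<le> C * ((2 / m) * \<epsilon>)"
        using cq C m e0 by (auto split: nat.splits)
      have 2: "\<bar>t0 * coeff q k\<bar> \<le> \<bar>t0\<bar> * (C * ((2 / m) * \<epsilon>))"
        unfolding abs_mult using cq by (intro mult_left_mono) auto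
      have 3: "\<bar>if k = 0 then poly p t0 else 0\<bar> \<le> \<epsilon>" using p0 e0 by auto
      show ?thesis using 1 2 3 by linarith
    qed
    finally show "\<bar>coeff p k\<bar> \<le> (C * (2 / m) * (1 + \<bar>t0\<bar>) + 1) * \<epsilon>" by (simp add: algebra_simps add_divide_distrib)
  qed
qed

text \<open>Which d + 1 of the nodes are good depends on the sample point, so one constant has to
  serve all such subsets. The sum of the individual constants, plus 1, is positive even if there is
  no such subset.\<close>

lemma interpolation_bound_subsets:
  assumes "finite T"
  shows "\<exists>C>0. \<forall>U\<subseteq>T. card U = Suc d \<longrightarrow> (\<forall>p::real poly. \<forall>\<epsilon>. degree p \<le> d \<longrightarrow> (\<forall>t\<in>U. \<bar>poly p t\<bar> \<le> \<epsilon>) \<longrightarrow> (\<forall>k. \<bar>coeff p k\<bar> \<le> C * \<epsilon>))"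
proof -
  let ?\<U> = "{U. U \<subseteq> T \<and> card U = Suc d}"
  define P where "P = (\<lambda>U C. \<forall>p::real poly. \<forall>\<epsilon>. degree p \<le> d \<longrightarrow> (\<forall>t\<in>U. \<bar>poly p t\<bar> \<le> \<epsilon>) \<longrightarrow> (\<forall>k. \<bar>coeff p k\<bar> \<le> C * \<epsilon>))"
  have "\<forall>U\<in>?\<U>. \<exists>C>0. P U C"
    unfolding P_def using interpolation_bound assms by (blast intro: finite_subset)
  then obtain C where C: "\<And>U. U \<in> ?\<U> \<Longrightarrow> C U > 0 \<and> P U (C U)" by metis
  have fin: "finite ?\<U>" using assms by simp
  have le: "C U \<le> 1 + (\<Sum>U\<in>?\<U>. C U)" if "U \<in> ?\<U>" for U
  proof -
    have "C U \<le> (\<Sum>U\<in>?\<U>. C U)" using C fin by (intro member_le_sum[OF that]) (auto intro: less_imp_le)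
    then show ?thesis by simp
  qed
  have "P U (1 + (\<Sum>U\<in>?\<U>. C U))" if U: "U \<in> ?\<U>" for U
    unfolding P_def
  proof (intro allI impI)
    fix p :: "real poly" and \<epsilon> k assume p: "degree p \<le> d" "\<forall>t\<in>U. \<bar>poly p t\<bar> \<le> \<epsilon>"
    have "U \<noteq> {}" using U by auto
    then have "0 \<le> \<epsilon>" using p(2) by (metis abs_ge_zero order_trans all_not_in_conv)
    then have "C U * \<epsilon> \<le> (1 + (\<Sum>U\<in>?\<U>. C U)) * \<epsilon>" using le[OF U] by (intro mult_right_mono) auto
    then show "\<bar>coeff p k\<bar> \<le> (1 + (\<Sum>U\<in>?\<U>. C U)) * \<epsilon>" using C[OF U] p unfolding P_def by (meson order_trans)
  qed
  note Pall = this
  have "0 \<le> (\<Sum>U\<in>?\<U>. C U)" using C by (intro sum_nonneg less_imp_le) blast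
  then show ?thesis using Pall unfolding P_def by (intro exI[of _ "1 + (\<Sum>U\<in>?\<U>. C U)"] conjI allI impI) auto
qed

section \<open>Forms along a line as polynomials\<close>

lemma degree_prod_linear: "finite S \<Longrightarrow> degree (\<Prod>i\<in>S. [:a i, b i:] :: real poly) \<le> card S"
proof (induction S rule: finite_induct)
  case (insert i S)
  have "degree ([:a i, b i:] * (\<Prod>i\<in>S. [:a i, b i:])) \<le> 1 + card S"
    by (rule order_trans[OF degree_mult_le]) (use insert in \<open>auto intro!: add_mono\<close>)
  then show ?case using insert by simp
qed simp

lemma coeff_prod_linear: "finite S \<Longrightarrow> coeff (\<Prod>i\<in>S. [:a i, b i:] :: real poly) (card S) = (\<Prod>i\<in>S. b i)"
proof (induction S rule: finite_induct)
  case (insert i S)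
  have "coeff (\<Prod>i\<in>S. [:a i, b i:]) (Suc (card S)) = 0"
    using degree_prod_linear[OF insert.hyps(1)] by (intro coeff_eq_0) (simp add: le_imp_less_Suc)
  then show ?case using insert by simp
qed simp

definition line_poly :: "nat set \<Rightarrow> (nat set \<Rightarrow> real) \<Rightarrow> (nat \<Rightarrow> real) \<Rightarrow> (nat \<Rightarrow> real) \<Rightarrow> (nat \<Rightarrow> real) \<Rightarrow> (nat \<Rightarrow> real) \<Rightarrow> real poly" where
  "line_poly I c x x' y y' = (\<Sum>S\<in>Pow I. smult (c S) (\<Sum>k\<in>S. [:x' k, y' k:] * (\<Prod>i\<in>S - {k}. [:x i, y i:])))"

lemma poly_line_poly:
  "poly (line_poly I c x x' y y') t = form 0 I c (\<lambda>i. x i + t * y i) (\<lambda>i. x' i + t * y' i)"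
proof -
  have "x' k * P + t * (y' k * P) = (x' k + t * y' k) * P" for k P by (simp add: algebra_simps)
  then show ?thesis by (simp add: line_poly_def form_def mon_def poly_sum poly_prod)
qed

text \<open>With the direction counted as one of the factors, each term of the derivative of a
  monomial of size d is a product of d linear polynomials. The extreme coefficients are therefore
  the values of the form at the two end vectors.\<close>

lemma line_poly_props:
  assumes "finite I" "\<And>S. S \<subseteq> I \<Longrightarrow> card S \<noteq> d \<Longrightarrow> c S = 0"
  shows "degree (line_poly I c x x' y y') \<le> d" "coeff (line_poly I c x x' y y') 0 = form 0 I c x x'"
    "coeff (line_poly I c x x' y y') d = form 0 I c y y'"
proof -
  define q where "q = (\<lambda>S k. [:x' k, y' k:] * (\<Prod>i\<in>S - {k}. [:x i, y i:]))"
  have q: "degree (q S k) \<le> card S \<and> coeff (q S k) (card S) = y' k * (\<Prod>i\<in>S - {k}. y i)" if "S \<subseteq> I" "k \<in> S" for S k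
  proof -
    have fS: "finite S" using that assms finite_subset by auto
    define S' where "S' = S - {k}"
    have S: "card S = Suc (card S')" "finite S'" unfolding S'_def using fS that card_Suc_Diff1[of S k] by auto
    have "coeff (\<Prod>i\<in>S'. [:x i, y i:]) (Suc (card S')) = 0"
      using degree_prod_linear[OF S(2), of x y] by (intro coeff_eq_0) (simp add: le_imp_less_Suc)
    moreover have "degree ([:x' k, y' k:] * (\<Prod>i\<in>S'. [:x i, y i:])) \<le> 1 + card S'"
      by (rule order_trans[OF degree_mult_le]) (use degree_prod_linear[OF S(2), of x y] in \<open>auto intro!: add_mono\<close>)
    ultimately show ?thesis unfolding q_def S'_def[symmetric] S(1)
      by (simp add: coeff_prod_linear[OF S(2)])
  qed
  have eq: "line_poly I c x x' y y' = (\<Sum>S\<in>Pow I. smult (c S) (\<Sum>k\<in>S. q S k))"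
    by (simp add: line_poly_def q_def)
  show "degree (line_poly I c x x' y y') \<le> d"
    unfolding eq
  proof (rule degree_sum_le)
    fix S assume S: "S \<in> Pow I"
    show "degree (smult (c S) (\<Sum>k\<in>S. q S k)) \<le> d"
    proof (cases "card S = d")
      case True
      have "degree (\<Sum>k\<in>S. q S k) \<le> d" using S q True assms(1) by (intro degree_sum_le) (auto intro: finite_subset)
      then show ?thesis by (rule order_trans[OF degree_smult_le])
    qed (use assms S in auto)
  qed (use assms in auto)
  show "coeff (line_poly I c x x' y y') 0 = form 0 I c x x'"
    using poly_line_poly[of I c x x' y y' 0] by (simp add: poly_0_coeff_0)
  show "coeff (line_poly I c x x' y y') d = form 0 I c y y'"
    unfolding eq form_def mon_def coeff_sum coeff_smult
  proof (intro sum.cong refl)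
    fix S assume S: "S \<in> Pow I"
    show "c S * (\<Sum>k\<in>S. coeff (q S k) d) = c S * (0 * (\<Prod>i\<in>S. y i) + (\<Sum>k\<in>S. y' k * (\<Prod>i\<in>S - {k}. y i)))"
      using assms(2)[of S] S q by (cases "card S = d") (auto intro!: sum.cong)
  qed
qed

text \<open>Homogeneity of degree d jointly in point and direction; it clears the denominators
  \<open>sqrt (1 + t\<^sup>2)\<close> of the rotated copies.\<close>

lemma form_scale:
  assumes "finite I" "\<And>S. S \<subseteq> I \<Longrightarrow> card S \<noteq> d \<Longrightarrow> c S = 0"
  shows "form 0 I c (\<lambda>i. r * x i) (\<lambda>i. r * y i) = r ^ d * form 0 I c x y"
  unfolding form_def sum_distrib_left
proof (intro sum.cong refl)
  fix S assume S: "S \<in> Pow I"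
  show "c S * mon 0 (\<lambda>i. r * x i) (\<lambda>i. r * y i) S = r ^ d * (c S * mon 0 x y S)"
  proof (cases "card S = d")
    case True
    have fS: "finite S" using S assms finite_subset by auto
    have *: "(r * y k) * (\<Prod>i\<in>S - {k}. r * x i) = r ^ d * (y k * (\<Prod>i\<in>S - {k}. x i))" if "k \<in> S" for k
    proof -
      have "r ^ d = r * r ^ card (S - {k})" using that fS True by (metis card.remove power_Suc)
      then show ?thesis by (simp add: prod.distrib)
    qed
    have "(\<Sum>k\<in>S. (r * y k) * (\<Prod>i\<in>S - {k}. r * x i)) = (\<Sum>k\<in>S. r ^ d * (y k * (\<Prod>i\<in>S - {k}. x i)))"
      by (intro sum.cong refl *)
    then have "mon 0 (\<lambda>i. r * x i) (\<lambda>i. r * y i) S = r ^ d * mon 0 x y S"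
      by (simp add: mon_def flip: sum_distrib_left)
    then show ?thesis by simp
  qed (use assms S in auto)
qed

section \<open>Gaussian vectors and their rotations\<close>

definition std_gauss :: "real measure" where
  "std_gauss = density lborel std_normal_density"

lemma prob_space_std_gauss: "prob_space std_gauss"
  unfolding std_gauss_def by (rule prob_space_normal_density) simp

lemma sets_std_gauss [simp, measurable_cong]: "sets std_gauss = sets borel"
  by (simp add: std_gauss_def)

lemma space_std_gauss [simp]: "space std_gauss = UNIV"
  by (simp add: std_gauss_def)

lemma std_gauss_moments:
  "integrable std_gauss (\<lambda>x. x ^ k)" "integral\<^sup>L std_gauss (\<lambda>x. x) = 0"
  "integral\<^sup>L std_gauss (\<lambda>x. x\<^sup>2) = 1" "integral\<^sup>L std_gauss (\<lambda>x. x ^ 4) = 3"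
proof -
  show "integrable std_gauss (\<lambda>x. x ^ k)"
    unfolding std_gauss_def by (subst integrable_density) (auto intro: integrable_std_normal_moment)
  show "integral\<^sup>L std_gauss (\<lambda>x. x) = 0"
    unfolding std_gauss_def using integral_std_normal_moment_odd[of 0] by (subst integral_density) auto
  show "integral\<^sup>L std_gauss (\<lambda>x. x\<^sup>2) = 1"
    unfolding std_gauss_def using integral_std_normal_moment_even[of 1] by (subst integral_density) auto
  show "integral\<^sup>L std_gauss (\<lambda>x. x ^ 4) = 3"
    unfolding std_gauss_def using integral_std_normal_moment_even[of 2] by (subst integral_density) (auto simp: fact_numeral)
qed

lemma distr_pair_marginals:
  assumes "prob_space M" "prob_space N"
  shows "distr (M \<Otimes>\<^sub>M N) M fst = M" "distr (M \<Otimes>\<^sub>M N) N snd = N"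
proof -
  interpret M: prob_space M by fact
  interpret N: prob_space N by fact
  interpret P: pair_prob_space M N ..
  show "distr (M \<Otimes>\<^sub>M N) M fst = M"
  proof (rule measure_eqI)
    fix A assume "A \<in> sets (distr (M \<Otimes>\<^sub>M N) M fst)"
    then have A: "A \<in> sets M" by simp
    have "fst -` A \<inter> space (M \<Otimes>\<^sub>M N) = A \<times> space N"
      using sets.sets_into_space[OF A] by (auto simp: space_pair_measure)
    then show "emeasure (distr (M \<Otimes>\<^sub>M N) M fst) A = emeasure M A"
      using A by (simp add: emeasure_distr N.emeasure_pair_measure_Times N.emeasure_space_1)
  qed simp
  show "distr (M \<Otimes>\<^sub>M N) N snd = N"
  proof (rule measure_eqI)
    fix A assume "A \<in> sets (distr (M \<Otimes>\<^sub>M N) N snd)"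
    then have A: "A \<in> sets N" by simp
    have "snd -` A \<inter> space (M \<Otimes>\<^sub>M N) = space M \<times> A"
      using sets.sets_into_space[OF A] by (auto simp: space_pair_measure)
    then show "emeasure (distr (M \<Otimes>\<^sub>M N) N snd) A = emeasure N A"
      using A by (simp add: emeasure_distr N.emeasure_pair_measure_Times M.emeasure_space_1)
  qed simp
qed

lemma indep_var_fst_snd:
  assumes "prob_space M" "prob_space N"
  shows "prob_space.indep_var (M \<Otimes>\<^sub>M N) M fst N snd"
proof -
  interpret M: prob_space M by fact
  interpret N: prob_space N by fact
  interpret P: pair_prob_space M N ..
  show ?thesis
    unfolding P.indep_var_distribution_eq distr_pair_marginals[OF assms] by (simp add: distr_id)
qed

text \<open>The rotation by arctan t, parametrised by the slope t so that the form becomes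
  polynomial in t once the denominator is cleared.\<close>

lemma std_gauss_combination:
  assumes t: "0 < t"
  shows "distr (std_gauss \<Otimes>\<^sub>M std_gauss) std_gauss (\<lambda>z. (fst z + t * snd z) / sqrt (1 + t\<^sup>2)) = std_gauss"
proof -
  let ?N = "std_gauss"
  interpret N: prob_space ?N by (rule prob_space_std_gauss)
  interpret P: pair_prob_space ?N ?N ..
  have [measurable]: "fst \<in> borel_measurable (?N \<Otimes>\<^sub>M ?N)" "snd \<in> borel_measurable (?N \<Otimes>\<^sub>M ?N)"
    using measurable_fst[of ?N ?N] measurable_snd[of ?N ?N] by (simp_all cong: measurable_cong_sets)
  have lb: "distr (?N \<Otimes>\<^sub>M ?N) lborel f = distr (?N \<Otimes>\<^sub>M ?N) ?N f" for f
    by (intro distr_cong) auto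
  have d: "distributed (?N \<Otimes>\<^sub>M ?N) lborel fst std_normal_density" "distributed (?N \<Otimes>\<^sub>M ?N) lborel snd std_normal_density"
    using distr_pair_marginals[OF prob_space_std_gauss prob_space_std_gauss]
    by (simp_all add: distributed_def lb std_gauss_def[symmetric])
  have "P.indep_var borel fst borel snd"
    using indep_var_fst_snd[OF prob_space_std_gauss prob_space_std_gauss]
      P.indep_var_compose[of ?N fst ?N snd "\<lambda>x. x" borel "\<lambda>x. x" borel] by (simp add: comp_def measurable_ident_sets)
  from P.indep_var_compose[OF this, of "\<lambda>x. x" borel "\<lambda>x. t * x" borel]
  have ind: "P.indep_var borel fst borel (\<lambda>z. t * snd z)" by (simp add: comp_def)
  have "distributed (?N \<Otimes>\<^sub>M ?N) lborel (\<lambda>z. 0 + t * snd z) (normal_density (0 + t * 0) (\<bar>t\<bar> * 1))"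
    using t by (intro P.normal_density_affine[OF d(2)]) auto
  then have d2: "distributed (?N \<Otimes>\<^sub>M ?N) lborel (\<lambda>z. t * snd z) (normal_density 0 t)" using t by simp
  have "distributed (?N \<Otimes>\<^sub>M ?N) lborel (\<lambda>z. fst z + t * snd z) (normal_density (0 + 0) (sqrt (1\<^sup>2 + t\<^sup>2)))"
    using t by (intro P.add_indep_normal[OF ind _ _ d(1) d2]) auto
  then have "distributed (?N \<Otimes>\<^sub>M ?N) lborel (\<lambda>z. fst z + t * snd z) (normal_density 0 (sqrt (1 + t\<^sup>2)))" by simp
  then have "distributed (?N \<Otimes>\<^sub>M ?N) lborel (\<lambda>z. (fst z + t * snd z) / sqrt (1 + t\<^sup>2)) std_normal_density"
    using P.normal_standard_normal_convert[of "sqrt (1 + t\<^sup>2)" "\<lambda>z. fst z + t * snd z" 0] by (simp add: add_pos_nonneg)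
  then show ?thesis
    unfolding distributed_def lb std_gauss_def[symmetric] by simp
qed

text \<open>
  Gaussian vectors are stored with the coordinates \<open>x\<^sub>i\<close> and \<open>y\<^sub>i\<close> at the positions \<open>2i\<close> and \<open>2i + 1\<close>; doubling
  the index set once more yields two independent copies.
\<close>

definition dbl :: "nat set \<Rightarrow> nat set" where
  "dbl I = (\<lambda>i. 2 * i) ` I \<union> (\<lambda>i. 2 * i + 1) ` I"

lemma dbl_simps [simp]: "2 * i \<in> dbl I \<longleftrightarrow> i \<in> I" "Suc (2 * i) \<in> dbl I \<longleftrightarrow> i \<in> I"
  "finite I \<Longrightarrow> finite (dbl I)" "dbl I = {} \<longleftrightarrow> I = {}"
proof -
  have odd: "2 * i \<noteq> Suc (2 * j)" for i j :: nat by presburger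
  show "2 * i \<in> dbl I \<longleftrightarrow> i \<in> I" "Suc (2 * i) \<in> dbl I \<longleftrightarrow> i \<in> I"
    using odd odd[symmetric] by (auto simp: dbl_def image_iff)
qed (auto simp: dbl_def)

text \<open>The pairs at positions 2i and 2i + 1 are disjoint, so functions of them are again
  independent. The same lemma serves to regroup coordinates into blocks and to combine two
  independent copies of a vector.\<close>

lemma distr_PiM_pairs:
  assumes I: "finite I" "I \<noteq> {}" and N: "prob_space N" and f: "f \<in> measurable (N \<Otimes>\<^sub>M N) R"
  shows "distr (PiM (dbl I) (\<lambda>_. N)) (PiM I (\<lambda>_. R)) (\<lambda>x. \<lambda>i\<in>I. f (x (2 * i), x (Suc (2 * i)))) =
    PiM I (\<lambda>_. distr (N \<Otimes>\<^sub>M N) R f)"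
proof -
  let ?P = "PiM (dbl I) (\<lambda>_. N)"
  interpret P: prob_space ?P using N by (intro prob_space_PiM) auto
  define K where "K = (\<lambda>i::nat. {2 * i, Suc (2 * i)})"
  have coords: "P.indep_vars (\<lambda>_. N) (\<lambda>i \<omega>. \<omega> i) (dbl I)"
    using N by (intro indep_vars_PiM_coordinates) auto
  have KI: "K i \<subseteq> dbl I" if "i \<in> I" for i using that by (auto simp: K_def)
  have "disjoint_family_on K I" unfolding disjoint_family_on_def K_def by auto
  from P.indep_vars_restrict[OF coords KI this]
  have 1: "P.indep_vars (\<lambda>i. PiM (K i) (\<lambda>_. N)) (\<lambda>i \<omega>. restrict \<omega> (K i)) I" by simp
  have "(\<lambda>r. f (r (2 * i), r (Suc (2 * i)))) \<in> measurable (PiM (K i) (\<lambda>_. N)) R" for i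
  proof -
    have "2 * i \<in> K i" "Suc (2 * i) \<in> K i" by (auto simp: K_def)
    then have "(\<lambda>r. (r (2 * i), r (Suc (2 * i)))) \<in> measurable (PiM (K i) (\<lambda>_. N)) (N \<Otimes>\<^sub>M N)" by measurable
    from measurable_compose[OF this f] show ?thesis .
  qed
  from P.indep_vars_compose2[OF 1 this]
  have "P.indep_vars (\<lambda>_. R) (\<lambda>i x. f (x (2 * i), x (Suc (2 * i)))) I" by (simp add: K_def)
  moreover have m: "(\<lambda>x. (x (2 * i), x (Suc (2 * i)))) \<in> measurable ?P (N \<Otimes>\<^sub>M N)" if "i \<in> I" for i
    using that by (intro measurable_Pair measurable_component_singleton) auto
  ultimately have "distr ?P (PiM I (\<lambda>_. R)) (\<lambda>x. \<lambda>i\<in>I. f (x (2 * i), x (Suc (2 * i)))) =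
      PiM I (\<lambda>i. distr ?P R (\<lambda>x. f (x (2 * i), x (Suc (2 * i)))))"
    using I measurable_compose[OF m f] by (subst (asm) P.indep_vars_iff_distr_eq_PiM') auto
  also have "\<dots> = PiM I (\<lambda>_. distr (N \<Otimes>\<^sub>M N) R f)"
  proof (rule PiM_cong)
    fix i assume i: "i \<in> I"
    have "P.indep_var (PiM {2 * i} (\<lambda>_. N)) (\<lambda>\<omega>. restrict \<omega> {2 * i}) (PiM {Suc (2 * i)} (\<lambda>_. N)) (\<lambda>\<omega>. restrict \<omega> {Suc (2 * i)})"
      using P.indep_var_restrict[OF coords, of "{2 * i}" "{Suc (2 * i)}"] i by auto
    from P.indep_var_compose[OF this, of "\<lambda>r. r (2 * i)" N "\<lambda>r. r (Suc (2 * i))" N]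
    have "P.indep_var N (\<lambda>\<omega>. \<omega> (2 * i)) N (\<lambda>\<omega>. \<omega> (Suc (2 * i)))" by (simp add: comp_def)
    then have "distr ?P (N \<Otimes>\<^sub>M N) (\<lambda>x. (x (2 * i), x (Suc (2 * i)))) = N \<Otimes>\<^sub>M N"
      using distr_PiM_component[of "dbl I" "\<lambda>_. N" "2 * i"] distr_PiM_component[of "dbl I" "\<lambda>_. N" "Suc (2 * i)"] N i
      by (simp add: P.indep_var_distribution_eq)
    then show "distr ?P R (\<lambda>x. f (x (2 * i), x (Suc (2 * i)))) = distr (N \<Otimes>\<^sub>M N) R f"
      using distr_distr[OF f m[OF i]] by (simp add: comp_def)
  qed simp
  finally show ?thesis .
qed

abbreviation gauss_space :: "nat set \<Rightarrow> (nat \<Rightarrow> real) measure" where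
  "gauss_space J \<equiv> PiM J (\<lambda>_. std_gauss)"

definition dform :: "nat set \<Rightarrow> (nat set \<Rightarrow> real) \<Rightarrow> (nat \<Rightarrow> real) \<Rightarrow> real" where
  "dform I c x = form 0 I c (\<lambda>i. x (2 * i)) (\<lambda>i. x (Suc (2 * i)))"

definition small_ball :: "nat set \<Rightarrow> (nat set \<Rightarrow> real) \<Rightarrow> real \<Rightarrow> real" where
  "small_ball I c \<delta> = measure (gauss_space (dbl I)) {x \<in> space (gauss_space (dbl I)). \<bar>dform I c x\<bar> \<le> \<delta>}"

lemma dform_measurable [measurable]: "dform I c \<in> borel_measurable (gauss_space (dbl I))"
  unfolding dform_def
proof (intro borel_measurable_form)
  fix i assume "i \<in> I"
  then have "2 * i \<in> dbl I" "Suc (2 * i) \<in> dbl I" by auto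
  then show "(\<lambda>x. x (2 * i)) \<in> borel_measurable (gauss_space (dbl I))"
    "(\<lambda>x. x (Suc (2 * i))) \<in> borel_measurable (gauss_space (dbl I))" by measurable
qed

text \<open>Any map of pairs that preserves the Gaussian law gives a vector with the original law.
  It is applied to the rotations and to the two projections, all on one space.\<close>

lemma small_ball_law:
  assumes I: "finite I" "I \<noteq> {}" and f: "f \<in> measurable (std_gauss \<Otimes>\<^sub>M std_gauss) std_gauss"
    and law: "distr (std_gauss \<Otimes>\<^sub>M std_gauss) std_gauss f = std_gauss"
  defines "J \<equiv> dbl (dbl I)"
  shows "(\<lambda>x. dform I c (\<lambda>j. f (x (2 * j), x (Suc (2 * j))))) \<in> borel_measurable (gauss_space J)"
    "measure (gauss_space J) {x \<in> space (gauss_space J). \<bar>dform I c (\<lambda>j. f (x (2 * j), x (Suc (2 * j))))\<bar> \<le> \<delta>} = small_ball I c \<delta>"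
proof -
  let ?Z = "\<lambda>x. \<lambda>j\<in>dbl I. f (x (2 * j), x (Suc (2 * j)))"
  have "(\<lambda>x. f (x (2 * j), x (Suc (2 * j)))) \<in> measurable (gauss_space J) std_gauss" if "j \<in> dbl I" for j
  proof -
    have "2 * j \<in> J" "Suc (2 * j) \<in> J" using that by (auto simp: J_def)
    then have "(\<lambda>x. (x (2 * j), x (Suc (2 * j)))) \<in> measurable (gauss_space J) (std_gauss \<Otimes>\<^sub>M std_gauss)" by measurable
    from measurable_compose[OF this f] show ?thesis .
  qed
  then have Z: "?Z \<in> measurable (gauss_space J) (gauss_space (dbl I))"
    by (intro measurable_restrict) auto
  have d: "distr (gauss_space J) (gauss_space (dbl I)) ?Z = gauss_space (dbl I)"
    unfolding J_def using distr_PiM_pairs[of "dbl I" std_gauss f std_gauss] I f law prob_space_std_gauss by simp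
  have eq: "dform I c (?Z x) = dform I c (\<lambda>j. f (x (2 * j), x (Suc (2 * j))))" for x
    unfolding dform_def by (rule form_cong) auto
  show "(\<lambda>x. dform I c (\<lambda>j. f (x (2 * j), x (Suc (2 * j))))) \<in> borel_measurable (gauss_space J)"
    using measurable_compose[OF Z dform_measurable[of I c]] by (simp only: eq)
  have "small_ball I c \<delta> = measure (distr (gauss_space J) (gauss_space (dbl I)) ?Z) {x \<in> space (gauss_space (dbl I)). \<bar>dform I c x\<bar> \<le> \<delta>}"
    unfolding small_ball_def d ..
  also have "\<dots> = measure (gauss_space J) (?Z -` {x \<in> space (gauss_space (dbl I)). \<bar>dform I c x\<bar> \<le> \<delta>} \<inter> space (gauss_space J))"
    by (rule measure_distr[OF Z]) measurable
  also have "?Z -` {x \<in> space (gauss_space (dbl I)). \<bar>dform I c x\<bar> \<le> \<delta>} \<inter> space (gauss_space J) =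
      {x \<in> space (gauss_space J). \<bar>dform I c (\<lambda>j. f (x (2 * j), x (Suc (2 * j))))\<bar> \<le> \<delta>}"
    using measurable_space[OF Z] eq by auto
  finally show "measure (gauss_space J) {x \<in> space (gauss_space J). \<bar>dform I c (\<lambda>j. f (x (2 * j), x (Suc (2 * j))))\<bar> \<le> \<delta>} = small_ball I c \<delta>" ..
qed

text \<open>
  For \<open>m\<close> values of \<open>t\<close> the rotated copies \<open>(G + t G') / sqrt (1 + t\<^sup>2)\<close> all have the same law as \<open>G\<close>. If the form is
  small at more than \<open>d\<close> of them, interpolation bounds the constant and the leading coefficient in \<open>t\<close>, which
  are the values of the form at \<open>G\<close> and at \<open>G'\<close>.
\<close>

lemma small_ball_recursion:
  assumes "0 < A" "0 < m"
  shows "\<exists>\<delta>>0. \<forall>I c. finite I \<longrightarrow> I \<noteq> {} \<longrightarrow> (\<forall>S\<subseteq>I. card S \<noteq> d \<longrightarrow> c S = 0) \<longrightarrow>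
    small_ball I c \<delta> \<le> real d / real m + (small_ball I c A)\<^sup>2"
proof -
  define T where "T = real ` {1..m}"
  have fT: "finite T" and cT: "card T = m" by (auto simp: T_def card_image)
  obtain C where C: "C > 0" and C2: "\<forall>U\<subseteq>T. card U = Suc d \<longrightarrow> (\<forall>p::real poly. \<forall>\<epsilon>. degree p \<le> d \<longrightarrow>
      (\<forall>t\<in>U. \<bar>poly p t\<bar> \<le> \<epsilon>) \<longrightarrow> (\<forall>k. \<bar>coeff p k\<bar> \<le> C * \<epsilon>))"
    using interpolation_bound_subsets[OF fT, of d] by (elim exE conjE) (rule that)
  \<comment> \<open>Bounds the factor by which the values of the polynomial exceed those of the
    rotated form, for all slopes up to m.\<close>
  define B where "B = sqrt (1 + (real m)\<^sup>2) ^ d"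
  have B: "0 < B" by (auto simp: B_def intro!: zero_less_power real_sqrt_gt_zero add_pos_nonneg)
  \<comment> \<open>Chosen so that interpolation of values of size B \<delta> returns coefficients
    of size exactly A.\<close>
  define \<delta> where "\<delta> = A / (C * B)"
  have \<delta>: "0 < \<delta>" "C * (B * \<delta>) = A" using assms B C by (auto simp: \<delta>_def)
  show ?thesis
  proof (intro exI[of _ \<delta>] conjI allI impI)
    show "0 < \<delta>" by fact
    fix I :: "nat set" and c :: "nat set \<Rightarrow> real"
    assume I: "finite I" "I \<noteq> {}" and hom: "\<forall>S\<subseteq>I. card S \<noteq> d \<longrightarrow> c S = 0"
    define J where "J = dbl (dbl I)"
    let ?P = "gauss_space J"
    interpret P: prob_space ?P using prob_space_std_gauss by (intro prob_space_PiM) auto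
    define k where "k = (\<lambda>t::real. \<lambda>z. (fst z + t * snd z) / sqrt (1 + t\<^sup>2))"
    have k_meas: "k t \<in> measurable (std_gauss \<Otimes>\<^sub>M std_gauss) std_gauss" for t
      unfolding k_def by measurable
    define D where "D = (\<lambda>f (x :: nat \<Rightarrow> real). dform I c (\<lambda>j. f (x (2 * j), x (Suc (2 * j)))))"
    define E where "E = (\<lambda>t. {x \<in> space ?P. \<bar>D (k t) x\<bar> \<le> \<delta>})"
    define both where "both = {x \<in> space ?P. \<bar>D fst x\<bar> \<le> A \<and> \<bar>D snd x\<bar> \<le> A}"
    have D_meas[measurable]: "D (k t) \<in> borel_measurable ?P" "D fst \<in> borel_measurable ?P" "D snd \<in> borel_measurable ?P"
      if "0 < t" for t
      unfolding D_def J_def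
      using small_ball_law(1)[OF I k_meas[of t], of c] std_gauss_combination[OF that]
        small_ball_law(1)[OF I _ distr_pair_marginals(1)[OF prob_space_std_gauss prob_space_std_gauss], of c]
        small_ball_law(1)[OF I _ distr_pair_marginals(2)[OF prob_space_std_gauss prob_space_std_gauss], of c]
      by (simp_all add: k_def)
    have E_meas[measurable]: "E t \<in> P.events" if "0 < t" for t unfolding E_def using D_meas[OF that] by measurable
    have both_meas[measurable]: "both \<in> P.events" unfolding both_def using D_meas[of 1] by measurable
    have PE: "P.prob (E t) = small_ball I c \<delta>" if "0 < t" for t
      unfolding E_def D_def J_def using std_gauss_combination[OF that]
      by (intro small_ball_law(2) I k_meas) (simp add: k_def)
    have Pboth: "P.prob both = (small_ball I c A)\<^sup>2"
    proof -
      \<comment> \<open>The two copies occupy the even and the odd positions of J, which are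
        disjoint; this turns the probability of the joint event into a square.\<close>
      define ev where "ev = (\<lambda>j. 2 * j) ` dbl I"
      define od where "od = (\<lambda>j. Suc (2 * j)) ` dbl I"
      have sub: "ev \<subseteq> J" "od \<subseteq> J" "ev \<inter> od = {}" by (auto simp: ev_def od_def J_def) presburger
      have coords: "P.indep_vars (\<lambda>_. std_gauss) (\<lambda>i \<omega>. \<omega> i) J"
        using prob_space_std_gauss by (intro indep_vars_PiM_coordinates) auto
      have "D fst \<in> borel_measurable (gauss_space ev)" "D snd \<in> borel_measurable (gauss_space od)"
        unfolding D_def dform_def fst_conv snd_conv
      proof (safe intro!: borel_measurable_form)
        fix i assume "i \<in> I"
        then have x: "2 * i \<in> dbl I" "Suc (2 * i) \<in> dbl I" by simp_all
        have m: "2 * (2 * i) \<in> ev" "2 * Suc (2 * i) \<in> ev" "Suc (2 * (2 * i)) \<in> od" "Suc (2 * Suc (2 * i)) \<in> od"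
          unfolding ev_def od_def by ((rule imageI, rule x)+)
        have comp: "(\<lambda>x. x j) \<in> borel_measurable (gauss_space L)" if "j \<in> L" for j and L :: "nat set" using that by measurable
        show "(\<lambda>x. x (2 * (2 * i))) \<in> borel_measurable (gauss_space ev)" "(\<lambda>x. x (2 * Suc (2 * i))) \<in> borel_measurable (gauss_space ev)"
          "(\<lambda>x. x (Suc (2 * (2 * i)))) \<in> borel_measurable (gauss_space od)" "(\<lambda>x. x (Suc (2 * Suc (2 * i)))) \<in> borel_measurable (gauss_space od)"
          using comp m by blast+
      qed
      from P.indep_var_compose[OF P.indep_var_restrict[OF coords sub(3,1,2)] this]
      have "P.indep_var borel (\<lambda>x. D fst (restrict x ev)) borel (\<lambda>x. D snd (restrict x od))" by (simp add: comp_def)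
      moreover have "D fst (restrict x ev) = D fst x" "D snd (restrict x od) = D snd x" for x
      proof -
        have r: "restrict x ev (2 * j) = x (2 * j)" "restrict x od (Suc (2 * j)) = x (Suc (2 * j))" if "j \<in> dbl I" for j
          using that by (auto simp: ev_def od_def)
        have "2 * i \<in> dbl I" "Suc (2 * i) \<in> dbl I" if "i \<in> I" for i using that by simp_all
        note r' = r(1)[OF this(1)] r(1)[OF this(2)] r(2)[OF this(1)] r(2)[OF this(2)]
        show "D fst (restrict x ev) = D fst x" "D snd (restrict x od) = D snd x"
          unfolding D_def dform_def fst_conv snd_conv by (rule form_cong, rule refl, erule r', erule r')+
      qed
      ultimately have "P.indep_var borel (D fst) borel (D snd)" by simp
      then have "P.prob {x \<in> space ?P. D fst x \<in> {-A..A} \<and> D snd x \<in> {-A..A}} =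
          P.prob {x \<in> space ?P. D fst x \<in> {-A..A}} * P.prob {x \<in> space ?P. D snd x \<in> {-A..A}}"
        by (intro P.prob_indep_random_variable) auto
      moreover have iv: "r \<in> {-A..A} \<longleftrightarrow> \<bar>r\<bar> \<le> A" for r by auto
      moreover have "P.prob {x \<in> space ?P. \<bar>D fst x\<bar> \<le> A} = small_ball I c A" "P.prob {x \<in> space ?P. \<bar>D snd x\<bar> \<le> A} = small_ball I c A"
        unfolding D_def J_def using distr_pair_marginals[OF prob_space_std_gauss prob_space_std_gauss]
        by (intro small_ball_law(2) I; simp)+
      ultimately show ?thesis unfolding iv both_def power2_eq_square by (simp only:)
    qed
    \<comment> \<open>Pointwise dichotomy: either at most d of the m events occur, or more than d
      occur and then x lies in \<open>both\<close>, where the trivial count m is used.\<close>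
    have count: "(\<Sum>t\<in>T. indicator (E t) x) \<le> real d + real m * indicator both x" if x: "x \<in> space ?P" for x
    proof -
      define U where "U = {t \<in> T. x \<in> E t}"
      have fU: "finite U" "card U \<le> m" using fT cT card_mono[of T U] by (auto simp: U_def)
      have "(\<Sum>t\<in>T. indicator (E t) x) = (\<Sum>t\<in>U. 1::real)"
        unfolding U_def using fT by (intro sum.mono_neutral_cong_right) (auto simp: indicator_def)
      then have cU: "(\<Sum>t\<in>T. indicator (E t) x) = real (card U)" by simp
      show ?thesis
      proof (cases "card U \<le> d")
        case True
        then show ?thesis unfolding cU by (simp add: indicator_def)
      next
        case False
        then obtain U' where U': "U' \<subseteq> U" "card U' = Suc d" by (metis not_less_eq_eq obtain_subset_with_card_n)
        define p where "p = line_poly I c (\<lambda>i. x (2 * (2 * i))) (\<lambda>i. x (2 * Suc (2 * i))) (\<lambda>i. x (Suc (2 * (2 * i)))) (\<lambda>i. x (Suc (2 * Suc (2 * i))))"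
        have hom': "\<And>S. S \<subseteq> I \<Longrightarrow> card S \<noteq> d \<Longrightarrow> c S = 0" using hom by blast
        have lp: "degree p \<le> d" unfolding p_def by (intro line_poly_props(1) I(1) hom')
        have lp0: "coeff p 0 = D fst x" "coeff p d = D snd x"
          unfolding p_def D_def dform_def fst_conv snd_conv
          using hom by (simp_all add: line_poly_props(2)[OF I(1), of d] line_poly_props(3)[OF I(1), of d])
        have "\<bar>poly p t\<bar> \<le> B * \<delta>" if t: "t \<in> U'" for t
        proof -
          have tT: "0 < t" "t \<le> real m" "\<bar>D (k t) x\<bar> \<le> \<delta>" using t U' by (auto simp: U_def T_def E_def)
          define s where "s = sqrt (1 + t\<^sup>2)"
          have s: "0 < s" unfolding s_def by (intro real_sqrt_gt_zero add_pos_nonneg) auto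
          have k': "k t z = (1 / s) * (fst z + t * snd z)" for z by (simp add: k_def s_def)
          have "D (k t) x = (1 / s) ^ d * poly p t"
            unfolding D_def dform_def k' p_def poly_line_poly fst_conv snd_conv by (intro form_scale I(1) hom')
          then have "poly p t = s ^ d * D (k t) x" using s by (simp add: power_one_over)
          then have "\<bar>poly p t\<bar> = s ^ d * \<bar>D (k t) x\<bar>" using s by (simp add: abs_mult)
          also have "\<dots> \<le> B * \<delta>"
            unfolding B_def using tT s \<delta> by (intro mult_mono power_mono) (auto simp: s_def)
          finally show ?thesis .
        qed
        moreover have "U' \<subseteq> T" using U' by (auto simp: U_def)
        ultimately have "\<bar>coeff p j\<bar> \<le> C * (B * \<delta>)" for j
          using U'(2) lp C2[rule_format, of U' p "B * \<delta>" j] by blast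
        then have "x \<in> both" using lp0 x unfolding both_def \<delta>(2) by (metis (no_types, lifting) mem_Collect_eq)
        then show ?thesis unfolding cU using fU by simp
      qed
    qed
    have Tpos: "0 < t" if "t \<in> T" for t using that by (auto simp: T_def)
    have Ei: "integrable ?P (indicat_real (E t))" "P.expectation (indicat_real (E t)) = P.prob (E t)" if "t \<in> T" for t
      using E_meas[OF Tpos[OF that]] sets.sets_into_space[OF E_meas[OF Tpos[OF that]]]
      by (auto simp: P.emeasure_eq_measure Int_absorb2)
    have bi: "integrable ?P (indicat_real both)" "P.expectation (indicat_real both) = P.prob both"
      using both_meas sets.sets_into_space[OF both_meas] by (auto simp: P.emeasure_eq_measure Int_absorb2)
    \<comment> \<open>All the events have the same probability, so integrating the count and
      dividing by m gives the recursion.\<close>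
    have "real m * small_ball I c \<delta> = (\<Sum>t\<in>T. P.prob (E t))"
    proof -
      have "(\<Sum>t\<in>T. P.prob (E t)) = (\<Sum>t\<in>T. small_ball I c \<delta>)" by (intro sum.cong refl PE) (auto simp: T_def)
      then show ?thesis using cT by simp
    qed
    also have "\<dots> = P.expectation (\<lambda>x. \<Sum>t\<in>T. indicator (E t) x)"
      using Ei by (subst Bochner_Integration.integral_sum) auto
    also have "\<dots> \<le> P.expectation (\<lambda>x. real d + real m * indicator both x)"
      using count Ei bi(1) by (intro integral_mono) (auto intro!: Bochner_Integration.integrable_sum)
    also have "\<dots> = real d + real m * (small_ball I c A)\<^sup>2"
      using Pboth bi by (simp add: P.prob_space)
    finally show "small_ball I c \<delta> \<le> real d / real m + (small_ball I c A)\<^sup>2"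
      using assms(2) by (simp add: field_simps)
  qed
qed

section \<open>Gaussian pairs and the starting bound\<close>

abbreviation gauss2 :: "(real \<times> real) measure" where
  "gauss2 \<equiv> std_gauss \<Otimes>\<^sub>M std_gauss"

lemma prob_space_pair: "prob_space M \<Longrightarrow> prob_space N \<Longrightarrow> prob_space (M \<Otimes>\<^sub>M N)"
proof -
  assume "prob_space M" "prob_space N"
  then interpret M: prob_space M + N: prob_space N by simp_all
  interpret pair_prob_space M N ..
  show ?thesis by (rule prob_space_axioms)
qed

lemma pair_marginal_integral:
  fixes f :: "'a \<Rightarrow> real" and g :: "'b \<Rightarrow> real"
  assumes "prob_space M" "prob_space N"
  shows "f \<in> borel_measurable M \<Longrightarrow> integral\<^sup>L (M \<Otimes>\<^sub>M N) (\<lambda>z. f (fst z)) = integral\<^sup>L M f"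
    "f \<in> borel_measurable M \<Longrightarrow> integrable (M \<Otimes>\<^sub>M N) (\<lambda>z. f (fst z)) \<longleftrightarrow> integrable M f"
    "g \<in> borel_measurable N \<Longrightarrow> integral\<^sup>L (M \<Otimes>\<^sub>M N) (\<lambda>z. g (snd z)) = integral\<^sup>L N g"
    "g \<in> borel_measurable N \<Longrightarrow> integrable (M \<Otimes>\<^sub>M N) (\<lambda>z. g (snd z)) \<longleftrightarrow> integrable N g"
  using integral_distr[OF measurable_fst[of M N], of f] integrable_distr_eq[OF measurable_fst[of M N], of f]
    integral_distr[OF measurable_snd[of M N], of g] integrable_distr_eq[OF measurable_snd[of M N], of g]
  unfolding distr_pair_marginals[OF assms] by auto

lemma gauss2_moments:
  "integrable gauss2 (\<lambda>z. fst z ^ k)" "integrable gauss2 (\<lambda>z. snd z ^ k)"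
  "integral\<^sup>L gauss2 fst = 0" "integral\<^sup>L gauss2 snd = 0"
  "integral\<^sup>L gauss2 (\<lambda>z. (fst z)\<^sup>2) = 1" "integral\<^sup>L gauss2 (\<lambda>z. (snd z)\<^sup>2) = 1"
  "integral\<^sup>L gauss2 (\<lambda>z. fst z ^ 4) = 3" "integral\<^sup>L gauss2 (\<lambda>z. snd z ^ 4) = 3"
  "integral\<^sup>L gauss2 (\<lambda>z. fst z * snd z) = 0"
proof -
  note p = prob_space_std_gauss prob_space_std_gauss
  interpret P: prob_space gauss2 by (rule prob_space_pair[OF p])
  show 1: "integrable gauss2 (\<lambda>z. fst z ^ k)" "integrable gauss2 (\<lambda>z. snd z ^ k)" for k
    using pair_marginal_integral(2,4)[OF p, of "\<lambda>x. x ^ k"] std_gauss_moments(1)[of k] by auto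
  show 2: "integral\<^sup>L gauss2 fst = 0" "integral\<^sup>L gauss2 snd = 0"
    "integral\<^sup>L gauss2 (\<lambda>z. (fst z)\<^sup>2) = 1" "integral\<^sup>L gauss2 (\<lambda>z. (snd z)\<^sup>2) = 1"
    "integral\<^sup>L gauss2 (\<lambda>z. fst z ^ 4) = 3" "integral\<^sup>L gauss2 (\<lambda>z. snd z ^ 4) = 3"
    using pair_marginal_integral(1,3)[OF p, of "\<lambda>x. x"] pair_marginal_integral(1,3)[OF p, of "\<lambda>x. x\<^sup>2"]
      pair_marginal_integral(1,3)[OF p, of "\<lambda>x. x ^ 4"] std_gauss_moments(2-4) by auto
  have "P.indep_var borel fst borel snd"
    using indep_var_fst_snd[OF p] P.indep_var_compose[of std_gauss fst std_gauss snd "\<lambda>x. x" borel "\<lambda>x. x" borel]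
    by (simp add: comp_def measurable_ident_sets)
  then show "integral\<^sup>L gauss2 (\<lambda>z. fst z * snd z) = 0"
    using P.indep_var_lebesgue_integral[of fst snd] 1[of 1] 2 by simp
qed

abbreviation gauss_blocks :: "nat set \<Rightarrow> (nat \<Rightarrow> real \<times> real) measure" where
  "gauss_blocks I \<equiv> PiM I (\<lambda>_. gauss2)"

text \<open>Translates between two encodings of a Gaussian vector: alternating positions, convenient
  for rotations, and pairs, to which the moment bounds for independent blocks apply.\<close>

lemma small_ball_blocks:
  assumes "finite I" "I \<noteq> {}"
  shows "measure (gauss_blocks I) {\<omega> \<in> space (gauss_blocks I). \<bar>form 0 I c (\<lambda>i. fst (\<omega> i)) (\<lambda>i. snd (\<omega> i))\<bar> \<le> \<delta>} = small_ball I c \<delta>"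
proof -
  let ?Z = "\<lambda>x. \<lambda>i\<in>I. (x (2 * i), x (Suc (2 * i)))"
  let ?G = "gauss_space (dbl I)"
  let ?F = "\<lambda>\<omega>. form 0 I c (\<lambda>i. fst (\<omega> i)) (\<lambda>i. snd (\<omega> i))"
  have d: "distr ?G (gauss_blocks I) ?Z = gauss_blocks I"
    using distr_PiM_pairs[OF assms prob_space_std_gauss, of "\<lambda>z. z" gauss2] by (simp add: distr_id)
  have Z: "?Z \<in> measurable ?G (gauss_blocks I)"
    by (intro measurable_restrict measurable_Pair measurable_component_singleton) auto
  have F[measurable]: "?F \<in> borel_measurable (gauss_blocks I)"
  proof (rule borel_measurable_form)
    fix i assume "i \<in> I"
    then have "(\<lambda>\<omega>. \<omega> i) \<in> measurable (gauss_blocks I) gauss2" by (rule measurable_component_singleton)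
    from measurable_compose[OF this measurable_fst] measurable_compose[OF this measurable_snd]
    show "(\<lambda>\<omega>. fst (\<omega> i)) \<in> borel_measurable (gauss_blocks I)" "(\<lambda>\<omega>. snd (\<omega> i)) \<in> borel_measurable (gauss_blocks I)"
      by (simp_all cong: measurable_cong_sets)
  qed
  have eq: "?F (?Z x) = dform I c x" for x
    unfolding dform_def by (rule form_cong) auto
  have "measure (gauss_blocks I) {\<omega> \<in> space (gauss_blocks I). \<bar>?F \<omega>\<bar> \<le> \<delta>} =
      measure (distr ?G (gauss_blocks I) ?Z) {\<omega> \<in> space (gauss_blocks I). \<bar>?F \<omega>\<bar> \<le> \<delta>}"
    unfolding d ..
  also have "\<dots> = measure ?G (?Z -` {\<omega> \<in> space (gauss_blocks I). \<bar>?F \<omega>\<bar> \<le> \<delta>} \<inter> space ?G)"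
    by (rule measure_distr[OF Z]) measurable
  also have "?Z -` {\<omega> \<in> space (gauss_blocks I). \<bar>?F \<omega>\<bar> \<le> \<delta>} \<inter> space ?G = {x \<in> space ?G. \<bar>dform I c x\<bar> \<le> \<delta>}"
    using measurable_space[OF Z] eq by auto
  finally show ?thesis by (simp add: small_ball_def)
qed

text \<open>Points with |D| \<le> 1/2 contribute at most 1/4 to the second moment, so at least 3/4
  comes from the complement. Cauchy-Schwarz against the indicator of the complement then gives
  (3/4)^2 \<le> C times its probability.\<close>

lemma (in prob_space) paley_zygmund:
  assumes D: "L4 D" and v: "1 \<le> expectation (\<lambda>\<omega>. (D \<omega>)\<^sup>2)" and C: "expectation (\<lambda>\<omega>. (D \<omega>) ^ 4) \<le> C"
  shows "0 < C" "prob {\<omega> \<in> space M. \<bar>D \<omega>\<bar> \<le> 1 / 2} \<le> 1 - 9 / (16 * C)"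
proof -
  have mD[measurable]: "D \<in> borel_measurable M" using D by (simp add: L4_def)
  define E where "E = {\<omega> \<in> space M. \<bar>D \<omega>\<bar> \<le> 1 / 2}"
  have E[measurable]: "E \<in> events" unfolding E_def by measurable
  let ?i = "indicat_real (space M - E)"
  have ii: "integrable M ?i" "expectation ?i = prob (space M - E)"
    by (auto simp: emeasure_eq_measure Int_absorb1)
  have isq: "(\<lambda>\<omega>. (?i \<omega>)\<^sup>2) = ?i" by (auto simp: indicator_def)
  have L2: "L2 (\<lambda>\<omega>. (D \<omega>)\<^sup>2)" "L2 ?i" using D ii(1) unfolding L4_square L2_def isq by auto
  have iD: "integrable M (\<lambda>\<omega>. (D \<omega>)\<^sup>2)" using L2_integrable[OF L2(1)] .
  have "1 \<le> expectation (\<lambda>\<omega>. (D \<omega>)\<^sup>2)" by fact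
  also have "\<dots> \<le> expectation (\<lambda>\<omega>. 1 / 4 + (D \<omega>)\<^sup>2 * ?i \<omega>)"
  proof (rule integral_mono)
    fix \<omega> assume w: "\<omega> \<in> space M"
    show "(D \<omega>)\<^sup>2 \<le> 1 / 4 + (D \<omega>)\<^sup>2 * ?i \<omega>"
    proof (cases "\<omega> \<in> E")
      case True
      then have "\<bar>D \<omega>\<bar>\<^sup>2 \<le> (1 / 2)\<^sup>2" unfolding E_def by (intro power_mono) auto
      then show ?thesis using True by (simp add: power2_eq_square)
    qed (use w in \<open>simp add: indicator_def\<close>)
  qed (use iD L2_integrable_mult[OF L2] in auto)
  also have "\<dots> = 1 / 4 + expectation (\<lambda>\<omega>. (D \<omega>)\<^sup>2 * ?i \<omega>)"
    using L2_integrable_mult[OF L2] by (simp add: prob_space)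
  finally have "3 / 4 \<le> expectation (\<lambda>\<omega>. (D \<omega>)\<^sup>2 * ?i \<omega>)" by simp
  then have "(3 / 4)\<^sup>2 \<le> (expectation (\<lambda>\<omega>. (D \<omega>)\<^sup>2 * ?i \<omega>))\<^sup>2" by (intro power_mono) auto
  also have "\<dots> \<le> expectation (\<lambda>\<omega>. ((D \<omega>)\<^sup>2)\<^sup>2) * expectation (\<lambda>\<omega>. (?i \<omega>)\<^sup>2)"
    using L2 by (intro Cauchy_Schwarz_expectation) (auto simp: L2_def)
  also note isq
  also have "expectation (\<lambda>\<omega>. ((D \<omega>)\<^sup>2)\<^sup>2) * expectation ?i \<le> C * prob (space M - E)"
    using C ii by (intro mult_mono) (auto intro: order_trans[OF _ C])
  finally have *: "9 / 16 \<le> C * prob (space M - E)" by (simp add: power2_eq_square)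
  have "C * prob (space M - E) \<le> 0" if "C \<le> 0" using that by (simp add: mult_nonpos_nonneg)
  with * show C0: "0 < C" by fastforce
  show "prob {\<omega> \<in> space M. \<bar>D \<omega>\<bar> \<le> 1 / 2} \<le> 1 - 9 / (16 * C)"
  proof -
    have "9 / (16 * C) \<le> prob (space M - E)" using * C0 by (simp add: field_simps)
    moreover have "prob (space M - E) = 1 - prob E" by (rule prob_compl) simp
    ultimately show ?thesis unfolding E_def by simp
  qed
qed

definition unit_form :: "nat \<Rightarrow> nat set \<Rightarrow> (nat set \<Rightarrow> real) \<Rightarrow> bool" where
  "unit_form d I c \<longleftrightarrow> finite I \<and> I \<noteq> {} \<and> (\<forall>S\<subseteq>I. card S \<noteq> d \<longrightarrow> c S = 0) \<and> coef_norm I c = 1"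

lemma deg_le_if_homogeneous: "\<forall>S\<subseteq>I. card S \<noteq> d \<longrightarrow> c S = 0 \<Longrightarrow> deg_le d I c"
  by (auto simp: deg_le_def)

text \<open>The second moment of the Gaussian derivative is d times the coefficient norm, hence at
  least 1, and (256 * 3)^d is the fourth-moment bound with the Gaussian value 3. Only a level below
  1 is obtained, which is all that the recursion needs.\<close>

lemma small_ball_start:
  assumes "1 \<le> d"
  shows "\<exists>\<rho><1. \<forall>I c. unit_form d I c \<longrightarrow> small_ball I c (1 / 2) \<le> \<rho>"
proof (intro exI[of _ "1 - 9 / (16 * (256 * 3) ^ d)"] conjI allI impI)
  show "1 - 9 / (16 * (256 * 3) ^ d) < (1::real)" by simp
  fix I :: "nat set" and c
  assume "unit_form d I c"
  then have I: "finite I" "I \<noteq> {}" and hom: "\<forall>S\<subseteq>I. card S \<noteq> d \<longrightarrow> c S = 0" and n: "coef_norm I c = 1"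
    unfolding unit_form_def by simp_all
  note p2 = prob_space_pair[OF prob_space_std_gauss prob_space_std_gauss]
  interpret B: indep_blocks "gauss_blocks I" "coord_algebra I (\<lambda>_. gauss2)" I
    using I p2 by (intro indep_blocks_PiM) auto
  have m: "fst \<in> borel_measurable gauss2" "snd \<in> borel_measurable gauss2"
    using measurable_fst[of std_gauss std_gauss] measurable_snd[of std_gauss std_gauss] by (simp_all cong: measurable_cong_sets)
  let ?X = "\<lambda>i \<omega>. fst ((\<omega> :: nat \<Rightarrow> real \<times> real) i)" and ?Y = "\<lambda>i \<omega>. snd ((\<omega> :: nat \<Rightarrow> real \<times> real) i)"
  have rv: "B.block_rv i (?X i)" "B.block_rv i (?Y i)" "B.L4 (?X i)" "B.L4 (?Y i)" if "i \<in> I" for i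
    using that I p2 m gauss2_moments
    by (auto intro!: coordinate_block_rv[where S = "\<lambda>_. gauss2"] coordinate_L4[where S = "\<lambda>_. gauss2"])
  have mom: "B.expectation (\<lambda>\<omega>. (?X i \<omega>)\<^sup>2) = 1" "B.expectation (\<lambda>\<omega>. (?Y i \<omega>)\<^sup>2) = 1"
    "B.expectation (\<lambda>\<omega>. ?X i \<omega> * ?Y i \<omega>) = 0"
    "B.expectation (\<lambda>\<omega>. (?X i \<omega>) ^ 4) \<le> 3" "B.expectation (\<lambda>\<omega>. (?Y i \<omega>) ^ 4) \<le> 3" if i: "i \<in> I" for i
  proof -
    have law: "B.expectation (\<lambda>\<omega>. f (\<omega> i)) = integral\<^sup>L gauss2 f" if "f \<in> borel_measurable gauss2" for f :: "real \<times> real \<Rightarrow> real"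
      using PiM_coordinate_law(1)[of I "\<lambda>_. gauss2" i f] i p2 that by simp
    show "B.expectation (\<lambda>\<omega>. (?X i \<omega>)\<^sup>2) = 1" "B.expectation (\<lambda>\<omega>. (?Y i \<omega>)\<^sup>2) = 1"
      "B.expectation (\<lambda>\<omega>. ?X i \<omega> * ?Y i \<omega>) = 0"
      "B.expectation (\<lambda>\<omega>. (?X i \<omega>) ^ 4) \<le> 3" "B.expectation (\<lambda>\<omega>. (?Y i \<omega>) ^ 4) \<le> 3"
      using law[of "\<lambda>z. (fst z)\<^sup>2"] law[of "\<lambda>z. (snd z)\<^sup>2"] law[of "\<lambda>z. fst z * snd z"] law[of "\<lambda>z. fst z ^ 4"] law[of "\<lambda>z. snd z ^ 4"]
        gauss2_moments m by auto
  qed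
  let ?D = "\<lambda>\<omega>. form 0 I c (\<lambda>i. ?X i \<omega>) (\<lambda>i. ?Y i \<omega>)"
  have "B.expectation (\<lambda>\<omega>. (?D \<omega>)\<^sup>2) = (\<Sum>S\<in>Pow I. (c S)\<^sup>2 * (0\<^sup>2 + 1 * real (card S)))"
    using B.form_second_moment[OF subset_refl rv(1,2) mom(1,2,3), of 0 c] by simp
  also have "\<dots> \<ge> (\<Sum>S\<in>Pow I. (c S)\<^sup>2)"
  proof (intro sum_mono)
    fix S assume "S \<in> Pow I"
    then show "(c S)\<^sup>2 \<le> (c S)\<^sup>2 * (0\<^sup>2 + 1 * real (card S))"
      using hom assms mult_left_mono[of 1 "real d" "(c S)\<^sup>2"] by (cases "card S = d") auto
  qed
  finally have E2: "1 \<le> B.expectation (\<lambda>\<omega>. (?D \<omega>)\<^sup>2)" using n by (simp add: coef_norm_def)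
  have E4: "B.L4 ?D" "B.expectation (\<lambda>\<omega>. (?D \<omega>) ^ 4) \<le> (256 * 3) ^ d"
    using B.form_fourth_moment[OF subset_refl rv mom(4,5), of 0 d c] deg_le_if_homogeneous[OF hom] n by auto
  show "small_ball I c (1 / 2) \<le> 1 - 9 / (16 * (256 * 3) ^ d)"
    using B.paley_zygmund(2)[OF E4(1) E2 E4(2)] unfolding small_ball_blocks[OF I] .
qed

text \<open>Consider all levels that some radius guarantees for every normalised form at once. Their
  infimum l is below 1 by the starting bound and satisfies l \<le> l^2 by the recursion; these two
  facts force l = 0. No rate in \<delta> is needed.\<close>

lemma small_ball_uniform:
  assumes d: "1 \<le> d" and \<eta>: "0 < \<eta>"
  shows "\<exists>\<delta>>0. \<forall>I c. unit_form d I c \<longrightarrow> small_ball I c \<delta> \<le> \<eta>"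
proof -
  define R where "R = {r. 0 \<le> r \<and> (\<exists>\<delta>>0. \<forall>I c. unit_form d I c \<longrightarrow> small_ball I c \<delta> \<le> r)}"
  obtain \<rho> where \<rho>: "\<rho> < 1" "\<And>I c. unit_form d I c \<Longrightarrow> small_ball I c (1 / 2) \<le> \<rho>"
    using small_ball_start[OF d] by (elim exE conjE) (rule that, auto)
  have R0: "max \<rho> 0 \<in> R" unfolding R_def using \<rho>(2)
    by (auto intro!: exI[of _ "1 / 2"] simp: le_max_iff_disj)
  have bdd: "bdd_below R" by (auto simp: R_def bdd_below_def)
  have mono: "r' \<in> R" if "r \<in> R" "r \<le> r'" for r r' using that unfolding R_def by (auto intro: order_trans)
  \<comment> \<open>The recursion with m so large that d / m \<le> \<epsilon>: level r at radius A
    yields level r^2 + \<epsilon> at another positive radius, still uniform over forms.\<close>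
  have step: "r\<^sup>2 + \<epsilon> \<in> R" if r: "r \<in> R" and \<epsilon>: "0 < \<epsilon>" for r \<epsilon>
  proof -
    obtain A where A: "A > 0" "\<And>I c. unit_form d I c \<Longrightarrow> small_ball I c A \<le> r" and r0: "0 \<le> r" using r unfolding R_def by blast
    obtain m where m: "real d / \<epsilon> < real m" using reals_Archimedean2 by blast
    have "0 \<le> real d / \<epsilon>" using \<epsilon> by simp
    then have m0: "0 < m" using m by linarith
    obtain \<delta> where \<delta>: "\<delta> > 0" "\<forall>I c. finite I \<longrightarrow> I \<noteq> {} \<longrightarrow> (\<forall>S\<subseteq>I. card S \<noteq> d \<longrightarrow> c S = 0) \<longrightarrow>
        small_ball I c \<delta> \<le> real d / real m + (small_ball I c A)\<^sup>2"
      using small_ball_recursion[OF A(1) m0, of d] by (elim exE conjE) (rule that)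
    have "small_ball I c \<delta> \<le> r\<^sup>2 + \<epsilon>" if "unit_form d I c" for I c
    proof -
      have "small_ball I c \<delta> \<le> real d / real m + (small_ball I c A)\<^sup>2" using \<delta>(2)[rule_format, of I c] that unfolding unit_form_def by simp
      also have "(small_ball I c A)\<^sup>2 \<le> r\<^sup>2" using A(2)[OF that] by (intro power_mono) (auto simp: small_ball_def)
      also have "real d / real m \<le> \<epsilon>" using m m0 \<epsilon> by (simp add: field_simps)
      finally show ?thesis by simp
    qed
    then show ?thesis using \<delta>(1) \<epsilon> unfolding R_def by (auto intro!: exI[of _ \<delta>])
  qed
  define l where "l = Inf R"
  have l_le: "l \<le> r" if "r \<in> R" for r unfolding l_def using bdd that by (rule cInf_lower[rotated])
  have l0: "0 \<le> l"
  proof -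
    have "R \<noteq> {}" using R0 by blast
    then show ?thesis unfolding l_def by (rule cInf_greatest) (simp add: R_def)
  qed
  have l1: "l < 1" using l_le[OF R0] \<rho>(1) by simp
  have near: "\<exists>r\<in>R. r < l + \<epsilon>" if "0 < \<epsilon>" for \<epsilon>
    using cInf_lessD[of R "l + \<epsilon>"] R0 that unfolding l_def by auto
  \<comment> \<open>A level within \<epsilon> / 8 of the infimum has a square exceeding l^2 by at
    most 3 \<epsilon> / 8; together with \<epsilon> / 2 from the recursion this stays below
    \<epsilon>.\<close>
  have "l \<le> l\<^sup>2"
  proof (rule field_le_epsilon)
    fix \<epsilon> :: real assume e: "0 < \<epsilon>"
    define \<epsilon>' where "\<epsilon>' = min 1 (\<epsilon> / 8)"
    have e': "0 < \<epsilon>'" "\<epsilon>' \<le> 1" "\<epsilon>' \<le> \<epsilon> / 8" using e by (auto simp: \<epsilon>'_def)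
    obtain r where r: "r \<in> R" "r < l + \<epsilon>'" using near e'(1) by blast
    have "l \<le> r\<^sup>2 + \<epsilon> / 2" using step[OF r(1), of "\<epsilon> / 2"] e l_le by auto
    also have "r\<^sup>2 \<le> (l + \<epsilon>')\<^sup>2" using r unfolding R_def by (intro power_mono) auto
    also have "(l + \<epsilon>')\<^sup>2 = l\<^sup>2 + \<epsilon>' * (2 * l + \<epsilon>')" by (simp add: power2_eq_square algebra_simps)
    also have "\<epsilon>' * (2 * l + \<epsilon>') \<le> \<epsilon> / 8 * 3" using l0 l1 e' e by (intro mult_mono) auto
    finally show "l \<le> l\<^sup>2 + \<epsilon>" using e by simp
  qed
  then have "l * (1 - l) \<le> 0" by (simp add: power2_eq_square algebra_simps)
  then have "l = 0" using l0 l1 by (simp add: mult_le_0_iff)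
  then obtain r where "r \<in> R" "r < \<eta>" using near[OF \<eta>] by auto
  then have "\<eta> \<in> R" using mono by simp
  then show ?thesis unfolding R_def by simp
qed

subsection \<open>Smoothing by moving averages\<close>

definition antideriv :: "(real \<Rightarrow> real) \<Rightarrow> real \<Rightarrow> real" where
  "antideriv h = (SOME H. \<forall>x. (H has_real_derivative h x) (at x))"

text \<open>The mean of h over [x, x + t]. Written with a primitive it can be differentiated at
  once; the choice of the primitive cancels in the difference.\<close>

definition avg :: "real \<Rightarrow> (real \<Rightarrow> real) \<Rightarrow> real \<Rightarrow> real" where
  "avg t h x = (antideriv h (x + t) - antideriv h x) / t"

lemma antideriv:
  assumes "continuous_on UNIV h"
  shows "(antideriv h has_real_derivative h x) (at x)"
proof -
  have "\<exists>H. \<forall>x. - \<infinity> < ereal x \<longrightarrow> ereal x < \<infinity> \<longrightarrow> (H has_vector_derivative h x) (at x)"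
    using assms by (intro einterval_antiderivative) (auto simp: continuous_on_eq_continuous_at)
  then have "\<exists>H. \<forall>x. (H has_real_derivative h x) (at x)" by (simp add: has_real_derivative_iff_has_vector_derivative)
  from someI_ex[OF this] show ?thesis unfolding antideriv_def by blast
qed

definition unit_cont :: "(real \<Rightarrow> real) \<Rightarrow> bool" where
  "unit_cont h \<longleftrightarrow> continuous_on UNIV h \<and> (\<forall>x. 0 \<le> h x \<and> h x \<le> 1)"

lemma avg_value:
  assumes "continuous_on UNIV h" "0 < t"
  shows "\<exists>\<xi>. x < \<xi> \<and> \<xi> < x + t \<and> avg t h x = h \<xi>"
  using MVT2[of x "x + t" "antideriv h" h] antideriv[OF assms(1)] assms(2) by (auto simp: avg_def)

lemma avg_deriv:
  assumes "continuous_on UNIV h"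
  shows "(avg t h has_real_derivative (h (x + t) - h x) / t) (at x)"
proof -
  have "((\<lambda>x. antideriv h (x + t)) has_real_derivative h (x + t)) (at x)"
    using antideriv[OF assms, of "x + t"] by (simp add: DERIV_shift)
  then show ?thesis unfolding avg_def[abs_def] using antideriv[OF assms, of x]
    by (intro DERIV_cdivide DERIV_diff) auto
qed

lemma continuous_on_if_DERIV: "(\<And>x. (f has_real_derivative f' x) (at x)) \<Longrightarrow> continuous_on UNIV f"
  by (intro continuous_at_imp_continuous_on) (blast intro: DERIV_isCont)

lemma unit_cont_avg:
  assumes "unit_cont h" "0 < t"
  shows "unit_cont (avg t h)"
  unfolding unit_cont_def
proof
  have c: "continuous_on UNIV h" using assms by (simp add: unit_cont_def)
  show "continuous_on UNIV (avg t h)" by (rule continuous_on_if_DERIV[OF avg_deriv[OF c]])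
  show "\<forall>x. 0 \<le> avg t h x \<and> avg t h x \<le> 1"
    using avg_value[OF c assms(2)] assms(1) unfolding unit_cont_def by metis
qed

text \<open>For a primitive H of h, the function H - avg t H is a primitive of h - avg t h. It
  compares H at two points less than t apart, and H is 1-Lipschitz because h has values in [0, 1].
  That the bound ignores the oscillation of h makes the smoothing error uniform over all test
  functions.\<close>

lemma avg_defect_primitive:
  assumes h: "unit_cont h" and t: "0 < t"
  shows "\<exists>\<phi>. (\<forall>x. (\<phi> has_real_derivative h x - avg t h x) (at x)) \<and> (\<forall>x. \<bar>\<phi> x\<bar> \<le> t)"
proof -
  let ?H = "antideriv h"
  have c: "continuous_on UNIV h" using h by (simp add: unit_cont_def)
  have cH: "continuous_on UNIV ?H" by (rule continuous_on_if_DERIV[OF antideriv[OF c]])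
  have "((\<lambda>x. ?H x - avg t ?H x) has_real_derivative h x - avg t h x) (at x)" for x
    using antideriv[OF c, of x] avg_deriv[OF cH, of t x] unfolding avg_def[of t h x] by (intro DERIV_diff)
  moreover have "\<bar>?H x - avg t ?H x\<bar> \<le> t" for x
  proof -
    obtain \<xi> where \<xi>: "x < \<xi>" "\<xi> < x + t" "avg t ?H x = ?H \<xi>" using avg_value[OF cH t] by blast
    obtain z where z: "?H \<xi> - ?H x = (\<xi> - x) * h z" using MVT2[OF \<xi>(1), of ?H h] antideriv[OF c] by blast
    have "\<bar>(\<xi> - x) * h z\<bar> \<le> t * 1" unfolding abs_mult
      using \<xi> h by (intro mult_mono) (auto simp: unit_cont_def)
    then show ?thesis using z \<xi>(3) by linarith
  qed
  ultimately show ?thesis by (intro exI[of _ "\<lambda>x. ?H x - avg t ?H x"]) auto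
qed

text \<open>Every averaging turns a derivative into a difference quotient. Values in [0, 1] bound
  first differences by 1 and second differences by 2, and one average is Lipschitz with constant 1 /
  t, so the second difference is Lipschitz with constant 4 / t before the division by t^2.\<close>

lemma smooth3_avg:
  assumes h: "unit_cont h" and t: "0 < t"
  shows "smooth3 (1 / t) (2 / t\<^sup>2) (4 / t ^ 3) (avg t (avg t (avg t h)))"
proof -
  define h1 where "h1 = avg t h"
  define h2 where "h2 = avg t h1"
  have u: "unit_cont h" "unit_cont h1" "unit_cont h2" "unit_cont (avg t h2)"
    unfolding h1_def h2_def using h t by (auto intro!: unit_cont_avg)
  then have c: "continuous_on UNIV h" "continuous_on UNIV h1" "continuous_on UNIV h2" by (auto simp: unit_cont_def)
  have b: "0 \<le> h x" "h x \<le> 1" "0 \<le> h1 x" "h1 x \<le> 1" "0 \<le> h2 x" "h2 x \<le> 1" "0 \<le> avg t h2 x" "avg t h2 x \<le> 1" for x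
    using u by (auto simp: unit_cont_def)
  let ?p1 = "\<lambda>x. (h2 (x + t) - h2 x) / t"
  let ?p2 = "\<lambda>x. ((h1 (x + t + t) - h1 (x + t)) / t - (h1 (x + t) - h1 x) / t) / t"
  have d2: "((\<lambda>x. h2 (x + t)) has_real_derivative (h1 (x + t + t) - h1 (x + t)) / t) (at x)" for x
    using avg_deriv[OF c(2), of t "x + t"] unfolding h2_def by (simp add: DERIV_shift)
  have p2: "(?p1 has_real_derivative ?p2 x) (at x)" for x
    using d2[of x] avg_deriv[OF c(2), of t x] unfolding h2_def by (intro DERIV_cdivide DERIV_diff) auto
  have lip: "\<bar>h1 x - h1 y\<bar> \<le> (1 / t) * \<bar>x - y\<bar>" for x y
  proof -
    have "norm (h1 x - h1 y) \<le> (1 / t) * norm (x - y)"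
    proof (rule field_differentiable_bound[of UNIV h1 "\<lambda>x. (h (x + t) - h x) / t"])
      fix z :: real
      show "(h1 has_field_derivative (h (z + t) - h z) / t) (at z within UNIV)" unfolding h1_def using avg_deriv[OF c(1)] by simp
      have "\<bar>h (z + t) - h z\<bar> \<le> 1" using b(1,2)[of z] b(1,2)[of "z + t"] by linarith
      then show "norm ((h (z + t) - h z) / t) \<le> 1 / t" using t by (simp add: divide_right_mono)
    qed auto
    then show ?thesis by simp
  qed
  have "\<bar>?p1 x\<bar> \<le> 1 / t" for x
  proof -
    have "\<bar>h2 (x + t) - h2 x\<bar> \<le> 1" using b(5,6)[of x] b(5,6)[of "x + t"] by linarith
    then show ?thesis using t by (simp add: divide_right_mono)
  qed
  moreover have p2eq: "?p2 x = (h1 (x + t + t) - 2 * h1 (x + t) + h1 x) / t\<^sup>2" for x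
    using t by (simp add: field_simps power2_eq_square)
  moreover have "\<bar>(h1 (x + t + t) - 2 * h1 (x + t) + h1 x) / t\<^sup>2\<bar> \<le> 2 / t\<^sup>2" for x
  proof -
    have "\<bar>h1 (x + t + t) - 2 * h1 (x + t) + h1 x\<bar> \<le> 2" using b(3,4)[of x] b(3,4)[of "x + t"] b(3,4)[of "x + t + t"] by linarith
    then show ?thesis by (simp add: divide_right_mono)
  qed
  moreover have "\<bar>(h1 (x + t + t) - 2 * h1 (x + t) + h1 x) / t\<^sup>2 - (h1 (y + t + t) - 2 * h1 (y + t) + h1 y) / t\<^sup>2\<bar> \<le> 4 / t ^ 3 * \<bar>x - y\<bar>" for x y
  proof -
    have "\<bar>(h1 (x + t + t) - 2 * h1 (x + t) + h1 x) - (h1 (y + t + t) - 2 * h1 (y + t) + h1 y)\<bar> \<le> 4 * ((1 / t) * \<bar>x - y\<bar>)"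
      using lip[of x y] lip[of "x + t" "y + t"] lip[of "x + t + t" "y + t + t"] by simp
    then have "\<bar>(h1 (x + t + t) - 2 * h1 (x + t) + h1 x) - (h1 (y + t + t) - 2 * h1 (y + t) + h1 y)\<bar> / t\<^sup>2 \<le> 4 * ((1 / t) * \<bar>x - y\<bar>) / t\<^sup>2"
      by (intro divide_right_mono) auto
    also have "\<dots> = 4 / t ^ 3 * \<bar>x - y\<bar>" by (simp add: power2_eq_square power3_eq_cube)
    finally show ?thesis by (simp add: diff_divide_distrib[symmetric])
  qed
  moreover have "\<bar>avg t h2 x\<bar> \<le> 1" for x using b(7,8)[of x] by simp
  ultimately show ?thesis
    unfolding smooth3_def h1_def[symmetric] h2_def[symmetric]
    using avg_deriv[OF c(3), of t] p2 by (intro exI[of _ ?p1] exI[of _ ?p2]) (simp only: p2eq, blast)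
qed

section \<open>Differentiation and growth of forms along a curve\<close>

lemma form_has_derivative:
  assumes "finite I" "\<And>i. i \<in> I \<Longrightarrow> (X i has_real_derivative Y i \<theta>) (at \<theta>)"
  shows "((\<lambda>\<theta>. form 1 I c (\<lambda>i. X i \<theta>) (\<lambda>_. 0)) has_real_derivative form 0 I c (\<lambda>i. X i \<theta>) (\<lambda>i. Y i \<theta>)) (at \<theta>)"
  using assms
proof (induction I arbitrary: c rule: finite_induct)
  case (insert i I)
  have "((\<lambda>\<theta>. form 1 I c (\<lambda>i. X i \<theta>) (\<lambda>_. 0) + X i \<theta> * form 1 I (link i c) (\<lambda>i. X i \<theta>) (\<lambda>_. 0)) has_real_derivative
     form 0 I c (\<lambda>i. X i \<theta>) (\<lambda>i. Y i \<theta>) + (Y i \<theta> * form 1 I (link i c) (\<lambda>i. X i \<theta>) (\<lambda>_. 0) +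
       form 0 I (link i c) (\<lambda>i. X i \<theta>) (\<lambda>i. Y i \<theta>) * X i \<theta>)) (at \<theta>)"
    using insert by (intro DERIV_add DERIV_mult) auto
  then show ?case using insert.hyps by (simp add: form_insert algebra_simps)
qed simp

lemma form_has_second_derivative:
  assumes "finite I" "\<And>i. i \<in> I \<Longrightarrow> (X i has_real_derivative Y i \<theta>) (at \<theta>)" "\<And>i. i \<in> I \<Longrightarrow> (Y i has_real_derivative Z i \<theta>) (at \<theta>)"
  shows "((\<lambda>\<theta>. form 0 I c (\<lambda>i. X i \<theta>) (\<lambda>i. Y i \<theta>)) has_real_derivative form2 I c (\<lambda>i. X i \<theta>) (\<lambda>i. Y i \<theta>) (\<lambda>i. Z i \<theta>)) (at \<theta>)"
  using assms
proof (induction I arbitrary: c rule: finite_induct)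
  case (insert i I)
  have "((\<lambda>\<theta>. form 0 I c (\<lambda>i. X i \<theta>) (\<lambda>i. Y i \<theta>) + X i \<theta> * form 0 I (link i c) (\<lambda>i. X i \<theta>) (\<lambda>i. Y i \<theta>) +
      Y i \<theta> * form 1 I (link i c) (\<lambda>i. X i \<theta>) (\<lambda>_. 0)) has_real_derivative
     form2 I c (\<lambda>i. X i \<theta>) (\<lambda>i. Y i \<theta>) (\<lambda>i. Z i \<theta>) + (Y i \<theta> * form 0 I (link i c) (\<lambda>i. X i \<theta>) (\<lambda>i. Y i \<theta>) +
       form2 I (link i c) (\<lambda>i. X i \<theta>) (\<lambda>i. Y i \<theta>) (\<lambda>i. Z i \<theta>) * X i \<theta>) +
     (Z i \<theta> * form 1 I (link i c) (\<lambda>i. X i \<theta>) (\<lambda>_. 0) + form 0 I (link i c) (\<lambda>i. X i \<theta>) (\<lambda>i. Y i \<theta>) * Y i \<theta>)) (at \<theta>)"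
    using insert by (intro DERIV_add DERIV_mult form_has_derivative) auto
  then show ?case using insert.hyps by (simp add: form_insert form2_insert algebra_simps)
qed simp

text \<open>A deterministic envelope in product form: by independence it is integrable as soon as
  each factor is. It serves only to dominate, so the size of K is immaterial.\<close>

lemma form_growth:
  assumes "finite I"
  shows "\<exists>K\<ge>0. \<forall>x y \<rho>. (\<forall>i\<in>I. \<bar>x i\<bar> \<le> \<rho> i \<and> \<bar>y i\<bar> \<le> \<rho> i) \<longrightarrow> \<bar>form b I c x y\<bar> \<le> K * (\<Prod>i\<in>I. 1 + \<rho> i)"
  using assms
proof (induction I arbitrary: b c rule: finite_induct)
  case empty
  show ?case by (rule exI[of _ "\<bar>c {} * b\<bar>"]) simp
next
  case (insert i I)
  obtain K1 where K1: "K1 \<ge> 0" "\<And>x y \<rho>. (\<forall>i\<in>I. \<bar>x i\<bar> \<le> \<rho> i \<and> \<bar>y i\<bar> \<le> \<rho> i) \<Longrightarrow> \<bar>form b I c x y\<bar> \<le> K1 * (\<Prod>i\<in>I. 1 + \<rho> i)"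
    using insert.IH[of b c] by auto
  obtain K2 where K2: "K2 \<ge> 0" "\<And>x y \<rho>. (\<forall>i\<in>I. \<bar>x i\<bar> \<le> \<rho> i \<and> \<bar>y i\<bar> \<le> \<rho> i) \<Longrightarrow> \<bar>form b I (link i c) x y\<bar> \<le> K2 * (\<Prod>i\<in>I. 1 + \<rho> i)"
    using insert.IH[of b "link i c"] by auto
  obtain K3 where K3: "K3 \<ge> 0" "\<And>x y \<rho>. (\<forall>i\<in>I. \<bar>x i\<bar> \<le> \<rho> i \<and> \<bar>y i\<bar> \<le> \<rho> i) \<Longrightarrow> \<bar>form 1 I (link i c) x y\<bar> \<le> K3 * (\<Prod>i\<in>I. 1 + \<rho> i)"
    using insert.IH[of 1 "link i c"] by auto
  show ?case
  proof (intro exI[of _ "K1 + K2 + K3"] conjI allI impI)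
    fix x y \<rho> :: "nat \<Rightarrow> real" assume h: "\<forall>j\<in>insert i I. \<bar>x j\<bar> \<le> \<rho> j \<and> \<bar>y j\<bar> \<le> \<rho> j"
    have \<rho>0: "0 \<le> \<rho> j" if "j \<in> insert i I" for j using h that by (auto intro: order_trans[OF abs_ge_zero])
    define P where "P = (\<Prod>i\<in>I. 1 + \<rho> i)"
    have P: "0 \<le> P" unfolding P_def using \<rho>0 by (intro prod_nonneg) (auto intro: add_nonneg_nonneg)
    have 1: "\<bar>form b I c x y\<bar> \<le> K1 * P" and 2: "\<bar>form b I (link i c) x y\<bar> \<le> K2 * P" and 3: "\<bar>form 1 I (link i c) x (\<lambda>_. 0)\<bar> \<le> K3 * P"
      unfolding P_def using h \<rho>0 by (auto intro!: K1(2) K2(2) K3(2))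
    have "\<bar>form b (insert i I) c x y\<bar> \<le> \<bar>form b I c x y\<bar> + \<bar>x i\<bar> * \<bar>form b I (link i c) x y\<bar> + \<bar>y i\<bar> * \<bar>form 1 I (link i c) x (\<lambda>_. 0)\<bar>"
      using insert.hyps by (simp add: form_insert flip: abs_mult)
    also have "\<dots> \<le> K1 * P + (1 + \<rho> i) * (K2 * P) + (1 + \<rho> i) * (K3 * P)"
      using h \<rho>0 1 2 3 K2(1) K3(1) P by (intro add_mono mult_mono) (auto intro: order_trans[of _ "\<rho> i"])
    also have "K1 * P \<le> (1 + \<rho> i) * (K1 * P)"
      using mult_right_mono[of 1 "1 + \<rho> i" "K1 * P"] \<rho>0 K1(1) P by simp
    finally show "\<bar>form b (insert i I) c x y\<bar> \<le> (K1 + K2 + K3) * (\<Prod>i\<in>insert i I. 1 + \<rho> i)"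
      using insert.hyps by (simp add: P_def algebra_simps)
  qed (use K1 K2 K3 in auto)
qed

lemma form2_growth:
  assumes "finite I"
  shows "\<exists>K\<ge>0. \<forall>x y z \<rho>. (\<forall>i\<in>I. \<bar>x i\<bar> \<le> \<rho> i \<and> \<bar>y i\<bar> \<le> \<rho> i \<and> \<bar>z i\<bar> \<le> \<rho> i) \<longrightarrow> \<bar>form2 I c x y z\<bar> \<le> K * (\<Prod>i\<in>I. 1 + \<rho> i)"
  using assms
proof (induction I arbitrary: c rule: finite_induct)
  case empty
  show ?case by (rule exI[of _ 0]) simp
next
  case (insert i I)
  obtain K1 where K1: "K1 \<ge> 0" "\<And>x y z \<rho>. (\<forall>i\<in>I. \<bar>x i\<bar> \<le> \<rho> i \<and> \<bar>y i\<bar> \<le> \<rho> i \<and> \<bar>z i\<bar> \<le> \<rho> i) \<Longrightarrow> \<bar>form2 I c x y z\<bar> \<le> K1 * (\<Prod>i\<in>I. 1 + \<rho> i)"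
    using insert.IH[of c] by auto
  obtain K2 where K2: "K2 \<ge> 0" "\<And>x y z \<rho>. (\<forall>i\<in>I. \<bar>x i\<bar> \<le> \<rho> i \<and> \<bar>y i\<bar> \<le> \<rho> i \<and> \<bar>z i\<bar> \<le> \<rho> i) \<Longrightarrow> \<bar>form2 I (link i c) x y z\<bar> \<le> K2 * (\<Prod>i\<in>I. 1 + \<rho> i)"
    using insert.IH[of "link i c"] by auto
  obtain K3 where K3: "K3 \<ge> 0" "\<And>x y \<rho>. (\<forall>i\<in>I. \<bar>x i\<bar> \<le> \<rho> i \<and> \<bar>y i\<bar> \<le> \<rho> i) \<Longrightarrow> \<bar>form 0 I (link i c) x y\<bar> \<le> K3 * (\<Prod>i\<in>I. 1 + \<rho> i)"
    using form_growth[OF insert.hyps(1), of 0 "link i c"] by auto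
  obtain K4 where K4: "K4 \<ge> 0" "\<And>x y \<rho>. (\<forall>i\<in>I. \<bar>x i\<bar> \<le> \<rho> i \<and> \<bar>y i\<bar> \<le> \<rho> i) \<Longrightarrow> \<bar>form 1 I (link i c) x y\<bar> \<le> K4 * (\<Prod>i\<in>I. 1 + \<rho> i)"
    using form_growth[OF insert.hyps(1), of 1 "link i c"] by auto
  show ?case
  proof (intro exI[of _ "K1 + K2 + 2 * K3 + K4"] conjI allI impI)
    fix x y z \<rho> :: "nat \<Rightarrow> real" assume h: "\<forall>j\<in>insert i I. \<bar>x j\<bar> \<le> \<rho> j \<and> \<bar>y j\<bar> \<le> \<rho> j \<and> \<bar>z j\<bar> \<le> \<rho> j"
    have \<rho>0: "0 \<le> \<rho> j" if "j \<in> insert i I" for j using h that by (auto intro: order_trans[OF abs_ge_zero])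
    define P where "P = (\<Prod>i\<in>I. 1 + \<rho> i)"
    have P: "0 \<le> P" unfolding P_def using \<rho>0 by (intro prod_nonneg) (auto intro: add_nonneg_nonneg)
    have 1: "\<bar>form2 I c x y z\<bar> \<le> K1 * P" and 2: "\<bar>form2 I (link i c) x y z\<bar> \<le> K2 * P"
      and 3: "\<bar>form 0 I (link i c) x y\<bar> \<le> K3 * P" and 4: "\<bar>form 1 I (link i c) x (\<lambda>_. 0)\<bar> \<le> K4 * P"
      unfolding P_def using h \<rho>0 by (auto intro!: K1(2) K2(2) K3(2) K4(2))
    have "\<bar>form2 (insert i I) c x y z\<bar> \<le> \<bar>form2 I c x y z\<bar> + \<bar>x i\<bar> * \<bar>form2 I (link i c) x y z\<bar> +
        2 * (\<bar>y i\<bar> * \<bar>form 0 I (link i c) x y\<bar>) + \<bar>z i\<bar> * \<bar>form 1 I (link i c) x (\<lambda>_. 0)\<bar>"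
      using insert.hyps unfolding form2_insert[OF insert.hyps] abs_mult[symmetric] by linarith
    also have "\<dots> \<le> K1 * P + (1 + \<rho> i) * (K2 * P) + 2 * ((1 + \<rho> i) * (K3 * P)) + (1 + \<rho> i) * (K4 * P)"
      using h \<rho>0 1 2 3 4 K2(1) K3(1) K4(1) P by (intro add_mono mult_mono) (auto intro: order_trans[of _ "\<rho> i"])
    also have "K1 * P \<le> (1 + \<rho> i) * (K1 * P)"
      using mult_right_mono[of 1 "1 + \<rho> i" "K1 * P"] \<rho>0 K1(1) P by simp
    finally show "\<bar>form2 (insert i I) c x y z\<bar> \<le> (K1 + K2 + 2 * K3 + K4) * (\<Prod>i\<in>insert i I. 1 + \<rho> i)"
      using insert.hyps by (simp add: P_def algebra_simps)
  qed (use K1 K2 K3 K4 in auto)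
qed

lemma form_smult_right: "form 0 I c x (\<lambda>i. k * y i) = k * form 0 I c x y"
  by (simp add: form_def mon_def sum_distrib_left mult_ac)

lemma form2_scale: "form2 I c x (\<lambda>i. k * y i) (\<lambda>i. k\<^sup>2 * z i) = k\<^sup>2 * form2 I c x y z"
proof -
  have "mon 0 x (\<lambda>i. l * y i) S = l * mon 0 x y S" for l y S
    by (simp add: mon_def sum_distrib_left mult_ac)
  then have "mon2 x (\<lambda>i. k * y i) (\<lambda>i. k\<^sup>2 * z i) S = k\<^sup>2 * mon2 x y z S" for S
    by (simp add: mon2_def distrib_left sum_distrib_left power2_eq_square mult_ac)
  then show ?thesis by (simp add: form2_def sum_distrib_left mult_ac)
qed

subsection \<open>Rotation-invariant blocks\<close>

type_synonym block = "real \<times> real \<times> real"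

text \<open>
  A block \<open>(r, u, w)\<close> represents the variable \<open>r + \<alpha> u\<close>; the auxiliary \<open>w\<close> is its derivative, up to the factor
  \<open>\<alpha>\<close>, under the rotation of \<open>(u, w)\<close>.
\<close>

definition rot :: "real \<Rightarrow> block \<Rightarrow> block" where
  "rot \<theta> z = (fst z, fst (snd z) * cos \<theta> + snd (snd z) * sin \<theta>, snd (snd z) * cos \<theta> - fst (snd z) * sin \<theta>)"

definition val :: "real \<Rightarrow> block \<Rightarrow> real" where
  "val \<alpha> z = fst z + \<alpha> * fst (snd z)"

text \<open>Invariance is asked for angles up to pi/2 only: the quarter turn yields the vanishing
  moments, and small positive angles suffice for differentiating the flow at 0.\<close>

definition rot_block :: "real \<Rightarrow> real \<Rightarrow> real \<Rightarrow> real \<Rightarrow> block measure \<Rightarrow> bool" where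
  "rot_block \<alpha> \<kappa> e s \<nu> \<longleftrightarrow> prob_space \<nu> \<and> sets \<nu> = sets borel \<and>
     (\<forall>\<theta>. 0 \<le> \<theta> \<and> \<theta> \<le> pi / 2 \<longrightarrow> distr \<nu> borel (rot \<theta>) = \<nu>) \<and>
     integrable \<nu> (\<lambda>z. fst (snd z) ^ 4) \<and> integrable \<nu> (\<lambda>z. snd (snd z) ^ 4) \<and>
     (\<integral>z. fst (snd z) ^ 4 \<partial>\<nu>) \<le> 1 \<and> (\<integral>z. snd (snd z) ^ 4 \<partial>\<nu>) \<le> 1 \<and> (\<integral>z. (snd (snd z))\<^sup>2 \<partial>\<nu>) = s \<and>
     (\<integral>z. val \<alpha> z \<partial>\<nu>) = 0 \<and> integrable \<nu> (\<lambda>z. (val \<alpha> z)\<^sup>2) \<and> (\<integral>z. (val \<alpha> z)\<^sup>2 \<partial>\<nu>) = 1 \<and>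
     integrable \<nu> (\<lambda>z. \<bar>val \<alpha> z\<bar> powr (2 + e)) \<and> (\<integral>z. \<bar>val \<alpha> z\<bar> powr (2 + e) \<partial>\<nu>) \<le> \<kappa>"

lemma measurable_rot [measurable]: "rot \<theta> \<in> borel_measurable borel"
  unfolding rot_def by (simp add: borel_prod[symmetric])

lemma measurable_block [measurable]:
  "(\<lambda>z :: block. fst z) \<in> borel_measurable borel" "(\<lambda>z :: block. fst (snd z)) \<in> borel_measurable borel"
  "(\<lambda>z :: block. snd (snd z)) \<in> borel_measurable borel" "val \<alpha> \<in> borel_measurable borel"
  unfolding val_def by (simp_all add: borel_prod[symmetric])

text \<open>The quarter turn maps (u, w) to (w, -u) and fixes r. Invariance of the law then equates
  E u with E w and with -E w, equates E(r u) with E(r w) and with -E(r w), and E(u w) with -E(u w),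
  so all of them vanish.\<close>

lemma rot_block_moments:
  assumes "rot_block \<alpha> \<kappa> e s \<nu>"
  shows "prob_space \<nu>" "sets \<nu> = sets borel"
    "integrable \<nu> (\<lambda>z. (fst (snd z))\<^sup>2)" "integrable \<nu> (\<lambda>z. (snd (snd z))\<^sup>2)"
    "(\<integral>z. (fst (snd z))\<^sup>2 \<partial>\<nu>) \<le> 1" "s \<le> 1" "0 \<le> s"
    "(\<integral>z. fst (snd z) \<partial>\<nu>) = 0" "(\<integral>z. snd (snd z) \<partial>\<nu>) = 0" "(\<integral>z. val \<alpha> z * snd (snd z) \<partial>\<nu>) = 0"
    "integrable \<nu> (\<lambda>z. fst z)" "integrable \<nu> (\<lambda>z. fst (snd z))" "integrable \<nu> (\<lambda>z. snd (snd z))"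
proof -
  note b = assms[unfolded rot_block_def]
  interpret prob_space \<nu> using b by simp
  show "prob_space \<nu>" and s[measurable_cong]: "sets \<nu> = sets borel" using b by auto
  have m: "(\<lambda>z :: block. fst z) \<in> borel_measurable \<nu>" "(\<lambda>z :: block. fst (snd z)) \<in> borel_measurable \<nu>"
    "(\<lambda>z :: block. snd (snd z)) \<in> borel_measurable \<nu>" "val \<alpha> \<in> borel_measurable \<nu>" by measurable
  have L4: "L4 (\<lambda>z. fst (snd z))" "L4 (\<lambda>z. snd (snd z))" using b m by (auto simp: L4_def)
  then have L2: "L2 (\<lambda>z. fst (snd z))" "L2 (\<lambda>z. snd (snd z))" "L2 (val \<alpha>)"
    using b m(4) by (auto intro: L4_L2) (simp add: L2_def)
  then show i2: "integrable \<nu> (\<lambda>z. (fst (snd z))\<^sup>2)" "integrable \<nu> (\<lambda>z. (snd (snd z))\<^sup>2)" by (auto simp: L2_def)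
  have L2r: "L2 (\<lambda>z. fst z)"
    using L2_diff[OF L2(3) L2_cmult[OF L2(1), of \<alpha>]] by (simp add: val_def)
  show "integrable \<nu> (\<lambda>z. fst z)" "integrable \<nu> (\<lambda>z. fst (snd z))" "integrable \<nu> (\<lambda>z. snd (snd z))"
    using L2 L2r by (auto intro: L2_integrable)
  have le1: "(expectation (\<lambda>z. (f z)\<^sup>2)) \<le> 1" if "L4 f" "expectation (\<lambda>z. f z ^ 4) \<le> 1" for f
  proof -
    have "(expectation (\<lambda>z. (f z)\<^sup>2))\<^sup>2 \<le> 1\<^sup>2"
      using square_expectation_le[of "\<lambda>z. (f z)\<^sup>2"] that by (auto simp: L4_def)
    then show ?thesis by (rule power2_le_imp_le) simp
  qed
  show "(\<integral>z. (fst (snd z))\<^sup>2 \<partial>\<nu>) \<le> 1" "s \<le> 1" using le1[OF L4(1)] le1[OF L4(2)] b by auto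
  show "0 \<le> s" using b by (metis (no_types, lifting) Bochner_Integration.integral_nonneg zero_le_power2)
  have inv: "(\<integral>z. f (rot (pi / 2) z) \<partial>\<nu>) = (\<integral>z. f z \<partial>\<nu>)" if "f \<in> borel_measurable borel" for f :: "block \<Rightarrow> real"
  proof -
    have "distr \<nu> borel (rot (pi / 2)) = \<nu>" using b pi_ge_zero by simp
    then show ?thesis using integral_distr[of "rot (pi / 2)" \<nu> borel f] that by (simp add: measurable_cong_sets[OF s])
  qed
  have "(\<integral>z. snd (snd z) \<partial>\<nu>) = (\<integral>z. fst (snd z) \<partial>\<nu>)" "(\<integral>z. - fst (snd z) \<partial>\<nu>) = (\<integral>z. snd (snd z) \<partial>\<nu>)"
    using inv[of "\<lambda>z. fst (snd z)"] inv[of "\<lambda>z. snd (snd z)"] by (simp_all add: rot_def)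
  then show "(\<integral>z. fst (snd z) \<partial>\<nu>) = 0" "(\<integral>z. snd (snd z) \<partial>\<nu>) = 0" by simp_all
  have "(\<integral>z. fst z * snd (snd z) \<partial>\<nu>) = (\<integral>z. fst z * fst (snd z) \<partial>\<nu>)" "(\<integral>z. - (fst z * fst (snd z)) \<partial>\<nu>) = (\<integral>z. fst z * snd (snd z) \<partial>\<nu>)"
    "(\<integral>z. - (fst (snd z) * snd (snd z)) \<partial>\<nu>) = (\<integral>z. fst (snd z) * snd (snd z) \<partial>\<nu>)"
    using inv[of "\<lambda>z. fst z * fst (snd z)"] inv[of "\<lambda>z. fst z * snd (snd z)"] inv[of "\<lambda>z. fst (snd z) * snd (snd z)"]
    by (simp_all add: rot_def mult.commute)
  then have z: "(\<integral>z. fst z * snd (snd z) \<partial>\<nu>) = 0" "(\<integral>z. fst (snd z) * snd (snd z) \<partial>\<nu>) = 0" by simp_all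
  have "(\<integral>z. val \<alpha> z * snd (snd z) \<partial>\<nu>) = (\<integral>z. fst z * snd (snd z) + \<alpha> * (fst (snd z) * snd (snd z)) \<partial>\<nu>)"
    by (simp add: val_def algebra_simps)
  also have "\<dots> = 0"
    using z L2_integrable_mult[OF L2r L2(2)] L2_integrable_mult[OF L2(1,2)] by simp
  finally show "(\<integral>z. val \<alpha> z * snd (snd z) \<partial>\<nu>) = 0" .
qed

lemma flow_invariance:
  assumes I: "finite I" "I \<noteq> {}" and \<nu>: "\<And>i. i \<in> I \<Longrightarrow> rot_block \<alpha> \<kappa> e s (\<nu> i)" and \<theta>: "0 \<le> \<theta>" "\<theta> \<le> pi / 2"
    and f: "f \<in> borel_measurable (PiM I \<nu>)"
  shows "(\<lambda>\<omega>. \<lambda>i\<in>I. rot \<theta> (\<omega> i)) \<in> measurable (PiM I \<nu>) (PiM I \<nu>)"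
    "(\<integral>\<omega>. f (\<lambda>i\<in>I. rot \<theta> (\<omega> i)) \<partial>PiM I \<nu>) = (\<integral>\<omega>. (f \<omega> :: real) \<partial>PiM I \<nu>)"
proof -
  have s: "sets (\<nu> i) = sets borel" and p: "prob_space (\<nu> i)" and d: "distr (\<nu> i) borel (rot \<theta>) = \<nu> i" if "i \<in> I" for i
    using \<nu>[OF that] \<theta> by (auto simp: rot_block_def)
  have r: "rot \<theta> \<in> measurable (\<nu> i) (\<nu> i)" if "i \<in> I" for i
    using measurable_rot[of \<theta>] s[OF that] by (simp cong: measurable_cong_sets)
  show T: "(\<lambda>\<omega>. \<lambda>i\<in>I. rot \<theta> (\<omega> i)) \<in> measurable (PiM I \<nu>) (PiM I \<nu>)"
    using r by (intro measurable_restrict measurable_compose[OF measurable_component_singleton]) auto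
  have "distr (PiM I \<nu>) (PiM I \<nu>) (\<lambda>\<omega>. \<lambda>i\<in>I. rot \<theta> (\<omega> i)) = PiM I (\<lambda>i. distr (\<nu> i) (\<nu> i) (rot \<theta>))"
    using I p r by (intro distr_PiM_map) auto
  also have "\<dots> = PiM I \<nu>"
  proof (rule PiM_cong)
    fix i assume i: "i \<in> I"
    have "distr (\<nu> i) (\<nu> i) (rot \<theta>) = distr (\<nu> i) borel (rot \<theta>)" using s[OF i] by (intro distr_cong) auto
    then show "distr (\<nu> i) (\<nu> i) (rot \<theta>) = \<nu> i" using d[OF i] by simp
  qed simp
  finally show "(\<integral>\<omega>. f (\<lambda>i\<in>I. rot \<theta> (\<omega> i)) \<partial>PiM I \<nu>) = (\<integral>\<omega>. f \<omega> \<partial>PiM I \<nu>)"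
    using integral_distr[OF T f] by simp
qed

text \<open>y / (k + y^2) is a bounded substitute for 1 / y: multiplied by y it equals 1 up to k /
  (k + y^2), which is appreciable only where y^2 is comparable with k or smaller, and its derivative
  is at most 1 / k.\<close>

lemma weight_bounds:
  fixes k y :: real
  assumes "0 < k"
  shows "((\<lambda>y. y / (k + y\<^sup>2)) has_real_derivative (k - y\<^sup>2) / (k + y\<^sup>2)\<^sup>2) (at y)"
    "\<bar>(k - y\<^sup>2) / (k + y\<^sup>2)\<^sup>2\<bar> \<le> 1 / k" "\<bar>y * (y / (k + y\<^sup>2))\<bar> \<le> 1" "y * (y / (k + y\<^sup>2)) = 1 - k / (k + y\<^sup>2)"
proof -
  have pos: "0 < k + y\<^sup>2" using assms by (auto intro: add_pos_nonneg)
  show "((\<lambda>y. y / (k + y\<^sup>2)) has_real_derivative (k - y\<^sup>2) / (k + y\<^sup>2)\<^sup>2) (at y)"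
    using pos by (auto intro!: derivative_eq_intros simp: power2_eq_square algebra_simps)
  show eq: "y * (y / (k + y\<^sup>2)) = 1 - k / (k + y\<^sup>2)" using pos by (simp add: field_simps power2_eq_square)
  have "0 \<le> k / (k + y\<^sup>2)" "k / (k + y\<^sup>2) \<le> 1" using pos assms by (auto simp: field_simps)
  then show "\<bar>y * (y / (k + y\<^sup>2))\<bar> \<le> 1" unfolding eq by simp
  have "\<bar>k - y\<^sup>2\<bar> * k \<le> (k + y\<^sup>2) * (k + y\<^sup>2)"
  proof (intro mult_mono)
    show "\<bar>k - y\<^sup>2\<bar> \<le> k + y\<^sup>2" using assms zero_le_power2[of y] unfolding abs_le_iff by linarith
  qed (use assms pos in auto)
  then show "\<bar>(k - y\<^sup>2) / (k + y\<^sup>2)\<^sup>2\<bar> \<le> 1 / k"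
  proof -
    assume "\<bar>k - y\<^sup>2\<bar> * k \<le> (k + y\<^sup>2) * (k + y\<^sup>2)"
    then have "\<bar>k - y\<^sup>2\<bar> \<le> (k + y\<^sup>2)\<^sup>2 / k" using assms by (simp add: pos_le_divide_eq power2_eq_square)
    then show ?thesis using pos by (simp add: abs_divide pos_divide_le_eq)
  qed
qed

text \<open>
  With \<open>q(\<theta>)\<close> the value of the form after rotating all blocks by \<open>\<theta>\<close> and \<open>\<phi>\<close> a bounded primitive of \<open>h - avg t h\<close>,
  the expectation of \<open>\<phi>(q) q' / (k + q'\<^sup>2)\<close> does not depend on \<open>\<theta>\<close>. Its derivative is
  \<open>(h - avg t h)(q) (1 - k / (k + q'\<^sup>2))\<close> plus a term bounded by \<open>t / k\<close> times the expectation of \<open>|q''|\<close>.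
\<close>

lemma rotation_regularity:
  assumes I: "finite I" "I \<noteq> {}" and \<nu>: "\<And>i. i \<in> I \<Longrightarrow> rot_block \<alpha> \<kappa> e s (\<nu> i)" and \<alpha>: "0 < \<alpha>"
    and deg: "deg_le d I c" and n: "coef_norm I c \<le> 1"
    and h: "unit_cont h" and t: "0 < t" and k: "0 < k"
  defines "Q \<equiv> \<lambda>\<omega>. form 1 I c (\<lambda>i. val \<alpha> (\<omega> i)) (\<lambda>_. 0)"
    and "D \<equiv> \<lambda>\<omega>. form 0 I c (\<lambda>i. val \<alpha> (\<omega> i)) (\<lambda>i. snd (snd (\<omega> i)))"
  shows "\<bar>(\<integral>\<omega>. h (Q \<omega>) \<partial>PiM I \<nu>) - (\<integral>\<omega>. avg t h (Q \<omega>) \<partial>PiM I \<nu>)\<bar> \<le>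
    (\<integral>\<omega>. k / (k + (\<alpha> * D \<omega>)\<^sup>2) \<partial>PiM I \<nu>) + t / k * ((max 1 \<alpha>)\<^sup>2 * sqrt (second_const d))"
proof -
  let ?P = "PiM I \<nu>"
  have p: "prob_space (\<nu> i)" and sb: "sets (\<nu> i) = sets borel" if "i \<in> I" for i
    using rot_block_moments[OF \<nu>[OF that]] by auto
  interpret B: indep_blocks ?P "coord_algebra I \<nu>" I using I p by (intro indep_blocks_PiM) auto
  have coord: "(\<lambda>\<omega>. f (\<omega> i)) \<in> borel_measurable ?P" if "i \<in> I" "f \<in> borel_measurable borel" for f :: "block \<Rightarrow> real" and i
  proof -
    have "f \<in> borel_measurable (\<nu> i)" using that sb[OF that(1)] by (simp cong: measurable_cong_sets)
    moreover have "(\<lambda>\<omega>. \<omega> i) \<in> measurable ?P (\<nu> i)" using that(1) by (rule measurable_component_singleton)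
    ultimately show ?thesis by (rule measurable_compose[rotated])
  qed
  define X where "X = (\<lambda>\<theta> (\<omega> :: nat \<Rightarrow> block) i. val \<alpha> (rot \<theta> (\<omega> i)))"
  define Y where "Y = (\<lambda>\<theta> (\<omega> :: nat \<Rightarrow> block) i. \<alpha> * snd (snd (rot \<theta> (\<omega> i))))"
  define Z where "Z = (\<lambda>\<theta> (\<omega> :: nat \<Rightarrow> block) i. - \<alpha> * fst (snd (rot \<theta> (\<omega> i))))"
  define q where "q = (\<lambda>\<theta> \<omega>. form 1 I c (X \<theta> \<omega>) (\<lambda>_. 0))"
  define q1 where "q1 = (\<lambda>\<theta> \<omega>. form 0 I c (X \<theta> \<omega>) (Y \<theta> \<omega>))"
  define q2 where "q2 = (\<lambda>\<theta> \<omega>. form2 I c (X \<theta> \<omega>) (Y \<theta> \<omega>) (Z \<theta> \<omega>))"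
  have rot0: "rot 0 z = z" for z by (simp add: rot_def)
  have q0: "q 0 \<omega> = Q \<omega>" "q1 0 \<omega> = \<alpha> * D \<omega>" for \<omega>
    by (simp_all add: q_def q1_def Q_def D_def X_def Y_def rot0 form_smult_right)
  have dX: "((\<lambda>\<theta>. X \<theta> \<omega> i) has_real_derivative Y \<theta> \<omega> i) (at \<theta>)" "((\<lambda>\<theta>. Y \<theta> \<omega> i) has_real_derivative Z \<theta> \<omega> i) (at \<theta>)" for \<omega> i \<theta>
    unfolding X_def Y_def Z_def rot_def val_def by (auto intro!: derivative_eq_intros simp: algebra_simps)
  have dq: "((\<lambda>\<theta>. q \<theta> \<omega>) has_real_derivative q1 \<theta> \<omega>) (at \<theta>)" "((\<lambda>\<theta>. q1 \<theta> \<omega>) has_real_derivative q2 \<theta> \<omega>) (at \<theta>)" for \<omega> \<theta>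
    unfolding q_def q1_def q2_def using dX
    by (auto intro!: form_has_derivative form_has_second_derivative I)
  obtain \<phi> where \<phi>: "\<And>x. (\<phi> has_real_derivative h x - avg t h x) (at x)" "\<And>x. \<bar>\<phi> x\<bar> \<le> t"
    using avg_defect_primitive[OF h t] by blast
  define \<phi>' where "\<phi>' = (\<lambda>x. h x - avg t h x)"
  have uh: "unit_cont (avg t h)" by (rule unit_cont_avg[OF h t])
  have hc: "h \<in> borel_measurable borel" "avg t h \<in> borel_measurable borel" "\<phi> \<in> borel_measurable borel"
    using h uh continuous_on_if_DERIV[OF \<phi>(1)] by (auto simp: unit_cont_def intro: borel_measurable_continuous_onI)
  then have hc': "\<phi>' \<in> borel_measurable borel" unfolding \<phi>'_def by measurable
  have h01: "0 \<le> h x" "h x \<le> 1" "0 \<le> avg t h x" "avg t h x \<le> 1" for x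
    using h uh by (auto simp: unit_cont_def)
  have \<phi>'1: "\<bar>\<phi>' x\<bar> \<le> 1" for x using h01[of x] unfolding \<phi>'_def by (auto simp: abs_le_iff)
  define K where "K = (\<lambda>y. y / (k + y\<^sup>2))"
  define K' where "K' = (\<lambda>y. (k - y\<^sup>2) / (k + y\<^sup>2)\<^sup>2)"
  define \<Phi> where "\<Phi> = (\<lambda>\<theta> \<omega>. \<phi> (q \<theta> \<omega>) * K (q1 \<theta> \<omega>))"
  define \<Psi> where "\<Psi> = (\<lambda>\<theta> \<omega>. \<phi>' (q \<theta> \<omega>) * (q1 \<theta> \<omega> * K (q1 \<theta> \<omega>)) + \<phi> (q \<theta> \<omega>) * (K' (q1 \<theta> \<omega>) * q2 \<theta> \<omega>))"
  have d\<Phi>: "((\<lambda>\<theta>. \<Phi> \<theta> \<omega>) has_real_derivative \<Psi> \<theta> \<omega>) (at \<theta>)" for \<omega> \<theta>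
  proof -
    have "((\<lambda>\<theta>. \<phi> (q \<theta> \<omega>)) has_real_derivative \<phi>' (q \<theta> \<omega>) * q1 \<theta> \<omega>) (at \<theta>)"
      using DERIV_chain2[OF \<phi>(1) dq(1)] unfolding \<phi>'_def .
    moreover have "((\<lambda>\<theta>. K (q1 \<theta> \<omega>)) has_real_derivative K' (q1 \<theta> \<omega>) * q2 \<theta> \<omega>) (at \<theta>)"
      using DERIV_chain2[OF weight_bounds(1)[OF k] dq(2)] unfolding K_def K'_def .
    ultimately show ?thesis unfolding \<Phi>_def \<Psi>_def
      by (rule DERIV_cong[OF DERIV_mult]) (simp add: algebra_simps)
  qed
  \<comment> \<open>An envelope for the second derivative valid for all angles at once: rotated
    coordinates stay below \<rho>, and the product of the independent integrable factors 1 + \<rho>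
    is integrable.\<close>
  obtain C where C: "C \<ge> 0" "\<And>x y z \<rho>. (\<forall>i\<in>I. \<bar>x i\<bar> \<le> \<rho> i \<and> \<bar>y i\<bar> \<le> \<rho> i \<and> \<bar>z i\<bar> \<le> \<rho> i) \<Longrightarrow> \<bar>form2 I c x y z\<bar> \<le> C * (\<Prod>i\<in>I. 1 + \<rho> i)"
    using form2_growth[OF I(1), of c] by auto
  define \<rho> where "\<rho> = (\<lambda>z :: block. \<bar>fst z\<bar> + \<alpha> * (\<bar>fst (snd z)\<bar> + \<bar>snd (snd z)\<bar>))"
  define W where "W = (\<lambda>\<omega>. C * (\<Prod>i\<in>I. 1 + \<rho> (\<omega> i)))"
  have trig: "\<bar>a * cos \<theta> + b * sin \<theta>\<bar> \<le> \<bar>a\<bar> + \<bar>b\<bar>" "\<bar>b * cos \<theta> - a * sin \<theta>\<bar> \<le> \<bar>a\<bar> + \<bar>b\<bar>" for a b \<theta> :: real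
  proof -
    have ab: "\<bar>a * cos \<theta>\<bar> \<le> \<bar>a\<bar>" "\<bar>b * sin \<theta>\<bar> \<le> \<bar>b\<bar>" "\<bar>b * cos \<theta>\<bar> \<le> \<bar>b\<bar>" "\<bar>a * sin \<theta>\<bar> \<le> \<bar>a\<bar>"
      unfolding abs_mult by (auto intro: mult_left_le)
    show "\<bar>a * cos \<theta> + b * sin \<theta>\<bar> \<le> \<bar>a\<bar> + \<bar>b\<bar>" using ab(1,2) abs_triangle_ineq[of "a * cos \<theta>" "b * sin \<theta>"] by linarith
    show "\<bar>b * cos \<theta> - a * sin \<theta>\<bar> \<le> \<bar>a\<bar> + \<bar>b\<bar>" using ab(3,4) abs_triangle_ineq4[of "b * cos \<theta>" "a * sin \<theta>"] by linarith
  qed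
  have XYZ: "\<bar>X \<theta> \<omega> i\<bar> \<le> \<rho> (\<omega> i) \<and> \<bar>Y \<theta> \<omega> i\<bar> \<le> \<rho> (\<omega> i) \<and> \<bar>Z \<theta> \<omega> i\<bar> \<le> \<rho> (\<omega> i)" for \<theta> \<omega> i
  proof -
    let ?a = "fst (snd (\<omega> i))" and ?b = "snd (snd (\<omega> i))"
    have 1: "\<bar>\<alpha> * (?a * cos \<theta> + ?b * sin \<theta>)\<bar> \<le> \<alpha> * (\<bar>?a\<bar> + \<bar>?b\<bar>)" "\<bar>\<alpha> * (?b * cos \<theta> - ?a * sin \<theta>)\<bar> \<le> \<alpha> * (\<bar>?a\<bar> + \<bar>?b\<bar>)"
      unfolding abs_mult using \<alpha> trig by (auto intro!: mult_left_mono)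
    have "\<bar>X \<theta> \<omega> i\<bar> \<le> \<rho> (\<omega> i)"
      using abs_triangle_ineq[of "fst (\<omega> i)" "\<alpha> * (?a * cos \<theta> + ?b * sin \<theta>)"] 1(1) by (simp add: X_def \<rho>_def val_def rot_def)
    moreover have "\<bar>Y \<theta> \<omega> i\<bar> \<le> \<rho> (\<omega> i)"
      using 1(2) abs_ge_zero[of "fst (\<omega> i)"] unfolding Y_def \<rho>_def rot_def fst_conv snd_conv by linarith
    moreover have "\<bar>Z \<theta> \<omega> i\<bar> \<le> \<rho> (\<omega> i)"
      using 1(1) abs_ge_zero[of "fst (\<omega> i)"] unfolding Z_def \<rho>_def rot_def fst_conv snd_conv mult_minus_left abs_minus_cancel by linarith
    ultimately show ?thesis by blast
  qed
  have q2W: "\<bar>q2 \<theta> \<omega>\<bar> \<le> W \<omega>" for \<theta> \<omega> unfolding q2_def W_def using XYZ by (intro C(2)) auto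
  have \<Psi>W: "\<bar>\<Psi> \<theta> \<omega>\<bar> \<le> 1 + t / k * W \<omega>" for \<theta> \<omega>
  proof -
    have "\<bar>\<phi>' (q \<theta> \<omega>) * (q1 \<theta> \<omega> * K (q1 \<theta> \<omega>))\<bar> \<le> 1 * 1"
      unfolding abs_mult[of "\<phi>' (q \<theta> \<omega>)"] using \<phi>'1 weight_bounds(3)[OF k] unfolding K_def by (intro mult_mono) auto
    moreover have "\<bar>\<phi> (q \<theta> \<omega>) * (K' (q1 \<theta> \<omega>) * q2 \<theta> \<omega>)\<bar> \<le> t * (1 / k * W \<omega>)"
      unfolding abs_mult using \<phi>(2) weight_bounds(2)[OF k] q2W t k unfolding K'_def by (intro mult_mono) auto
    ultimately show ?thesis unfolding \<Psi>_def by (intro order_trans[OF abs_triangle_ineq]) simp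
  qed
  have mr: "(\<lambda>z. f (rot \<theta> z)) \<in> borel_measurable borel" if "f \<in> borel_measurable borel" for f :: "block \<Rightarrow> real" and \<theta>
    using measurable_compose[OF measurable_rot that] .
  have mXYZ: "(\<lambda>\<omega>. X \<theta> \<omega> i) \<in> borel_measurable ?P" "(\<lambda>\<omega>. Y \<theta> \<omega> i) \<in> borel_measurable ?P" "(\<lambda>\<omega>. Z \<theta> \<omega> i) \<in> borel_measurable ?P" if "i \<in> I" for \<theta> i
    unfolding X_def Y_def Z_def using that
    using coord[OF _ mr[of "val \<alpha>" \<theta>], of i] coord[OF _ mr[of "\<lambda>z. snd (snd z)" \<theta>], of i] coord[OF _ mr[of "\<lambda>z. fst (snd z)" \<theta>], of i]
    by simp_all
  have mq[measurable]: "q \<theta> \<in> borel_measurable ?P" "q1 \<theta> \<in> borel_measurable ?P" "q2 \<theta> \<in> borel_measurable ?P" for \<theta>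
    unfolding q_def q1_def q2_def using mXYZ by (auto intro!: borel_measurable_form borel_measurable_form2)
  have mK[measurable]: "K \<in> borel_measurable borel" "K' \<in> borel_measurable borel" unfolding K_def K'_def by measurable
  note [measurable] = hc hc'
  have m\<Phi>[measurable]: "\<Phi> \<theta> \<in> borel_measurable ?P" "\<Psi> \<theta> \<in> borel_measurable ?P" for \<theta>
    unfolding \<Phi>_def \<Psi>_def by measurable
  have iW: "integrable ?P W"
  proof -
    have "B.indep_vars (\<lambda>_. borel) (\<lambda>i \<omega>. 1 + \<rho> (\<omega> i)) I"
    proof (rule B.indep_vars_compose2[OF indep_vars_PiM_coordinates[OF p]])
      fix i assume "i \<in> I"
      then show "(\<lambda>z. 1 + \<rho> z) \<in> borel_measurable (\<nu> i)"
        unfolding \<rho>_def measurable_cong_sets[OF sb[OF \<open>i \<in> I\<close>] refl] by measurable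
    qed auto
    moreover have "integrable ?P (\<lambda>\<omega>. 1 + \<rho> (\<omega> i))" if i: "i \<in> I" for i
    proof -
      note bm = rot_block_moments[OF \<nu>[OF i]]
      interpret N: prob_space "\<nu> i" by (rule p[OF i])
      have "integrable (\<nu> i) (\<lambda>z. 1 + \<rho> z)" unfolding \<rho>_def using bm by (intro Bochner_Integration.integrable_add integrable_mult_right integrable_abs) auto
      moreover have "(\<lambda>z. 1 + \<rho> z) \<in> borel_measurable (\<nu> i)" unfolding \<rho>_def measurable_cong_sets[OF sb[OF i] refl] by measurable
      ultimately show ?thesis using PiM_coordinate_law(2)[of I \<nu> i "\<lambda>z. 1 + \<rho> z"] p i by blast
    qed
    ultimately have "integrable ?P (\<lambda>\<omega>. \<Prod>i\<in>I. 1 + \<rho> (\<omega> i))" using I by (intro B.indep_vars_integrable) auto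
    then show ?thesis unfolding W_def by simp
  qed
  have W0: "0 \<le> W \<omega>" for \<omega> using order_trans[OF abs_ge_zero q2W] .
  have \<Phi>b: "\<bar>\<Phi> \<theta> \<omega>\<bar> \<le> \<bar>\<Phi> 0 \<omega>\<bar> + \<theta> * (1 + t / k * W \<omega>)" "\<bar>(\<Phi> \<theta> \<omega> - \<Phi> 0 \<omega>) / \<theta>\<bar> \<le> 1 + t / k * W \<omega>" if \<theta>0: "0 < \<theta>" for \<theta> \<omega>
  proof -
    obtain \<xi> where \<xi>: "\<Phi> \<theta> \<omega> - \<Phi> 0 \<omega> = (\<theta> - 0) * \<Psi> \<xi> \<omega>"
      using MVT2[OF \<theta>0, of "\<lambda>\<theta>. \<Phi> \<theta> \<omega>" "\<lambda>\<theta>. \<Psi> \<theta> \<omega>"] d\<Phi> by blast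
    then show 2: "\<bar>(\<Phi> \<theta> \<omega> - \<Phi> 0 \<omega>) / \<theta>\<bar> \<le> 1 + t / k * W \<omega>" using \<theta>0 \<Psi>W[of \<xi> \<omega>] by simp
    then have "\<bar>\<Phi> \<theta> \<omega> - \<Phi> 0 \<omega>\<bar> \<le> \<theta> * (1 + t / k * W \<omega>)" using \<theta>0 by (simp add: pos_divide_le_eq mult.commute)
    then show "\<bar>\<Phi> \<theta> \<omega>\<bar> \<le> \<bar>\<Phi> 0 \<omega>\<bar> + \<theta> * (1 + t / k * W \<omega>)" by linarith
  qed
  have K1: "\<bar>K y\<bar> \<le> 1 + 1 / k" for y
  proof (cases "\<bar>y\<bar> \<le> 1")
    case True
    have "\<bar>y\<bar> / (k + y\<^sup>2) \<le> 1 / k" using True k by (intro frac_le) auto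
    then show ?thesis using k by (simp add: K_def abs_of_pos add_pos_nonneg)
  next
    case False
    have "\<bar>K y\<bar> * 1 \<le> \<bar>K y\<bar> * \<bar>y\<bar>" using False by (intro mult_left_mono) auto
    also have "\<dots> \<le> 1" using weight_bounds(3)[OF k, of y] unfolding K_def by (simp add: abs_mult mult.commute)
    finally show ?thesis using k by (simp add: add_increasing2)
  qed
  have i\<Phi>: "integrable ?P (\<Phi> \<theta>)" for \<theta>
  proof (rule B.integrable_const_bound[of _ "t * (1 + 1 / k)"])
    show "AE \<omega> in ?P. norm (\<Phi> \<theta> \<omega>) \<le> t * (1 + 1 / k)"
      unfolding \<Phi>_def real_norm_def abs_mult using \<phi>(2) K1 t by (intro AE_I2 mult_mono) auto
  qed simp
  \<comment> \<open>Angle 0 is approached from the right along 1 / (n + 1), within the range where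
    invariance is available.\<close>
  define \<theta>n where "\<theta>n = (\<lambda>n. 1 / real (Suc n))"
  have \<theta>n: "0 < \<theta>n n" "\<theta>n n \<le> pi / 2" for n
  proof -
    have "\<theta>n n \<le> 1" by (simp add: \<theta>n_def)
    then show "\<theta>n n \<le> pi / 2" using pi_gt3 by linarith
  qed (simp add: \<theta>n_def)
  \<comment> \<open>\<Phi> at angle \<theta> is \<Phi> at angle 0 evaluated at the rotated blocks,
    whose joint law is unchanged.\<close>
  have inv: "(\<integral>\<omega>. \<Phi> (\<theta>n n) \<omega> \<partial>?P) = (\<integral>\<omega>. \<Phi> 0 \<omega> \<partial>?P)" for n
  proof -
    have "(\<integral>\<omega>. \<Phi> 0 \<omega> \<partial>?P) = (\<integral>\<omega>. \<Phi> 0 (\<lambda>i\<in>I. rot (\<theta>n n) (\<omega> i)) \<partial>?P)"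
      using flow_invariance(2)[where f = "\<Phi> 0" and \<theta> = "\<theta>n n" and \<nu> = \<nu> and I = I] I \<nu> less_imp_le[OF \<theta>n(1)] \<theta>n(2) m\<Phi>(1)
      by metis
    also have "(\<lambda>\<omega>. \<Phi> 0 (\<lambda>i\<in>I. rot (\<theta>n n) (\<omega> i))) = \<Phi> (\<theta>n n)"
      unfolding \<Phi>_def q_def q1_def X_def Y_def
      by (auto simp: rot0 fun_eq_iff intro!: arg_cong2[where f = "(*)"] arg_cong[where f = \<phi>] arg_cong[where f = K] form_cong)
    finally show ?thesis ..
  qed
  \<comment> \<open>Differentiation under the integral: the mean value theorem dominates the
    difference quotients by the envelope. As their integrals are all 0, so is the integral of the
    derivative.\<close>
  have conv: "(\<lambda>n. \<integral>\<omega>. (\<Phi> (\<theta>n n) \<omega> - \<Phi> 0 \<omega>) / \<theta>n n \<partial>?P) \<longlonglongrightarrow> (\<integral>\<omega>. \<Psi> 0 \<omega> \<partial>?P)"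
  proof (rule integral_dominated_convergence[where w = "\<lambda>\<omega>. 1 + t / k * W \<omega>"])
    show "AE \<omega> in ?P. (\<lambda>n. (\<Phi> (\<theta>n n) \<omega> - \<Phi> 0 \<omega>) / \<theta>n n) \<longlonglongrightarrow> \<Psi> 0 \<omega>"
    proof (rule AE_I2)
      fix \<omega>
      have "((\<lambda>h. (\<Phi> (0 + h) \<omega> - \<Phi> 0 \<omega>) / h) \<longlongrightarrow> \<Psi> 0 \<omega>) (at 0)" using d\<Phi>[of \<omega> 0] unfolding DERIV_def .
      moreover have "filterlim \<theta>n (at 0) sequentially"
        unfolding filterlim_at \<theta>n_def using LIMSEQ_inverse_real_of_nat by (auto simp: inverse_eq_divide)
      ultimately show "(\<lambda>n. (\<Phi> (\<theta>n n) \<omega> - \<Phi> 0 \<omega>) / \<theta>n n) \<longlonglongrightarrow> \<Psi> 0 \<omega>"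
        using filterlim_compose by fastforce
    qed
    show "AE \<omega> in ?P. norm ((\<Phi> (\<theta>n n) \<omega> - \<Phi> 0 \<omega>) / \<theta>n n) \<le> 1 + t / k * W \<omega>" for n
      using \<Phi>b(2)[OF \<theta>n(1)[of n]] by auto
  qed (use iW in auto)
  have zero: "(\<integral>\<omega>. (\<Phi> (\<theta>n n) \<omega> - \<Phi> 0 \<omega>) / \<theta>n n \<partial>?P) = 0" for n
    using i\<Phi> inv by simp
  have "(\<lambda>n::nat. 0) \<longlonglongrightarrow> (\<integral>\<omega>. \<Psi> 0 \<omega> \<partial>?P)" using conv unfolding zero .
  then have \<Psi>0: "(\<integral>\<omega>. \<Psi> 0 \<omega> \<partial>?P) = 0" by (simp add: LIMSEQ_const_iff)
  \<comment> \<open>For large \<alpha> the velocity \<alpha> w and the acceleration -\<alpha> u may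
    have second moments above 1. Division by \<beta> and \<beta>^2 normalises them, and
    \<open>form2\<close> scales by \<beta>^2, the factor in the conclusion.\<close>
  define \<beta> where "\<beta> = max 1 \<alpha>"
  have \<beta>: "1 \<le> \<beta>" "\<alpha> \<le> \<beta>" by (auto simp: \<beta>_def)
  have L2q2: "B.L2 (q2 0)" "B.expectation (\<lambda>\<omega>. (q2 0 \<omega>)\<^sup>2) \<le> (\<beta>\<^sup>2)\<^sup>2 * second_const d"
  proof -
    let ?x = "val \<alpha>" and ?y = "\<lambda>z :: block. \<alpha> / \<beta> * snd (snd z)" and ?z = "\<lambda>z :: block. - \<alpha> / \<beta>\<^sup>2 * fst (snd z)"
    have mm: "?x \<in> borel_measurable (\<nu> i)" "?y \<in> borel_measurable (\<nu> i)" "?z \<in> borel_measurable (\<nu> i)" if "i \<in> I" for i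
      unfolding measurable_cong_sets[OF sb[OF that] refl] by measurable
    have rv: "B.block_rv i (\<lambda>\<omega>. ?x (\<omega> i))" "B.block_rv i (\<lambda>\<omega>. ?y (\<omega> i))" "B.block_rv i (\<lambda>\<omega>. ?z (\<omega> i))" if i: "i \<in> I" for i
      using rot_block_moments[OF \<nu>[OF i]] \<nu>[OF i, unfolded rot_block_def] I p i mm[OF i]
      by (auto intro!: coordinate_block_rv simp: power_mult_distrib power_divide)
    have law: "B.expectation (\<lambda>\<omega>. f (\<omega> i)) = integral\<^sup>L (\<nu> i) f" if "i \<in> I" "f \<in> borel_measurable borel" for f :: "block \<Rightarrow> real" and i
    proof -
      have "f \<in> borel_measurable (\<nu> i)" using that by (simp add: measurable_cong_sets[OF sb[OF that(1)] refl])
      then show ?thesis using PiM_coordinate_law(1)[of I \<nu> i f] p that(1) by blast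
    qed
    have r1: "(\<alpha> / \<beta>)\<^sup>2 \<le> 1" using \<alpha> \<beta> by (simp add: power_le_one)
    have r2: "(\<alpha> / \<beta>\<^sup>2)\<^sup>2 \<le> 1"
    proof -
      have "\<alpha> / \<beta>\<^sup>2 \<le> 1" using \<alpha> \<beta> by (simp add: power2_eq_square) (metis mult_mono mult_1 less_imp_le order_trans zero_le_one)
      then show ?thesis using \<alpha> \<beta> by (simp add: power_le_one)
    qed
    have E: "B.expectation (\<lambda>\<omega>. (?x (\<omega> i))\<^sup>2) = 1" "B.expectation (\<lambda>\<omega>. (?y (\<omega> i))\<^sup>2) = (\<alpha> / \<beta>)\<^sup>2 * s"
      "B.expectation (\<lambda>\<omega>. ?x (\<omega> i) * ?y (\<omega> i)) = 0" "B.expectation (\<lambda>\<omega>. (?z (\<omega> i))\<^sup>2) \<le> 1" if i: "i \<in> I" for i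
    proof -
      note b = rot_block_moments[OF \<nu>[OF i]] and b' = \<nu>[OF i, unfolded rot_block_def]
      show "B.expectation (\<lambda>\<omega>. (?x (\<omega> i))\<^sup>2) = 1" using law[OF i, of "\<lambda>z. (val \<alpha> z)\<^sup>2"] b' by simp
      show "B.expectation (\<lambda>\<omega>. (?y (\<omega> i))\<^sup>2) = (\<alpha> / \<beta>)\<^sup>2 * s"
        using law[OF i, of "\<lambda>z. (snd (snd z))\<^sup>2"] b' by (simp add: power_mult_distrib power_divide)
      have "(\<lambda>\<omega>. ?x (\<omega> i) * ?y (\<omega> i)) = (\<lambda>\<omega>. (\<alpha> / \<beta>) * (?x (\<omega> i) * snd (snd (\<omega> i))))" by auto
      then show "B.expectation (\<lambda>\<omega>. ?x (\<omega> i) * ?y (\<omega> i)) = 0"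
        using law[OF i, of "\<lambda>z. ?x z * snd (snd z)"] b by simp
      have "B.expectation (\<lambda>\<omega>. (?z (\<omega> i))\<^sup>2) = (\<alpha> / \<beta>\<^sup>2)\<^sup>2 * (\<integral>z. (fst (snd z))\<^sup>2 \<partial>\<nu> i)"
        using law[OF i, of "\<lambda>z. (fst (snd z))\<^sup>2"] by (simp add: power_mult_distrib power_divide)
      also have "\<dots> \<le> 1 * 1" using r2 b(5) by (intro mult_mono) auto
      finally show "B.expectation (\<lambda>\<omega>. (?z (\<omega> i))\<^sup>2) \<le> 1" by simp
    qed
    have s01: "0 \<le> (\<alpha> / \<beta>)\<^sup>2 * s" "(\<alpha> / \<beta>)\<^sup>2 * s \<le> 1"
    proof -
      obtain i where i: "i \<in> I" using I by auto
      have "0 \<le> s" "s \<le> 1" using rot_block_moments[OF \<nu>[OF i]] by auto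
      then show "0 \<le> (\<alpha> / \<beta>)\<^sup>2 * s" "(\<alpha> / \<beta>)\<^sup>2 * s \<le> 1" using r1 by (auto intro: mult_le_one)
    qed
    define G where "G = (\<lambda>\<omega>. form2 I c (\<lambda>i. ?x (\<omega> i)) (\<lambda>i. ?y (\<omega> i)) (\<lambda>i. ?z (\<omega> i)))"
    have G: "B.L2 G" "B.expectation (\<lambda>\<omega>. (G \<omega>)\<^sup>2) \<le> second_const d * coef_norm I c"
      using B.form2_second_moment[OF subset_refl rv E(1,2,3) s01 deg E(4)] unfolding G_def by auto
    have qG: "q2 0 \<omega> = \<beta>\<^sup>2 * G \<omega>" for \<omega>
    proof -
      have "X 0 \<omega> = (\<lambda>i. ?x (\<omega> i))" "Y 0 \<omega> = (\<lambda>i. \<beta> * ?y (\<omega> i))" "Z 0 \<omega> = (\<lambda>i. \<beta>\<^sup>2 * ?z (\<omega> i))"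
        using \<beta> by (auto simp: X_def Y_def Z_def rot0)
      then show ?thesis unfolding q2_def G_def by (simp only: form2_scale)
    qed
    have "q2 0 = (\<lambda>\<omega>. \<beta>\<^sup>2 * G \<omega>)" using qG by auto
    then show "B.L2 (q2 0)" using B.L2_cmult[OF G(1), of "\<beta>\<^sup>2"] by simp
    have "B.expectation (\<lambda>\<omega>. (q2 0 \<omega>)\<^sup>2) = (\<beta>\<^sup>2)\<^sup>2 * B.expectation (\<lambda>\<omega>. (G \<omega>)\<^sup>2)"
      unfolding qG power_mult_distrib by simp
    also have "\<dots> \<le> (\<beta>\<^sup>2)\<^sup>2 * (second_const d * 1)"
      using G(2) mult_left_mono[OF n, of "second_const d"] by (intro mult_left_mono) auto
    finally show "B.expectation (\<lambda>\<omega>. (q2 0 \<omega>)\<^sup>2) \<le> (\<beta>\<^sup>2)\<^sup>2 * second_const d" by simp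
  qed
  have Eq2: "B.expectation (\<lambda>\<omega>. \<bar>q2 0 \<omega>\<bar>) \<le> \<beta>\<^sup>2 * sqrt (second_const d)"
  proof -
    have "\<bar>B.expectation (\<lambda>\<omega>. \<bar>q2 0 \<omega>\<bar> * 1)\<bar> \<le> 1 * sqrt ((\<beta>\<^sup>2)\<^sup>2 * second_const d)"
      using L2q2 by (intro B.abs_expectation_le_sqrt) (auto simp: B.L2_def B.prob_space)
    then show ?thesis using real_sqrt_unique[of "\<beta>\<^sup>2" "(\<beta>\<^sup>2)\<^sup>2"] by (simp add: real_sqrt_mult)
  qed
  have iq2: "integrable ?P (\<lambda>\<omega>. \<bar>q2 0 \<omega>\<bar>)" using B.L2_integrable[OF L2q2(1)] by simp
  define V where "V = (\<lambda>\<omega>. k / (k + (q1 0 \<omega>)\<^sup>2))"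
  have V: "0 \<le> V \<omega>" "V \<omega> \<le> 1" for \<omega>
    unfolding V_def using k by (auto simp: add_pos_nonneg field_simps)
  have mV[measurable]: "V \<in> borel_measurable ?P" unfolding V_def by measurable
  have bnd: "integrable ?P f" if "f \<in> borel_measurable ?P" "\<And>\<omega>. \<bar>f \<omega>\<bar> \<le> 1" for f :: "(nat \<Rightarrow> block) \<Rightarrow> real"
    using that by (intro B.integrable_const_bound[of _ 1]) auto
  \<comment> \<open>Solved for h - avg t h: the main term has expectation 0, \<open>V\<close> is the
    defect of the regularised division by the speed, and the last term carries the second
    derivative.\<close>
  have \<Psi>eq: "\<phi>' (q 0 \<omega>) = \<Psi> 0 \<omega> + \<phi>' (q 0 \<omega>) * V \<omega> - \<phi> (q 0 \<omega>) * (K' (q1 0 \<omega>) * q2 0 \<omega>)" for \<omega>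
    unfolding \<Psi>_def K_def V_def weight_bounds(4)[OF k] by (simp add: algebra_simps)
  have i\<Psi>: "integrable ?P (\<Psi> 0)"
    by (rule Bochner_Integration.integrable_bound[of _ "\<lambda>\<omega>. 1 + t / k * W \<omega>"]) (use iW \<Psi>W W0 t k in \<open>auto intro!: AE_I2 order_trans[OF \<Psi>W]\<close>)
  have b1: "\<bar>\<phi>' (q 0 \<omega>) * V \<omega>\<bar> \<le> V \<omega>" for \<omega>
    unfolding abs_mult using \<phi>'1[of "q 0 \<omega>"] V[of \<omega>] by (simp add: mult_left_le_one_le)
  have b2: "\<bar>\<phi> (q 0 \<omega>) * (K' (q1 0 \<omega>) * q2 0 \<omega>)\<bar> \<le> t / k * \<bar>q2 0 \<omega>\<bar>" for \<omega>
  proof -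
    have "\<bar>\<phi> (q 0 \<omega>) * (K' (q1 0 \<omega>) * q2 0 \<omega>)\<bar> \<le> t * (1 / k * \<bar>q2 0 \<omega>\<bar>)"
      unfolding abs_mult using \<phi>(2) weight_bounds(2)[OF k] t k unfolding K'_def by (intro mult_mono) auto
    then show ?thesis by simp
  qed
  have i1: "integrable ?P (\<lambda>\<omega>. \<phi>' (q 0 \<omega>) * V \<omega>)" using b1 V(2) by (intro bnd) (auto intro: order_trans)
  have i2: "integrable ?P (\<lambda>\<omega>. \<phi> (q 0 \<omega>) * (K' (q1 0 \<omega>) * q2 0 \<omega>))"
    by (rule Bochner_Integration.integrable_bound[of _ "\<lambda>\<omega>. t / k * \<bar>q2 0 \<omega>\<bar>"]) (use iq2 b2 t k in \<open>auto simp: abs_mult\<close>)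
  have iV: "integrable ?P V" using V by (intro bnd) auto
  have "B.expectation (\<lambda>\<omega>. \<phi>' (q 0 \<omega>)) = B.expectation (\<lambda>\<omega>. \<phi>' (q 0 \<omega>) * V \<omega>) - B.expectation (\<lambda>\<omega>. \<phi> (q 0 \<omega>) * (K' (q1 0 \<omega>) * q2 0 \<omega>))"
    by (subst \<Psi>eq) (use i\<Psi> i1 i2 \<Psi>0 in simp)
  moreover have "\<bar>B.expectation (\<lambda>\<omega>. \<phi>' (q 0 \<omega>) * V \<omega>)\<bar> \<le> B.expectation V"
    by (rule order_trans[OF integral_abs_bound], rule integral_mono) (use i1 iV b1 in auto)
  moreover have "\<bar>B.expectation (\<lambda>\<omega>. \<phi> (q 0 \<omega>) * (K' (q1 0 \<omega>) * q2 0 \<omega>))\<bar> \<le> B.expectation (\<lambda>\<omega>. t / k * \<bar>q2 0 \<omega>\<bar>)"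
    by (rule order_trans[OF integral_abs_bound], rule integral_mono) (use i2 iq2 b2 in auto)
  moreover have "B.expectation (\<lambda>\<omega>. t / k * \<bar>q2 0 \<omega>\<bar>) \<le> t / k * (\<beta>\<^sup>2 * sqrt (second_const d))"
    using Eq2 t k by (simp add: mult_left_mono divide_right_mono)
  ultimately have "\<bar>B.expectation (\<lambda>\<omega>. \<phi>' (q 0 \<omega>))\<bar> \<le> B.expectation V + t / k * (\<beta>\<^sup>2 * sqrt (second_const d))"
    by linarith
  moreover have "B.expectation (\<lambda>\<omega>. \<phi>' (q 0 \<omega>)) = (\<integral>\<omega>. h (Q \<omega>) \<partial>?P) - (\<integral>\<omega>. avg t h (Q \<omega>) \<partial>?P)"
  proof -
    have "integrable ?P (\<lambda>\<omega>. h (q 0 \<omega>))" "integrable ?P (\<lambda>\<omega>. avg t h (q 0 \<omega>))"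
      using h01 by (auto intro!: bnd)
    then show ?thesis unfolding \<phi>'_def q0(1) by simp
  qed
  ultimately show ?thesis unfolding V_def q0(2) \<beta>_def by simp
qed

subsection \<open>Universality for rotation-invariant blocks\<close>

text \<open>Points of a product space are fixed outside I, whereas the image under the maps
  \<open>g i\<close> is not; \<open>dep\<close> expresses that f sees only the coordinates in
  I.\<close>

lemma integral_PiM_map:
  fixes f :: "(nat \<Rightarrow> 'c) \<Rightarrow> real"
  assumes "finite I" "I \<noteq> {}" "\<And>i. i \<in> I \<Longrightarrow> prob_space (S i)" "\<And>i. i \<in> I \<Longrightarrow> g i \<in> measurable (S i) (R i)"
    and law: "\<And>i. i \<in> I \<Longrightarrow> distr (S i) (R i) (g i) = R i" and f: "f \<in> borel_measurable (PiM I R)"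
    and dep: "\<And>\<omega>. f (\<lambda>i\<in>I. \<omega> i) = f \<omega>"
  shows "(\<integral>\<omega>. f (\<lambda>i. g i (\<omega> i)) \<partial>PiM I S) = (\<integral>\<omega>. f \<omega> \<partial>PiM I R)"
proof -
  let ?T = "\<lambda>\<omega>. \<lambda>i\<in>I. g i (\<omega> i)"
  have T: "?T \<in> measurable (PiM I S) (PiM I R)"
  proof (rule measurable_restrict)
    fix i assume i: "i \<in> I"
    show "(\<lambda>\<omega>. g i (\<omega> i)) \<in> measurable (PiM I S) (R i)"
      by (rule measurable_compose[of "\<lambda>\<omega>. \<omega> i" _ "S i"]) (use i assms in auto)
  qed
  have "distr (PiM I S) (PiM I R) ?T = PiM I (\<lambda>i. distr (S i) (R i) (g i))"
    using assms by (intro distr_PiM_map) auto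
  also have "\<dots> = PiM I R" using law by (intro PiM_cong) auto
  finally have "(\<integral>\<omega>. f (?T \<omega>) \<partial>PiM I S) = (\<integral>\<omega>. f \<omega> \<partial>PiM I R)"
    using integral_distr[OF T f] by simp
  then show ?thesis using dep[of "\<lambda>i. g i (_ i)"] by simp
qed

lemma form_restrict:
  "form b I c (\<lambda>i. f (restrict \<omega> I i)) (\<lambda>i. g (restrict \<omega> I i)) = form b I c (\<lambda>i. f (\<omega> i)) (\<lambda>i. g (\<omega> i))"
  by (rule form_cong) auto

lemma coordinate_form_measurable:
  assumes "\<And>i. i \<in> I \<Longrightarrow> f \<in> borel_measurable (S i)" "\<And>i. i \<in> I \<Longrightarrow> g \<in> borel_measurable (S i)"
  shows "(\<lambda>\<omega>. form b I c (\<lambda>i. f (\<omega> i)) (\<lambda>i. g (\<omega> i))) \<in> borel_measurable (PiM I S)"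
proof (rule borel_measurable_form)
  fix i assume i: "i \<in> I"
  show "(\<lambda>\<omega>. f (\<omega> i)) \<in> borel_measurable (PiM I S)" "(\<lambda>\<omega>. g (\<omega> i)) \<in> borel_measurable (PiM I S)"
    by (rule measurable_compose[of "\<lambda>\<omega>. \<omega> i" _ "S i"]; use i assms in auto)+
qed

text \<open>One statement for two uses: (b, \<zeta>) = (1, 0) is the value of the form, and (0, 1)
  its derivative in the direction w. The factor \<open>sqrt s\<close> gives the Gaussian direction
  the second moment of w.\<close>

lemma gaussian_comparison_bound:
  assumes uf: "unit_form d I c" and \<nu>: "\<And>i. i \<in> I \<Longrightarrow> rot_block \<alpha> \<kappa> e s (\<nu> i)"
    and e: "0 < e" and \<kappa>: "0 \<le> \<kappa>" and R: "1 \<le> R" and \<tau>: "0 < \<tau>" "\<And>i. i \<in> I \<Longrightarrow> influence I c i \<le> \<tau>"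
    and \<psi>: "smooth3 m1 m2 m3 \<psi>" and b: "b\<^sup>2 \<le> 1" and \<zeta>: "\<zeta> \<in> {0, 1}"
  defines "\<epsilon> \<equiv> \<kappa> * R powr - e" and "K \<equiv> 16 * R ^ 4 + 3"
  shows "\<bar>(\<integral>\<omega>. \<psi> (form b I c (\<lambda>i. val \<alpha> (\<omega> i)) (\<lambda>i. \<zeta> * snd (snd (\<omega> i)))) \<partial>PiM I \<nu>) -
     (\<integral>\<omega>. \<psi> (form b I c (\<lambda>i. fst (\<omega> i)) (\<lambda>i. \<zeta> * sqrt s * snd (\<omega> i))) \<partial>gauss_blocks I)\<bar>
    \<le> m1 * sqrt (\<epsilon> * diff_const d) + real d * (2 * 6 ^ d * (2 * sqrt \<epsilon>) * m2 + 20 * K * (256 * K) ^ d * m3 * sqrt \<tau>)"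
proof -
  have I: "finite I" "I \<noteq> {}" and hom: "\<forall>S\<subseteq>I. card S \<noteq> d \<longrightarrow> c S = 0" and n: "coef_norm I c \<le> 1"
    using uf unfolding unit_form_def by auto
  \<comment> \<open>Each original block is paired with its Gaussian replacement inside one
    independent block, so that exchanging them leaves the independence structure untouched.\<close>
  define S where "S = (\<lambda>i. \<nu> i \<Otimes>\<^sub>M gauss2)"
  note pg = prob_space_pair[OF prob_space_std_gauss prob_space_std_gauss]
  have p: "prob_space (\<nu> i)" and sb: "sets (\<nu> i) = sets borel" if "i \<in> I" for i
    using rot_block_moments[OF \<nu>[OF that]] by auto
  have pS: "prob_space (S i)" if "i \<in> I" for i unfolding S_def by (rule prob_space_pair[OF p[OF that] pg])
  interpret B: indep_blocks "PiM I S" "coord_algebra I S" I using I pS by (intro indep_blocks_PiM) auto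
  obtain i0 where i0: "i0 \<in> I" using I by auto
  have s01: "0 \<le> s" "s \<le> 1" using rot_block_moments[OF \<nu>[OF i0]] by auto
  have mg: "(fst :: real \<times> real \<Rightarrow> real) \<in> borel_measurable gauss2" "(snd :: real \<times> real \<Rightarrow> real) \<in> borel_measurable gauss2"
    using measurable_fst[of std_gauss std_gauss] measurable_snd[of std_gauss std_gauss] by (simp_all cong: measurable_cong_sets)
  let ?X = "\<lambda>z :: block \<times> real \<times> real. val \<alpha> (fst z)" and ?Y = "\<lambda>z :: block \<times> real \<times> real. \<zeta> * snd (snd (fst z))"
  let ?X' = "\<lambda>z :: block \<times> real \<times> real. fst (snd z)" and ?Y' = "\<lambda>z :: block \<times> real \<times> real. \<zeta> * sqrt s * snd (snd z)"
  have m1: "f \<in> borel_measurable (\<nu> i)" if "i \<in> I" "f \<in> borel_measurable borel" for f :: "block \<Rightarrow> real" and i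
    using that sb[OF that(1)] by (simp cong: measurable_cong_sets)
  have mS1: "(\<lambda>z. f (fst z)) \<in> borel_measurable (S i)" if "i \<in> I" "f \<in> borel_measurable borel" for f :: "block \<Rightarrow> real" and i
    unfolding S_def by (rule measurable_compose[OF measurable_fst m1[OF that]])
  have mS2: "(\<lambda>z. f (snd z)) \<in> borel_measurable (S i)" if "f \<in> borel_measurable gauss2" for f :: "real \<times> real \<Rightarrow> real" and i
    unfolding S_def by (rule measurable_compose[OF measurable_snd that])
  have int1: "integral\<^sup>L (S i) (\<lambda>z. f (fst z)) = integral\<^sup>L (\<nu> i) f" "integrable (S i) (\<lambda>z. f (fst z)) \<longleftrightarrow> integrable (\<nu> i) f"
    if "i \<in> I" "f \<in> borel_measurable borel" for f :: "block \<Rightarrow> real" and i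
    unfolding S_def using pair_marginal_integral(1,2)[OF p[OF that(1)] pg m1[OF that]] by auto
  have int2: "integral\<^sup>L (S i) (\<lambda>z. f (snd z)) = integral\<^sup>L gauss2 f" "integrable (S i) (\<lambda>z. f (snd z)) \<longleftrightarrow> integrable gauss2 f"
    if "i \<in> I" "f \<in> borel_measurable gauss2" for f :: "real \<times> real \<Rightarrow> real" and i
    unfolding S_def using pair_marginal_integral(3,4)[OF p[OF that(1)] pg that(2)] by auto
  have mm: "?X \<in> borel_measurable (S i)" "(\<lambda>z. snd (snd (fst z))) \<in> borel_measurable (S i)" "?X' \<in> borel_measurable (S i)"
    "(\<lambda>z. snd (snd z)) \<in> borel_measurable (S i)" if "i \<in> I" for i
    using mS1[OF that measurable_block(4)] mS1[OF that measurable_block(3)] mS2[OF mg(1)] mS2[OF mg(2)] by auto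
  have mmY: "?Y \<in> borel_measurable (S i)" "?Y' \<in> borel_measurable (S i)" if "i \<in> I" for i
    using mm[OF that] by auto
  have \<zeta>2: "\<zeta>\<^sup>2 = \<zeta>" "\<zeta> ^ 4 = \<zeta>" "0 \<le> \<zeta>" "\<zeta> \<le> 1" using \<zeta> by auto
  have mom: "integral\<^sup>L (S i) ?X = 0" "integral\<^sup>L (S i) ?Y = 0" "integral\<^sup>L (S i) ?X' = 0" "integral\<^sup>L (S i) ?Y' = 0"
    "integrable (S i) (\<lambda>z. (?X z)\<^sup>2)" "integrable (S i) (\<lambda>z. (?Y z)\<^sup>2)" "integrable (S i) (\<lambda>z. (?X' z)\<^sup>2)" "integrable (S i) (\<lambda>z. (?Y' z)\<^sup>2)"
    "integrable (S i) (\<lambda>z. (?Y z) ^ 4)" "integrable (S i) (\<lambda>z. (?X' z) ^ 4)" "integrable (S i) (\<lambda>z. (?Y' z) ^ 4)"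
    "integral\<^sup>L (S i) (\<lambda>z. (?X z)\<^sup>2) = 1" "integral\<^sup>L (S i) (\<lambda>z. (?Y z)\<^sup>2) = \<zeta> * s" "integral\<^sup>L (S i) (\<lambda>z. (?X' z)\<^sup>2) = 1"
    "integral\<^sup>L (S i) (\<lambda>z. (?Y' z)\<^sup>2) = \<zeta> * s" "integral\<^sup>L (S i) (\<lambda>z. ?X z * ?Y z) = 0" "integral\<^sup>L (S i) (\<lambda>z. ?X' z * ?Y' z) = 0"
    "integral\<^sup>L (S i) (\<lambda>z. (?Y z) ^ 4) \<le> 3" "integral\<^sup>L (S i) (\<lambda>z. (?X' z) ^ 4) \<le> 3" "integral\<^sup>L (S i) (\<lambda>z. (?Y' z) ^ 4) \<le> 3"
    "integrable (S i) (\<lambda>z. \<bar>?X z\<bar> powr (2 + e))" "integral\<^sup>L (S i) (\<lambda>z. \<bar>?X z\<bar> powr (2 + e)) \<le> \<kappa>"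
    if i: "i \<in> I" for i
  proof -
    note r = rot_block_moments[OF \<nu>[OF i]] and r' = \<nu>[OF i, unfolded rot_block_def]
    note i1 = int1[OF i] and i2 = int2[OF i]
    show "integral\<^sup>L (S i) ?X = 0" "integrable (S i) (\<lambda>z. (?X z)\<^sup>2)" "integral\<^sup>L (S i) (\<lambda>z. (?X z)\<^sup>2) = 1"
      "integrable (S i) (\<lambda>z. \<bar>?X z\<bar> powr (2 + e))" "integral\<^sup>L (S i) (\<lambda>z. \<bar>?X z\<bar> powr (2 + e)) \<le> \<kappa>"
      using i1[of "val \<alpha>"] i1[of "\<lambda>z. (val \<alpha> z)\<^sup>2"] i1[of "\<lambda>z. \<bar>val \<alpha> z\<bar> powr (2 + e)"] r' by auto
    show "integral\<^sup>L (S i) ?Y = 0" "integrable (S i) (\<lambda>z. (?Y z)\<^sup>2)" "integral\<^sup>L (S i) (\<lambda>z. (?Y z)\<^sup>2) = \<zeta> * s"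
      using i1[of "\<lambda>z. snd (snd z)"] i1[of "\<lambda>z. (snd (snd z))\<^sup>2"] r r' \<zeta>2 by (auto simp: power_mult_distrib)
    show "integrable (S i) (\<lambda>z. (?Y z) ^ 4)" using i1[of "\<lambda>z. (snd (snd z)) ^ 4"] r' by (auto simp: power_mult_distrib)
    have "integral\<^sup>L (S i) (\<lambda>z. (?Y z) ^ 4) = \<zeta> * (\<integral>z. (snd (snd z)) ^ 4 \<partial>\<nu> i)"
      using i1[of "\<lambda>z. (snd (snd z)) ^ 4"] \<zeta>2 by (simp add: power_mult_distrib)
    also have "\<dots> \<le> 1 * 1" using r' \<zeta>2 by (intro mult_mono) auto
    finally show "integral\<^sup>L (S i) (\<lambda>z. (?Y z) ^ 4) \<le> 3" by simp
    have "(\<lambda>z. ?X z * ?Y z) = (\<lambda>z. \<zeta> * (val \<alpha> (fst z) * snd (snd (fst z))))" by auto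
    then show "integral\<^sup>L (S i) (\<lambda>z. ?X z * ?Y z) = 0" using i1(1)[of "\<lambda>z. val \<alpha> z * snd (snd z)"] r by simp
    show "integral\<^sup>L (S i) ?X' = 0" "integrable (S i) (\<lambda>z. (?X' z)\<^sup>2)" "integral\<^sup>L (S i) (\<lambda>z. (?X' z)\<^sup>2) = 1"
      "integrable (S i) (\<lambda>z. (?X' z) ^ 4)" "integral\<^sup>L (S i) (\<lambda>z. (?X' z) ^ 4) \<le> 3"
      using i2[of fst] i2[of "\<lambda>z. (fst z)\<^sup>2"] i2[of "\<lambda>z. fst z ^ 4"] gauss2_moments mg by auto
    show "integral\<^sup>L (S i) ?Y' = 0" "integrable (S i) (\<lambda>z. (?Y' z)\<^sup>2)" "integral\<^sup>L (S i) (\<lambda>z. (?Y' z)\<^sup>2) = \<zeta> * s" "integrable (S i) (\<lambda>z. (?Y' z) ^ 4)"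
      using i2[of snd] i2[of "\<lambda>z. (snd z)\<^sup>2"] i2[of "\<lambda>z. snd z ^ 4"] gauss2_moments mg \<zeta>2 s01 by (auto simp: power_mult_distrib)
    have "integral\<^sup>L (S i) (\<lambda>z. (?Y' z) ^ 4) = \<zeta> * s\<^sup>2 * 3"
      using i2[of "\<lambda>z. (snd z) ^ 4"] mg gauss2_moments \<zeta>2 s01 real_sqrt_pow2[of s] power_mult[of "sqrt s" 2 2] by (simp add: power_mult_distrib)
    also have "\<dots> \<le> 1 * 1 * 3" using \<zeta>2 s01 by (intro mult_mono) (auto intro: power_le_one)
    finally show "integral\<^sup>L (S i) (\<lambda>z. (?Y' z) ^ 4) \<le> 3" by simp
    have "(\<lambda>z. ?X' z * ?Y' z) = (\<lambda>z. \<zeta> * sqrt s * (fst (snd z) * snd (snd z)))" by auto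
    then show "integral\<^sup>L (S i) (\<lambda>z. ?X' z * ?Y' z) = 0" using i2(1)[of "\<lambda>z. fst z * snd z"] mg gauss2_moments by simp
  qed
  have law: "B.expectation (\<lambda>\<omega>. f (\<omega> i)) = integral\<^sup>L (S i) f" "integrable (PiM I S) (\<lambda>\<omega>. f (\<omega> i)) \<longleftrightarrow> integrable (S i) f"
    if "i \<in> I" "f \<in> borel_measurable (S i)" for f :: "block \<times> real \<times> real \<Rightarrow> real" and i
    using PiM_coordinate_law[of I S i f] pS that by blast+
  have rv: "B.block_rv i (\<lambda>\<omega>. ?X (\<omega> i))" "B.block_rv i (\<lambda>\<omega>. ?Y (\<omega> i))" "B.block_rv i (\<lambda>\<omega>. ?X' (\<omega> i))" "B.block_rv i (\<lambda>\<omega>. ?Y' (\<omega> i))"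
    if i: "i \<in> I" for i
    using coordinate_block_rv[where S = S, OF I(1) pS i mm(1)[OF i] mom(5)[OF i] mom(1)[OF i]] coordinate_block_rv[where S = S, OF I(1) pS i mmY(1)[OF i] mom(6)[OF i] mom(2)[OF i]]
      coordinate_block_rv[where S = S, OF I(1) pS i mm(3)[OF i] mom(7)[OF i] mom(3)[OF i]] coordinate_block_rv[where S = S, OF I(1) pS i mmY(2)[OF i] mom(8)[OF i] mom(4)[OF i]] by auto
  have L4: "B.L4 (\<lambda>\<omega>. ?Y (\<omega> i))" "B.L4 (\<lambda>\<omega>. ?X' (\<omega> i))" "B.L4 (\<lambda>\<omega>. ?Y' (\<omega> i))" if i: "i \<in> I" for i
    using coordinate_L4[where S = S, OF I(1) pS i mmY(1)[OF i] mom(9)[OF i]] coordinate_L4[where S = S, OF I(1) pS i mm(3)[OF i] mom(10)[OF i]]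
      coordinate_L4[where S = S, OF I(1) pS i mmY(2)[OF i] mom(11)[OF i]] by auto
  have E: "B.expectation (\<lambda>\<omega>. (?X (\<omega> i))\<^sup>2) = 1" "B.expectation (\<lambda>\<omega>. (?X' (\<omega> i))\<^sup>2) = 1"
    "B.expectation (\<lambda>\<omega>. (?Y (\<omega> i))\<^sup>2) = \<zeta> * s" "B.expectation (\<lambda>\<omega>. (?Y' (\<omega> i))\<^sup>2) = \<zeta> * s"
    "B.expectation (\<lambda>\<omega>. ?X (\<omega> i) * ?Y (\<omega> i)) = 0" "B.expectation (\<lambda>\<omega>. ?X' (\<omega> i) * ?Y' (\<omega> i)) = 0"
    "B.expectation (\<lambda>\<omega>. (?Y (\<omega> i)) ^ 4) \<le> 3" "B.expectation (\<lambda>\<omega>. (?X' (\<omega> i)) ^ 4) \<le> 3" "B.expectation (\<lambda>\<omega>. (?Y' (\<omega> i)) ^ 4) \<le> 3"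
    "integrable (PiM I S) (\<lambda>\<omega>. \<bar>?X (\<omega> i)\<bar> powr (2 + e))" "B.expectation (\<lambda>\<omega>. \<bar>?X (\<omega> i)\<bar> powr (2 + e)) \<le> \<kappa>" if i: "i \<in> I" for i
  proof -
    note M = mm[OF i] mmY[OF i]
    note sq = borel_measurable_power[OF M(1), of 2] borel_measurable_power[OF M(3), of 2] borel_measurable_power[OF M(5), of 2] borel_measurable_power[OF M(6), of 2]
      borel_measurable_power[OF M(5), of 4] borel_measurable_power[OF M(3), of 4] borel_measurable_power[OF M(6), of 4]
      borel_measurable_times[OF M(1) M(5)] borel_measurable_times[OF M(3) M(6)]
    have pw: "(\<lambda>z. \<bar>?X z\<bar> powr (2 + e)) \<in> borel_measurable (S i)" using M(1) by measurable
    show "B.expectation (\<lambda>\<omega>. (?X (\<omega> i))\<^sup>2) = 1" "B.expectation (\<lambda>\<omega>. (?X' (\<omega> i))\<^sup>2) = 1"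
      "B.expectation (\<lambda>\<omega>. (?Y (\<omega> i))\<^sup>2) = \<zeta> * s" "B.expectation (\<lambda>\<omega>. (?Y' (\<omega> i))\<^sup>2) = \<zeta> * s"
      "B.expectation (\<lambda>\<omega>. ?X (\<omega> i) * ?Y (\<omega> i)) = 0" "B.expectation (\<lambda>\<omega>. ?X' (\<omega> i) * ?Y' (\<omega> i)) = 0"
      "B.expectation (\<lambda>\<omega>. (?Y (\<omega> i)) ^ 4) \<le> 3" "B.expectation (\<lambda>\<omega>. (?X' (\<omega> i)) ^ 4) \<le> 3" "B.expectation (\<lambda>\<omega>. (?Y' (\<omega> i)) ^ 4) \<le> 3"
      "integrable (PiM I S) (\<lambda>\<omega>. \<bar>?X (\<omega> i)\<bar> powr (2 + e))" "B.expectation (\<lambda>\<omega>. \<bar>?X (\<omega> i)\<bar> powr (2 + e)) \<le> \<kappa>"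
      unfolding law(1)[OF i sq(1)] law(1)[OF i sq(2)] law(1)[OF i sq(3)] law(1)[OF i sq(4)] law(1)[OF i sq(5)] law(1)[OF i sq(6)]
        law(1)[OF i sq(7)] law(1)[OF i sq(8)] law(1)[OF i sq(9)] law(1)[OF i pw] law(2)[OF i pw]
      using mom[OF i] by (simp_all only:)
  qed
  have \<zeta>s: "0 \<le> \<zeta> * s" "\<zeta> * s \<le> 1" using \<zeta>2 s01 by (auto intro: mult_le_one)
  have main: "\<bar>B.expectation (\<lambda>\<omega>. \<psi> (form b I c (\<lambda>i. ?X (\<omega> i)) (\<lambda>i. ?Y (\<omega> i)))) -
      B.expectation (\<lambda>\<omega>. \<psi> (form b I c (\<lambda>i. ?X' (\<omega> i)) (\<lambda>i. ?Y' (\<omega> i))))\<bar>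
    \<le> m1 * sqrt (\<epsilon> * diff_const d) + real d * (2 * 6 ^ d * (2 * sqrt \<epsilon>) * m2 + 20 * K * (256 * K) ^ d * m3 * sqrt \<tau>)"
    unfolding \<epsilon>_def K_def
    by (rule B.invariance[OF rv E(1,10,11) e \<kappa> R L4 E(7,8,9) E(2,5,6,3,4) \<zeta>s \<psi> b deg_le_if_homogeneous[OF hom] \<tau>(2,1) n])
  have m\<psi>: "\<psi> \<in> borel_measurable borel" by (rule smooth3_measurable[OF \<psi>])
  have t1: "B.expectation (\<lambda>\<omega>. \<psi> (form b I c (\<lambda>i. ?X (\<omega> i)) (\<lambda>i. ?Y (\<omega> i)))) =
      (\<integral>\<omega>. \<psi> (form b I c (\<lambda>i. val \<alpha> (\<omega> i)) (\<lambda>i. \<zeta> * snd (snd (\<omega> i)))) \<partial>PiM I \<nu>)"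
  proof (rule integral_PiM_map[where S = S and g = "\<lambda>_. fst" and f = "\<lambda>\<omega>. \<psi> (form b I c (\<lambda>i. val \<alpha> (\<omega> i)) (\<lambda>i. \<zeta> * snd (snd (\<omega> i))))", OF I pS])
    show "distr (S i) (\<nu> i) fst = \<nu> i" if "i \<in> I" for i unfolding S_def by (rule distr_pair_marginals(1)[OF p[OF that] pg])
    show "(\<lambda>\<omega>. \<psi> (form b I c (\<lambda>i. val \<alpha> (\<omega> i)) (\<lambda>i. \<zeta> * snd (snd (\<omega> i))))) \<in> borel_measurable (PiM I \<nu>)"
      by (rule measurable_compose[OF _ m\<psi>], rule coordinate_form_measurable[where f = "val \<alpha>" and g = "\<lambda>z. \<zeta> * snd (snd z)"]) (auto intro!: m1)
  qed (auto simp: S_def form_restrict intro!: arg_cong[where f = \<psi>] form_cong)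
  have t2: "B.expectation (\<lambda>\<omega>. \<psi> (form b I c (\<lambda>i. ?X' (\<omega> i)) (\<lambda>i. ?Y' (\<omega> i)))) =
      (\<integral>\<omega>. \<psi> (form b I c (\<lambda>i. fst (\<omega> i)) (\<lambda>i. \<zeta> * sqrt s * snd (\<omega> i))) \<partial>gauss_blocks I)"
  proof (rule integral_PiM_map[where S = S and g = "\<lambda>_. snd" and f = "\<lambda>\<omega>. \<psi> (form b I c (\<lambda>i. fst (\<omega> i)) (\<lambda>i. \<zeta> * sqrt s * snd (\<omega> i)))", OF I pS])
    show "distr (S i) gauss2 snd = gauss2" if "i \<in> I" for i unfolding S_def by (rule distr_pair_marginals(2)[OF p[OF that] pg])
    show "(\<lambda>\<omega>. \<psi> (form b I c (\<lambda>i. fst (\<omega> i)) (\<lambda>i. \<zeta> * sqrt s * snd (\<omega> i)))) \<in> borel_measurable (gauss_blocks I)"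
      by (rule measurable_compose[OF _ m\<psi>], rule coordinate_form_measurable[where f = fst and g = "\<lambda>z. \<zeta> * sqrt s * snd z"]) (use mg in auto)
  qed (auto simp: S_def form_restrict intro!: arg_cong[where f = \<psi>] form_cong)
  show ?thesis using main unfolding t1 t2 .
qed

lemma gaussian_comparison:
  fixes d :: nat and \<kappa> e m1 m2 m3 \<eta> :: real
  assumes e: "0 < e" and \<kappa>: "0 \<le> \<kappa>" and \<eta>: "0 < \<eta>"
  shows "\<exists>\<tau>>0. \<forall>I c \<nu> \<psi> b \<zeta>. unit_form d I c \<longrightarrow> (\<forall>i\<in>I. rot_block \<alpha> \<kappa> e s (\<nu> i)) \<longrightarrow> (\<forall>i\<in>I. influence I c i \<le> \<tau>) \<longrightarrow>
     smooth3 m1 m2 m3 \<psi> \<longrightarrow> b\<^sup>2 \<le> 1 \<longrightarrow> \<zeta> \<in> {0, 1} \<longrightarrow>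
     \<bar>(\<integral>\<omega>. \<psi> (form b I c (\<lambda>i. val \<alpha> (\<omega> i)) (\<lambda>i. \<zeta> * snd (snd (\<omega> i)))) \<partial>PiM I \<nu>) -
     (\<integral>\<omega>. \<psi> (form b I c (\<lambda>i. fst (\<omega> i)) (\<lambda>i. \<zeta> * sqrt s * snd (\<omega> i))) \<partial>gauss_blocks I)\<bar> \<le> \<eta>"
proof -
  \<comment> \<open>Collects the terms proportional to the root of \<kappa> R^(-e). They do not
    involve the influences and are made small by R alone.\<close>
  define L where "L = m1 * sqrt (diff_const d) + real d * (2 * 6 ^ d * 2 * m2)"
  have "((\<lambda>R. L * sqrt (\<kappa> * R powr - e)) \<longlongrightarrow> L * sqrt (\<kappa> * 0)) at_top"
    by (intro tendsto_intros tendsto_neg_powr filterlim_ident) (use e in auto)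
  then have "eventually (\<lambda>R. L * sqrt (\<kappa> * R powr - e) < \<eta> / 2) at_top"
    using \<eta> by (intro order_tendstoD(2)[of _ 0]) auto
  then have "eventually (\<lambda>R. L * sqrt (\<kappa> * R powr - e) < \<eta> / 2 \<and> 1 \<le> R) at_top"
    using eventually_ge_at_top[of 1] by eventually_elim simp
  then obtain R where R: "L * sqrt (\<kappa> * R powr - e) < \<eta> / 2" "1 \<le> R"
    using eventually_happens'[OF trivial_limit_at_top_linorder] by blast
  define K where "K = 16 * R ^ 4 + 3"
  define L' where "L' = real d * (20 * K * (256 * K) ^ d * m3)"
  \<comment> \<open>R is fixed at this point and with it the constant K, so the remaining term is a
    multiple of \<open>sqrt \<tau>\<close>; the added 1 avoids division by 0.\<close>
  define \<tau> where "\<tau> = (\<eta> / (2 * (\<bar>L'\<bar> + 1)))\<^sup>2"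
  have \<tau>: "0 < \<tau>" "sqrt \<tau> = \<eta> / (2 * (\<bar>L'\<bar> + 1))" using \<eta> by (auto simp: \<tau>_def)
  have "L' * sqrt \<tau> \<le> \<bar>L'\<bar> * sqrt \<tau>" using \<tau>(1) by (intro mult_right_mono) auto
  also have "\<dots> \<le> \<eta> / 2"
  proof -
    have "\<bar>L'\<bar> * \<eta> \<le> (\<bar>L'\<bar> + 1) * \<eta>" using \<eta> by (intro mult_right_mono) auto
    then show ?thesis unfolding \<tau>(2) by (simp add: field_simps)
  qed
  finally have L': "L' * sqrt \<tau> \<le> \<eta> / 2" .
  show ?thesis
  proof (intro exI[of _ \<tau>] conjI allI impI)
    show "0 < \<tau>" by fact
    fix I c \<nu> \<psi> and b \<zeta> :: real
    assume a: "unit_form d I c" "\<forall>i\<in>I. rot_block \<alpha> \<kappa> e s (\<nu> i)" "\<forall>i\<in>I. influence I c i \<le> \<tau>" "smooth3 m1 m2 m3 \<psi>" "b\<^sup>2 \<le> 1" "\<zeta> \<in> {0, 1}"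
    have "\<bar>(\<integral>\<omega>. \<psi> (form b I c (\<lambda>i. val \<alpha> (\<omega> i)) (\<lambda>i. \<zeta> * snd (snd (\<omega> i)))) \<partial>PiM I \<nu>) -
     (\<integral>\<omega>. \<psi> (form b I c (\<lambda>i. fst (\<omega> i)) (\<lambda>i. \<zeta> * sqrt s * snd (\<omega> i))) \<partial>gauss_blocks I)\<bar>
     \<le> m1 * sqrt (\<kappa> * R powr - e * diff_const d) + real d * (2 * 6 ^ d * (2 * sqrt (\<kappa> * R powr - e)) * m2 + 20 * K * (256 * K) ^ d * m3 * sqrt \<tau>)"
      unfolding K_def using a by (intro gaussian_comparison_bound[OF a(1) _ e \<kappa> R(2) \<tau>(1) _ a(4) a(5) a(6)]) auto
    also have "\<dots> = L * sqrt (\<kappa> * R powr - e) + L' * sqrt \<tau>"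
      unfolding L_def L'_def real_sqrt_mult by (simp add: algebra_simps)
    also have "\<dots> \<le> \<eta>" using R(1) L' by linarith
    finally show "\<bar>(\<integral>\<omega>. \<psi> (form b I c (\<lambda>i. val \<alpha> (\<omega> i)) (\<lambda>i. \<zeta> * snd (snd (\<omega> i)))) \<partial>PiM I \<nu>) -
     (\<integral>\<omega>. \<psi> (form b I c (\<lambda>i. fst (\<omega> i)) (\<lambda>i. \<zeta> * sqrt s * snd (\<omega> i))) \<partial>gauss_blocks I)\<bar> \<le> \<eta>" .
  qed
qed

text \<open>Equal to 1 up to 4 \<delta> and to 0 from 5 \<delta> on. Three averages of width
  \<delta> evaluate it at a point less than 3 \<delta> to the right, so the averaged bump lies
  between the indicators of the radii \<delta> and 8 \<delta>.\<close>

definition bump :: "real \<Rightarrow> real \<Rightarrow> real" where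
  "bump \<delta> x = max 0 (min 1 (5 - \<bar>x\<bar> / \<delta>))"

abbreviation avg3 :: "real \<Rightarrow> (real \<Rightarrow> real) \<Rightarrow> real \<Rightarrow> real" where
  "avg3 t h \<equiv> avg t (avg t (avg t h))"

lemma unit_cont_avg3: "unit_cont h \<Longrightarrow> 0 < t \<Longrightarrow> unit_cont (avg3 t h)"
  by (intro unit_cont_avg)

lemma unit_cont_measurable: "unit_cont h \<Longrightarrow> h \<in> borel_measurable borel"
  by (simp add: unit_cont_def borel_measurable_continuous_onI)

lemma unit_cont_bump: "0 < \<delta> \<Longrightarrow> unit_cont (bump \<delta>)"
  unfolding unit_cont_def bump_def by (auto intro!: continuous_intros)

lemma avg3_bump:
  assumes \<delta>: "0 < \<delta>"
  shows "indicat_real {x. \<bar>x\<bar> \<le> \<delta>} x \<le> avg3 \<delta> (bump \<delta>) x" "avg3 \<delta> (bump \<delta>) x \<le> indicat_real {x. \<bar>x\<bar> \<le> 8 * \<delta>} x"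
proof -
  have u: "unit_cont (bump \<delta>)" "unit_cont (avg \<delta> (bump \<delta>))" "unit_cont (avg \<delta> (avg \<delta> (bump \<delta>)))" "unit_cont (avg3 \<delta> (bump \<delta>))"
    using unit_cont_bump[OF \<delta>] \<delta> by (auto intro!: unit_cont_avg)
  then have c: "continuous_on UNIV (bump \<delta>)" "continuous_on UNIV (avg \<delta> (bump \<delta>))" "continuous_on UNIV (avg \<delta> (avg \<delta> (bump \<delta>)))"
    by (auto simp: unit_cont_def)
  obtain x1 where x1: "x < x1" "x1 < x + \<delta>" "avg3 \<delta> (bump \<delta>) x = avg \<delta> (avg \<delta> (bump \<delta>)) x1" using avg_value[OF c(3) \<delta>] by blast
  obtain x2 where x2: "x1 < x2" "x2 < x1 + \<delta>" "avg \<delta> (avg \<delta> (bump \<delta>)) x1 = avg \<delta> (bump \<delta>) x2" using avg_value[OF c(2) \<delta>] by blast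
  obtain x3 where x3: "x2 < x3" "x3 < x2 + \<delta>" "avg \<delta> (bump \<delta>) x2 = bump \<delta> x3" using avg_value[OF c(1) \<delta>] by blast
  have eq: "avg3 \<delta> (bump \<delta>) x = bump \<delta> x3" and rng: "x < x3" "x3 < x + 3 * \<delta>" using x1 x2 x3 by auto
  have b01: "0 \<le> bump \<delta> x3" "bump \<delta> x3 \<le> 1" by (auto simp: bump_def)
  show "indicat_real {x. \<bar>x\<bar> \<le> \<delta>} x \<le> avg3 \<delta> (bump \<delta>) x"
  proof (cases "\<bar>x\<bar> \<le> \<delta>")
    case True
    then have "\<bar>x3\<bar> / \<delta> \<le> 4" using rng \<delta> by (simp add: pos_divide_le_eq abs_le_iff)
    then show ?thesis unfolding eq by (simp add: bump_def indicator_def)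
  qed (use b01 eq in auto)
  show "avg3 \<delta> (bump \<delta>) x \<le> indicat_real {x. \<bar>x\<bar> \<le> 8 * \<delta>} x"
  proof (cases "\<bar>x\<bar> \<le> 8 * \<delta>")
    case False
    then have "5 \<le> \<bar>x3\<bar> / \<delta>" using rng \<delta> by (simp add: pos_le_divide_eq)
    then show ?thesis unfolding eq using False by (simp add: bump_def)
  qed (use b01 eq in auto)
qed

text \<open>The scale t and the threshold \<tau> depend on neither the form nor h. One averaging
  costs four portions \<eta> / 12: Gaussian comparison for the derivative, Gaussian small ball, the
  regularisation where the derivative is not small, and the second-derivative term. Three averagings
  make \<eta>.\<close>

lemma smoothing_error:
  assumes d: "1 \<le> d" and e: "0 < e" and \<kappa>: "0 \<le> \<kappa>" and \<alpha>: "0 < \<alpha>" and s: "0 < s" and \<eta>: "0 < \<eta>"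
  shows "\<exists>t>0. \<exists>\<tau>>0. \<forall>I c \<nu> h. unit_form d I c \<longrightarrow> (\<forall>i\<in>I. rot_block \<alpha> \<kappa> e s (\<nu> i)) \<longrightarrow> (\<forall>i\<in>I. influence I c i \<le> \<tau>) \<longrightarrow> unit_cont h \<longrightarrow>
     \<bar>(\<integral>\<omega>. h (form 1 I c (\<lambda>i. val \<alpha> (\<omega> i)) (\<lambda>_. 0)) \<partial>PiM I \<nu>) - (\<integral>\<omega>. avg3 t h (form 1 I c (\<lambda>i. val \<alpha> (\<omega> i)) (\<lambda>_. 0)) \<partial>PiM I \<nu>)\<bar> \<le> \<eta>"
proof -
  have \<eta>12: "0 < \<eta> / 12" using \<eta> by simp
  obtain \<delta>' where \<delta>': "\<delta>' > 0" "\<forall>I c. unit_form d I c \<longrightarrow> small_ball I c \<delta>' \<le> \<eta> / 12"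
    using small_ball_uniform[OF d \<eta>12] by auto
  define \<delta> where "\<delta> = sqrt s * \<delta>' / 8"
  have \<delta>: "0 < \<delta>" "8 * \<delta> = sqrt s * \<delta>'" using s \<delta>' by (auto simp: \<delta>_def)
  \<comment> \<open>Where |D| exceeds \<delta>, the defect k / (k + (\<alpha> D)^2) is then at most
    \<eta> / 12.\<close>
  define k where "k = (\<alpha> * \<delta>)\<^sup>2 * (\<eta> / 12)"
  have k: "0 < k" "k / (\<alpha> * \<delta>)\<^sup>2 = \<eta> / 12" using \<alpha> \<delta> \<eta> by (auto simp: k_def)
  define C where "C = (max 1 \<alpha>)\<^sup>2 * sqrt (second_const d)"
  have C: "0 \<le> C" by (simp add: C_def)
  \<comment> \<open>k is fixed first; t then makes t / k times the bound on the second derivative at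
    most \<eta> / 12, and the added 1 covers C = 0.\<close>
  define t where "t = \<eta> * k / (12 * (C + 1))"
  have t: "0 < t" "t / k * C \<le> \<eta> / 12"
  proof -
    show "0 < t" using \<eta> k C by (simp add: t_def)
    have "t / k * C = \<eta> / 12 * (C / (C + 1))" using k(1) by (simp add: t_def)
    also have "\<dots> \<le> \<eta> / 12 * 1" using \<eta> C by (intro mult_left_mono) auto
    finally show "t / k * C \<le> \<eta> / 12" by simp
  qed
  obtain \<tau> where \<tau>: "\<tau> > 0" and cmp: "\<forall>I c \<nu> \<psi> b \<zeta>. unit_form d I c \<longrightarrow> (\<forall>i\<in>I. rot_block \<alpha> \<kappa> e s (\<nu> i)) \<longrightarrow> (\<forall>i\<in>I. influence I c i \<le> \<tau>) \<longrightarrow>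
     smooth3 (1 / \<delta>) (2 / \<delta>\<^sup>2) (4 / \<delta> ^ 3) \<psi> \<longrightarrow> b\<^sup>2 \<le> 1 \<longrightarrow> \<zeta> \<in> {0, 1} \<longrightarrow>
     \<bar>(\<integral>\<omega>. \<psi> (form b I c (\<lambda>i. val \<alpha> (\<omega> i)) (\<lambda>i. \<zeta> * snd (snd (\<omega> i)))) \<partial>PiM I \<nu>) -
     (\<integral>\<omega>. \<psi> (form b I c (\<lambda>i. fst (\<omega> i)) (\<lambda>i. \<zeta> * sqrt s * snd (\<omega> i))) \<partial>gauss_blocks I)\<bar> \<le> \<eta> / 12"
    using gaussian_comparison[OF e \<kappa> \<eta>12, of d \<alpha> s "1 / \<delta>" "2 / \<delta>\<^sup>2" "4 / \<delta> ^ 3"] by (elim exE conjE) (rule that)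
  show ?thesis
  proof (rule exI[of _ t], rule conjI[OF t(1)], rule exI[of _ \<tau>], rule conjI[OF \<tau>], intro allI impI)
    fix I c \<nu> h
    assume uf: "unit_form d I c" and \<nu>: "\<forall>i\<in>I. rot_block \<alpha> \<kappa> e s (\<nu> i)" and inf: "\<forall>i\<in>I. influence I c i \<le> \<tau>" and h: "unit_cont h"
    have I: "finite I" "I \<noteq> {}" and hom: "\<forall>S\<subseteq>I. card S \<noteq> d \<longrightarrow> c S = 0" and n: "coef_norm I c \<le> 1"
      using uf unfolding unit_form_def by auto
    let ?P = "PiM I \<nu>" and ?G = "gauss_blocks I"
    have p: "prob_space (\<nu> i)" and sb: "sets (\<nu> i) = sets borel" if "i \<in> I" for i
      using rot_block_moments \<nu> that by auto
    interpret P: prob_space ?P using p by (intro prob_space_PiM) auto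
    interpret G: prob_space ?G by (intro prob_space_PiM prob_space_pair prob_space_std_gauss)
    define D where "D = (\<lambda>\<omega> :: nat \<Rightarrow> block. form 0 I c (\<lambda>i. val \<alpha> (\<omega> i)) (\<lambda>i. snd (snd (\<omega> i))))"
    define DG where "DG = (\<lambda>\<omega> :: nat \<Rightarrow> real \<times> real. form 0 I c (\<lambda>i. fst (\<omega> i)) (\<lambda>i. snd (\<omega> i)))"
    have mg: "(fst :: real \<times> real \<Rightarrow> real) \<in> borel_measurable gauss2" "(snd :: real \<times> real \<Rightarrow> real) \<in> borel_measurable gauss2"
      using measurable_fst[of std_gauss std_gauss] measurable_snd[of std_gauss std_gauss] by (simp_all cong: measurable_cong_sets)
    have D[measurable]: "D \<in> borel_measurable ?P"
      unfolding D_def by (rule coordinate_form_measurable) (auto simp: measurable_cong_sets[OF sb refl])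
    have DG[measurable]: "DG \<in> borel_measurable ?G"
      unfolding DG_def using mg by (intro coordinate_form_measurable) auto
    define f where "f = avg3 \<delta> (bump \<delta>)"
    have uf': "unit_cont f" unfolding f_def by (intro unit_cont_avg3 unit_cont_bump \<delta>)
    have mf[measurable]: "f \<in> borel_measurable borel" by (rule unit_cont_measurable[OF uf'])
    have f01: "0 \<le> f x" "f x \<le> 1" for x using uf' by (auto simp: unit_cont_def)
    have f1: "indicat_real {x. \<bar>x\<bar> \<le> \<delta>} x \<le> f x" "f x \<le> indicat_real {x. \<bar>x\<bar> \<le> 8 * \<delta>} x" for x
      unfolding f_def using avg3_bump[OF \<delta>(1)] by auto
    \<comment> \<open>Small-ball probabilities are transferred from the Gaussian derivative through
      a smooth majorant of the indicator, since the comparison holds for smooth test functions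
      only.\<close>
    have "\<bar>P.expectation (\<lambda>\<omega>. f (form 0 I c (\<lambda>i. val \<alpha> (\<omega> i)) (\<lambda>i. 1 * snd (snd (\<omega> i))))) -
       G.expectation (\<lambda>\<omega>. f (form 0 I c (\<lambda>i. fst (\<omega> i)) (\<lambda>i. 1 * sqrt s * snd (\<omega> i))))\<bar> \<le> \<eta> / 12"
      using cmp[rule_format, of I c \<nu> f 0 1] uf \<nu> inf smooth3_avg[OF unit_cont_bump[OF \<delta>(1)] \<delta>(1)] unfolding f_def by auto
    then have c1: "P.expectation (\<lambda>\<omega>. f (D \<omega>)) \<le> G.expectation (\<lambda>\<omega>. f (sqrt s * DG \<omega>)) + \<eta> / 12"
      unfolding D_def DG_def mult_1 form_smult_right abs_le_iff by linarith
    have "G.expectation (\<lambda>\<omega>. f (sqrt s * DG \<omega>)) \<le> G.expectation (indicat_real {\<omega> \<in> space ?G. \<bar>DG \<omega>\<bar> \<le> \<delta>'})"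
    proof (rule integral_mono)
      show "integrable ?G (\<lambda>\<omega>. f (sqrt s * DG \<omega>))" using f01 by (intro G.integrable_const_bound[of _ 1]) auto
      show "integrable ?G (indicat_real {\<omega> \<in> space ?G. \<bar>DG \<omega>\<bar> \<le> \<delta>'})" by (intro G.integrable_const_bound[of _ 1]) (auto simp: indicator_def)
      fix \<omega> assume w: "\<omega> \<in> space ?G"
      have "\<bar>sqrt s * DG \<omega>\<bar> \<le> 8 * \<delta> \<longleftrightarrow> \<bar>DG \<omega>\<bar> \<le> \<delta>'" unfolding \<delta>(2) abs_mult using s by simp
      then show "f (sqrt s * DG \<omega>) \<le> indicat_real {\<omega> \<in> space ?G. \<bar>DG \<omega>\<bar> \<le> \<delta>'} \<omega>"
        using f1(2)[of "sqrt s * DG \<omega>"] w by (simp add: indicator_def)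
    qed
    also have "\<dots> = small_ball I c \<delta>'"
    proof -
      have "{\<omega> \<in> space ?G. \<bar>DG \<omega>\<bar> \<le> \<delta>'} \<inter> space ?G = {\<omega> \<in> space ?G. \<bar>DG \<omega>\<bar> \<le> \<delta>'}" by auto
      then show ?thesis
        unfolding small_ball_blocks[OF I, of c \<delta>', symmetric] DG_def by (simp only: Bochner_Integration.integral_indicator)
    qed
    also have "\<dots> \<le> \<eta> / 12" using \<delta>'(2) uf by blast
    finally have c2: "P.expectation (\<lambda>\<omega>. f (D \<omega>)) \<le> \<eta> / 6" using c1 by simp
    have "P.expectation (\<lambda>\<omega>. k / (k + (\<alpha> * D \<omega>)\<^sup>2)) \<le> P.expectation (\<lambda>\<omega>. f (D \<omega>) + \<eta> / 12)"
    proof (rule integral_mono)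
      have le1: "k / (k + y\<^sup>2) \<le> 1" "0 \<le> k / (k + y\<^sup>2)" for y using k(1) by (auto simp: divide_le_eq add_pos_nonneg)
      show "integrable ?P (\<lambda>\<omega>. k / (k + (\<alpha> * D \<omega>)\<^sup>2))"
        by (intro P.integrable_const_bound[of _ 1] AE_I2) (simp only: real_norm_def abs_of_nonneg[OF le1(2)] le1(1), measurable)
      show "integrable ?P (\<lambda>\<omega>. f (D \<omega>) + \<eta> / 12)"
        using f01 by (intro Bochner_Integration.integrable_add P.integrable_const_bound[of "\<lambda>\<omega>. f (D \<omega>)" 1]) auto
      fix \<omega>
      show "k / (k + (\<alpha> * D \<omega>)\<^sup>2) \<le> f (D \<omega>) + \<eta> / 12"
      proof (cases "\<bar>D \<omega>\<bar> \<le> \<delta>")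
        case True
        then have "1 \<le> f (D \<omega>)" using f1(1)[of "D \<omega>"] by (simp add: indicator_def)
        then show ?thesis using le1(1)[of "\<alpha> * D \<omega>"] \<eta> by linarith
      next
        case False
        then have "\<alpha> * \<delta> \<le> \<bar>\<alpha> * D \<omega>\<bar>" unfolding abs_mult using \<alpha> by simp
        then have "(\<alpha> * \<delta>)\<^sup>2 \<le> (\<alpha> * D \<omega>)\<^sup>2" using \<alpha> \<delta> by (subst power2_abs[of "\<alpha> * D \<omega>", symmetric]) (intro power_mono, auto)
        then have "k / (k + (\<alpha> * D \<omega>)\<^sup>2) \<le> k / (\<alpha> * \<delta>)\<^sup>2" using k \<alpha> \<delta> by (intro frac_le) auto
        then show ?thesis using k(2) f01(1)[of "D \<omega>"] by linarith
      qed
    qed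
    also have "\<dots> = P.expectation (\<lambda>\<omega>. f (D \<omega>)) + \<eta> / 12"
    proof -
      have "integrable ?P (\<lambda>\<omega>. f (D \<omega>))" using f01 by (intro P.integrable_const_bound[of _ 1]) auto
      then show ?thesis by (simp add: P.prob_space)
    qed
    finally have c3: "P.expectation (\<lambda>\<omega>. k / (k + (\<alpha> * D \<omega>)\<^sup>2)) \<le> \<eta> / 4" using c2 by simp
    have step: "\<bar>(\<integral>\<omega>. g (form 1 I c (\<lambda>i. val \<alpha> (\<omega> i)) (\<lambda>_. 0)) \<partial>?P) - (\<integral>\<omega>. avg t g (form 1 I c (\<lambda>i. val \<alpha> (\<omega> i)) (\<lambda>_. 0)) \<partial>?P)\<bar> \<le> \<eta> / 3"
      if "unit_cont g" for g
    proof -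
      have "\<bar>(\<integral>\<omega>. g (form 1 I c (\<lambda>i. val \<alpha> (\<omega> i)) (\<lambda>_. 0)) \<partial>?P) - (\<integral>\<omega>. avg t g (form 1 I c (\<lambda>i. val \<alpha> (\<omega> i)) (\<lambda>_. 0)) \<partial>?P)\<bar>
          \<le> P.expectation (\<lambda>\<omega>. k / (k + (\<alpha> * D \<omega>)\<^sup>2)) + t / k * C"
        unfolding D_def C_def using rotation_regularity[OF I _ \<alpha> deg_le_if_homogeneous[OF hom] n that t(1) k(1)] \<nu> by blast
      then show ?thesis using c3 t(2) by linarith
    qed
    \<comment> \<open>Averages remain continuous with values in [0, 1], so the same bound applies
      three times in succession.\<close>
    have u: "unit_cont (avg t h)" "unit_cont (avg t (avg t h))" using h t(1) by (auto intro!: unit_cont_avg)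
    show "\<bar>(\<integral>\<omega>. h (form 1 I c (\<lambda>i. val \<alpha> (\<omega> i)) (\<lambda>_. 0)) \<partial>?P) - (\<integral>\<omega>. avg3 t h (form 1 I c (\<lambda>i. val \<alpha> (\<omega> i)) (\<lambda>_. 0)) \<partial>?P)\<bar> \<le> \<eta>"
      using step[OF h] step[OF u(1)] step[OF u(2)] by linarith
  qed
qed

text \<open>Four errors of \<eta> / 4: smoothing and Gaussian comparison for each of the two
  families. The Gaussian integral is the same for both, because it depends on the coefficients and
  the test function but not on the block laws.\<close>

lemma universality:
  assumes d: "1 \<le> d" and e: "0 < e" and \<kappa>: "0 \<le> \<kappa>" and \<alpha>: "0 < \<alpha>" and s: "0 < s" and \<eta>: "0 < \<eta>"
  shows "\<exists>\<tau>>0. \<forall>I c \<nu> \<nu>' h. unit_form d I c \<longrightarrow> (\<forall>i\<in>I. rot_block \<alpha> \<kappa> e s (\<nu> i)) \<longrightarrow> (\<forall>i\<in>I. rot_block \<alpha> \<kappa> e s (\<nu>' i)) \<longrightarrow>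
     (\<forall>i\<in>I. influence I c i \<le> \<tau>) \<longrightarrow> unit_cont h \<longrightarrow>
     \<bar>(\<integral>\<omega>. h (form 1 I c (\<lambda>i. val \<alpha> (\<omega> i)) (\<lambda>_. 0)) \<partial>PiM I \<nu>) - (\<integral>\<omega>. h (form 1 I c (\<lambda>i. val \<alpha> (\<omega> i)) (\<lambda>_. 0)) \<partial>PiM I \<nu>')\<bar> \<le> \<eta>"
proof -
  have \<eta>4: "0 < \<eta> / 4" using \<eta> by simp
  obtain t \<tau>1 where t: "0 < t" "0 < \<tau>1" and sm: "\<forall>I c \<nu> h. unit_form d I c \<longrightarrow> (\<forall>i\<in>I. rot_block \<alpha> \<kappa> e s (\<nu> i)) \<longrightarrow> (\<forall>i\<in>I. influence I c i \<le> \<tau>1) \<longrightarrow> unit_cont h \<longrightarrow>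
     \<bar>(\<integral>\<omega>. h (form 1 I c (\<lambda>i. val \<alpha> (\<omega> i)) (\<lambda>_. 0)) \<partial>PiM I \<nu>) - (\<integral>\<omega>. avg3 t h (form 1 I c (\<lambda>i. val \<alpha> (\<omega> i)) (\<lambda>_. 0)) \<partial>PiM I \<nu>)\<bar> \<le> \<eta> / 4"
    using smoothing_error[OF d e \<kappa> \<alpha> s \<eta>4] by (elim exE conjE) (rule that)
  obtain \<tau>2 where \<tau>2: "0 < \<tau>2" and cmp: "\<forall>I c \<nu> \<psi> b \<zeta>. unit_form d I c \<longrightarrow> (\<forall>i\<in>I. rot_block \<alpha> \<kappa> e s (\<nu> i)) \<longrightarrow> (\<forall>i\<in>I. influence I c i \<le> \<tau>2) \<longrightarrow>
     smooth3 (1 / t) (2 / t\<^sup>2) (4 / t ^ 3) \<psi> \<longrightarrow> b\<^sup>2 \<le> 1 \<longrightarrow> \<zeta> \<in> {0, 1} \<longrightarrow>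
     \<bar>(\<integral>\<omega>. \<psi> (form b I c (\<lambda>i. val \<alpha> (\<omega> i)) (\<lambda>i. \<zeta> * snd (snd (\<omega> i)))) \<partial>PiM I \<nu>) -
     (\<integral>\<omega>. \<psi> (form b I c (\<lambda>i. fst (\<omega> i)) (\<lambda>i. \<zeta> * sqrt s * snd (\<omega> i))) \<partial>gauss_blocks I)\<bar> \<le> \<eta> / 4"
    using gaussian_comparison[OF e \<kappa> \<eta>4, of d \<alpha> s "1 / t" "2 / t\<^sup>2" "4 / t ^ 3"] by (elim exE conjE) (rule that)
  show ?thesis
  proof (rule exI[of _ "min \<tau>1 \<tau>2"], rule conjI, use t \<tau>2 in simp, intro allI impI)
    fix I c \<nu> \<nu>' h
    assume uf: "unit_form d I c" and \<nu>: "\<forall>i\<in>I. rot_block \<alpha> \<kappa> e s (\<nu> i)" "\<forall>i\<in>I. rot_block \<alpha> \<kappa> e s (\<nu>' i)"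
      and inf: "\<forall>i\<in>I. influence I c i \<le> min \<tau>1 \<tau>2" and h: "unit_cont h"
    have inf': "\<forall>i\<in>I. influence I c i \<le> \<tau>1" "\<forall>i\<in>I. influence I c i \<le> \<tau>2" using inf by auto
    note smooth = smooth3_avg[OF h t(1)]
    note A = sm[rule_format, OF uf _ _ h, of \<nu>] sm[rule_format, OF uf _ _ h, of \<nu>']
    note B = cmp[rule_format, OF uf _ _ smooth, of \<nu> 1 0] cmp[rule_format, OF uf _ _ smooth, of \<nu>' 1 0]
    show "\<bar>(\<integral>\<omega>. h (form 1 I c (\<lambda>i. val \<alpha> (\<omega> i)) (\<lambda>_. 0)) \<partial>PiM I \<nu>) - (\<integral>\<omega>. h (form 1 I c (\<lambda>i. val \<alpha> (\<omega> i)) (\<lambda>_. 0)) \<partial>PiM I \<nu>')\<bar> \<le> \<eta>"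
    proof -
      have tri: "\<bar>x - y\<bar> \<le> \<eta>" if "\<bar>x - x'\<bar> \<le> \<eta> / 4" "\<bar>y - y'\<bar> \<le> \<eta> / 4" "\<bar>x' - z\<bar> \<le> \<eta> / 4" "\<bar>y' - z\<bar> \<le> \<eta> / 4" for x x' y y' z
        using that unfolding abs_le_iff by auto
      show ?thesis
        by (rule tri[OF A B[unfolded mult_zero_left]]) (use \<nu> inf' in auto)
    qed
  qed
qed

subsection \<open>Rotation-invariant blocks from \<open>class_C\<close>\<close>

abbreviation plane :: "(real \<times> real) measure" where
  "plane \<equiv> lborel \<Otimes>\<^sub>M lborel"

definition rot2 :: "real \<Rightarrow> real \<times> real \<Rightarrow> real \<times> real" where
  "rot2 \<theta> z = (fst z * cos \<theta> + snd z * sin \<theta>, snd z * cos \<theta> - fst z * sin \<theta>)"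

lemma measurable_plane [measurable]:
  "fst \<in> borel_measurable plane" "snd \<in> borel_measurable plane"
  using measurable_fst[of "lborel :: real measure" "lborel :: real measure"]
    measurable_snd[of "lborel :: real measure" "lborel :: real measure"] by (simp_all cong: measurable_cong_sets)

lemma shear_measurable [measurable]:
  "(\<lambda>z. (fst z + a * snd z, snd z)) \<in> measurable plane plane" "(\<lambda>z. (fst z, snd z + a * fst z)) \<in> measurable plane plane"
proof -
  have "(\<lambda>z. fst z + a * snd z) \<in> measurable plane lborel" "(\<lambda>z. snd z + a * fst z) \<in> measurable plane lborel"
    "fst \<in> measurable plane lborel" "snd \<in> measurable plane lborel"
    by (simp_all cong: measurable_cong_sets)
  then show "(\<lambda>z. (fst z + a * snd z, snd z)) \<in> measurable plane plane" "(\<lambda>z. (fst z, snd z + a * fst z)) \<in> measurable plane plane"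
    by (auto intro: measurable_Pair)
qed

lemma nn_integral_translate:
  assumes "f \<in> borel_measurable lborel"
  shows "(\<integral>\<^sup>+ x. f (x + c) \<partial>lborel) = (\<integral>\<^sup>+ x. f (x :: real) \<partial>lborel)"
  using nn_integral_real_affine[of f 1 c] assms by (simp add: add.commute cong: measurable_cong_sets)

lemma nn_integral_shear:
  assumes f: "f \<in> borel_measurable plane"
  shows "(\<integral>\<^sup>+ z. f (fst z + a * snd z, snd z) \<partial>plane) = (\<integral>\<^sup>+ z. f z \<partial>plane)"
    "(\<integral>\<^sup>+ z. f (fst z, snd z + a * fst z) \<partial>plane) = (\<integral>\<^sup>+ z. f z \<partial>plane)"
proof -
  have m1: "(\<lambda>z. f (fst z + a * snd z, snd z)) \<in> borel_measurable plane" and m2: "(\<lambda>z. f (fst z, snd z + a * fst z)) \<in> borel_measurable plane"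
    using measurable_compose[OF shear_measurable(1) f] measurable_compose[OF shear_measurable(2) f] by auto
  have "(\<integral>\<^sup>+ z. f (fst z + a * snd z, snd z) \<partial>plane) = (\<integral>\<^sup>+ y. \<integral>\<^sup>+ x. f (x + a * y, y) \<partial>lborel \<partial>lborel)"
    using lborel_pair.nn_integral_snd[OF m1] by simp
  also have "\<dots> = (\<integral>\<^sup>+ y. \<integral>\<^sup>+ x. f (x, y) \<partial>lborel \<partial>lborel)"
    by (intro nn_integral_cong nn_integral_translate measurable_compose[OF _ f] measurable_Pair) auto
  also have "\<dots> = (\<integral>\<^sup>+ z. f z \<partial>plane)" by (rule lborel_pair.nn_integral_snd[OF f])
  finally show "(\<integral>\<^sup>+ z. f (fst z + a * snd z, snd z) \<partial>plane) = (\<integral>\<^sup>+ z. f z \<partial>plane)" .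
  have "(\<integral>\<^sup>+ z. f (fst z, snd z + a * fst z) \<partial>plane) = (\<integral>\<^sup>+ x. \<integral>\<^sup>+ y. f (x, y + a * x) \<partial>lborel \<partial>lborel)"
    using lborel.nn_integral_fst[OF m2] by simp
  also have "\<dots> = (\<integral>\<^sup>+ x. \<integral>\<^sup>+ y. f (x, y) \<partial>lborel \<partial>lborel)"
    by (intro nn_integral_cong nn_integral_translate measurable_compose[OF _ f] measurable_Pair) auto
  also have "\<dots> = (\<integral>\<^sup>+ z. f z \<partial>plane)" by (rule lborel.nn_integral_fst[OF f])
  finally show "(\<integral>\<^sup>+ z. f (fst z, snd z + a * fst z) \<partial>plane) = (\<integral>\<^sup>+ z. f z \<partial>plane)" .
qed

text \<open>A rotation is a product of three shears, and shears preserve area by Fubini.\<close>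

lemma nn_integral_rot2:
  assumes f: "f \<in> borel_measurable plane" and \<theta>: "0 \<le> \<theta>" "\<theta> \<le> pi / 2"
  shows "(\<integral>\<^sup>+ z. f (rot2 \<theta> z) \<partial>plane) = (\<integral>\<^sup>+ z. f z \<partial>plane)"
proof (cases "\<theta> = 0")
  case True
  then show ?thesis by (simp add: rot2_def)
next
  case False
  then have s: "0 < sin \<theta>" using \<theta> pi_gt_zero by (intro sin_gt_zero) auto
  \<comment> \<open>This is tan(\<theta> / 2), and \<open>ab\<close> and \<open>a2\<close> are
    half-angle identities. The division by the sine is why \<theta> = 0 is treated apart.\<close>
  define a where "a = (1 - cos \<theta>) / sin \<theta>"
  define b where "b = - sin \<theta>"
  let ?S1 = "\<lambda>z :: real \<times> real. (fst z + a * snd z, snd z)" and ?S2 = "\<lambda>z :: real \<times> real. (fst z, snd z + b * fst z)"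
  have ab: "1 + a * b = cos \<theta>" using s by (simp add: a_def b_def)
  have "a * (1 + cos \<theta>) = (1 - (cos \<theta>)\<^sup>2) / sin \<theta>" by (simp add: a_def power2_eq_square algebra_simps)
  also have "\<dots> = sin \<theta>" using s unfolding sin_squared_eq[symmetric] by (simp add: power2_eq_square)
  finally have a2: "a * (1 + cos \<theta>) = sin \<theta>" .
  have eq: "rot2 \<theta> z = ?S1 (?S2 (?S1 z))" for z
  proof -
    have "fst z + a * snd z + a * (snd z + b * (fst z + a * snd z)) = fst z * (1 + a * b) + snd z * (a * (1 + (1 + a * b)))"
      by (simp add: algebra_simps)
    also have "\<dots> = fst z * cos \<theta> + snd z * sin \<theta>" unfolding ab a2 ..
    finally have 1: "fst z + a * snd z + a * (snd z + b * (fst z + a * snd z)) = fst z * cos \<theta> + snd z * sin \<theta>" .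
    have "snd z + b * (fst z + a * snd z) = snd z * (1 + a * b) + fst z * b" by (simp add: algebra_simps)
    then show ?thesis using 1 unfolding ab by (simp add: rot2_def b_def)
  qed
  have m1: "(\<lambda>z. f (?S1 z)) \<in> borel_measurable plane" by (rule measurable_compose[OF shear_measurable(1) f])
  have m2: "(\<lambda>z. f (?S1 (?S2 z))) \<in> borel_measurable plane" by (rule measurable_compose[OF shear_measurable(2) m1])
  have "(\<integral>\<^sup>+ z. f (rot2 \<theta> z) \<partial>plane) = (\<integral>\<^sup>+ z. f (?S1 (?S2 (?S1 z))) \<partial>plane)" unfolding eq ..
  also have "\<dots> = (\<integral>\<^sup>+ z. f (?S1 (?S2 z)) \<partial>plane)" using nn_integral_shear(1)[OF m2, of a] by simp
  also have "\<dots> = (\<integral>\<^sup>+ z. f (?S1 z) \<partial>plane)" using nn_integral_shear(2)[OF m1, of b] by simp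
  also have "\<dots> = (\<integral>\<^sup>+ z. f z \<partial>plane)" by (rule nn_integral_shear(1)[OF f])
  finally show ?thesis .
qed

section \<open>The uniform law on the square\<close>

abbreviation unif :: "real measure" where
  "unif \<equiv> uniform_measure lborel {-1..1}"

lemma prob_space_unif: "prob_space unif"
  by (rule prob_space_uniform_measure) auto

lemma nn_integral_unif: "f \<in> borel_measurable borel \<Longrightarrow> (\<integral>\<^sup>+ x. f x \<partial>unif) = (\<integral>\<^sup>+ x. f x * indicator {-1..1} x \<partial>lborel) / 2"
  by (subst nn_integral_uniform_measure) auto

abbreviation square :: "(real \<times> real) measure" where
  "square \<equiv> unif \<Otimes>\<^sub>M unif"

lemma sets_square [measurable_cong]: "sets square = sets plane"
  by (intro sets_pair_measure_cong) auto

lemma nn_integral_square: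
  assumes f: "f \<in> borel_measurable plane"
  shows "(\<integral>\<^sup>+ z. f z \<partial>square) = (\<integral>\<^sup>+ z. f z * indicator ({-1..1} \<times> {-1..1}) z \<partial>plane) / 4"
proof -
  interpret U: prob_space unif by (rule prob_space_unif)
  have fx: "(\<lambda>y. f (x, y)) \<in> borel_measurable borel" for x
    using measurable_compose[OF measurable_Pair1'[of x lborel lborel] f] by (simp cong: measurable_cong_sets)
  have fsq: "f \<in> borel_measurable square" using f by (simp cong: measurable_cong_sets add: sets_square)
  have g: "(\<lambda>z. f z * indicator ({-1..1} \<times> {-1..1}) z) \<in> borel_measurable plane"
    using f by measurable
  have "(\<integral>\<^sup>+ z. f z \<partial>square) = (\<integral>\<^sup>+ x. \<integral>\<^sup>+ y. f (x, y) \<partial>unif \<partial>unif)"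
    by (rule U.nn_integral_fst[OF fsq, symmetric])
  also have "\<dots> = (\<integral>\<^sup>+ x. (\<integral>\<^sup>+ y. f (x, y) * indicator {-1..1} y \<partial>lborel) / 2 \<partial>unif)"
    using fx by (intro nn_integral_cong nn_integral_unif)
  also have "\<dots> = (\<integral>\<^sup>+ x. (\<integral>\<^sup>+ y. f (x, y) * indicator {-1..1} y \<partial>lborel) / 2 * indicator {-1..1} x \<partial>lborel) / 2"
  proof (rule nn_integral_unif)
    have "(\<lambda>z. f z * indicator {-1..1} (snd z)) \<in> borel_measurable plane" using f by measurable
    from lborel.borel_measurable_nn_integral_fst[OF this]
    show "(\<lambda>x. (\<integral>\<^sup>+ y. f (x, y) * indicator {-1..1} y \<partial>lborel) / 2) \<in> borel_measurable borel"
      by (simp cong: measurable_cong_sets)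
  qed
  also have "(\<integral>\<^sup>+ x. (\<integral>\<^sup>+ y. f (x, y) * indicator {-1..1} y \<partial>lborel) / 2 * indicator {-1..1} x \<partial>lborel) =
      (\<integral>\<^sup>+ x. (\<integral>\<^sup>+ y. f (x, y) * indicator ({-1..1} \<times> {-1..1}) (x, y) \<partial>lborel) / 2 \<partial>lborel)"
  proof (intro nn_integral_cong)
    fix x :: real
    show "(\<integral>\<^sup>+ y. f (x, y) * indicator {-1..1} y \<partial>lborel) / 2 * indicator {-1..1} x =
      (\<integral>\<^sup>+ y. f (x, y) * indicator ({-1..1} \<times> {-1..1}) (x, y) \<partial>lborel) / 2"
      by (cases "x \<in> {-1..1}") (simp_all add: indicator_times)
  qed
  also have "\<dots> = (\<integral>\<^sup>+ x. (\<integral>\<^sup>+ y. f (x, y) * indicator ({-1..1} \<times> {-1..1}) (x, y) \<partial>lborel) \<partial>lborel) / 2"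
    using lborel.borel_measurable_nn_integral_fst[OF g] by (rule nn_integral_divide)
  also have "(\<integral>\<^sup>+ x. (\<integral>\<^sup>+ y. f (x, y) * indicator ({-1..1} \<times> {-1..1}) (x, y) \<partial>lborel) \<partial>lborel) =
      (\<integral>\<^sup>+ z. f z * indicator ({-1..1} \<times> {-1..1}) z \<partial>plane)"
    using lborel.nn_integral_fst[OF g] by simp
  finally show ?thesis
    by (simp add: divide_ennreal_def mult.assoc ennreal_inverse_mult[symmetric] del: times_divide_eq_right)
qed

abbreviation in_disc :: "real \<times> real \<Rightarrow> bool" where
  "in_disc z \<equiv> (fst z)\<^sup>2 + (snd z)\<^sup>2 \<le> 1"

text \<open>Outside the disc nothing moves: the square itself is not invariant under rotations, yet
  its uniform law has to be kept in order that u stays uniform on [-1, 1].\<close>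

definition disc_rot :: "real \<Rightarrow> real \<times> real \<Rightarrow> real \<times> real" where
  "disc_rot \<theta> z = (if in_disc z then rot2 \<theta> z else z)"

lemma rot2_norm: "(fst (rot2 \<theta> z))\<^sup>2 + (snd (rot2 \<theta> z))\<^sup>2 = (fst z)\<^sup>2 + (snd z)\<^sup>2"
proof -
  have "(fst (rot2 \<theta> z))\<^sup>2 + (snd (rot2 \<theta> z))\<^sup>2 = ((fst z)\<^sup>2 + (snd z)\<^sup>2) * ((sin \<theta>)\<^sup>2 + (cos \<theta>)\<^sup>2)"
    unfolding rot2_def fst_conv snd_conv by algebra
  then show ?thesis by simp
qed

lemma rot2_measurable [measurable]: "rot2 \<theta> \<in> measurable plane plane"
proof -
  have "(\<lambda>z. fst z * cos \<theta> + snd z * sin \<theta>) \<in> measurable plane lborel" "(\<lambda>z. snd z * cos \<theta> - fst z * sin \<theta>) \<in> measurable plane lborel"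
    by (simp_all cong: measurable_cong_sets)
  then show ?thesis unfolding rot2_def[abs_def] by (rule measurable_Pair)
qed

lemma in_disc_sets [measurable]: "Measurable.pred plane in_disc"
  by measurable

lemma disc_rot_measurable [measurable]: "disc_rot \<theta> \<in> measurable plane plane"
  unfolding disc_rot_def[abs_def] by (intro measurable_If rot2_measurable in_disc_sets[unfolded pred_def]) auto

lemma in_disc_le:
  assumes "in_disc z" shows "\<bar>fst z\<bar> \<le> 1" "\<bar>snd z\<bar> \<le> 1"
proof -
  have "(fst z)\<^sup>2 \<le> 1" "(snd z)\<^sup>2 \<le> 1" using assms zero_le_power2[of "fst z"] zero_le_power2[of "snd z"] by linarith+
  then show "\<bar>fst z\<bar> \<le> 1" "\<bar>snd z\<bar> \<le> 1" by (simp_all add: abs_square_le_1)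
qed

text \<open>The disc lies in the square and is mapped to itself with area preserved, and the rest of
  the square is fixed pointwise. The integrals are split accordingly into \<open>g\<close> and
  \<open>k\<close>.\<close>

lemma distr_disc_rot:
  assumes \<theta>: "0 \<le> \<theta>" "\<theta> \<le> pi / 2"
  shows "distr square square (disc_rot \<theta>) = square"
proof (rule measure_eqI)
  fix A assume "A \<in> sets (distr square square (disc_rot \<theta>))"
  then have A[measurable]: "A \<in> sets plane" by (simp add: sets_square)
  have m: "disc_rot \<theta> \<in> measurable square square" using disc_rot_measurable[of \<theta>] by (simp cong: measurable_cong_sets add: sets_square)
  have Asq: "A \<in> sets square" using A by (simp add: sets_square)
  let ?Q = "{-1..1} \<times> {-1..1} :: (real \<times> real) set"
  define g where "g = (\<lambda>z. indicator A z * indicator {z. in_disc z} z :: ennreal)"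
  define k where "k = (\<lambda>z. indicator A z * indicator ?Q z * indicator {z. \<not> in_disc z} z :: ennreal)"
  have sD: "{z. in_disc z} \<in> sets plane" "{z. \<not> in_disc z} \<in> sets plane"
  proof -
    show D: "{z. in_disc z} \<in> sets plane" using in_disc_sets by (simp add: pred_def space_pair_measure)
    have "{z. \<not> in_disc z} = space plane - {z. in_disc z}" by (auto simp: space_pair_measure)
    then show "{z. \<not> in_disc z} \<in> sets plane" using sets.Diff[OF sets.top D] by simp
  qed
  have mg: "g \<in> borel_measurable plane" and mk: "k \<in> borel_measurable plane"
    unfolding g_def k_def using sD by (auto intro!: borel_measurable_times_ennreal borel_measurable_indicator)
  have inQ: "z \<in> ?Q" if "in_disc z" for z using in_disc_le[OF that] by (cases z) (auto simp: abs_le_iff)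
  have d1: "indicator A (disc_rot \<theta> z) * indicator ?Q z = g (rot2 \<theta> z) + k z" for z
    using rot2_norm[of \<theta> z] inQ[of z] by (cases "in_disc z") (auto simp: g_def k_def disc_rot_def indicator_def)
  have d2: "indicator A z * indicator ?Q z = g z + k z" for z
    using inQ[of z] by (cases "in_disc z") (auto simp: g_def k_def indicator_def)
  have mA: "(\<lambda>z. indicator A (disc_rot \<theta> z) :: ennreal) \<in> borel_measurable plane"
    by (rule measurable_compose[OF disc_rot_measurable]) (use A in measurable)
  have "emeasure (distr square square (disc_rot \<theta>)) A = (\<integral>\<^sup>+ z. indicator A z \<partial>distr square square (disc_rot \<theta>))"
    using Asq by simp
  also have "\<dots> = (\<integral>\<^sup>+ z. indicator A (disc_rot \<theta> z) \<partial>square)"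
    using m Asq by (intro nn_integral_distr) auto
  also have "\<dots> = (\<integral>\<^sup>+ z. g (rot2 \<theta> z) + k z \<partial>plane) / 4"
    unfolding nn_integral_square[OF mA] d1 ..
  also have "(\<integral>\<^sup>+ z. g (rot2 \<theta> z) + k z \<partial>plane) = (\<integral>\<^sup>+ z. g (rot2 \<theta> z) \<partial>plane) + (\<integral>\<^sup>+ z. k z \<partial>plane)"
    using measurable_compose[OF rot2_measurable mg] mk by (rule nn_integral_add)
  also have "\<dots> = (\<integral>\<^sup>+ z. g z + k z \<partial>plane)"
    unfolding nn_integral_rot2[OF mg \<theta>] using mg mk by (rule nn_integral_add[symmetric])
  also have "\<dots> / 4 = (\<integral>\<^sup>+ z. indicator A z \<partial>square)"
    unfolding d2[symmetric] by (rule nn_integral_square[symmetric]) measurable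
  also have "\<dots> = emeasure square A" using Asq by simp
  finally show "emeasure (distr square square (disc_rot \<theta>)) A = emeasure square A" .
qed simp

definition disc_moment :: real where
  "disc_moment = (\<integral>z. (if in_disc z then (snd z)\<^sup>2 else 0) \<partial>square)"

text \<open>The value is immaterial; it must only be positive, so that the derivative along the flow
  is not degenerate.\<close>

lemma disc_moment_pos: "0 < disc_moment"
proof -
  interpret S: prob_space square by (rule prob_space_pair[OF prob_space_unif prob_space_unif])
  let ?f = "\<lambda>z :: real \<times> real. if in_disc z then (snd z)\<^sup>2 else 0"
  \<comment> \<open>A rectangle of probability 1/32 inside the disc, on which the squared second
    coordinate is at least 1/16.\<close>
  let ?B = "{0..1/2} \<times> {1/4..1/2} :: (real \<times> real) set"
  have mf[measurable]: "?f \<in> borel_measurable square"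
  proof -
    have "?f \<in> borel_measurable plane" by measurable
    then show ?thesis by (simp cong: measurable_cong_sets add: sets_square)
  qed
  have B: "?B \<in> sets square" by auto
  have le: "1 / 16 * indicat_real ?B z \<le> ?f z" for z
  proof (cases "z \<in> ?B")
    case True
    then have z: "0 \<le> fst z" "fst z \<le> 1 / 2" "1 / 4 \<le> snd z" "snd z \<le> 1 / 2" by auto
    have "(fst z)\<^sup>2 \<le> (1 / 2)\<^sup>2" "(snd z)\<^sup>2 \<le> (1 / 2)\<^sup>2" "(1 / 4)\<^sup>2 \<le> (snd z)\<^sup>2" using z by (auto intro!: power_mono)
    then show ?thesis using True by (simp add: power2_eq_square)
  qed auto
  have f1: "\<bar>?f z\<bar> \<le> 1" for z using in_disc_le(2)[of z] by (auto simp: abs_square_le_1)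
  have "measure unif {0..1/2} = 1 / 4" "measure unif {1/4..1/2} = 1 / 8"
    by (simp_all add: measure_uniform_measure Int_absorb1)
  moreover have "measure square ?B = measure unif {0..1/2} * measure unif {1/4..1/2}"
  proof -
    interpret U: prob_space unif by (rule prob_space_unif)
    show ?thesis by (simp add: measure_def U.emeasure_pair_measure_Times enn2real_mult)
  qed
  ultimately have "S.expectation (\<lambda>z. 1 / 16 * indicat_real ?B z) = 1 / 512" using B sets.sets_into_space[OF B] by (simp add: Int_absorb2)
  moreover have "S.expectation (\<lambda>z. 1 / 16 * indicat_real ?B z) \<le> disc_moment"
    unfolding disc_moment_def
  proof (rule integral_mono)
    show "integrable square (\<lambda>z. 1 / 16 * indicat_real ?B z)" using B by (intro S.integrable_const_bound[of _ 1]) (auto simp: indicator_def)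
    show "integrable square ?f" using f1 by (intro S.integrable_const_bound[of _ 1]) auto
  qed (rule le)
  ultimately show ?thesis by simp
qed

section \<open>Blocks with a prescribed law from \<open>class_C\<close>\<close>

text \<open>
  The arguments are \<open>((\<epsilon>, v), (u, w))\<close>. Outside the event that \<open>\<epsilon> = 1\<close> and \<open>(u, w)\<close> lies in the disc, the
  whole variable is stored in the rotation-invariant first component.
\<close>

definition to_block :: "real \<Rightarrow> real \<Rightarrow> (real \<times> real) \<times> (real \<times> real) \<Rightarrow> block" where
  "to_block \<alpha> x0 z = (let e = fst (fst z); v = snd (fst z); u = snd z; x = (if e = 1 then \<alpha> * fst u + x0 else v) in
     if e = 1 \<and> in_disc u then (x - \<alpha> * fst u, fst u, snd u) else (x, 0, 0))"

lemma val_to_block: "val \<alpha> (to_block \<alpha> x0 z) = (if fst (fst z) = 1 then \<alpha> * fst (snd z) + x0 else snd (fst z))"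
  by (simp add: to_block_def val_def Let_def)

text \<open>Rotating a block amounts to moving the point of the square from which it is built,
  including the case where the block stores (x, 0, 0) and nothing moves. Invariance of the uniform
  law thereby passes to the block law.\<close>

lemma rot_to_block: "rot \<theta> (to_block \<alpha> x0 z) = to_block \<alpha> x0 (fst z, disc_rot \<theta> (snd z))"
proof (cases "fst (fst z) = 1 \<and> in_disc (snd z)")
  case True
  moreover have "in_disc (rot2 \<theta> (snd z))" using True by (simp add: rot2_norm)
  ultimately show ?thesis by (simp add: to_block_def disc_rot_def rot_def rot2_def Let_def)
next
  case False
  have "\<not> in_disc (snd z) \<Longrightarrow> disc_rot \<theta> (snd z) = snd z" by (simp add: disc_rot_def)
  then show ?thesis using False by (auto simp: to_block_def rot_def Let_def)
qed

lemma to_block_measurable: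
  assumes K: "sets K = sets (borel \<Otimes>\<^sub>M borel)"
  shows "to_block \<alpha> x0 \<in> borel_measurable (K \<Otimes>\<^sub>M square)"
proof -
  have s: "sets (K \<Otimes>\<^sub>M square) = sets ((borel \<Otimes>\<^sub>M borel) \<Otimes>\<^sub>M (borel \<Otimes>\<^sub>M borel))"
    by (intro sets_pair_measure_cong K) (auto intro: sets_pair_measure_cong)
  have "to_block \<alpha> x0 \<in> measurable ((borel \<Otimes>\<^sub>M borel) \<Otimes>\<^sub>M (borel \<Otimes>\<^sub>M borel)) (borel \<Otimes>\<^sub>M (borel \<Otimes>\<^sub>M borel))"
    unfolding to_block_def[abs_def] Let_def by measurable
  then show ?thesis unfolding borel_prod by (simp add: measurable_cong_sets[OF s refl] borel_prod)
qed

text \<open>Class membership is a statement about the law of X, so the block is built afresh from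
  the joint law of (E, V) and an independent uniform point of the square whose first coordinate
  plays the part of U. The second coordinate is the extra randomness that makes the rotation
  possible.\<close>

lemma class_C_block:
  assumes M: "prob_space M" and C: "class_C p \<alpha> M X" and X: "(\<integral>\<omega>. X \<omega> \<partial>M) = 0" "(\<integral>\<omega>. (X \<omega>)\<^sup>2 \<partial>M) = 1"
    and mom: "integrable M (\<lambda>\<omega>. \<bar>X \<omega>\<bar> powr (2 + e))" "(\<integral>\<omega>. \<bar>X \<omega>\<bar> powr (2 + e) \<partial>M) \<le> \<kappa>"
  shows "\<exists>\<nu>. rot_block \<alpha> \<kappa> e (p * disc_moment) \<nu> \<and> distr \<nu> borel (val \<alpha>) = distr M borel X"
proof -
  have mX: "X \<in> borel_measurable M" using C by (simp add: class_C_def)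
  obtain W :: "(real \<times> real \<times> real) measure" and U E V x0 where W: "prob_space W"
    and ind: "prob_space.indep_vars W (\<lambda>_. borel) (nth [U, E, V]) {..<3}"
    and U: "distr W borel U = unif" and E: "measure W {w \<in> space W. E w = 1} = p" "measure W {w \<in> space W. E w = 0} = 1 - p"
    and law: "distr M borel X = distr W borel (\<lambda>w. E w * (\<alpha> * U w + x0) + (1 - E w) * V w)"
    using C unfolding class_C_def by blast
  interpret M: prob_space M by (rule M)
  interpret W: prob_space W by (rule W)
  have rvs: "U \<in> borel_measurable W" "E \<in> borel_measurable W" "V \<in> borel_measurable W"
  proof -
    have *: "nth [U, E, V] i \<in> borel_measurable W" if "i < 3" for i
      using ind that unfolding W.indep_vars_def by auto
    show "U \<in> borel_measurable W" "E \<in> borel_measurable W" "V \<in> borel_measurable W"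
      using *[of 0] *[of 1] *[of 2] by (auto simp: numeral_2_eq_2)
  qed
  note [measurable] = rvs
  let ?B2 = "borel \<Otimes>\<^sub>M borel :: (real \<times> real) measure"
  \<comment> \<open>U is padded with 0 because \<open>indep_var\<close> takes two variables of one
    type.\<close>
  have EV_U: "W.indep_var ?B2 (\<lambda>w. (E w, V w)) ?B2 (\<lambda>w. (U w, 0))"
  proof -
    have "W.indep_var (PiM {1, 2} (\<lambda>_. borel)) (\<lambda>w. restrict (\<lambda>i. nth [U, E, V] i w) {1, 2}) (PiM {0} (\<lambda>_. borel)) (\<lambda>w. restrict (\<lambda>i. nth [U, E, V] i w) {0})"
      by (rule W.indep_var_restrict[OF ind]) auto
    from W.indep_var_compose[OF this, of "\<lambda>r. (r 1, r 2)" ?B2 "\<lambda>r. (r 0, 0)" ?B2]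
    show ?thesis by (simp add: comp_def numeral_2_eq_2)
  qed
  define K where "K = distr W (borel \<Otimes>\<^sub>M borel) (\<lambda>w. (E w, V w))"
  have mEV: "(\<lambda>w. (E w, V w)) \<in> measurable W (borel \<Otimes>\<^sub>M borel)" by measurable
  have pK: "prob_space K" unfolding K_def using mEV by (rule W.prob_space_distr)
  have sK: "sets K = sets (borel \<Otimes>\<^sub>M borel)" by (simp add: K_def)
  have joint: "distr W ((borel \<Otimes>\<^sub>M borel) \<Otimes>\<^sub>M borel) (\<lambda>w. ((E w, V w), U w)) = K \<Otimes>\<^sub>M unif"
  proof -
    let ?L = "distr W ?B2 (\<lambda>w. (U w, 0))"
    have mU0: "(\<lambda>w. (U w, 0)) \<in> measurable W ?B2" by measurable
    have "distr ?L borel fst = unif" unfolding U[symmetric] using mU0 by (subst distr_distr) (auto simp: comp_def)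
    moreover have "sigma_finite_measure unif" using prob_space_unif by (simp add: prob_space_imp_sigma_finite)
    ultimately have "K \<Otimes>\<^sub>M unif = distr (K \<Otimes>\<^sub>M ?L) (?B2 \<Otimes>\<^sub>M borel) (\<lambda>(x, y). (x, fst y))"
      using pair_measure_distr[of "\<lambda>x. x" K ?B2 fst ?L borel] sK by (simp add: distr_id2 measurable_ident_sets)
    also have "K \<Otimes>\<^sub>M ?L = distr W (?B2 \<Otimes>\<^sub>M ?B2) (\<lambda>w. ((E w, V w), (U w, 0)))"
      using EV_U unfolding W.indep_var_distribution_eq K_def by simp
    also have "distr \<dots> (?B2 \<Otimes>\<^sub>M borel) (\<lambda>(x, y). (x, fst y)) = distr W (?B2 \<Otimes>\<^sub>M borel) (\<lambda>w. ((E w, V w), U w))"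
      by (subst distr_distr) (auto simp: comp_def)
    finally show ?thesis ..
  qed
  note pU = prob_space_unif and pQ = prob_space_pair[OF prob_space_unif prob_space_unif]
  interpret U: prob_space unif by (rule pU)
  interpret Q: prob_space square by (rule pQ)
  define S where "S = K \<Otimes>\<^sub>M square"
  interpret S: prob_space S unfolding S_def by (rule prob_space_pair[OF pK pQ])
  let ?\<rho> = "to_block \<alpha> x0"
  have m\<rho>[measurable]: "?\<rho> \<in> borel_measurable S" unfolding S_def by (rule to_block_measurable[OF sK])
  define \<nu> where "\<nu> = distr S borel ?\<rho>"
  interpret N: prob_space \<nu> unfolding \<nu>_def by (rule S.prob_space_distr) measurable
  have s\<nu>: "sets \<nu> = sets borel" by (simp add: \<nu>_def)
  have inv: "distr \<nu> borel (rot \<theta>) = \<nu>" if "0 \<le> \<theta>" "\<theta> \<le> pi / 2" for \<theta>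
  proof -
    let ?T = "\<lambda>(x :: real \<times> real, y). (x, disc_rot \<theta> y)"
    have md: "disc_rot \<theta> \<in> measurable square square" using disc_rot_measurable[of \<theta>] by (simp cong: measurable_cong_sets add: sets_square)
    have "distr K K (\<lambda>x. x) \<Otimes>\<^sub>M distr square square (disc_rot \<theta>) = distr S S ?T"
      unfolding S_def using md by (intro pair_measure_distr) (auto simp: distr_disc_rot[OF that] intro: Q.sigma_finite_measure)
    then have T: "distr S S ?T = S" by (simp add: distr_id distr_disc_rot[OF that] S_def)
    have mT: "?T \<in> measurable S S" unfolding S_def using md by measurable
    have "distr \<nu> borel (rot \<theta>) = distr S borel (\<lambda>z. rot \<theta> (?\<rho> z))"
      unfolding \<nu>_def by (subst distr_distr) (auto simp: comp_def)
    also have "(\<lambda>z. rot \<theta> (?\<rho> z)) = (\<lambda>z. ?\<rho> (?T z))" by (auto simp: rot_to_block fun_eq_iff)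
    also have "distr S borel (\<lambda>z. ?\<rho> (?T z)) = distr (distr S S ?T) borel ?\<rho>"
      using mT by (subst distr_distr) (auto simp: comp_def)
    finally show ?thesis unfolding T \<nu>_def .
  qed
  let ?x = "\<lambda>z :: (real \<times> real) \<times> real. if fst (fst z) = 1 then \<alpha> * snd z + x0 else snd (fst z)"
  have mx: "?x \<in> borel_measurable ((borel \<Otimes>\<^sub>M borel) \<Otimes>\<^sub>M borel)" by measurable
  have sKU: "sets (K \<Otimes>\<^sub>M unif) = sets ((borel \<Otimes>\<^sub>M borel) \<Otimes>\<^sub>M borel)" by (intro sets_pair_measure_cong sK) simp
  have mx': "?x \<in> borel_measurable (K \<Otimes>\<^sub>M unif)" using mx by (simp only: measurable_cong_sets[OF sKU refl])
  \<comment> \<open>Only the two probabilities are given, but they add up to 1. Almost surely E is 0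
    or 1, and there the mixture in \<open>class_C\<close> agrees with the case distinction in
    \<open>to_block\<close>.\<close>
  have AE_E: "AE w in W. E w = 1 \<or> E w = 0"
  proof -
    have "W.prob ({w \<in> space W. E w = 1} \<union> {w \<in> space W. E w = 0}) = p + (1 - p)"
      using W.finite_measure_Union[of "{w \<in> space W. E w = 1}" "{w \<in> space W. E w = 0}"] E by fastforce
    moreover have "{w \<in> space W. E w = 1} \<union> {w \<in> space W. E w = 0} = {w \<in> space W. E w = 1 \<or> E w = 0}" by auto
    ultimately have "W.prob {w \<in> space W. E w = 1 \<or> E w = 0} = 1" by simp
    then show ?thesis by (subst W.prob_Collect_eq_1[symmetric]) auto
  qed
  have lawX: "distr \<nu> borel (val \<alpha>) = distr M borel X"
  proof -
    let ?P = "\<lambda>(x :: real \<times> real, y :: real \<times> real). (x, fst y)"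
    have mf: "fst \<in> measurable square unif" by measurable
    have "distr K K (\<lambda>x. x) \<Otimes>\<^sub>M distr square unif fst = distr S (K \<Otimes>\<^sub>M unif) ?P"
      unfolding S_def using distr_pair_marginals(1)[OF pU pU] by (intro pair_measure_distr mf) (auto intro: U.sigma_finite_measure)
    then have P: "distr S (K \<Otimes>\<^sub>M unif) ?P = K \<Otimes>\<^sub>M unif" using distr_pair_marginals(1)[OF pU pU] by (simp add: distr_id)
    have mP: "?P \<in> measurable S (K \<Otimes>\<^sub>M unif)" unfolding S_def using mf by measurable
    have "distr \<nu> borel (val \<alpha>) = distr S borel (\<lambda>z. val \<alpha> (?\<rho> z))"
      unfolding \<nu>_def by (subst distr_distr) (auto simp: comp_def)
    also have "(\<lambda>z. val \<alpha> (?\<rho> z)) = (\<lambda>z. ?x (?P z))" by (auto simp: val_to_block fun_eq_iff)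
    also have "distr S borel (\<lambda>z. ?x (?P z)) = distr (distr S (K \<Otimes>\<^sub>M unif) ?P) borel ?x"
      using mP mx' by (subst distr_distr) (auto simp: comp_def)
    also have "\<dots> = distr W borel (\<lambda>w. ?x ((E w, V w), U w))"
      unfolding P unfolding joint[symmetric] using mx by (subst distr_distr) (auto simp: comp_def)
    also have "\<dots> = distr W borel (\<lambda>w. E w * (\<alpha> * U w + x0) + (1 - E w) * V w)"
      by (rule distr_cong_AE) (use AE_E in auto)
    finally show ?thesis unfolding law .
  qed
  have trans: "integral\<^sup>L \<nu> (\<lambda>z. f (val \<alpha> z)) = integral\<^sup>L M (\<lambda>\<omega>. f (X \<omega>))" "integrable \<nu> (\<lambda>z. f (val \<alpha> z)) \<longleftrightarrow> integrable M (\<lambda>\<omega>. f (X \<omega>))"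
    if f: "f \<in> borel_measurable borel" for f :: "real \<Rightarrow> real"
  proof -
    have mv: "val \<alpha> \<in> measurable \<nu> borel" by (simp add: measurable_cong_sets[OF s\<nu> refl])
    show "integral\<^sup>L \<nu> (\<lambda>z. f (val \<alpha> z)) = integral\<^sup>L M (\<lambda>\<omega>. f (X \<omega>))"
      using integral_distr[OF mv f] integral_distr[OF mX f] unfolding lawX by simp
    show "integrable \<nu> (\<lambda>z. f (val \<alpha> z)) \<longleftrightarrow> integrable M (\<lambda>\<omega>. f (X \<omega>))"
      using integrable_distr_eq[OF mv f] integrable_distr_eq[OF mX f] unfolding lawX by simp
  qed
  have b1: "\<bar>fst (snd (?\<rho> z))\<bar> \<le> 1" "\<bar>snd (snd (?\<rho> z))\<bar> \<le> 1" for z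
    using in_disc_le[of "snd z"] by (auto simp: to_block_def Let_def)
  have AEb: "AE z in \<nu>. \<bar>fst (snd z)\<bar> \<le> 1 \<and> \<bar>snd (snd z)\<bar> \<le> 1"
    unfolding \<nu>_def by (subst AE_distr_iff) (use b1 in auto)
  have mb: "(\<lambda>z. fst (snd z)) \<in> borel_measurable \<nu>" "(\<lambda>z. snd (snd z)) \<in> borel_measurable \<nu>"
    by (simp_all add: measurable_cong_sets[OF s\<nu> refl])
  have four: "integrable \<nu> (\<lambda>z. g z ^ 4)" "(\<integral>z. g z ^ 4 \<partial>\<nu>) \<le> 1" if "g \<in> borel_measurable \<nu>" "AE z in \<nu>. \<bar>g z\<bar> \<le> 1" for g :: "block \<Rightarrow> real"
  proof -
    have le: "AE z in \<nu>. g z ^ 4 \<le> 1"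
      using that(2) by eventually_elim (metis power_even_abs_numeral even_numeral abs_ge_zero power_le_one)
    show i: "integrable \<nu> (\<lambda>z. g z ^ 4)" using le that(1) by (intro N.integrable_const_bound[of _ 1]) auto
    have "(\<integral>z. g z ^ 4 \<partial>\<nu>) \<le> (\<integral>z. 1 \<partial>\<nu>)" using i le by (intro integral_mono_AE) auto
    then show "(\<integral>z. g z ^ 4 \<partial>\<nu>) \<le> 1" by (simp add: N.prob_space)
  qed
  \<comment> \<open>The stored w is nonzero only if E = 1 and the point lies in the disc; the two
    conditions are independent, which gives p times \<open>disc_moment\<close>, the same for every X
    in the class.\<close>
  have w2: "(\<integral>z. (snd (snd z))\<^sup>2 \<partial>\<nu>) = p * disc_moment"
  proof -
    let ?f = "\<lambda>k :: real \<times> real. if fst k = 1 then 1 else 0 :: real"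
    let ?g = "\<lambda>u :: real \<times> real. if in_disc u then (snd u)\<^sup>2 else 0"
    have mf: "?f \<in> borel_measurable K" unfolding measurable_cong_sets[OF sK refl] by measurable
    have mg: "?g \<in> borel_measurable square"
    proof -
      have "?g \<in> borel_measurable plane" by measurable
      then show ?thesis by (simp cong: measurable_cong_sets add: sets_square)
    qed
    have "(\<integral>z. (snd (snd z))\<^sup>2 \<partial>\<nu>) = (\<integral>z. (snd (snd (?\<rho> z)))\<^sup>2 \<partial>S)"
      unfolding \<nu>_def by (rule integral_distr) measurable
    also have "\<dots> = (\<integral>z. ?f (fst z) * ?g (snd z) \<partial>S)"
      by (intro Bochner_Integration.integral_cong refl) (simp add: to_block_def Let_def)
    also have "\<dots> = (\<integral>z. ?f (fst z) \<partial>S) * (\<integral>z. ?g (snd z) \<partial>S)"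
    proof (rule S.indep_var_lebesgue_integral)
      show "S.indep_var borel (\<lambda>z. ?f (fst z)) borel (\<lambda>z. ?g (snd z))"
        using S.indep_var_compose[OF indep_var_fst_snd[OF pK pQ, folded S_def] mf mg] by (simp add: comp_def)
      have "(\<lambda>z. ?f (fst z)) \<in> borel_measurable S" "(\<lambda>z. ?g (snd z)) \<in> borel_measurable S"
        unfolding S_def using measurable_compose[OF measurable_fst mf] measurable_compose[OF measurable_snd mg] by auto
      then show "integrable S (\<lambda>z. ?f (fst z))" "integrable S (\<lambda>z. ?g (snd z))"
        using in_disc_le(2) by (auto intro!: S.integrable_const_bound[of _ 1] simp: abs_square_le_1)
    qed
    also have "(\<integral>z. ?g (snd z) \<partial>S) = disc_moment"
      unfolding disc_moment_def S_def by (rule pair_marginal_integral(3)[OF pK pQ mg])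
    also have "(\<integral>z. ?f (fst z) \<partial>S) = p"
    proof -
      have "(\<integral>z. ?f (fst z) \<partial>S) = integral\<^sup>L K ?f" unfolding S_def by (rule pair_marginal_integral(1)[OF pK pQ mf])
      also have "\<dots> = (\<integral>w. ?f (E w, V w) \<partial>W)"
        unfolding K_def by (rule integral_distr[OF mEV]) measurable
      also have "\<dots> = (\<integral>w. indicator {w \<in> space W. E w = 1} w \<partial>W)"
        by (intro Bochner_Integration.integral_cong refl) (simp add: indicator_def)
      also have "\<dots> = W.prob ({w \<in> space W. E w = 1} \<inter> space W)" by (rule Bochner_Integration.integral_indicator)
      also have "{w \<in> space W. E w = 1} \<inter> space W = {w \<in> space W. E w = 1}" by auto
      finally show ?thesis using E(1) by simp
    qed
    finally show ?thesis .
  qed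
  \<comment> \<open>The Bochner integral of a non-integrable function is 0 by convention, so the
    value 1 certifies integrability.\<close>
  have sq: "integrable M (\<lambda>\<omega>. (X \<omega>)\<^sup>2)" using X(2) not_integrable_integral_eq by fastforce
  have "rot_block \<alpha> \<kappa> e (p * disc_moment) \<nu>"
    unfolding rot_block_def
    using N.prob_space_axioms s\<nu> inv four[OF mb(1)] four[OF mb(2)] AEb w2 trans[of "\<lambda>x. x"] trans[of "\<lambda>x. x\<^sup>2"] trans[of "\<lambda>x. \<bar>x\<bar> powr (2 + e)"]
      X mom sq by auto
  then show ?thesis using lawX by blast
qed

subsection \<open>Reduction of the theorem to blocks\<close>

text \<open>Sums over all orderings of S, since a multilinear monomial does not see the order. For
  symmetric coefficients this is d! times any one of them.\<close>

definition set_coef :: "nat \<Rightarrow> (nat list \<Rightarrow> real) \<Rightarrow> nat set \<Rightarrow> real" where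
  "set_coef d a S = (if card S = d then \<Sum>is\<in>permutations_of_set S. a is else 0)"

lemma finite_multi_indices: "finite (multi_indices d N)"
proof -
  have "multi_indices d N = {is. set is \<subseteq> {1..N} \<and> length is = d}" by (auto simp: multi_indices_def)
  then show ?thesis by (simp add: finite_lists_length_eq)
qed

lemma sum_multi_indices:
  fixes g :: "nat list \<Rightarrow> real"
  assumes "\<And>is. is \<in> multi_indices d N \<Longrightarrow> \<not> distinct is \<Longrightarrow> g is = 0"
  shows "(\<Sum>is\<in>multi_indices d N. g is) = (\<Sum>S\<in>Pow {1..N}. if card S = d then \<Sum>is\<in>permutations_of_set S. g is else 0)"
proof -
  let ?D = "{is \<in> multi_indices d N. distinct is}"
  have "(\<Sum>is\<in>multi_indices d N. g is) = sum g ?D"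
    using assms by (intro sum.mono_neutral_right finite_multi_indices) auto
  also have "\<dots> = (\<Sum>S\<in>Pow {1..N}. sum g {is \<in> ?D. set is = S})"
    by (rule sum.group[symmetric]) (auto simp: finite_multi_indices, auto simp: multi_indices_def)
  also have "\<dots> = (\<Sum>S\<in>Pow {1..N}. if card S = d then \<Sum>is\<in>permutations_of_set S. g is else 0)"
  proof (intro sum.cong refl)
    fix S assume S: "S \<in> Pow {1..N}"
    show "sum g {is \<in> ?D. set is = S} = (if card S = d then \<Sum>is\<in>permutations_of_set S. g is else 0)"
    proof (cases "card S = d")
      case True
      then have "{is \<in> ?D. set is = S} = permutations_of_set S"
        using S by (auto simp: multi_indices_def permutations_of_set_def distinct_card)
      then show ?thesis using True by simp
    next
      case False
      then have "{is \<in> ?D. set is = S} = {}" by (auto simp: multi_indices_def distinct_card)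
      then show ?thesis using False by (simp only: sum.empty if_False)
    qed
  qed
  finally show ?thesis .
qed

lemma vanishes_if_not_distinct:
  "vanishes_on_diagonals d N a \<Longrightarrow> is \<in> multi_indices d N \<Longrightarrow> \<not> distinct is \<Longrightarrow> a is = 0"
  unfolding vanishes_on_diagonals_def distinct_conv_nth multi_indices_def by blast

lemma Q_form_eq_form:
  assumes "vanishes_on_diagonals d N a"
  shows "Q_form d N a x = form 1 {1..N} (set_coef d a) x (\<lambda>_. 0)"
proof -
  have "Q_form d N a x = (\<Sum>S\<in>Pow {1..N}. if card S = d then \<Sum>is\<in>permutations_of_set S. a is * (\<Prod>j<d. x (is ! j)) else 0)"
    unfolding Q_form_def using vanishes_if_not_distinct[OF assms] by (intro sum_multi_indices) simp
  also have "\<dots> = form 1 {1..N} (set_coef d a) x (\<lambda>_. 0)"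
    unfolding form_def
  proof (intro sum.cong refl)
    fix S :: "nat set"
    have "(\<Prod>j<d. x (is ! j)) = (\<Prod>i\<in>S. x i)" if "is \<in> permutations_of_set S" "card S = d" for "is"
    proof -
      have "bij_betw ((!) is) {..<d} S"
        using that by (intro bij_betw_nth) (auto simp: permutations_of_set_def distinct_card)
      then show ?thesis by (rule prod.reindex_bij_betw)
    qed
    then show "(if card S = d then \<Sum>is\<in>permutations_of_set S. a is * (\<Prod>j<d. x (is ! j)) else 0) = set_coef d a S * mon 1 x (\<lambda>_. 0) S"
      by (simp add: set_coef_def mon_one_zero sum_distrib_right)
  qed
  finally show ?thesis .
qed

lemma symmetric_coeffs_eq:
  assumes "symmetric_coeffs d N a" "S \<subseteq> {1..N}" "card S = d" "is \<in> permutations_of_set S" "js \<in> permutations_of_set S"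
  shows "a is = a js"
proof -
  have "mset is = mset js" using assms(4,5) by (metis permutations_of_setD set_eq_iff_mset_eq_distinct)
  then obtain \<pi> where \<pi>: "\<pi> permutes {..<length js}" "permute_list \<pi> js = is" by (rule mset_eq_permutation)
  have "length js = d" using assms(3,5) by (simp add: length_finite_permutations_of_set)
  moreover have "js \<in> multi_indices d N" using \<open>length js = d\<close> assms(2,5) by (auto simp: multi_indices_def permutations_of_set_def)
  ultimately show ?thesis using assms(1) \<pi> unfolding symmetric_coeffs_def by metis
qed

lemma set_coef_eq:
  assumes "symmetric_coeffs d N a" "S \<subseteq> {1..N}" "card S = d" "is \<in> permutations_of_set S"
  shows "set_coef d a S = fact d * a is"
proof -
  have "finite S" using assms(2) finite_subset by blast
  have "(\<Sum>js\<in>permutations_of_set S. a js) = (\<Sum>js\<in>permutations_of_set S. a is)"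
    by (intro sum.cong refl symmetric_coeffs_eq[OF assms(1-3) _ assms(4)])
  then show ?thesis using assms(3) \<open>finite S\<close> by (simp add: set_coef_def)
qed

text \<open>Of the two factors d! in the square of d! a(is), one is spent on summing over the d!
  orderings of S and the other remains. This is exactly the normalisation in the hypothesis of the
  theorem.\<close>

lemma coef_norm_set_coef:
  assumes "symmetric_coeffs d N a" "vanishes_on_diagonals d N a"
  shows "coef_norm {1..N} (set_coef d a) = fact d * (\<Sum>is\<in>multi_indices d N. (a is)\<^sup>2)"
proof -
  have "(set_coef d a S)\<^sup>2 = fact d * (if card S = d then \<Sum>is\<in>permutations_of_set S. (a is)\<^sup>2 else 0)" if S: "S \<in> Pow {1..N}" for S
  proof (cases "card S = d")
    case True
    have "finite S" using S finite_subset by blast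
    have "(\<Sum>is\<in>permutations_of_set S. (set_coef d a S)\<^sup>2) = (\<Sum>is\<in>permutations_of_set S. (fact d)\<^sup>2 * (a is)\<^sup>2)"
      using set_coef_eq[OF assms(1) _ True] S by (intro sum.cong refl) (simp add: power_mult_distrib)
    then have "fact d * (set_coef d a S)\<^sup>2 = fact d * (fact d * (\<Sum>is\<in>permutations_of_set S. (a is)\<^sup>2))"
      using True \<open>finite S\<close> by (simp add: sum_distrib_left[symmetric] power2_eq_square mult.assoc)
    then show ?thesis using True by simp
  qed (simp add: set_coef_def)
  then show ?thesis unfolding coef_norm_def
    using vanishes_if_not_distinct[OF assms(2)] by (subst sum_multi_indices) (auto simp: sum_distrib_left intro!: sum.cong)
qed

text \<open>A set containing i is represented by one ordering, with i in front and the rest sorted.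
  The sum on the right runs over all orderings of the rest; the excess is dropped.\<close>

lemma influence_set_coef_le:
  assumes a: "symmetric_coeffs d N a" and d: "1 \<le> d" and i: "i \<in> {1..N}"
  shows "influence {1..N} (set_coef d a) i \<le> (fact d)\<^sup>2 * (\<Sum>js\<in>multi_indices (d - 1) N. (a (i # js))\<^sup>2)"
proof -
  let ?T = "{S \<in> Pow {1..N}. i \<in> S \<and> card S = d}"
  let ?l = "\<lambda>S. sorted_list_of_set (S - {i})"
  have fin: "finite S" if "S \<in> ?T" for S using that finite_subset[of S "{1..N}"] by simp
  have "influence {1..N} (set_coef d a) i = (\<Sum>S\<in>?T. (set_coef d a S)\<^sup>2)"
    unfolding influence_def by (intro sum.mono_neutral_right) (auto simp: set_coef_def)
  also have "\<dots> = (\<Sum>S\<in>?T. (fact d)\<^sup>2 * (a (i # ?l S))\<^sup>2)"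
  proof (intro sum.cong refl)
    fix S assume S: "S \<in> ?T"
    then have "i # ?l S \<in> permutations_of_set S" using fin[OF S] by (auto simp: permutations_of_set_def)
    then have "set_coef d a S = fact d * a (i # ?l S)" using S by (intro set_coef_eq[OF a]) auto
    then show "(set_coef d a S)\<^sup>2 = (fact d)\<^sup>2 * (a (i # ?l S))\<^sup>2" by (simp add: power_mult_distrib)
  qed
  also have "\<dots> = (fact d)\<^sup>2 * (\<Sum>js\<in>?l ` ?T. (a (i # js))\<^sup>2)"
  proof -
    have "inj_on ?l ?T"
    proof (rule inj_onI)
      fix S S' assume S: "S \<in> ?T" "S' \<in> ?T" and eq: "?l S = ?l S'"
      have "S - {i} = S' - {i}" using arg_cong[OF eq, of set] fin[OF S(1)] fin[OF S(2)] by simp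
      then show "S = S'" using S by auto
    qed
    then show ?thesis by (simp add: sum.reindex sum_distrib_left comp_def)
  qed
  also have "\<dots> \<le> (fact d)\<^sup>2 * (\<Sum>js\<in>multi_indices (d - 1) N. (a (i # js))\<^sup>2)"
  proof (intro mult_left_mono sum_mono2 finite_multi_indices)
    show "?l ` ?T \<subseteq> multi_indices (d - 1) N"
    proof
      fix js assume "js \<in> ?l ` ?T"
      then obtain S where S: "S \<in> ?T" "js = ?l S" by blast
      then show "js \<in> multi_indices (d - 1) N" using fin[OF S(1)] by (auto simp: multi_indices_def)
    qed
  qed auto
  finally show ?thesis .
qed

text \<open>Only the joint law enters. Independence makes it the product of the laws of the X i, and
  \<open>val \<alpha>\<close> carries the product of the blocks to the same product.\<close>

lemma expectation_independent_eq_blocks: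
  assumes M: "prob_space M" and ind: "prob_space.indep_vars M (\<lambda>_. borel) X I" and I: "finite I" "I \<noteq> {}"
    and \<nu>: "\<And>i. i \<in> I \<Longrightarrow> prob_space (\<nu> i)" "\<And>i. i \<in> I \<Longrightarrow> sets (\<nu> i) = sets borel"
    and law: "\<And>i. i \<in> I \<Longrightarrow> distr (\<nu> i) borel (val \<alpha>) = distr M borel (X i)"
    and h: "(h :: real \<Rightarrow> real) \<in> borel_measurable borel"
  shows "(\<integral>\<omega>. h (form 1 I c (\<lambda>i. X i \<omega>) (\<lambda>_. 0)) \<partial>M) = (\<integral>\<omega>. h (form 1 I c (\<lambda>i. val \<alpha> (\<omega> i)) (\<lambda>_. 0)) \<partial>PiM I \<nu>)"
proof -
  interpret prob_space M by (rule M)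
  have rv: "X i \<in> borel_measurable M" if "i \<in> I" for i using ind that unfolding indep_vars_def by auto
  define R where "R i = distr M borel (X i)" for i
  define f where "f \<omega> = h (form 1 I c \<omega> (\<lambda>_. 0))" for \<omega>
  have f: "f \<in> borel_measurable (PiM I R)"
    unfolding f_def[abs_def] by (rule measurable_compose[OF _ h], rule coordinate_form_measurable[where f = "\<lambda>x. x" and g = "\<lambda>_. 0"]) (auto simp: R_def)
  have dep: "f (\<lambda>i\<in>I. \<omega> i) = f \<omega>" for \<omega> unfolding f_def by (intro arg_cong[where f = h] form_cong) auto
  have s: "sets (PiM I R) = sets (PiM I (\<lambda>_. borel))" by (intro sets_PiM_cong) (auto simp: R_def)
  let ?T = "\<lambda>\<omega>. \<lambda>i\<in>I. X i \<omega>"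
  have T: "?T \<in> measurable M (PiM I (\<lambda>_. borel))" by (intro measurable_restrict rv)
  have "distr M (PiM I (\<lambda>_. borel)) ?T = PiM I R"
    using ind indep_vars_iff_distr_eq_PiM'[OF I(2), of X "\<lambda>_. borel"] rv unfolding R_def by simp
  moreover have "f \<in> borel_measurable (PiM I (\<lambda>_. borel))" using f by (simp only: measurable_cong_sets[OF s refl])
  ultimately have "(\<integral>\<omega>. f (\<lambda>i. X i \<omega>) \<partial>M) = integral\<^sup>L (PiM I R) f"
    using integral_distr[OF T, of f] dep[of "\<lambda>i. X i _"] by simp
  also have "\<dots> = (\<integral>\<omega>. f (\<lambda>i. val \<alpha> (\<omega> i)) \<partial>PiM I \<nu>)"
  proof (rule integral_PiM_map[symmetric, OF I \<nu>(1) _ _ f dep])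
    fix i assume i: "i \<in> I"
    show "val \<alpha> \<in> measurable (\<nu> i) (R i)" by (simp add: measurable_cong_sets[OF \<nu>(2)[OF i] refl] R_def)
    have "distr (\<nu> i) (R i) (val \<alpha>) = distr (\<nu> i) borel (val \<alpha>)" by (rule distr_cong) (auto simp: R_def)
    then show "distr (\<nu> i) (R i) (val \<alpha>) = R i" using law[OF i] by (simp add: R_def)
  qed
  finally show ?thesis unfolding f_def .
qed

text \<open>Stated for every sufficiently large \<kappa>, so that two sequences can later be given a
  common moment bound.\<close>

lemma class_D_blocks:
  assumes M: "prob_space M" and D: "class_D \<alpha> p e M X"
  shows "\<exists>\<kappa>0\<ge>0. \<forall>\<kappa>\<ge>\<kappa>0. \<exists>\<nu>. \<forall>i\<ge>1. rot_block \<alpha> \<kappa> e (p * disc_moment) (\<nu> i) \<and> distr (\<nu> i) borel (val \<alpha>) = distr M borel (X i)"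
proof -
  define s where "s = (SUP i\<in>{1..}. \<integral>\<^sup>+ \<omega>. ennreal (\<bar>X i \<omega>\<bar> powr (2 + e)) \<partial>M)"
  have s: "s < \<infinity>" using D by (simp add: class_D_def s_def)
  have C: "class_C p \<alpha> M (X i)" "(\<integral>\<omega>. X i \<omega> \<partial>M) = 0" "(\<integral>\<omega>. (X i \<omega>)\<^sup>2 \<partial>M) = 1" if "1 \<le> i" for i
    using D that by (auto simp: class_D_def)
  have mom: "integrable M (\<lambda>\<omega>. \<bar>X i \<omega>\<bar> powr (2 + e))" "(\<integral>\<omega>. \<bar>X i \<omega>\<bar> powr (2 + e) \<partial>M) \<le> enn2real s" if i: "1 \<le> i" for i
  proof -
    have [measurable]: "X i \<in> borel_measurable M" using C(1)[OF i] by (simp add: class_C_def)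
    have le: "(\<integral>\<^sup>+ \<omega>. ennreal (\<bar>X i \<omega>\<bar> powr (2 + e)) \<partial>M) \<le> s" unfolding s_def using i by (intro SUP_upper) simp
    then show "integrable M (\<lambda>\<omega>. \<bar>X i \<omega>\<bar> powr (2 + e))" using s by (intro integrableI_nonneg) auto
    show "(\<integral>\<omega>. \<bar>X i \<omega>\<bar> powr (2 + e) \<partial>M) \<le> enn2real s"
      using s le by (subst integral_eq_nn_integral) (auto intro: enn2real_mono)
  qed
  show ?thesis
  proof (intro exI[of _ "enn2real s"] conjI allI impI)
    fix \<kappa> assume \<kappa>: "enn2real s \<le> \<kappa>"
    have "\<exists>\<nu>. rot_block \<alpha> \<kappa> e (p * disc_moment) \<nu> \<and> distr \<nu> borel (val \<alpha>) = distr M borel (X i)" if "1 \<le> i" for i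
      using C[OF that] mom[OF that] \<kappa> by (intro class_C_block[OF M]) auto
    then show "\<exists>\<nu>. \<forall>i\<ge>1. rot_block \<alpha> \<kappa> e (p * disc_moment) (\<nu> i) \<and> distr (\<nu> i) borel (val \<alpha>) = distr M borel (X i)" by metis
  qed simp
qed

text \<open>A Borel set is approximated from inside by compact sets, and the indicator of a compact
  set K from above by the continuous functions max 0 (1 - n dist(x, K)). One inequality suffices, as
  the two measures can be exchanged.\<close>

lemma measure_le_if_unit_cont:
  fixes \<mu> \<mu>' :: "real measure"
  assumes \<mu>: "prob_space \<mu>" "sets \<mu> = sets borel" and \<mu>': "prob_space \<mu>'" "sets \<mu>' = sets borel"
    and h: "\<And>h. unit_cont h \<Longrightarrow> integral\<^sup>L \<mu> h \<le> integral\<^sup>L \<mu>' h + \<eta>" and A: "A \<in> sets borel" and \<eta>: "0 \<le> \<eta>"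
  shows "measure \<mu> A \<le> measure \<mu>' A + \<eta>"
proof -
  interpret \<mu>: prob_space \<mu> by (rule \<mu>)
  interpret \<mu>': prob_space \<mu>' by (rule \<mu>')
  have K: "measure \<mu> K \<le> measure \<mu>' A + \<eta>" if K: "K \<subseteq> A" "compact K" for K
  \<comment> \<open>The distance to the empty set is 0 by convention, so the functions below would
    not tend to its indicator.\<close>
  proof (cases "K = {}")
    case False
    define f where "f n x = max 0 (1 - real n * infdist x K)" for n x
    have f: "unit_cont (f n)" for n unfolding unit_cont_def f_def
      by (auto intro!: continuous_intros simp: infdist_nonneg)
    have fm: "f n \<in> borel_measurable borel" for n using f by (rule unit_cont_measurable)
    have fb: "0 \<le> f n x" "f n x \<le> 1" for n x using f[of n] by (auto simp: unit_cont_def)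
    have sK: "K \<in> sets borel" using K(2) by (simp add: borel_compact)
    have lim: "(\<lambda>n. f n x) \<longlonglongrightarrow> indicator K x" for x
    proof (cases "x \<in> K")
      case True
      then show ?thesis by (simp add: f_def)
    next
      case outside: False
      then have "0 < infdist x K" using False K(2) infdist_pos_not_in_closed compact_imp_closed by blast
      then obtain n0 where n0: "1 < real n0 * infdist x K" by (rule reals_Archimedean3[THEN spec, THEN exE])
      have "\<forall>\<^sub>F n in sequentially. f n x = 0"
        using eventually_ge_at_top[of n0]
      proof eventually_elim
        case (elim n)
        have "real n0 * infdist x K \<le> real n * infdist x K" using elim by (intro mult_right_mono infdist_nonneg) simp
        then show ?case using n0 by (simp add: f_def)
      qed
      then show ?thesis using outside by (simp add: tendsto_eventually)
    qed
    have "(\<lambda>n. integral\<^sup>L \<mu>' (f n)) \<longlonglongrightarrow> integral\<^sup>L \<mu>' (indicator K :: real \<Rightarrow> real)"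
    proof (rule integral_dominated_convergence[where w = "\<lambda>_. 1"])
      show "(indicator K :: real \<Rightarrow> real) \<in> borel_measurable \<mu>'" "f n \<in> borel_measurable \<mu>'" for n
        using sK fm[of n] by (simp_all add: measurable_cong_sets[OF \<mu>'(2) refl])
    qed (use lim fb in auto)
    then have l: "(\<lambda>n. integral\<^sup>L \<mu>' (f n) + \<eta>) \<longlonglongrightarrow> measure \<mu>' K + \<eta>"
      using sK sets_eq_imp_space_eq[OF \<mu>'(2)] by (intro tendsto_add) (simp_all add: \<mu>'(2))
    have "measure \<mu> K \<le> integral\<^sup>L \<mu>' (f n) + \<eta>" for n
    proof -
      have "integral\<^sup>L \<mu> (indicator K :: real \<Rightarrow> real) \<le> integral\<^sup>L \<mu> (f n)"
      proof (rule integral_mono)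
        show "integrable \<mu> (indicator K :: real \<Rightarrow> real)" using sK \<mu>(2) by (intro integrable_real_indicator) (auto simp: \<mu>.emeasure_eq_measure)
        show "integrable \<mu> (f n)"
          using fm[of n] fb by (intro \<mu>.integrable_const_bound[of _ 1]) (auto simp: measurable_cong_sets[OF \<mu>(2) refl])
        show "indicator K x \<le> f n x" for x using fb[of n x] by (auto simp: indicator_def f_def)
      qed
      moreover have "integral\<^sup>L \<mu> (indicator K :: real \<Rightarrow> real) = measure \<mu> K"
        using sets_eq_imp_space_eq[OF \<mu>(2)] by simp
      ultimately show ?thesis using h[OF f[of n]] by linarith
    qed
    then have "measure \<mu> K \<le> measure \<mu>' K + \<eta>" using l by (intro LIMSEQ_le_const) auto
    also have "measure \<mu>' K \<le> measure \<mu>' A" using K A \<mu>' by (intro \<mu>'.finite_measure_mono) auto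
    finally show ?thesis by simp
  qed (use \<eta> in simp)
  have "emeasure \<mu> A = (SUP K\<in>{K. K \<subseteq> A \<and> compact K}. emeasure \<mu> K)"
    using A \<mu>(2) by (intro inner_regular) auto
  also have "\<dots> \<le> ennreal (measure \<mu>' A + \<eta>)"
    using K \<eta> by (intro SUP_least) (auto simp: \<mu>.emeasure_eq_measure simp del: ennreal_plus intro!: ennreal_leI)
  finally show ?thesis using \<eta> by (simp add: \<mu>.emeasure_eq_measure del: ennreal_plus)
qed

text \<open>A supremum of reals is informative only for a bounded family, so the bound for each
  single event comes first; the empty event gives the lower bound 0.\<close>

lemma dTV_bounds:
  assumes M: "prob_space M" "prob_space M'" and U: "U \<in> borel_measurable M" and V: "V \<in> borel_measurable M'"
    and h: "\<And>h. unit_cont h \<Longrightarrow> \<bar>(\<integral>\<omega>. h (U \<omega>) \<partial>M) - (\<integral>\<omega>. h (V \<omega>) \<partial>M')\<bar> \<le> \<eta>" and \<eta>: "0 \<le> \<eta>"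
  shows "0 \<le> dTV M U M' V" "dTV M U M' V \<le> \<eta>"
proof -
  interpret M: prob_space M by (rule M)
  interpret M': prob_space M' by (rule M)
  let ?\<mu> = "distr M borel U" and ?\<mu>' = "distr M' borel V"
  have p: "prob_space ?\<mu>" "prob_space ?\<mu>'" using U V by (auto intro: M.prob_space_distr M'.prob_space_distr)
  have le: "\<bar>measure M (U -` A \<inter> space M) - measure M' (V -` A \<inter> space M')\<bar> \<le> \<eta>" if A: "A \<in> sets borel" for A
  proof -
    have i: "integral\<^sup>L ?\<mu> h \<le> integral\<^sup>L ?\<mu>' h + \<eta>" "integral\<^sup>L ?\<mu>' h \<le> integral\<^sup>L ?\<mu> h + \<eta>" if uc: "unit_cont h" for h
    proof -
      have "h \<in> borel_measurable borel" using uc by (rule unit_cont_measurable)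
      then show "integral\<^sup>L ?\<mu> h \<le> integral\<^sup>L ?\<mu>' h + \<eta>" "integral\<^sup>L ?\<mu>' h \<le> integral\<^sup>L ?\<mu> h + \<eta>"
        using h[OF uc] U V by (auto simp: integral_distr abs_le_iff)
    qed
    have "measure ?\<mu> A \<le> measure ?\<mu>' A + \<eta>" "measure ?\<mu>' A \<le> measure ?\<mu> A + \<eta>"
      by (rule measure_le_if_unit_cont; use p i A \<eta> in simp)+
    then show ?thesis using A U V by (simp add: measure_distr abs_le_iff)
  qed
  show "dTV M U M' V \<le> \<eta>" unfolding dTV_def by (rule cSUP_least) (use le in auto)
  have "bdd_above ((\<lambda>A. \<bar>measure M (U -` A \<inter> space M) - measure M' (V -` A \<inter> space M')\<bar>) ` sets borel)"
    using le by (auto intro!: bdd_aboveI[of _ \<eta>])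
  from cSUP_upper[OF _ this, of "{}"] show "0 \<le> dTV M U M' V" unfolding dTV_def by simp
qed

theorem theorem1p8:
  fixes d :: nat and N :: "nat \<Rightarrow> nat" and a :: "nat \<Rightarrow> nat list \<Rightarrow> real"
    and M :: "'a measure" and X :: "nat \<Rightarrow> 'a \<Rightarrow> real"
    and M' :: "'b measure" and Y :: "nat \<Rightarrow> 'b \<Rightarrow> real"
    and \<alpha> p e :: real
  assumes "d \<ge> 1"
    and "\<And>n. n \<ge> 1 \<Longrightarrow> N n > 0"
    and "filterlim N at_top sequentially"
    and "\<And>n. n \<ge> 1 \<Longrightarrow> symmetric_coeffs d (N n) (a n)"
    and "\<And>n. n \<ge> 1 \<Longrightarrow> vanishes_on_diagonals d (N n) (a n)"
    and "\<And>n. n \<ge> 1 \<Longrightarrow> fact d * (\<Sum>is\<in>multi_indices d (N n). (a n is)\<^sup>2) = 1"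
    and "(\<lambda>n. MAX i\<in>{1..N n}. \<Sum>js\<in>multi_indices (d - 1) (N n). (a n (i # js))\<^sup>2)
           \<longlonglongrightarrow> 0"
    and "prob_space M" and "prob_space M'"
    and "\<alpha> > 0" and "0 < p" and "p \<le> 1" and "e > 0"
    and "class_D \<alpha> p e M X"
    and "class_D \<alpha> p e M' Y"
  shows "(\<lambda>n. dTV M (\<lambda>\<omega>. Q_form d (N n) (a n) (\<lambda>i. X i \<omega>))
                 M' (\<lambda>\<omega>. Q_form d (N n) (a n) (\<lambda>i. Y i \<omega>))) \<longlonglongrightarrow> 0"
proof -
  note d = assms(1) and M = assms(8) and M' = assms(9) and \<alpha> = assms(10) and p = assms(11) and e = assms(13)
  note X = assms(14) and Y = assms(15)
  let ?Q = "\<lambda>n Z \<omega>. Q_form d (N n) (a n) (\<lambda>i. Z i \<omega>)"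
  \<comment> \<open>Depends only on the common p, hence serves X and Y alike; this makes their
    Gaussian counterparts coincide.\<close>
  let ?s = "p * disc_moment"
  obtain \<kappa>1 where \<kappa>1: "0 \<le> \<kappa>1" "\<forall>\<kappa>\<ge>\<kappa>1. \<exists>\<nu>. \<forall>i\<ge>1. rot_block \<alpha> \<kappa> e ?s (\<nu> i) \<and> distr (\<nu> i) borel (val \<alpha>) = distr M borel (X i)"
    using class_D_blocks[OF M X] by (elim exE conjE) (rule that)
  obtain \<kappa>2 where \<kappa>2: "0 \<le> \<kappa>2" "\<forall>\<kappa>\<ge>\<kappa>2. \<exists>\<nu>. \<forall>i\<ge>1. rot_block \<alpha> \<kappa> e ?s (\<nu> i) \<and> distr (\<nu> i) borel (val \<alpha>) = distr M' borel (Y i)"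
    using class_D_blocks[OF M' Y] by (elim exE conjE) (rule that)
  \<comment> \<open>\<open>universality\<close> takes a single moment bound for both families of
    blocks.\<close>
  define \<kappa> where "\<kappa> = max \<kappa>1 \<kappa>2"
  have \<kappa>: "0 \<le> \<kappa>" "\<kappa>1 \<le> \<kappa>" "\<kappa>2 \<le> \<kappa>" using \<kappa>1(1) by (auto simp: \<kappa>_def)
  obtain \<nu> where \<nu>: "\<And>i. 1 \<le> i \<Longrightarrow> rot_block \<alpha> \<kappa> e ?s (\<nu> i)" "\<And>i. 1 \<le> i \<Longrightarrow> distr (\<nu> i) borel (val \<alpha>) = distr M borel (X i)"
    using \<kappa>1(2)[rule_format, OF \<kappa>(2)] by blast
  obtain \<nu>' where \<nu>': "\<And>i. 1 \<le> i \<Longrightarrow> rot_block \<alpha> \<kappa> e ?s (\<nu>' i)" "\<And>i. 1 \<le> i \<Longrightarrow> distr (\<nu>' i) borel (val \<alpha>) = distr M' borel (Y i)"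
    using \<kappa>2(2)[rule_format, OF \<kappa>(3)] by blast
  have s: "0 < ?s" using p disc_moment_pos by simp
  have dtv: "\<forall>\<^sub>F n in sequentially. 0 \<le> dTV M (?Q n X) M' (?Q n Y) \<and> dTV M (?Q n X) M' (?Q n Y) \<le> \<eta>" if \<eta>: "0 < \<eta>" for \<eta>
  proof -
    obtain \<tau> where \<tau>: "0 < \<tau>" and uni: "\<forall>I c \<nu> \<nu>' h. unit_form d I c \<longrightarrow> (\<forall>i\<in>I. rot_block \<alpha> \<kappa> e ?s (\<nu> i)) \<longrightarrow> (\<forall>i\<in>I. rot_block \<alpha> \<kappa> e ?s (\<nu>' i)) \<longrightarrow>
     (\<forall>i\<in>I. influence I c i \<le> \<tau>) \<longrightarrow> unit_cont h \<longrightarrow>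
     \<bar>(\<integral>\<omega>. h (form 1 I c (\<lambda>i. val \<alpha> (\<omega> i)) (\<lambda>_. 0)) \<partial>PiM I \<nu>) - (\<integral>\<omega>. h (form 1 I c (\<lambda>i. val \<alpha> (\<omega> i)) (\<lambda>_. 0)) \<partial>PiM I \<nu>')\<bar> \<le> \<eta>"
      using universality[OF d e \<kappa>(1) \<alpha> s \<eta>] by (elim exE conjE) (rule that)
    \<comment> \<open>Division by the square of d! compensates the factor lost in passing from
      multi-indices to sets.\<close>
    have small: "\<forall>\<^sub>F n in sequentially. (MAX i\<in>{1..N n}. \<Sum>js\<in>multi_indices (d - 1) (N n). (a n (i # js))\<^sup>2) < \<tau> / (fact d)\<^sup>2"
      using \<tau> by (intro order_tendstoD(2)[OF assms(7)]) simp
    show ?thesis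
      using small eventually_ge_at_top[of 1]
    proof eventually_elim
      case (elim n)
      let ?I = "{1..N n}" and ?c = "set_coef d (a n)"
      have I: "finite ?I" "?I \<noteq> {}" using assms(2)[OF elim(2)] by auto
      note sym = assms(4)[OF elim(2)] and van = assms(5)[OF elim(2)]
      have uf: "unit_form d ?I ?c" unfolding unit_form_def
        using I coef_norm_set_coef[OF sym van] assms(6)[OF elim(2)] by (simp add: set_coef_def)
      have inf: "influence ?I ?c i \<le> \<tau>" if i: "i \<in> ?I" for i
      proof -
        have "(\<Sum>js\<in>multi_indices (d - 1) (N n). (a n (i # js))\<^sup>2) \<le> (MAX i\<in>?I. \<Sum>js\<in>multi_indices (d - 1) (N n). (a n (i # js))\<^sup>2)"
          using i by (intro Max_ge) auto
        then have "(fact d)\<^sup>2 * (\<Sum>js\<in>multi_indices (d - 1) (N n). (a n (i # js))\<^sup>2) \<le> (fact d)\<^sup>2 * (\<tau> / (fact d)\<^sup>2)"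
          using elim(1) by (intro mult_left_mono) auto
        then show ?thesis using influence_set_coef_le[OF sym d i] by simp
      qed
      have ind: "prob_space.indep_vars M (\<lambda>_. borel) X ?I" "prob_space.indep_vars M' (\<lambda>_. borel) Y ?I"
        using X Y by (auto simp: class_D_def intro: prob_space.indep_vars_subset[OF M] prob_space.indep_vars_subset[OF M'])
      have rv: "X i \<in> borel_measurable M" "Y i \<in> borel_measurable M'" if "i \<in> ?I" for i
        using X Y that by (auto simp: class_D_def class_C_def)
      have Q: "?Q n Z \<omega> = form 1 ?I ?c (\<lambda>i. Z i \<omega>) (\<lambda>_. 0)" for Z :: "nat \<Rightarrow> 'c \<Rightarrow> real" and \<omega> by (rule Q_form_eq_form[OF van])
      have h: "\<bar>(\<integral>\<omega>. h (?Q n X \<omega>) \<partial>M) - (\<integral>\<omega>. h (?Q n Y \<omega>) \<partial>M')\<bar> \<le> \<eta>" if uc: "unit_cont h" for h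
      proof -
        have hm: "h \<in> borel_measurable borel" using uc by (rule unit_cont_measurable)
        have "(\<integral>\<omega>. h (?Q n X \<omega>) \<partial>M) = (\<integral>\<omega>. h (form 1 ?I ?c (\<lambda>i. val \<alpha> (\<omega> i)) (\<lambda>_. 0)) \<partial>PiM ?I \<nu>)"
          unfolding Q by (rule expectation_independent_eq_blocks[OF M ind(1) I _ _ _ hm]) (use \<nu> in \<open>auto simp: rot_block_def\<close>)
        moreover have "(\<integral>\<omega>. h (?Q n Y \<omega>) \<partial>M') = (\<integral>\<omega>. h (form 1 ?I ?c (\<lambda>i. val \<alpha> (\<omega> i)) (\<lambda>_. 0)) \<partial>PiM ?I \<nu>')"
          unfolding Q by (rule expectation_independent_eq_blocks[OF M' ind(2) I _ _ _ hm]) (use \<nu>' in \<open>auto simp: rot_block_def\<close>)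
        moreover have "\<forall>i\<in>?I. rot_block \<alpha> \<kappa> e ?s (\<nu> i)" "\<forall>i\<in>?I. rot_block \<alpha> \<kappa> e ?s (\<nu>' i)" "\<forall>i\<in>?I. influence ?I ?c i \<le> \<tau>"
          using \<nu>(1) \<nu>'(1) inf by auto
        ultimately show ?thesis using uni[rule_format, OF uf, of \<nu> \<nu>' h] uc by simp
      qed
      have "?Q n X \<in> borel_measurable M" "?Q n Y \<in> borel_measurable M'"
        unfolding Q[abs_def] by (rule borel_measurable_form; use rv in simp)+
      from dTV_bounds[OF M M' this h] \<eta> show ?case by simp
    qed
  qed
  show ?thesis
  proof (rule tendstoI)
    fix \<eta> :: real assume "0 < \<eta>"
    then have "0 < \<eta> / 2" by simp
    from dtv[OF this] show "\<forall>\<^sub>F n in sequentially. dist (dTV M (?Q n X) M' (?Q n Y)) 0 < \<eta>"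
      by eventually_elim (use \<open>0 < \<eta>\<close> in auto)
  qed
qed

end
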